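(* Let $\mathcal{H}$ be a Hilbert space and let $\mathcal{F}=\{\mathcal{S}_\alpha\}_{\alpha\in\Gamma}$ be a commuting family of spherical isometries on $\mathcal{H}$, with $\mathcal{S}_\alpha=\{T_{j,\alpha}\}_{j\in J_\alpha}$ for each $\alpha\in\Gamma$. Let $\mathcal{T}(\mathcal{F})\subset B(\mathcal{H})$ be the space of all $\mathcal{F}$-Toeplitz operators, and let $C^*(\mathcal{T}(\mathcal{F}))$ be the $C^*$-subalgebra of $B(\mathcal{H})$ generated by $\mathcal{T}(\mathcal{F})$. Then: (1) There exists a completely positive unital mapping $\Phi\colon B(\mathcal{H})\to B(\mathcal{H})$ such that $\Phi^2=\Phi$ and whose range coincides with $\mathcal{T}(\mathcal{F})$. (2) There exist a Hilbert space $\widehat{\mathcal{H}}$ containing $\mathcal{H}$ and a commuting family $\widehat{\mathcal{F}}=\{\widehat{\mathcal{S}}_\alpha\}_{\alpha\in\Gamma}$ of normal spherical isometries on $\widehat{\mathcal{H}}$, with $\widehat{\mathcal{S}}_\alpha=\{\widehat{T}_{j,\alpha}\}_{j\in J_\alpha}$, which leaves $\mathcal{H}$ invariant and whose restriction to $\mathcal{H}$ coincides with $\mathcal{F}$ (that is, $\widehat{T}_{j,\alpha}\mathcal{H}\subset\mathcal{H}$ and $\widehat{T}_{j,\alpha}|_{\mathcal{H}}=T_{j,\alpha}$ for all $\alpha\in\Gamma$, $j\in J_\alpha$); in other words, the family $\mathcal{F}$ is subnormal. (3) Suppose that the normal extension $\widehat{\mathcal{F}}$ in (2) is minimal, i.e.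 $\widehat{\mathcal{H}}$ is the smallest reducing subspace for $\widehat{\mathcal{F}}$ containing $\mathcal{H}$, and let $\Phi$ be as in (1). Then there exists a unital $*$-representation $\pi\colon C^*(\mathcal{T}(\mathcal{F}))\to B(\widehat{\mathcal{H}})$ such that: (3a) $\pi(T_{j,\alpha})=\widehat{T}_{j,\alpha}$ for all $\alpha\in\Gamma$ and $j\in J_\alpha$. (3b) If $P_{\mathcal{H}}$ is the orthogonal projection of $\widehat{\mathcal{H}}$ onto $\mathcal{H}$, then $\Phi(X)=P_{\mathcal{H}}\pi(X)|_{\mathcal{H}}$ for every $X\in C^*(\mathcal{T}(\mathcal{F}))$. (3c) The image $\pi(C^*(\mathcal{T}(\mathcal{F})))$ coincides with the commutant in $B(\widehat{\mathcal{H}})$ of the $C^*$-algebra $C^*(\widehat{\mathcal{F}})$ generated by $\widehat{\mathcal{F}}$ in $B(\widehat{\mathcal{H}})$. (3d) The mapping $\rho\colon\pi(C^*(\mathcal{T}(\mathcal{F})))\to B(\mathcal{H})$ defined by $\rho(\pi(X))=P_{\mathcal{H}}\pi(X)|_{\mathcal{H}}$ for $X\in C^*(\mathcal{T}(\mathcal{F}))$ is a complete isometry onto the space $\mathcal{T}(\mathcal{F})$, and $\pi\circ\rho$ is the identity on $\pi(C^*(\mathcal{T}(\mathcal{F})))$. Therefore the short exact sequence $$0\to\operatorname{Ker}\pi\hookrightarrow C^*(\mathcal{T}(\mathcal{F}))\xrightarrow{\ \pi\ }\pi(C^*(\mathcal{T}(\mathcal{F})))\to 0$$ has a completely isometric cross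 section. Moreover, $\operatorname{Ker}\pi$ coincides with the closed two-sided ideal of $C^*(\mathcal{T}(\mathcal{F}))$ generated by all operators of the form $XY-\Phi(XY)$ with $X,Y\in\mathcal{T}(\mathcal{F})$. (3e) If $C^*(\mathcal{F})$ denotes the unital $C^*$-algebra generated by $\mathcal{F}$ in $B(\mathcal{H})$, then $\Phi(C^*(\mathcal{F}))=C^*(\mathcal{F})\cap\mathcal{T}(\mathcal{F})$. Moreover, the kernel of the restriction of $\pi$ to $C^*(\mathcal{F})$ coincides with the closed ideal of $C^*(\mathcal{F})$ generated by all the commutators $XY-YX$ with $X,Y\in\mathcal{T}(\mathcal{F})\cap C^*(\mathcal{F})$; hence it coincides with the commutator ideal $\mathcal{C}$ of $C^*(\mathcal{F})$. Therefore there is a short exact sequence $$0\to\mathcal{C}\hookrightarrow C^*(\mathcal{F})\xrightarrow{\ \pi\ }C^*(\widehat{\mathcal{F}})\to 0$$ for which the restriction of $\rho$ to $C^*(\widehat{\mathcal{F}})$ is a completely isometric cross section. (3f) An operator $X\in B(\mathcal{H})$ belongs to the commutant of $\mathcal{F}$ if and only if both $X$ and $X^*X$ belong to $\mathcal{T}(\mathcal{F})$. In this case there exists a unique operator $\widehat{X}$ in the commutant of $\widehat{\mathcal{F}}$ which leaves $\mathcal{H}$ invariant and whose restriction to $\mathcal{H}$ coincides with $X$. Moreover, the map $X\mapsto\widehat{X}$ is norm preserving.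
   Context: $B(\mathcal{H})$ denotes the algebra of all bounded operators on the (complex) Hilbert space $\mathcal{H}$. Index sets may be infinite. A spherical isometry on $\mathcal{H}$ is a commuting family $\{T_j\}_{j\in J}$ of bounded operators on $\mathcal{H}$ such that $\sum_{j\in J}T_j^*T_j=1$ in the weak operator topology. It is called normal if all $T_j$ are normal operators. A commuting family of spherical isometries on $\mathcal{H}$ is a family $\mathcal{F}=\{\mathcal{S}_\alpha\}_{\alpha\in\Gamma}$ such that each $\mathcal{S}_\alpha=\{T_{j,\alpha}\}_{j\in J_\alpha}$ is a spherical isometry and the union $\bigcup_{\alpha\in\Gamma}\mathcal{S}_\alpha$ is a commutative set of operators. The algebras generated by $\mathcal{F}$, its commutant, reducing subspaces for it, etc., refer to the set of operators $\bigcup_{\alpha\in\Gamma}\mathcal{S}_\alpha$ (and similarly for $\widehat{\mathcal{F}}$). The space $\mathcal{T}(\mathcal{F})$ of all $\mathcal{F}$-Toeplitz operators is the set of all $X\in B(\mathcal{H})$ such that $\sum_{j\in J_\alpha}T_{j,\alpha}^*XT_{j,\alpha}=X$ (in the weak operator topology) for all $\alpha\in\Gamma$. It contains the commutant of $\mathcal{F}$. The $C^*$-algebras $C^*(\mathcal{T}(\mathcal{F}))$, $C^*(\mathcal{F})$ and $C^*(\widehat{\mathcal{F}})$ are taken to contain the identity operator. The commutator ideal of a $C^*$-algebra is the closed two-sided ideal generated by all commutators $XY-YX$ of its elements. A completely isometric cross section of a short exact sequence $0\to I\to A\xrightarrow{\pi}B\to 0$ of $C^*$-algebras is a completely isometric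 linear map $\rho\colon B\to A$ with $\pi\circ\rho=\mathrm{id}_B$. *)

theory Defs
  imports "HOL-Analysis.Analysis"
begin

section \<open>Complex Hilbert spaces\<close>

class scaleC =
  fixes scaleC :: "complex \<Rightarrow> 'a \<Rightarrow> 'a"  (infixr \<open>*\<^sub>C\<close> 75)

text \<open>
  A complex Hilbert space is a real Hilbert space (whose norm, topology and completeness are
  those of the library) with a compatible complex scalar multiplication and a complex inner
  product that is conjugate linear in its first argument and has the real one as its real part.
\<close>

class complex_hilbert_space = scaleC + real_inner + complete_space +
  fixes cinner :: "'a \<Rightarrow> 'a \<Rightarrow> complex"
  assumes scaleC_add_right: "a *\<^sub>C (x + y) = a *\<^sub>C x + a *\<^sub>C y"
    and scaleC_add_left: "(a + b) *\<^sub>C x = a *\<^sub>C x + b *\<^sub>C x"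
    and scaleC_scaleC: "a *\<^sub>C (b *\<^sub>C x) = (a * b) *\<^sub>C x"
    and scaleC_of_real: "complex_of_real r *\<^sub>C x = r *\<^sub>R x"
    and cinner_commute: "cinner x y = cnj (cinner y x)"
    and cinner_add_right: "cinner x (y + z) = cinner x y + cinner x z"
    and cinner_scaleC_right: "cinner x (a *\<^sub>C y) = a * cinner x y"
    and Re_cinner: "Re (cinner x y) = inner x y"

lemma norm_scaleC: "norm (a *\<^sub>C x) = cmod a * norm x"
  for x :: "'a::complex_hilbert_space"
proof -
  have im: "Im (cinner x x) = 0"
    by (metis Reals_cnj_iff cinner_commute complex_is_Real_iff)
  have "cinner (a *\<^sub>C x) (a *\<^sub>C x) = a * (cnj a * cinner x x)"
    by (metis cinner_commute cinner_scaleC_right complex_cnj_cnj complex_cnj_mult)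
  also have "\<dots> = complex_of_real ((cmod a)\<^sup>2) * cinner x x"
    by (simp only: complex_norm_square mult.assoc)
  finally have "inner (a *\<^sub>C x) (a *\<^sub>C x) = (cmod a)\<^sup>2 * inner x x"
    unfolding Re_cinner [symmetric] by simp
  then show ?thesis
    by (simp add: norm_eq_sqrt_inner real_sqrt_mult)
qed

lemma bounded_linear_scaleC: "bounded_linear (\<lambda>x. a *\<^sub>C (x::'a::complex_hilbert_space))"
proof (rule bounded_linear_intro)
  show "a *\<^sub>C (r *\<^sub>R x) = r *\<^sub>R (a *\<^sub>C x)" for r and x :: 'a
    by (metis mult.commute scaleC_of_real scaleC_scaleC)
  show "norm (a *\<^sub>C x) \<le> norm x * cmod a" for x :: 'a
    by (simp add: norm_scaleC)
qed (rule scaleC_add_right)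

instantiation blinfun :: (real_normed_vector, complex_hilbert_space) scaleC
begin
lift_definition scaleC_blinfun :: "complex \<Rightarrow> ('a \<Rightarrow>\<^sub>L 'b) \<Rightarrow> 'a \<Rightarrow>\<^sub>L 'b" is "\<lambda>a A x. a *\<^sub>C A x"
  by (rule bounded_linear_compose [OF bounded_linear_scaleC])
instance ..
end

definition complex_subspace :: "'a::{zero,plus,scaleC} set \<Rightarrow> bool" where
  "complex_subspace M \<longleftrightarrow> 0 \<in> M \<and> (\<forall>x\<in>M. \<forall>y\<in>M. x + y \<in> M) \<and> (\<forall>a. \<forall>x\<in>M. a *\<^sub>C x \<in> M)"

definition complex_linear_on :: "'a set \<Rightarrow> ('a::{plus,scaleC} \<Rightarrow> 'b::{plus,scaleC}) \<Rightarrow> bool" where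
  "complex_linear_on M f \<longleftrightarrow>
     (\<forall>x\<in>M. \<forall>y\<in>M. f (x + y) = f x + f y) \<and> (\<forall>a. \<forall>x\<in>M. f (a *\<^sub>C x) = a *\<^sub>C f x)"

subsection \<open>The space of square summable functions\<close>

text \<open>
  An ambient Hilbert space for existence statements: every Hilbert space is isometrically
  isomorphic to a closed subspace of \<open>'x ell2\<close> as soon as \<open>'x\<close> has at least as many elements as
  an orthonormal basis.  If a subnormal family on \<open>'h\<close> has minimal normal extension on \<open>K\<close>, then
  a vector \<open>v\<close> of \<open>K\<close> is determined by the function sending an operator \<open>X\<close> to \<open>P\<^sub>H \<pi>(X)\<^sup>* v\<close>, so
  that the index type \<open>('h \<Rightarrow>\<^sub>L 'h) \<Rightarrow> 'h\<close> is large enough for \<open>K\<close>.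
\<close>

typedef 'x ell2 = "{f :: 'x \<Rightarrow> complex. (\<lambda>i. (cmod (f i))\<^sup>2) summable_on UNIV}"
  morphisms ell2_apply Ell2
  by (rule exI [of _ "\<lambda>_. 0"]) simp

setup_lifting type_definition_ell2

lemma ell2_prod_abs_summable:
  fixes f g :: "'x \<Rightarrow> complex"
  assumes "(\<lambda>i. (cmod (f i))\<^sup>2) summable_on UNIV" "(\<lambda>i. (cmod (g i))\<^sup>2) summable_on UNIV"
  shows "(\<lambda>i. cmod (cnj (f i) * g i)) summable_on UNIV"
proof (rule summable_on_comparison_test)
  show "(\<lambda>i. (cmod (f i))\<^sup>2 + (cmod (g i))\<^sup>2) summable_on UNIV"
    using assms by (rule summable_on_add)
  show "cmod (cnj (f i) * g i) \<le> (cmod (f i))\<^sup>2 + (cmod (g i))\<^sup>2" for i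
    using sum_squares_bound [of "cmod (f i)" "cmod (g i)"]
      mult_nonneg_nonneg [OF norm_ge_zero [of "f i"] norm_ge_zero [of "g i"]]
    unfolding norm_mult complex_mod_cnj by linarith
qed auto

lemma ell2_prod_summable:
  fixes f g :: "'x \<Rightarrow> complex"
  assumes "(\<lambda>i. (cmod (f i))\<^sup>2) summable_on UNIV" "(\<lambda>i. (cmod (g i))\<^sup>2) summable_on UNIV"
  shows "(\<lambda>i. cnj (f i) * g i) summable_on UNIV"
  by (rule abs_summable_summable, rule ell2_prod_abs_summable [OF assms])

lemma ell2_add_summable:
  fixes f g :: "'x \<Rightarrow> complex"
  assumes "(\<lambda>i. (cmod (f i))\<^sup>2) summable_on UNIV" "(\<lambda>i. (cmod (g i))\<^sup>2) summable_on UNIV"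
  shows "(\<lambda>i. (cmod (f i + g i))\<^sup>2) summable_on UNIV"
proof (rule summable_on_comparison_test)
  show "(\<lambda>i. 2 * (cmod (f i))\<^sup>2 + 2 * (cmod (g i))\<^sup>2) summable_on UNIV"
    using assms by (intro summable_on_add summable_on_cmult_right)
  show "(cmod (f i + g i))\<^sup>2 \<le> 2 * (cmod (f i))\<^sup>2 + 2 * (cmod (g i))\<^sup>2" for i
  proof -
    have "(cmod (f i + g i))\<^sup>2 \<le> (cmod (f i) + cmod (g i))\<^sup>2"
      by (intro power_mono norm_triangle_ineq) auto
    then show ?thesis
      using sum_squares_bound [of "cmod (f i)" "cmod (g i)"] by (simp add: power2_sum)
  qed
qed auto

lift_definition ell2_cinner :: "'a ell2 \<Rightarrow> 'a ell2 \<Rightarrow> complex"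
  is "\<lambda>f g. \<Sum>\<^sub>\<infinity>i. cnj (f i) * g i" .

instantiation ell2 :: (type) scaleC
begin
lift_definition scaleC_ell2 :: "complex \<Rightarrow> 'a ell2 \<Rightarrow> 'a ell2" is "\<lambda>a f i. a * f i"
  by (simp add: norm_mult power_mult_distrib summable_on_cmult_right)
instance ..
end

instantiation ell2 :: (type) real_inner
begin

lift_definition zero_ell2 :: "'a ell2" is "\<lambda>_. 0" by simp

lift_definition plus_ell2 :: "'a ell2 \<Rightarrow> 'a ell2 \<Rightarrow> 'a ell2" is "\<lambda>f g i. f i + g i"
  by (rule ell2_add_summable)

lift_definition uminus_ell2 :: "'a ell2 \<Rightarrow> 'a ell2" is "\<lambda>f i. - f i" by simp

lift_definition minus_ell2 :: "'a ell2 \<Rightarrow> 'a ell2 \<Rightarrow> 'a ell2" is "\<lambda>f g i. f i - g i"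
proof -
  fix f g :: "'a \<Rightarrow> complex"
  assume "(\<lambda>i. (cmod (f i))\<^sup>2) summable_on UNIV" "(\<lambda>i. (cmod (g i))\<^sup>2) summable_on UNIV"
  then show "(\<lambda>i. (cmod (f i - g i))\<^sup>2) summable_on UNIV"
    using ell2_add_summable [of f "\<lambda>i. - g i"] by simp
qed

definition scaleR_ell2 :: "real \<Rightarrow> 'a ell2 \<Rightarrow> 'a ell2" where
  "scaleR_ell2 r f = complex_of_real r *\<^sub>C f"

definition inner_ell2 :: "'a ell2 \<Rightarrow> 'a ell2 \<Rightarrow> real" where
  "inner_ell2 f g = Re (ell2_cinner f g)"

definition norm_ell2 :: "'a ell2 \<Rightarrow> real" where
  "norm_ell2 f = sqrt (inner f f)"

definition sgn_ell2 :: "'a ell2 \<Rightarrow> 'a ell2" where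
  "sgn_ell2 f = inverse (norm f) *\<^sub>R f"

definition dist_ell2 :: "'a ell2 \<Rightarrow> 'a ell2 \<Rightarrow> real" where
  "dist_ell2 f g = norm (f - g)"

definition uniformity_ell2 :: "('a ell2 \<times> 'a ell2) filter" where
  "uniformity_ell2 = (INF e\<in>{0<..}. principal {(x, y). dist x y < e})"

definition open_ell2 :: "'a ell2 set \<Rightarrow> bool" where
  "open_ell2 U \<longleftrightarrow> (\<forall>x\<in>U. \<forall>\<^sub>F (x', y) in uniformity. x' = x \<longrightarrow> y \<in> U)"

lemma ell2_cinner_add: "ell2_cinner (f::'a ell2) (g + h) = ell2_cinner f g + ell2_cinner f h"
  by transfer (simp add: distrib_left infsum_add ell2_prod_summable)

lemma ell2_cinner_scale: "ell2_cinner (f::'a ell2) (a *\<^sub>C g) = a * ell2_cinner f g"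
proof transfer
  fix f g :: "'a \<Rightarrow> complex" and a
  have "(\<Sum>\<^sub>\<infinity>i. cnj (f i) * (a * g i)) = (\<Sum>\<^sub>\<infinity>i. a * (cnj (f i) * g i))"
    by (simp add: mult.left_commute)
  also have "\<dots> = a * (\<Sum>\<^sub>\<infinity>i. cnj (f i) * g i)"
    by (rule infsum_cmult_right')
  finally show "(\<Sum>\<^sub>\<infinity>i. cnj (f i) * (a * g i)) = a * (\<Sum>\<^sub>\<infinity>i. cnj (f i) * g i)" .
qed

lemma ell2_cinner_commute: "ell2_cinner (f::'a ell2) g = cnj (ell2_cinner g f)"
  by transfer (simp add: mult.commute flip: infsum_cnj)

lemma inner_ell2_self: "inner (f::'a ell2) f = (\<Sum>\<^sub>\<infinity>i. (cmod (ell2_apply f i))\<^sup>2)"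
proof -
  have "ell2_cinner f f = (\<Sum>\<^sub>\<infinity>i. complex_of_real ((cmod (ell2_apply f i))\<^sup>2))"
    unfolding ell2_cinner.rep_eq complex_norm_square by (simp add: mult.commute)
  also have "\<dots> = complex_of_real (\<Sum>\<^sub>\<infinity>i. (cmod (ell2_apply f i))\<^sup>2)"
    using ell2_apply [of f] by (intro infsumI has_sum_of_real) (simp add: summable_iff_has_sum_infsum)
  finally show ?thesis
    by (simp add: inner_ell2_def)
qed

lemma norm_ell2_sq: "(norm (f::'a ell2))\<^sup>2 = (\<Sum>\<^sub>\<infinity>i. (cmod (ell2_apply f i))\<^sup>2)"
  by (simp add: norm_ell2_def inner_ell2_self infsum_nonneg)

lemma finite_sum_le_norm_ell2:
  "finite F \<Longrightarrow> (\<Sum>i\<in>F. (cmod (ell2_apply f i))\<^sup>2) \<le> (norm (f::'a ell2))\<^sup>2"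
  unfolding norm_ell2_sq using ell2_apply [of f] by (intro finite_sum_le_infsum) auto

instance
proof
  fix r s :: real and x y z :: "'a ell2" and U :: "'a ell2 set"
  show "x + y + z = x + (y + z)" by transfer (simp add: add.assoc)
  show "x + y = y + x" by transfer (simp add: add.commute)
  show "0 + x = x" by transfer simp
  show "- x + x = 0" by transfer simp
  show "x - y = x + - y" by transfer simp
  show "r *\<^sub>R (x + y) = r *\<^sub>R x + r *\<^sub>R y"
    unfolding scaleR_ell2_def by transfer (simp add: distrib_left)
  show "(r + s) *\<^sub>R x = r *\<^sub>R x + s *\<^sub>R x"
    unfolding scaleR_ell2_def by transfer (simp add: distrib_right)
  show "r *\<^sub>R s *\<^sub>R x = (r * s) *\<^sub>R x"
    unfolding scaleR_ell2_def by transfer (simp add: mult.assoc)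
  show "1 *\<^sub>R x = x"
    unfolding scaleR_ell2_def by transfer simp
  have comm: "inner x y = inner y x" for x y :: "'a ell2"
    unfolding inner_ell2_def by (subst ell2_cinner_commute) simp
  show "inner x y = inner y x" by (rule comm)
  show "inner (x + y) z = inner x z + inner y z"
    unfolding comm [of _ z] by (simp add: inner_ell2_def ell2_cinner_add)
  show "inner (r *\<^sub>R x) y = r * inner x y"
    unfolding comm [of _ y] by (simp add: inner_ell2_def scaleR_ell2_def ell2_cinner_scale)
  show "0 \<le> inner x x"
    unfolding inner_ell2_self by (rule infsum_nonneg) simp
  show "inner x x = 0 \<longleftrightarrow> x = 0"
  proof
    assume "inner x x = 0"
    then have "(cmod (ell2_apply x i))\<^sup>2 = 0" for i
      using finite_sum_le_norm_ell2 [of "{i}" x] by (simp add: norm_ell2_def)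
    then show "x = 0" by transfer (simp add: fun_eq_iff)
  next
    assume "x = 0"
    then show "inner x x = 0" by (simp add: inner_ell2_self zero_ell2.rep_eq)
  qed
  show "norm x = sqrt (inner x x)" by (rule norm_ell2_def)
  show "sgn x = inverse (norm x) *\<^sub>R x" by (rule sgn_ell2_def)
  show "dist x y = norm (x - y)" by (rule dist_ell2_def)
  show "uniformity = (INF e\<in>{0<..}. principal {(x, y::'a ell2). dist x y < e})"
    by (rule uniformity_ell2_def)
  show "open U \<longleftrightarrow> (\<forall>x\<in>U. \<forall>\<^sub>F (x', y) in uniformity. x' = x \<longrightarrow> y \<in> U)"
    by (rule open_ell2_def)
qed

end

instance ell2 :: (type) complete_space
proof
  fix X :: "nat \<Rightarrow> 'a ell2"
  assume "Cauchy X"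
  have ex: "\<exists>N. \<forall>m\<ge>N. \<forall>n\<ge>N. norm (X m - X n) < e" if "e > 0" for e
    using \<open>Cauchy X\<close> that unfolding Cauchy_def dist_ell2_def by simp
  have "Cauchy (\<lambda>n. ell2_apply (X n) i)" for i
  proof (unfold Cauchy_def, intro allI impI)
    fix e :: real
    assume "e > 0"
    then obtain N where N: "\<And>m n. m \<ge> N \<Longrightarrow> n \<ge> N \<Longrightarrow> norm (X m - X n) < e"
      using ex by blast
    have "cmod (ell2_apply (X m) i - ell2_apply (X n) i) \<le> norm (X m - X n)" for m n
    proof (rule power2_le_imp_le)
      show "(cmod (ell2_apply (X m) i - ell2_apply (X n) i))\<^sup>2 \<le> (norm (X m - X n))\<^sup>2"
        using finite_sum_le_norm_ell2 [of "{i}" "X m - X n"] by (simp add: minus_ell2.rep_eq)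
      show "0 \<le> norm (X m - X n)"
        by (simp add: norm_ell2_def inner_ell2_self infsum_nonneg)
    qed
    then show "\<exists>M. \<forall>m\<ge>M. \<forall>n\<ge>M. dist (ell2_apply (X m) i) (ell2_apply (X n) i) < e"
      using N unfolding dist_norm by (meson order_le_less_trans)
  qed
  then have "\<exists>l. (\<lambda>n. ell2_apply (X n) i) \<longlonglongrightarrow> l" for i
    by (simp add: Cauchy_convergent_iff convergent_def)
  then obtain f where f: "\<And>i. (\<lambda>n. ell2_apply (X n) i) \<longlonglongrightarrow> f i"
    by metis
  have key: "(\<Sum>i\<in>F. (cmod (ell2_apply (X m) i - f i))\<^sup>2) \<le> e\<^sup>2"
    if N: "\<And>m n. m \<ge> N \<Longrightarrow> n \<ge> N \<Longrightarrow> norm (X m - X n) < e" and "m \<ge> N" "finite F" for N e m F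
  proof (rule LIMSEQ_le_const2)
    show "(\<lambda>n. \<Sum>i\<in>F. (cmod (ell2_apply (X m) i - ell2_apply (X n) i))\<^sup>2)
      \<longlonglongrightarrow> (\<Sum>i\<in>F. (cmod (ell2_apply (X m) i - f i))\<^sup>2)"
      by (intro tendsto_intros f)
    have "(\<Sum>i\<in>F. (cmod (ell2_apply (X m) i - ell2_apply (X n) i))\<^sup>2) \<le> e\<^sup>2" if "n \<ge> N" for n
    proof -
      have "(\<Sum>i\<in>F. (cmod (ell2_apply (X m) i - ell2_apply (X n) i))\<^sup>2) \<le> (norm (X m - X n))\<^sup>2"
        using finite_sum_le_norm_ell2 [OF \<open>finite F\<close>, of "X m - X n"]
        by (simp add: minus_ell2.rep_eq)
      also have "\<dots> \<le> e\<^sup>2"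
        using N [OF \<open>m \<ge> N\<close> \<open>n \<ge> N\<close>]
        by (intro power_mono) (auto simp: norm_ell2_def inner_ell2_self infsum_nonneg)
      finally show ?thesis .
    qed
    then show "\<exists>M. \<forall>n\<ge>M. (\<Sum>i\<in>F. (cmod (ell2_apply (X m) i - ell2_apply (X n) i))\<^sup>2) \<le> e\<^sup>2"
      by blast
  qed
  have diff: "(\<lambda>i. (cmod (ell2_apply (X m) i - f i))\<^sup>2) summable_on UNIV"
    "(\<Sum>\<^sub>\<infinity>i. (cmod (ell2_apply (X m) i - f i))\<^sup>2) \<le> e\<^sup>2"
    if N: "\<And>m n. m \<ge> N \<Longrightarrow> n \<ge> N \<Longrightarrow> norm (X m - X n) < e" and "m \<ge> N" for N e m
  proof -
    show sm: "(\<lambda>i. (cmod (ell2_apply (X m) i - f i))\<^sup>2) summable_on UNIV"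
      using key [OF that] by (intro nonneg_bdd_above_summable_on) (auto intro!: bdd_aboveI)
    show "(\<Sum>\<^sub>\<infinity>i. (cmod (ell2_apply (X m) i - f i))\<^sup>2) \<le> e\<^sup>2"
      using sm key [OF that] by (intro infsum_le_finite_sums) auto
  qed
  obtain N where "\<And>m n. m \<ge> N \<Longrightarrow> n \<ge> N \<Longrightarrow> norm (X m - X n) < 1"
    using ex [of 1] by auto
  then have "(\<lambda>i. (cmod (ell2_apply (X N) i - f i))\<^sup>2) summable_on UNIV"
    using diff(1) by blast
  then have "(\<lambda>i. (cmod (- (ell2_apply (X N) i - f i)))\<^sup>2) summable_on UNIV"
    unfolding norm_minus_cancel .
  then have fs: "(\<lambda>i. (cmod (f i))\<^sup>2) summable_on UNIV"
    using ell2_add_summable [of "ell2_apply (X N)" "\<lambda>i. - (ell2_apply (X N) i - f i)"]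
      ell2_apply [of "X N"] by simp
  have "X \<longlonglongrightarrow> Ell2 f"
  proof (unfold LIMSEQ_def, intro allI impI)
    fix e :: real
    assume "e > 0"
    then obtain N where N: "\<And>m n. m \<ge> N \<Longrightarrow> n \<ge> N \<Longrightarrow> norm (X m - X n) < e / 2"
      using ex [of "e / 2"] by auto
    have "dist (X m) (Ell2 f) < e" if "m \<ge> N" for m
    proof -
      have "(norm (X m - Ell2 f))\<^sup>2 \<le> (e / 2)\<^sup>2"
        unfolding norm_ell2_sq minus_ell2.rep_eq Ell2_inverse [OF CollectI, OF fs]
        using N that by (rule diff(2))
      then have "norm (X m - Ell2 f) \<le> e / 2"
        by (rule power2_le_imp_le) (use \<open>e > 0\<close> in simp)
      then show ?thesis
        using \<open>e > 0\<close> unfolding dist_ell2_def by simp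
    qed
    then show "\<exists>N. \<forall>n\<ge>N. dist (X n) (Ell2 f) < e" by blast
  qed
  then show "convergent X" by (auto simp: convergent_def)
qed

instantiation ell2 :: (type) complex_hilbert_space
begin

definition cinner_ell2 :: "'a ell2 \<Rightarrow> 'a ell2 \<Rightarrow> complex" where
  "cinner_ell2 = ell2_cinner"

instance
proof
  fix a b :: complex and r :: real and x y z :: "'a ell2"
  show "a *\<^sub>C (x + y) = a *\<^sub>C x + a *\<^sub>C y" by transfer (simp add: distrib_left)
  show "(a + b) *\<^sub>C x = a *\<^sub>C x + b *\<^sub>C x" by transfer (simp add: distrib_right)
  show "a *\<^sub>C b *\<^sub>C x = (a * b) *\<^sub>C x" by transfer (simp add: mult.assoc)
  show "complex_of_real r *\<^sub>C x = r *\<^sub>R x" by (simp add: scaleR_ell2_def)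
  show "cinner x y = cnj (cinner y x)"
    unfolding cinner_ell2_def by (rule ell2_cinner_commute)
  show "cinner x (y + z) = cinner x y + cinner x z"
    unfolding cinner_ell2_def by (rule ell2_cinner_add)
  show "cinner x (a *\<^sub>C y) = a * cinner x y"
    unfolding cinner_ell2_def by (rule ell2_cinner_scale)
  show "Re (cinner x y) = inner x y"
    unfolding cinner_ell2_def inner_ell2_def ..
qed

end

section \<open>Operators on closed subspaces\<close>

text \<open>
  Every Hilbert space occurring below is a closed subspace \<open>K\<close> of a type of class
  \<open>complex_hilbert_space\<close>; \<open>K = UNIV\<close> gives the type itself.  This makes it possible to
  quantify existentially over Hilbert spaces.  A bounded operator on \<open>K\<close> is represented by its
  extension by \<open>0\<close> to the orthogonal complement of \<open>K\<close>.  The representation preserves sums,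
  products, adjoints, norms and positivity; the identity operator of \<open>K\<close> becomes the
  orthogonal projection onto \<open>K\<close>.
\<close>

definition hilbert_subspace :: "'a::complex_hilbert_space set \<Rightarrow> bool" where
  "hilbert_subspace K \<longleftrightarrow> complex_subspace K \<and> closed K"

definition bounded_ops ::
  "'a::complex_hilbert_space set \<Rightarrow> ('a \<Rightarrow>\<^sub>L 'a) set"  (\<open>\<B>\<close>) where
  "\<B> K = {A. complex_linear_on UNIV (blinfun_apply A) \<and> range (blinfun_apply A) \<subseteq> K \<and>
             (\<forall>x. (\<forall>y\<in>K. cinner y x = 0) \<longrightarrow> A x = 0)}"

definition orth_proj :: "'a::complex_hilbert_space set \<Rightarrow> 'a \<Rightarrow>\<^sub>L 'a" where
  "orth_proj K = (THE P :: 'a \<Rightarrow>\<^sub>L 'a. \<forall>x. P x \<in> K \<and> (\<forall>y\<in>K. cinner y (x - P x) = 0))"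

lemma orth_proj_UNIV: "orth_proj (UNIV :: 'a::complex_hilbert_space set) = id_blinfun"
  unfolding orth_proj_def
proof (rule the_equality)
  fix P :: "'a \<Rightarrow>\<^sub>L 'a"
  assume "\<forall>x. P x \<in> UNIV \<and> (\<forall>y\<in>UNIV. cinner y (x - P x) = 0)"
  then have "inner (x - P x) (x - P x) = 0" for x
    unfolding Re_cinner [symmetric] by simp
  then show "P = id_blinfun"
    by (intro blinfun_eqI) simp
next
  have "cinner y (0::'a) = 0" for y
    using cinner_add_right [of y 0 0] by simp
  then show "\<forall>x::'a. id_blinfun x \<in> UNIV \<and> (\<forall>y\<in>UNIV. cinner y (x - id_blinfun x) = 0)"
    by simp
qed

definition adj ::
  "('a::complex_hilbert_space \<Rightarrow>\<^sub>L 'b::complex_hilbert_space) \<Rightarrow> 'b \<Rightarrow>\<^sub>L 'a" where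
  "adj A = (THE B :: 'b \<Rightarrow>\<^sub>L 'a. \<forall>x y. cinner (A x) y = cinner x (B y))"

definition wot_has_sum ::
  "('j \<Rightarrow> 'a::complex_hilbert_space \<Rightarrow>\<^sub>L 'a) \<Rightarrow> ('a \<Rightarrow>\<^sub>L 'a) \<Rightarrow> 'j set \<Rightarrow> bool" where
  "wot_has_sum A S I \<longleftrightarrow> (\<forall>x y. ((\<lambda>j. cinner x (A j y)) has_sum cinner x (S y)) I)"

definition normal_op :: "('a::complex_hilbert_space \<Rightarrow>\<^sub>L 'a) \<Rightarrow> bool" where
  "normal_op A \<longleftrightarrow> adj A o\<^sub>L A = A o\<^sub>L adj A"

definition commuting_ops :: "('a::complex_hilbert_space \<Rightarrow>\<^sub>L 'a) set \<Rightarrow> bool" where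
  "commuting_ops S \<longleftrightarrow> (\<forall>A\<in>S. \<forall>B\<in>S. A o\<^sub>L B = B o\<^sub>L A)"

definition commutant ::
  "'a::complex_hilbert_space set \<Rightarrow> ('a \<Rightarrow>\<^sub>L 'a) set \<Rightarrow> ('a \<Rightarrow>\<^sub>L 'a) set" where
  "commutant K S = {A \<in> \<B> K. \<forall>B\<in>S. A o\<^sub>L B = B o\<^sub>L A}"

section \<open>C*-algebras of operators\<close>

definition cstar_subalgebra ::
  "'a::complex_hilbert_space set \<Rightarrow> ('a \<Rightarrow>\<^sub>L 'a) set \<Rightarrow> bool" where
  "cstar_subalgebra K \<A> \<longleftrightarrow> \<A> \<subseteq> \<B> K \<and> complex_subspace \<A> \<and> closed \<A> \<and>
     (\<forall>A\<in>\<A>. \<forall>B\<in>\<A>. A o\<^sub>L B \<in> \<A>) \<and> (\<forall>A\<in>\<A>. adj A \<in> \<A>)"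

definition cstar ::
  "'a::complex_hilbert_space set \<Rightarrow> ('a \<Rightarrow>\<^sub>L 'a) set \<Rightarrow> ('a \<Rightarrow>\<^sub>L 'a) set" where
  "cstar K S = \<Inter>{\<A>. cstar_subalgebra K \<A> \<and> orth_proj K \<in> \<A> \<and> S \<subseteq> \<A>}"

definition closed_ideal_gen ::
  "('a::complex_hilbert_space \<Rightarrow>\<^sub>L 'a) set \<Rightarrow> ('a \<Rightarrow>\<^sub>L 'a) set \<Rightarrow> ('a \<Rightarrow>\<^sub>L 'a) set" where
  "closed_ideal_gen \<A> S = \<Inter>{I. I \<subseteq> \<A> \<and> complex_subspace I \<and> closed I \<and> S \<subseteq> I \<and>
     (\<forall>A\<in>\<A>. \<forall>X\<in>I. A o\<^sub>L X \<in> I \<and> X o\<^sub>L A \<in> I)}"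

definition commutators :: "('a::complex_hilbert_space \<Rightarrow>\<^sub>L 'a) set \<Rightarrow> ('a \<Rightarrow>\<^sub>L 'a) set" where
  "commutators S = {(X o\<^sub>L Y) - (Y o\<^sub>L X) | X Y. X \<in> S \<and> Y \<in> S}"

definition commutator_ideal ::
  "('a::complex_hilbert_space \<Rightarrow>\<^sub>L 'a) set \<Rightarrow> ('a \<Rightarrow>\<^sub>L 'a) set" where
  "commutator_ideal \<A> = closed_ideal_gen \<A> (commutators \<A>)"

definition star_hom ::
  "('a::complex_hilbert_space \<Rightarrow>\<^sub>L 'a) set \<Rightarrow>
   (('a \<Rightarrow>\<^sub>L 'a) \<Rightarrow> ('b::complex_hilbert_space \<Rightarrow>\<^sub>L 'b)) \<Rightarrow> bool" where
  "star_hom \<A> \<pi> \<longleftrightarrow> complex_linear_on \<A> \<pi> \<and>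
     (\<forall>X\<in>\<A>. \<forall>Y\<in>\<A>. \<pi> (X o\<^sub>L Y) = \<pi> X o\<^sub>L \<pi> Y) \<and> (\<forall>X\<in>\<A>. \<pi> (adj X) = adj (\<pi> X))"

text \<open>A unital representation on \<open>K\<close> of a C*-algebra of operators on the whole type \<open>'a\<close>.\<close>

definition unital_star_rep ::
  "('a::complex_hilbert_space \<Rightarrow>\<^sub>L 'a) set \<Rightarrow>
   (('a \<Rightarrow>\<^sub>L 'a) \<Rightarrow> ('b::complex_hilbert_space \<Rightarrow>\<^sub>L 'b)) \<Rightarrow> 'b set \<Rightarrow> bool" where
  "unital_star_rep \<A> \<pi> K \<longleftrightarrow> star_hom \<A> \<pi> \<and> \<pi> ` \<A> \<subseteq> \<B> K \<and> \<pi> id_blinfun = orth_proj K"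

definition star_kernel ::
  "('a::complex_hilbert_space \<Rightarrow>\<^sub>L 'a) set \<Rightarrow>
   (('a \<Rightarrow>\<^sub>L 'a) \<Rightarrow> ('b::complex_hilbert_space \<Rightarrow>\<^sub>L 'b)) \<Rightarrow> ('a \<Rightarrow>\<^sub>L 'a) set" where
  "star_kernel \<A> \<pi> = {X \<in> \<A>. \<pi> X = 0}"

subsection \<open>Complete positivity and complete isometry\<close>

text \<open>
  An \<open>n \<times> n\<close> operator matrix is a function of two indices, of which only the values at indices
  below \<open>n\<close> are relevant; it acts on the direct sum of \<open>n\<close> copies of the Hilbert space.  For entries
  in \<open>\<B> K\<close> it makes no difference whether the vectors range over \<open>K\<close> or over the whole type.
\<close>

definition op_matrix_positive ::
  "nat \<Rightarrow> (nat \<Rightarrow> nat \<Rightarrow> 'a::complex_hilbert_space \<Rightarrow>\<^sub>L 'a) \<Rightarrow> bool" where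
  "op_matrix_positive n A \<longleftrightarrow>
     (\<forall>x :: nat \<Rightarrow> 'a. (\<Sum>i<n. cinner (x i) (\<Sum>j<n. A i j (x j))) \<in> \<real>\<^sub>\<ge>\<^sub>0)"

definition op_matrix_norm ::
  "nat \<Rightarrow> (nat \<Rightarrow> nat \<Rightarrow> 'a::complex_hilbert_space \<Rightarrow>\<^sub>L 'a) \<Rightarrow> real" where
  "op_matrix_norm n A =
     (SUP x \<in> {x :: nat \<Rightarrow> 'a. (\<Sum>i<n. (norm (x i))\<^sup>2) \<le> 1}.
        sqrt (\<Sum>i<n. (norm (\<Sum>j<n. A i j (x j)))\<^sup>2))"

definition completely_positive ::
  "('a::complex_hilbert_space \<Rightarrow>\<^sub>L 'a) set \<Rightarrow>
   (('a \<Rightarrow>\<^sub>L 'a) \<Rightarrow> ('b::complex_hilbert_space \<Rightarrow>\<^sub>L 'b)) \<Rightarrow> bool" where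
  "completely_positive \<A> \<Phi> \<longleftrightarrow> complex_linear_on \<A> \<Phi> \<and>
     (\<forall>n A. (\<forall>i<n. \<forall>j<n. A i j \<in> \<A>) \<and> op_matrix_positive n A
        \<longrightarrow> op_matrix_positive n (\<lambda>i j. \<Phi> (A i j)))"

definition complete_isometry ::
  "('a::complex_hilbert_space \<Rightarrow>\<^sub>L 'a) set \<Rightarrow>
   (('a \<Rightarrow>\<^sub>L 'a) \<Rightarrow> ('b::complex_hilbert_space \<Rightarrow>\<^sub>L 'b)) \<Rightarrow> bool" where
  "complete_isometry \<A> \<rho> \<longleftrightarrow> complex_linear_on \<A> \<rho> \<and>
     (\<forall>n A. (\<forall>i<n. \<forall>j<n. A i j \<in> \<A>)
        \<longrightarrow> op_matrix_norm n (\<lambda>i j. \<rho> (A i j)) = op_matrix_norm n A)"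

text \<open>Exactness of \<open>0 \<rightarrow> I \<hookrightarrow> \<A> \<rightarrow> \<B>' \<rightarrow> 0\<close>, where the last but one map is \<open>\<pi>\<close>.\<close>

definition short_exact ::
  "('a::complex_hilbert_space \<Rightarrow>\<^sub>L 'a) set \<Rightarrow> ('a \<Rightarrow>\<^sub>L 'a) set \<Rightarrow>
   (('a \<Rightarrow>\<^sub>L 'a) \<Rightarrow> ('b::complex_hilbert_space \<Rightarrow>\<^sub>L 'b)) \<Rightarrow> 'b set \<Rightarrow> ('b \<Rightarrow>\<^sub>L 'b) set \<Rightarrow> bool" where
  "short_exact I \<A> \<pi> K \<B>' \<longleftrightarrow> cstar_subalgebra UNIV \<A> \<and> cstar_subalgebra K \<B>' \<and>
     star_hom \<A> \<pi> \<and> I = star_kernel \<A> \<pi> \<and> \<pi> ` \<A> = \<B>'"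

definition completely_isometric_cross_section ::
  "('a::complex_hilbert_space \<Rightarrow>\<^sub>L 'a) set \<Rightarrow> (('a \<Rightarrow>\<^sub>L 'a) \<Rightarrow> ('b \<Rightarrow>\<^sub>L 'b)) \<Rightarrow>
   ('b::complex_hilbert_space \<Rightarrow>\<^sub>L 'b) set \<Rightarrow> (('b \<Rightarrow>\<^sub>L 'b) \<Rightarrow> ('a \<Rightarrow>\<^sub>L 'a)) \<Rightarrow> bool" where
  "completely_isometric_cross_section \<A> \<pi> \<B>' \<rho> \<longleftrightarrow>
     \<rho> ` \<B>' \<subseteq> \<A> \<and> complete_isometry \<B>' \<rho> \<and> (\<forall>Y\<in>\<B>'. \<pi> (\<rho> Y) = Y)"

section \<open>Spherical isometries and Toeplitz operators\<close>

definition spherical_isometry ::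
  "'a::complex_hilbert_space set \<Rightarrow> 'j set \<Rightarrow> ('j \<Rightarrow> 'a \<Rightarrow>\<^sub>L 'a) \<Rightarrow> bool" where
  "spherical_isometry K I S \<longleftrightarrow> S ` I \<subseteq> \<B> K \<and> commuting_ops (S ` I) \<and>
     wot_has_sum (\<lambda>j. adj (S j) o\<^sub>L S j) (orth_proj K) I"

definition family_ops ::
  "'g set \<Rightarrow> ('g \<Rightarrow> 'j set) \<Rightarrow> ('g \<Rightarrow> 'j \<Rightarrow> 'a::complex_hilbert_space \<Rightarrow>\<^sub>L 'a) \<Rightarrow> ('a \<Rightarrow>\<^sub>L 'a) set" where
  "family_ops \<Gamma> J T = (\<Union>\<alpha>\<in>\<Gamma>. T \<alpha> ` J \<alpha>)"

definition commuting_spherical_family ::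
  "'a::complex_hilbert_space set \<Rightarrow> 'g set \<Rightarrow> ('g \<Rightarrow> 'j set) \<Rightarrow> ('g \<Rightarrow> 'j \<Rightarrow> 'a \<Rightarrow>\<^sub>L 'a) \<Rightarrow> bool" where
  "commuting_spherical_family K \<Gamma> J T \<longleftrightarrow>
     (\<forall>\<alpha>\<in>\<Gamma>. spherical_isometry K (J \<alpha>) (T \<alpha>)) \<and> commuting_ops (family_ops \<Gamma> J T)"

definition toeplitz ::
  "'g set \<Rightarrow> ('g \<Rightarrow> 'j set) \<Rightarrow> ('g \<Rightarrow> 'j \<Rightarrow> 'a::complex_hilbert_space \<Rightarrow>\<^sub>L 'a) \<Rightarrow> ('a \<Rightarrow>\<^sub>L 'a) set" where
  "toeplitz \<Gamma> J T =
     {X \<in> \<B> UNIV. \<forall>\<alpha>\<in>\<Gamma>. wot_has_sum (\<lambda>j. adj (T \<alpha> j) o\<^sub>L X o\<^sub>L T \<alpha> j) X (J \<alpha>)}"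

definition toeplitz_projection ::
  "'g set \<Rightarrow> ('g \<Rightarrow> 'j set) \<Rightarrow> ('g \<Rightarrow> 'j \<Rightarrow> 'a::complex_hilbert_space \<Rightarrow>\<^sub>L 'a) \<Rightarrow>
   (('a \<Rightarrow>\<^sub>L 'a) \<Rightarrow> ('a \<Rightarrow>\<^sub>L 'a)) \<Rightarrow> bool" where
  "toeplitz_projection \<Gamma> J T \<Phi> \<longleftrightarrow> completely_positive (\<B> UNIV) \<Phi> \<and> \<Phi> id_blinfun = id_blinfun \<and>
     (\<forall>X \<in> \<B> UNIV. \<Phi> (\<Phi> X) = \<Phi> X) \<and> \<Phi> ` \<B> UNIV = toeplitz \<Gamma> J T"

subsection \<open>Normal extensions\<close>

text \<open>
  The inclusion of \<open>H\<close> into a larger Hilbert space \<open>K\<close> is an isometric linear map \<open>V\<close> from \<open>H\<close>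
  to \<open>K\<close>, by which \<open>H\<close> is identified with \<open>range V\<close>.  Under this identification
  \<open>restricts_to V Y X\<close> says that \<open>Y\<close> leaves \<open>H\<close> invariant with restriction \<open>X\<close>, and
  \<open>compression V Y\<close> is \<open>P\<^sub>H Y\<close> restricted to \<open>H\<close>.
\<close>

definition isometric_embedding ::
  "('h::complex_hilbert_space \<Rightarrow>\<^sub>L 'k::complex_hilbert_space) \<Rightarrow> 'k set \<Rightarrow> bool" where
  "isometric_embedding V K \<longleftrightarrow> complex_linear_on UNIV (blinfun_apply V) \<and>
     (\<forall>x. norm (V x) = norm x) \<and> range (blinfun_apply V) \<subseteq> K"

definition restricts_to ::
  "('h::complex_hilbert_space \<Rightarrow>\<^sub>L 'k::complex_hilbert_space) \<Rightarrow> ('k \<Rightarrow>\<^sub>L 'k) \<Rightarrow> ('h \<Rightarrow>\<^sub>L 'h) \<Rightarrow> bool" where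
  "restricts_to V Y X \<longleftrightarrow> (\<forall>x. Y (V x) = V (X x))"

definition compression ::
  "('h::complex_hilbert_space \<Rightarrow>\<^sub>L 'k::complex_hilbert_space) \<Rightarrow> ('k \<Rightarrow>\<^sub>L 'k) \<Rightarrow> ('h \<Rightarrow>\<^sub>L 'h)" where
  "compression V Y =
     Blinfun (\<lambda>x. inv (blinfun_apply V) (orth_proj (range (blinfun_apply V)) (Y (V x))))"

definition normal_extension ::
  "'g set \<Rightarrow> ('g \<Rightarrow> 'j set) \<Rightarrow> ('g \<Rightarrow> 'j \<Rightarrow> 'h::complex_hilbert_space \<Rightarrow>\<^sub>L 'h) \<Rightarrow>
   'k::complex_hilbert_space set \<Rightarrow> ('h \<Rightarrow>\<^sub>L 'k) \<Rightarrow> ('g \<Rightarrow> 'j \<Rightarrow> 'k \<Rightarrow>\<^sub>L 'k) \<Rightarrow> bool" where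
  "normal_extension \<Gamma> J T K V N \<longleftrightarrow>
     hilbert_subspace K \<and> isometric_embedding V K \<and>
     commuting_spherical_family K \<Gamma> J N \<and>
     (\<forall>\<alpha>\<in>\<Gamma>. \<forall>j\<in>J \<alpha>. normal_op (N \<alpha> j) \<and> restricts_to V (N \<alpha> j) (T \<alpha> j))"

definition reducing_subspace ::
  "'k::complex_hilbert_space set \<Rightarrow> ('k \<Rightarrow>\<^sub>L 'k) set \<Rightarrow> 'k set \<Rightarrow> bool" where
  "reducing_subspace K S M \<longleftrightarrow> hilbert_subspace M \<and> M \<subseteq> K \<and>
     (\<forall>A\<in>S. \<forall>x\<in>M. blinfun_apply A x \<in> M \<and> adj A x \<in> M)"

definition minimal_normal_extension ::
  "'g set \<Rightarrow> ('g \<Rightarrow> 'j set) \<Rightarrow> ('g \<Rightarrow> 'j \<Rightarrow> 'h::complex_hilbert_space \<Rightarrow>\<^sub>L 'h) \<Rightarrow>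
   'k::complex_hilbert_space set \<Rightarrow> ('h \<Rightarrow>\<^sub>L 'k) \<Rightarrow> ('g \<Rightarrow> 'j \<Rightarrow> 'k \<Rightarrow>\<^sub>L 'k) \<Rightarrow> bool" where
  "minimal_normal_extension \<Gamma> J T K V N \<longleftrightarrow> normal_extension \<Gamma> J T K V N \<and>
     (\<forall>M. reducing_subspace K (family_ops \<Gamma> J N) M \<and> range (blinfun_apply V) \<subseteq> M \<longrightarrow> M = K)"

end

theory Submission
  imports Defs
begin

text \<open>
  Fix a commuting family of spherical isometries and let \<open>S\<^sub>\<alpha>(X) = \<Sum>\<^sub>j T\<^sub>j\<^sup>* X T\<^sub>j\<close>, the sum extending over the
  spherical isometry with index \<open>\<alpha>\<close>.  These are commuting unital completely positive maps, weakly
  continuous on bounded sets, and the Toeplitz operators are their common fixed points.  A weak limit \<open>\<Phi>\<close> of their Cesaro averages is therefore a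
  completely positive projection onto the Toeplitz operators, with \<open>\<Phi> \<circ> S\<^sub>\<alpha> = \<Phi>\<close> (\<open>averaging_projection_exists\<close>).

  The relations between such maps and products come from the Schwarz inequality
  \<open>\<Phi>(X)\<^sup>* \<Phi>(X) \<le> \<Phi>(X\<^sup>* X)\<close>: an operator with equality for itself and its adjoint lies in the
  multiplicative domain, where \<open>\<Phi>\<close> is multiplicative against every operator.  For a Toeplitz operator \<open>X\<close> the squares of
  the commutators with the \<open>T\<^sub>j\<close> sum up to \<open>S\<^sub>\<alpha>(X\<^sup>* X) - X\<^sup>* X\<close>, which \<open>\<Phi>\<close> annihilates, so that \<open>\<Phi>\<close> does not see the
  difference between \<open>T\<^sub>j X\<close> and \<open>X T\<^sub>j\<close> (\<open>commutator_negligible\<close>).  If the \<open>T\<^sub>j\<close> are normal, it follows that the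
  Toeplitz operators are exactly the operators commuting with the family (\<open>toeplitz_on_commutes\<close>).  Without normality the
  commutant consists of those Toeplitz operators \<open>X\<close> for which \<open>X\<^sup>* X\<close> is a Toeplitz operator too,
  since the sum of the squares is then \<open>0\<close>.

  A normal extension is obtained from the positive definite kernel \<open>\<langle>h, \<Phi>(X\<^sup>* Y) k\<rangle>\<close> on pairs \<open>(X, h)\<close> of a Toeplitz
  operator and a vector.  In a Hilbert space realizing it by vectors \<open>v X h\<close>, the operators \<open>v X h \<mapsto> v X (T\<^sub>j h)\<close> have the
  adjoints \<open>v X h \<mapsto> v (T\<^sub>j\<^sup>* X) h\<close>.  They change different arguments of \<open>v\<close>, so the operators are normal, and
  \<open>h \<mapsto> v 1 h\<close> embeds the given space (\<open>normal_extension_dilation\<close>).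

  Now let a minimal normal extension \<open>N\<^sub>j\<close> and its embedding \<open>V\<close> be given.  Compression \<open>\<rho>(Y) = V\<^sup>* Y V\<close> maps the commutant of
  the extension to Toeplitz operators.  It is injective by minimality, and its inverse \<open>\<sigma>\<close> is obtained by averaging \<open>V X V\<^sup>*\<close>
  over the extension; hence \<open>\<sigma>\<close> is completely positive as well.  Put \<open>\<pi> = \<sigma> \<circ> \<Phi>\<close>, for an arbitrary completely positive
  projection \<open>\<Phi>\<close>.  For a Toeplitz operator \<open>X\<close> the Schwarz inequalities for \<open>\<Phi>\<close> and \<open>\<sigma>\<close> bound \<open>\<Phi>(X\<^sup>* X)\<close> by
  \<open>\<rho>(\<sigma>(X)\<^sup>* \<sigma>(X))\<close> from both sides (\<open>sigma_\<Phi>_square\<close>), so that \<open>X\<close> is in the multiplicative domain of \<open>\<pi>\<close>.  This makes \<open>\<pi>\<close> a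
  representation of the algebra generated by the Toeplitz operators, with \<open>\<rho> \<circ> \<pi> = \<Phi>\<close> and \<open>\<pi> \<circ> \<rho>\<close> the identity of the
  commutant.  Both \<open>\<rho>\<close> and its left inverse \<open>\<pi>\<close> are completely contractive, so that \<open>\<rho>\<close> is completely
  isometric.  The kernel of \<open>\<pi>\<close> consists of the differences \<open>X - \<Phi>(X)\<close>, and an induction over the generated
  algebra shows that these lie in the ideals in question.  Finally, if \<open>X\<close> and \<open>X\<^sup>* X\<close> are Toeplitz operators, then
  \<open>\<sigma>(X)\<close> has the same length as \<open>X\<close> on vectors of the given space, and thus maps this space into itself.
\<close>

section \<open>Complex Hilbert spaces: inner products, projections and functionals\<close>

lemma scaleC_simps [simp]:
  fixes x y :: "'a::complex_hilbert_space"
  shows "1 *\<^sub>C x = x" "0 *\<^sub>C x = 0" "a *\<^sub>C (0::'a) = 0" "(- a) *\<^sub>C x = - (a *\<^sub>C x)"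
    "a *\<^sub>C (- x) = - (a *\<^sub>C x)" "a *\<^sub>C (x - y) = a *\<^sub>C x - a *\<^sub>C y"
    "a *\<^sub>C b *\<^sub>C x = (a * b) *\<^sub>C x"
proof -
  show "1 *\<^sub>C x = x" using scaleC_of_real [of 1 x] by simp
  show z: "0 *\<^sub>C x = 0" using scaleC_of_real [of 0 x] by simp
  show "a *\<^sub>C (0::'a) = 0"
    by (rule linear_simps [OF bounded_linear_scaleC])
  show "(- a) *\<^sub>C x = - (a *\<^sub>C x)"
    using scaleC_add_left [of a "- a" x] z by (simp add: eq_neg_iff_add_eq_0 add.commute)
  show "a *\<^sub>C (- x) = - (a *\<^sub>C x)" "a *\<^sub>C (x - y) = a *\<^sub>C x - a *\<^sub>C y"
    by (rule linear_simps [OF bounded_linear_scaleC])+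
qed (rule scaleC_scaleC)

lemma scaleC_sum: "a *\<^sub>C (\<Sum>i\<in>I. f i) = (\<Sum>i\<in>I. a *\<^sub>C f i)"
  for f :: "'i \<Rightarrow> 'a::complex_hilbert_space"
  by (rule Real_Vector_Spaces.linear_sum
      [OF bounded_linear.linear [OF bounded_linear_scaleC]])

lemma cinner_add_left: "cinner (x + y) z = cinner x z + cinner y z"
  by (metis cinner_add_right cinner_commute complex_cnj_add)

lemma cinner_scaleC_left: "cinner (a *\<^sub>C x) y = cnj a * cinner x y"
  by (metis cinner_commute cinner_scaleC_right complex_cnj_mult)

lemma cinner_cauchy_schwarz: "cmod (cinner x y) \<le> norm x * norm y"
proof (cases "cinner x y = 0")
  case False
  define c where "c = cnj (sgn (cinner x y))"
  have "c * cinner x y = complex_of_real (cmod (cinner x y))"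
    using False by (simp add: c_def sgn_eq mult.commute complex_norm_square [symmetric] power2_eq_square)
  then have "cmod (cinner x y) = Re (cinner x (c *\<^sub>C y))"
    by (simp add: cinner_scaleC_right)
  also have "\<dots> \<le> norm x * norm (c *\<^sub>C y)"
    unfolding Re_cinner by (rule norm_cauchy_schwarz)
  also have "norm (c *\<^sub>C y) = norm y"
    using False by (simp add: norm_scaleC c_def norm_sgn)
  finally show ?thesis .
qed simp

lemma bounded_bilinear_cinner:
  "bounded_bilinear (cinner :: 'a::complex_hilbert_space \<Rightarrow> 'a \<Rightarrow> complex)"
proof
  show "\<exists>K. \<forall>a b. norm (cinner (a::'a) b) \<le> norm a * norm b * K"
    using cinner_cauchy_schwarz by (intro exI [of _ "1::real"]) (simp only: mult_1_right, blast)
qed (simp_all add: cinner_add_left cinner_add_right cinner_scaleC_left cinner_scaleC_right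
    scaleR_conv_of_real flip: scaleC_of_real)

lemmas cinner_linear_simps [simp] =
  bounded_bilinear.zero_left [OF bounded_bilinear_cinner]
  bounded_bilinear.zero_right [OF bounded_bilinear_cinner]
  bounded_bilinear.minus_left [OF bounded_bilinear_cinner]
  bounded_bilinear.minus_right [OF bounded_bilinear_cinner]

lemmas cinner_diff_left = bounded_bilinear.diff_left [OF bounded_bilinear_cinner]
lemmas cinner_diff_right = bounded_bilinear.diff_right [OF bounded_bilinear_cinner]
lemmas cinner_sum_left = bounded_bilinear.sum_left [OF bounded_bilinear_cinner]
lemmas cinner_sum_right = bounded_bilinear.sum_right [OF bounded_bilinear_cinner]
lemmas tendsto_cinner [tendsto_intros] = bounded_bilinear.tendsto [OF bounded_bilinear_cinner]
lemmas continuous_on_cinner [continuous_intros] =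
  bounded_bilinear.continuous_on [OF bounded_bilinear_cinner]

lemma cinner_self: "cinner x x = complex_of_real ((norm x)\<^sup>2)"
proof -
  have "Im (cinner x x) = 0"
    by (metis Reals_cnj_iff cinner_commute complex_is_Real_iff)
  then show ?thesis
    by (simp add: complex_eq_iff Re_cinner power2_norm_eq_inner)
qed

lemma cinner_self_eq_0 [simp]: "cinner x x = 0 \<longleftrightarrow> x = 0"
  by (simp add: cinner_self)

lemma cinner_eqI: "(\<And>z. cinner z x = cinner z y) \<Longrightarrow> x = y"
  by (metis cinner_diff_right cinner_self_eq_0 eq_iff_diff_eq_0)

lemma nonneg_Reals_complexI: "Im z = 0 \<Longrightarrow> 0 \<le> Re z \<Longrightarrow> z \<in> \<real>\<^sub>\<ge>\<^sub>0"
  by (simp add: complex_nonneg_Reals_iff)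

lemma complex_subspace_imp_subspace: "complex_subspace M \<Longrightarrow> subspace M"
  for M :: "'a::complex_hilbert_space set"
  by (auto simp: complex_subspace_def subspace_def simp flip: scaleC_of_real)

lemma subspace_closure:
  fixes M :: "'a::real_normed_vector set"
  assumes M: "subspace M"
  shows "subspace (closure M)"
  unfolding subspace_def
proof (intro conjI ballI allI)
  show "0 \<in> closure M"
    using subspace_0 [OF M] closure_subset by blast
next
  fix x y assume "x \<in> closure M" "y \<in> closure M"
  then obtain f g where "\<And>n. f n \<in> M" "f \<longlonglongrightarrow> x" "\<And>n. g n \<in> M" "g \<longlonglongrightarrow> y"
    unfolding closure_sequential by blast
  then show "x + y \<in> closure M"
    unfolding closure_sequential
    by (intro exI [of _ "\<lambda>n. f n + g n"]) (auto intro: tendsto_add subspace_add [OF M])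
next
  fix c x assume "x \<in> closure M"
  then obtain f where "\<And>n. f n \<in> M" "f \<longlonglongrightarrow> x"
    unfolding closure_sequential by blast
  then show "c *\<^sub>R x \<in> closure M"
    unfolding closure_sequential
    by (intro exI [of _ "\<lambda>n. c *\<^sub>R f n"]) (auto intro!: tendsto_intros subspace_scale [OF M])
qed

lemma closure_complex_subspace:
  fixes M :: "'a::complex_hilbert_space set"
  assumes M: "complex_subspace M"
  shows "complex_subspace (closure M)"
proof -
  have *: "a *\<^sub>C x \<in> closure M" if "x \<in> closure M" for a x
  proof -
    have "(\<lambda>x. a *\<^sub>C x) ` closure M \<subseteq> closure ((\<lambda>x. a *\<^sub>C x) ` M)"
      by (rule closure_bounded_linear_image_subset [OF bounded_linear_scaleC])
    also have "\<dots> \<subseteq> closure M"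
      using M by (intro closure_mono) (auto simp: complex_subspace_def)
    finally show ?thesis using that by auto
  qed
  have "subspace (closure M)"
    by (rule subspace_closure [OF complex_subspace_imp_subspace [OF M]])
  then show ?thesis
    using * by (simp add: complex_subspace_def subspace_def)
qed

text \<open>A minimizing sequence for the distance from \<open>x\<close> is Cauchy by the parallelogram law.\<close>

lemma closed_subspace_orthogonal_decomposition:
  fixes M :: "'a::{real_inner,complete_space} set"
  assumes M: "subspace M" "closed M"
  shows "\<exists>p\<in>M. \<forall>y\<in>M. inner y (x - p) = 0"
proof -
  define d where "d = (INF y\<in>M. (norm (x - y))\<^sup>2)"
  have M0: "M \<noteq> {}" using subspace_0 [OF M(1)] by auto
  have bdd: "bdd_below ((\<lambda>y. (norm (x - y))\<^sup>2) ` M)"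
    by (intro bdd_belowI [of _ 0]) auto
  have d_le: "d \<le> (norm (x - y))\<^sup>2" if "y \<in> M" for y
    unfolding d_def using that by (intro cINF_lower [OF bdd])
  have "\<exists>y\<in>M. (norm (x - y))\<^sup>2 < d + 1 / real (Suc n)" for n
  proof -
    have "d < d + 1 / real (Suc n)" by simp
    then show ?thesis
      unfolding d_def using cINF_less_iff [OF M0 bdd] by blast
  qed
  then obtain Y where Y: "\<And>n. Y n \<in> M" "\<And>n. (norm (x - Y n))\<^sup>2 < d + 1 / real (Suc n)"
    by metis
  have par: "(norm (Y m - Y n))\<^sup>2 \<le> 2 / real (Suc m) + 2 / real (Suc n)" for m n
  proof -
    have "(1/2) *\<^sub>R (Y m + Y n) \<in> M"
      using Y(1) M(1) by (simp add: subspace_add subspace_scale)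
    from d_le [OF this]
    have "4 * d \<le> (norm (2 *\<^sub>R (x - (1/2) *\<^sub>R (Y m + Y n))))\<^sup>2"
      by (simp add: power_mult_distrib)
    also have "2 *\<^sub>R (x - (1/2) *\<^sub>R (Y m + Y n)) = (x - Y m) + (x - Y n)"
      by (simp add: scaleR_right_diff_distrib scaleR_2)
    finally have "4 * d \<le> (norm ((x - Y m) + (x - Y n)))\<^sup>2" .
    moreover have "(norm ((x - Y m) + (x - Y n)))\<^sup>2 + (norm ((x - Y m) - (x - Y n)))\<^sup>2
       = 2 * (norm (x - Y m))\<^sup>2 + 2 * (norm (x - Y n))\<^sup>2"
      unfolding power2_norm_eq_inner by (simp add: inner_add inner_diff algebra_simps)
    moreover have "norm ((x - Y m) - (x - Y n)) = norm (Y m - Y n)"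
      by (simp add: norm_minus_commute)
    ultimately show ?thesis
      using Y(2) [of m] Y(2) [of n] by simp
  qed
  have "Cauchy Y"
  proof (unfold Cauchy_def, intro allI impI)
    fix e :: real assume e: "e > 0"
    then obtain N where N: "1 / real (Suc N) < e\<^sup>2 / 4"
      using nat_approx_posE [of "e\<^sup>2/4"] by (metis zero_less_divide_iff zero_less_numeral zero_less_power)
    have "dist (Y m) (Y n) < e" if "m \<ge> N" "n \<ge> N" for m n
    proof -
      have "1 / real (Suc m) \<le> 1 / real (Suc N)" "1 / real (Suc n) \<le> 1 / real (Suc N)"
        using that by (auto simp: field_simps)
      then have "(norm (Y m - Y n))\<^sup>2 < e\<^sup>2"
        using par [of m n] N by linarith
      then show ?thesis
        using e by (simp add: dist_norm power2_less_imp_less)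
    qed
    then show "\<exists>M. \<forall>m\<ge>M. \<forall>n\<ge>M. dist (Y m) (Y n) < e" by blast
  qed
  then obtain p where p: "Y \<longlonglongrightarrow> p"
    by (auto simp: Cauchy_convergent_iff convergent_def)
  have pM: "p \<in> M"
    using closed_sequentially [OF M(2)] Y(1) p by blast
  have "(\<lambda>n. d + 1 / real (Suc n)) \<longlonglongrightarrow> d + 0"
    using LIMSEQ_inverse_real_of_nat by (intro tendsto_add tendsto_const) (simp add: inverse_eq_divide)
  moreover have "(\<lambda>n. (norm (x - Y n))\<^sup>2) \<longlonglongrightarrow> (norm (x - p))\<^sup>2"
    by (intro tendsto_intros p)
  ultimately have pd: "(norm (x - p))\<^sup>2 \<le> d"
    using Y(2) by (intro LIMSEQ_le) (auto intro: less_imp_le)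
  have "inner y (x - p) = 0" if y: "y \<in> M" for y
  proof (cases "y = 0")
    case False
    define t where "t = inner y (x - p) / (norm y)\<^sup>2"
    have "p + t *\<^sub>R y \<in> M"
      using pM y M(1) by (simp add: subspace_add subspace_scale)
    from d_le [OF this] pd have "(norm (x - p))\<^sup>2 \<le> (norm ((x - p) - t *\<^sub>R y))\<^sup>2"
      unfolding diff_diff_eq by linarith
    also have "\<dots> = (norm (x - p))\<^sup>2 - 2 * t * inner y (x - p) + t\<^sup>2 * (norm y)\<^sup>2"
      unfolding power2_norm_eq_inner
      by (simp add: inner_diff inner_commute power2_eq_square algebra_simps)
    also have "\<dots> = (norm (x - p))\<^sup>2 - (inner y (x - p))\<^sup>2 / (norm y)\<^sup>2"
      using False by (simp add: t_def power2_eq_square field_simps)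
    finally show ?thesis
      using False by (simp add: field_simps)
  qed simp
  with pM show ?thesis by blast
qed

text \<open>
  A functional with bound \<open>C\<close> on a subspace that need not be closed is presented by its graph, and the
  vector representing it is read off from the projection of \<open>(0, 1)\<close> onto the closure of the
  graph, so that neither extension of functionals nor well-definedness has to be discussed.
\<close>

lemma bounded_functional_graph_real:
  fixes G :: "('a::{real_inner,complete_space} \<times> real) set"
  assumes G: "subspace G" and C: "0 \<le> C" and bound: "\<And>x t. (x, t) \<in> G \<Longrightarrow> \<bar>t\<bar> \<le> C * norm x"
  shows "\<exists>u. u \<in> closure (fst ` G) \<and> norm u \<le> C \<and> (\<forall>x t. (x, t) \<in> G \<longrightarrow> inner u x = t)"
proof -
  obtain p where p: "p \<in> closure G" "\<And>g. g \<in> closure G \<Longrightarrow> inner g ((0, 1) - p) = 0"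
    using closed_subspace_orthogonal_decomposition [OF subspace_closure [OF G] closed_closure]
    by blast
  obtain a s where as: "p = (a, s)" by (cases p)
  have "closed {g :: 'a \<times> real. \<bar>snd g\<bar> \<le> C * norm (fst g)}"
    by (intro closed_Collect_le continuous_intros)
  then have "closure G \<subseteq> {g. \<bar>snd g\<bar> \<le> C * norm (fst g)}"
    using bound by (intro closure_minimal) auto
  then have cb: "\<bar>t\<bar> \<le> C * norm x" if "(x, t) \<in> closure G" for x t
    using that by auto
  have orth: "inner x a = t * (1 - s)" if "(x, t) \<in> closure G" for x t
    using p(2) [OF that] as by simp
  have aa: "(norm a)\<^sup>2 = s * (1 - s)"
    using orth [of a s] p(1) as by (simp add: power2_norm_eq_inner)
  have s1: "s \<noteq> 1"
  proof
    assume "s = 1"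
    then have "a = 0" using aa by simp
    then show False using cb [of a s] p(1) as \<open>s = 1\<close> by simp
  qed
  have s01: "0 \<le> s" "s < 1"
  proof -
    have "0 \<le> s * (1 - s)" using aa by (metis zero_le_power2)
    then show "0 \<le> s" "s < 1" using s1 by (auto simp: zero_le_mult_iff)
  qed
  define u where "u = (1 / (1 - s)) *\<^sub>R a"
  have sub: "subspace (closure (fst ` G))"
    using G by (intro subspace_closure linear_subspace_image) (auto simp: linear_fst)
  have "fst ` closure G \<subseteq> closure (fst ` G)"
    by (intro closure_bounded_linear_image_subset bounded_linear_fst)
  then have "a \<in> closure (fst ` G)" using p(1) as by force
  then have "u \<in> closure (fst ` G)"
    unfolding u_def using sub by (rule subspace_scale [rotated])
  moreover have "norm u \<le> C"
  proof (cases "a = 0")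
    case True
    then show ?thesis using C by (simp add: u_def)
  next
    case False
    have "norm a * norm a = s * (1 - s)"
      using aa by (simp add: power2_eq_square)
    also have "\<dots> \<le> C * norm a * (1 - s)"
      using cb [of a s] p(1) as s01 by (intro mult_right_mono) auto
    finally have "norm a \<le> C * (1 - s)"
      using False by (simp add: mult.assoc mult.left_commute [of C] mult_le_cancel_left)
    then show ?thesis
      using s01 by (simp add: u_def field_simps)
  qed
  moreover have "inner u x = t" if "(x, t) \<in> G" for x t
    using orth [of x t] that s1 closure_subset [of G] by (auto simp: u_def inner_commute field_simps)
  ultimately show ?thesis by blast
qed

text \<open>A complex functional is determined by its real part, since its imaginary part at \<open>x\<close> is the real part at
  \<open>- \<i> x\<close>; hence the vector that represents the real part represents the functional.\<close>

lemma bounded_functional_graph: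
  fixes G :: "('a::complex_hilbert_space \<times> complex) set"
  assumes zero: "(0, 0) \<in> G"
    and add: "\<And>x y s t. (x, s) \<in> G \<Longrightarrow> (y, t) \<in> G \<Longrightarrow> (x + y, s + t) \<in> G"
    and scale: "\<And>a x t. (x, t) \<in> G \<Longrightarrow> (a *\<^sub>C x, a * t) \<in> G"
    and C: "0 \<le> C" and bound: "\<And>x t. (x, t) \<in> G \<Longrightarrow> cmod t \<le> C * norm x"
  shows "\<exists>u. u \<in> closure (fst ` G) \<and> norm u \<le> C \<and> (\<forall>x t. (x, t) \<in> G \<longrightarrow> cinner u x = t)"
proof -
  define R where "R = (\<lambda>(x, t). (x, Re t)) ` G"
  have R: "(x, Re t) \<in> R" if "(x, t) \<in> G" for x t
    using that by (force simp: R_def)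
  have "subspace R"
    unfolding subspace_def
  proof (intro conjI ballI allI)
    show "0 \<in> R" using R [OF zero] by (simp add: zero_prod_def)
  next
    fix p q assume "p \<in> R" "q \<in> R"
    then obtain x s y t where "p = (x, Re s)" "(x, s) \<in> G" "q = (y, Re t)" "(y, t) \<in> G"
      by (auto simp: R_def)
    then show "p + q \<in> R" using R [OF add] by fastforce
  next
    fix c p assume "p \<in> R"
    then obtain x s where "p = (x, Re s)" "(x, s) \<in> G"
      by (auto simp: R_def)
    then show "c *\<^sub>R p \<in> R"
      using R [OF scale [of x s "complex_of_real c"]] by (simp add: scaleC_of_real)
  qed
  moreover have "\<bar>t\<bar> \<le> C * norm x" if "(x, t) \<in> R" for x t
    using that bound abs_Re_le_cmod order_trans by (fastforce simp: R_def)
  ultimately have "\<exists>u. u \<in> closure (fst ` R) \<and> norm u \<le> C \<and> (\<forall>x t. (x, t) \<in> R \<longrightarrow> inner u x = t)"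
    using C by (intro bounded_functional_graph_real)
  then obtain u where u: "u \<in> closure (fst ` R)" "norm u \<le> C"
      "\<And>x t. (x, t) \<in> R \<Longrightarrow> inner u x = t"
    by blast
  have "fst ` R = fst ` G" by (force simp: R_def)
  moreover have "cinner u x = t" if "(x, t) \<in> G" for x t
  proof (rule complex_eqI)
    show "Re (cinner u x) = Re t"
      using u(3) [OF R [OF that]] by (simp add: Re_cinner)
    have "Re (cinner u ((- \<i>) *\<^sub>C x)) = Re (- \<i> * t)"
      using u(3) [OF R [OF scale [OF that, of "- \<i>"]]] by (simp only: Re_cinner)
    then show "Im (cinner u x) = Im t"
      by (simp add: cinner_scaleC_right del: scaleC_simps)
  qed
  ultimately show ?thesis using u(1,2) by auto
qed

section \<open>Bounded operators, adjoints and compressions\<close>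

abbreviation clinear :: "('a::complex_hilbert_space \<Rightarrow>\<^sub>L 'b::complex_hilbert_space) \<Rightarrow> bool" where
  "clinear A \<equiv> complex_linear_on UNIV (blinfun_apply A)"

lemma scaleC_blinfun_apply: "blinfun_apply (a *\<^sub>C A) x = a *\<^sub>C blinfun_apply A x"
  by (simp add: scaleC_blinfun.rep_eq)

lemma clinear_scaleC: "clinear A \<Longrightarrow> blinfun_apply A (a *\<^sub>C x) = a *\<^sub>C A x"
  by (simp add: complex_linear_on_def)

lemma clinearI: "(\<And>a x. blinfun_apply A (a *\<^sub>C x) = a *\<^sub>C A x) \<Longrightarrow> clinear A"
  by (simp add: complex_linear_on_def blinfun.add_right)

lemma operator_of_form:
  fixes B :: "'a::complex_hilbert_space \<Rightarrow> 'b::complex_hilbert_space \<Rightarrow> complex"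
  assumes addl: "\<And>x x' y. B (x + x') y = B x y + B x' y"
    and scalel: "\<And>a x y. B (a *\<^sub>C x) y = cnj a * B x y"
    and addr: "\<And>x y y'. B x (y + y') = B x y + B x y'"
    and scaler: "\<And>a x y. B x (a *\<^sub>C y) = a * B x y"
    and C: "0 \<le> C" and bound: "\<And>x y. cmod (B x y) \<le> C * norm x * norm y"
  obtains A :: "'b \<Rightarrow>\<^sub>L 'a"
  where "clinear A" "\<And>x y. cinner x (A y) = B x y" "\<And>y. norm (A y) \<le> C * norm y"
proof -
  have "\<exists>u. norm u \<le> C * norm y \<and> (\<forall>x. cinner x u = B x y)" for y
  proof -
    have "\<exists>u. u \<in> closure (fst ` range (\<lambda>x. (x, cnj (B x y)))) \<and> norm u \<le> C * norm y \<and>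
         (\<forall>x t. (x, t) \<in> range (\<lambda>x. (x, cnj (B x y))) \<longrightarrow> cinner u x = t)"
    proof (rule bounded_functional_graph)
      have "B 0 y = 0" using scalel [of 0 0 y] by simp
      then show "(0, 0) \<in> range (\<lambda>x. (x, cnj (B x y)))"
        by (intro image_eqI [of _ _ 0]) simp_all
      show "0 \<le> C * norm y" using C by simp
      show "cmod t \<le> C * norm y * norm x" if "(x, t) \<in> range (\<lambda>x. (x, cnj (B x y)))" for x t
        using that bound [of x y] by (auto simp: mult.assoc mult.commute [of "norm x"])
      show "(x + x', s + t) \<in> range (\<lambda>x. (x, cnj (B x y)))"
        if "(x, s) \<in> range (\<lambda>x. (x, cnj (B x y)))" "(x', t) \<in> range (\<lambda>x. (x, cnj (B x y)))"
        for x x' s t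
        using that by (intro image_eqI [of _ _ "x + x'"]) (auto simp: addl)
      show "(a *\<^sub>C x, a * t) \<in> range (\<lambda>x. (x, cnj (B x y)))"
        if "(x, t) \<in> range (\<lambda>x. (x, cnj (B x y)))" for a x t
        using that by (intro image_eqI [of _ _ "a *\<^sub>C x"]) (auto simp: scalel)
    qed
    then obtain u where "norm u \<le> C * norm y" "\<And>x. cinner u x = cnj (B x y)" by blast
    then show ?thesis by (metis cinner_commute complex_cnj_cnj)
  qed
  then obtain f where f: "\<And>y. norm (f y) \<le> C * norm y" "\<And>x y. cinner x (f y) = B x y"
    by metis
  have "bounded_linear f"
  proof (rule bounded_linear_intro)
    show "f (x + y) = f x + f y" for x y
      by (rule cinner_eqI) (simp add: f addr cinner_add_right)
    show "f (r *\<^sub>R x) = r *\<^sub>R f x" for r x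
      by (rule cinner_eqI) (simp add: f scaler cinner_scaleC_right flip: scaleC_of_real)
    show "norm (f x) \<le> norm x * C" for x
      using f(1) by (simp add: mult.commute)
  qed
  then have app: "blinfun_apply (Blinfun f) = f" by (rule bounded_linear_Blinfun_apply)
  show ?thesis
  proof (rule that [of "Blinfun f"])
    have "f (a *\<^sub>C x) = a *\<^sub>C f x" for a x
      by (rule cinner_eqI) (simp add: f scaler cinner_scaleC_right)
    then show "clinear (Blinfun f)" by (intro clinearI) (simp add: app)
  qed (simp_all add: app f)
qed

lemma adj_unique:
  assumes "\<And>x y. cinner (blinfun_apply A x) y = cinner x (blinfun_apply B y)"
  shows "adj A = B"
  unfolding adj_def
proof (rule the_equality)
  fix B' assume "\<forall>x y. cinner (A x) y = cinner x (blinfun_apply B' y)"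
  then show "B' = B"
    using assms by (intro blinfun_eqI cinner_eqI) metis
qed (use assms in simp)

lemma adj_exists:
  fixes A :: "'a::complex_hilbert_space \<Rightarrow>\<^sub>L 'b::complex_hilbert_space"
  assumes A: "clinear A"
  shows "clinear (adj A)" and "cinner (A x) y = cinner x (adj A y)"
    and "norm (adj A y) \<le> norm A * norm y"
proof -
  obtain B :: "'b \<Rightarrow>\<^sub>L 'a" where B: "clinear B" "\<And>x y. cinner x (B y) = cinner (A x) y"
    "\<And>y. norm (B y) \<le> norm A * norm y"
  proof (rule operator_of_form [of "\<lambda>x y. cinner (A x) y" "norm A"])
    show "cmod (cinner (A x) y) \<le> norm A * norm x * norm y" for x y
      by (rule order_trans [OF cinner_cauchy_schwarz]) (simp add: norm_blinfun mult_right_mono)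
  qed (use A in \<open>simp_all add: blinfun.add_right cinner_add_left cinner_add_right clinear_scaleC
        cinner_scaleC_left cinner_scaleC_right\<close>)
  have "adj A = B" by (rule adj_unique) (simp add: B)
  with B show "clinear (adj A)" "cinner (A x) y = cinner x (adj A y)"
    "norm (adj A y) \<le> norm A * norm y" by auto
qed

lemma cinner_adj: "clinear A \<Longrightarrow> cinner x (adj A y) = cinner (blinfun_apply A x) y"
  by (simp add: adj_exists)

lemma cinner_adj_left: "clinear A \<Longrightarrow> cinner (adj A x) y = cinner x (blinfun_apply A y)"
  by (metis adj_exists(2) cinner_commute)

lemma clinear_adj: "clinear A \<Longrightarrow> clinear (adj A)"
  by (rule adj_exists)

lemma adj_adj: "clinear A \<Longrightarrow> adj (adj A) = A"
  by (rule adj_unique) (simp add: cinner_adj_left)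

lemma clinear_compose: "clinear A \<Longrightarrow> clinear B \<Longrightarrow> clinear (A o\<^sub>L B)"
  by (rule clinearI) (simp add: clinear_scaleC)

lemma clinear_plus: "clinear A \<Longrightarrow> clinear B \<Longrightarrow> clinear (A + B)"
  by (rule clinearI) (simp add: clinear_scaleC blinfun.add_left scaleC_add_right)

lemma clinear_minus: "clinear A \<Longrightarrow> clinear B \<Longrightarrow> clinear (A - B)"
  by (rule clinearI) (simp add: clinear_scaleC blinfun.diff_left)

lemma clinear_scale: "clinear A \<Longrightarrow> clinear (a *\<^sub>C A)"
  by (rule clinearI) (simp add: clinear_scaleC scaleC_blinfun_apply mult.commute)

lemma clinear_id: "clinear id_blinfun"
  by (rule clinearI) simp

lemma clinear_zero: "clinear 0"
  by (rule clinearI) simp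

lemmas clinear_intros = clinear_adj clinear_compose clinear_plus clinear_minus clinear_scale
  clinear_id clinear_zero

lemma adj_plus: "clinear A \<Longrightarrow> clinear B \<Longrightarrow> adj (A + B) = adj A + adj B"
  by (rule adj_unique) (simp add: blinfun.add_left cinner_add_left cinner_add_right cinner_adj)

lemma adj_minus: "clinear A \<Longrightarrow> clinear B \<Longrightarrow> adj (A - B) = adj A - adj B"
  by (rule adj_unique) (simp add: blinfun.diff_left cinner_diff_left cinner_diff_right cinner_adj)

lemma adj_scaleC: "clinear A \<Longrightarrow> adj (a *\<^sub>C A) = cnj a *\<^sub>C adj A"
  by (rule adj_unique)
    (simp add: scaleC_blinfun_apply cinner_scaleC_left cinner_scaleC_right cinner_adj)

lemma adj_compose: "clinear A \<Longrightarrow> clinear B \<Longrightarrow> adj (A o\<^sub>L B) = adj B o\<^sub>L adj A"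
  by (rule adj_unique) (simp add: cinner_adj)

lemma adj_id: "adj id_blinfun = id_blinfun"
  by (rule adj_unique) simp

lemma norm_adj_le: "clinear A \<Longrightarrow> norm (adj A) \<le> norm A"
  by (rule norm_blinfun_bound) (simp_all add: adj_exists)

lemma scaleC_blinfun_simps:
  fixes A B :: "'a::real_normed_vector \<Rightarrow>\<^sub>L 'b::complex_hilbert_space"
  shows "1 *\<^sub>C A = A" "0 *\<^sub>C A = 0" "a *\<^sub>C (0 :: 'a \<Rightarrow>\<^sub>L 'b) = 0" "(- 1) *\<^sub>C A = - A"
    "a *\<^sub>C (A + B) = a *\<^sub>C A + a *\<^sub>C B" "a *\<^sub>C (A - B) = a *\<^sub>C A - a *\<^sub>C B"
  by (auto intro!: blinfun_eqI simp: scaleC_blinfun_apply blinfun.add_left blinfun.diff_left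
      blinfun.minus_left scaleC_add_right)

lemma compose_scaleC_left: "(a *\<^sub>C A) o\<^sub>L B = a *\<^sub>C (A o\<^sub>L B)"
  for A :: "'b::real_normed_vector \<Rightarrow>\<^sub>L 'c::complex_hilbert_space"
    and B :: "'a::real_normed_vector \<Rightarrow>\<^sub>L 'b"
  by (rule blinfun_eqI) (simp add: scaleC_blinfun_apply)

lemma compose_scaleC_right: "clinear A \<Longrightarrow> A o\<^sub>L (a *\<^sub>C B) = a *\<^sub>C (A o\<^sub>L B)"
  by (rule blinfun_eqI) (simp add: scaleC_blinfun_apply clinear_scaleC)

lemma norm_scaleC_blinfun: "norm (a *\<^sub>C A) \<le> cmod a * norm A"
  for A :: "'a::real_normed_vector \<Rightarrow>\<^sub>L 'b::complex_hilbert_space"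
  by (rule norm_blinfun_bound)
     (simp_all add: scaleC_blinfun_apply norm_scaleC mult.assoc mult_left_mono norm_blinfun)

lemma compose_add_left: "(A + B) o\<^sub>L C = (A o\<^sub>L C) + (B o\<^sub>L C)"
  and compose_add_right: "D o\<^sub>L (E + F) = (D o\<^sub>L E) + (D o\<^sub>L F)"
  and compose_diff_right: "D o\<^sub>L (E - F) = (D o\<^sub>L E) - (D o\<^sub>L F)"
  by (auto intro!: blinfun_eqI simp: blinfun.add_left blinfun.add_right blinfun.diff_left
      blinfun.diff_right)

lemma cinner_tendsto_operator:
  assumes "(\<lambda>n. A n) \<longlonglongrightarrow> A'"
  shows "(\<lambda>n. blinfun_apply (A n) x) \<longlonglongrightarrow> blinfun_apply A' x"
  by (intro blinfun.tendsto assms tendsto_const)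

subsection \<open>Orthogonal projections and operators on a closed subspace\<close>

lemma orth_proj_exists:
  fixes K :: "'a::complex_hilbert_space set"
  assumes K: "hilbert_subspace K"
  shows "\<exists>!P :: 'a \<Rightarrow>\<^sub>L 'a. \<forall>x. P x \<in> K \<and> (\<forall>y\<in>K. cinner y (x - P x) = 0)"
proof -
  have Ks: "complex_subspace K" "subspace K" "closed K"
    using K by (simp_all add: hilbert_subspace_def complex_subspace_imp_subspace)
  have uniq: "p = q" if "p \<in> K" "q \<in> K" "\<forall>y\<in>K. cinner y (x - p) = 0" "\<forall>y\<in>K. cinner y (x - q) = 0"
    for x p q
  proof -
    have "p - q \<in> K" using that Ks(2) by (simp add: subspace_diff)
    then have "cinner (p - q) ((x - q) - (x - p)) = 0"
      unfolding cinner_diff_right [of _ "x - q"] using that by simp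
    then show ?thesis by (simp add: cinner_self)
  qed
  have "\<exists>p\<in>K. \<forall>y\<in>K. cinner y (x - p) = 0" for x
  proof -
    obtain p where p: "p \<in> K" "\<And>y. y \<in> K \<Longrightarrow> inner y (x - p) = 0"
      using closed_subspace_orthogonal_decomposition [OF Ks(2,3)] by blast
    have "cinner y (x - p) = 0" if y: "y \<in> K" for y
    proof (rule complex_eqI)
      have "\<i> *\<^sub>C y \<in> K" using Ks(1) y by (simp add: complex_subspace_def)
      from p(2) [OF this] show "Im (cinner y (x - p)) = Im 0"
        by (simp add: cinner_scaleC_left flip: Re_cinner)
      show "Re (cinner y (x - p)) = Re 0"
        using p(2) [OF y] by (simp add: Re_cinner)
    qed
    with p(1) show ?thesis by blast
  qed
  then obtain f where f: "\<And>x. f x \<in> K" "\<And>x y. y \<in> K \<Longrightarrow> cinner y (x - f x) = 0"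
    by metis
  have "bounded_linear f"
  proof (rule bounded_linear_intro)
    show "f (x + y) = f x + f y" for x y
    proof (rule uniq [of _ _ "x + y"])
      show "\<forall>z\<in>K. cinner z (x + y - (f x + f y)) = 0"
        using f(2) [of _ x] f(2) [of _ y] by (simp add: cinner_add_right cinner_diff_right)
    qed (use f Ks(2) in \<open>auto simp: subspace_add\<close>)
    show "f (r *\<^sub>R x) = r *\<^sub>R f x" for r x
    proof (rule uniq [of _ _ "r *\<^sub>R x"])
      show "\<forall>z\<in>K. cinner z (r *\<^sub>R x - r *\<^sub>R f x) = 0"
        using f(2) [of _ x]
        by (simp add: cinner_diff_right bounded_bilinear.scaleR_right [OF bounded_bilinear_cinner])
    qed (use f Ks(2) in \<open>auto simp: subspace_scale\<close>)
    show "norm (f x) \<le> norm x * 1" for x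
    proof -
      have "cinner (f x) (f x) = cinner (f x) x"
        using f(2) [OF f(1), of x x] by (simp add: cinner_diff_right)
      then have "norm (f x) * norm (f x) = cmod (cinner (f x) x)"
        by (metis cinner_self norm_of_real abs_of_nonneg zero_le_power2 power2_eq_square)
      also have "\<dots> \<le> norm (f x) * norm x" by (rule cinner_cauchy_schwarz)
      finally show ?thesis
        by (cases "f x = 0") (auto simp: mult_le_cancel_left)
    qed
  qed
  then have app: "blinfun_apply (Blinfun f) = f" by (rule bounded_linear_Blinfun_apply)
  show ?thesis
  proof (rule ex1I [of _ "Blinfun f"])
    show "\<forall>x. Blinfun f x \<in> K \<and> (\<forall>y\<in>K. cinner y (x - Blinfun f x) = 0)"
      unfolding app using f by blast
    show "P = Blinfun f" if "\<forall>x. P x \<in> K \<and> (\<forall>y\<in>K. cinner y (x - blinfun_apply P x) = 0)"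
      for P :: "'a \<Rightarrow>\<^sub>L 'a"
    proof (rule blinfun_eqI)
      fix x show "blinfun_apply P x = blinfun_apply (Blinfun f) x"
        unfolding app using that f by (intro uniq [of _ _ x]) auto
    qed
  qed
qed

lemma orth_proj_unique:
  assumes "hilbert_subspace K" "\<And>x. blinfun_apply P x \<in> K"
    "\<And>x y. y \<in> K \<Longrightarrow> cinner y (x - blinfun_apply P x) = 0"
  shows "orth_proj K = P"
  unfolding orth_proj_def using the1_equality [OF orth_proj_exists [OF assms(1)]] assms by blast

context
  fixes K :: "'a::complex_hilbert_space set"
  assumes K: "hilbert_subspace K"
begin

lemma orth_proj_in: "orth_proj K x \<in> K"
  and cinner_orth_proj_diff: "y \<in> K \<Longrightarrow> cinner y (x - orth_proj K x) = 0"
  using theI' [OF orth_proj_exists [OF K]] by (auto simp: orth_proj_def)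

lemma orth_proj_fixes: "x \<in> K \<Longrightarrow> orth_proj K x = x"
proof -
  assume x: "x \<in> K"
  have "x - orth_proj K x \<in> K"
    using x orth_proj_in K by (auto simp: hilbert_subspace_def intro!: subspace_diff
        complex_subspace_imp_subspace)
  from cinner_orth_proj_diff [OF this, of x] show ?thesis by simp
qed

lemma cinner_orth_proj: "y \<in> K \<Longrightarrow> cinner y (orth_proj K x) = cinner y x"
  using cinner_orth_proj_diff [of y x] by (simp add: cinner_diff_right)

lemma cinner_orth_proj_left: "cinner (orth_proj K y) x = cinner y (orth_proj K x)"
  by (metis cinner_commute cinner_orth_proj orth_proj_in)

lemma adj_orth_proj: "adj (orth_proj K) = orth_proj K"
  by (rule adj_unique) (simp add: cinner_orth_proj_left)

lemma clinear_orth_proj: "clinear (orth_proj K)"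
  by (rule clinearI, rule cinner_eqI) (simp add: cinner_scaleC_right flip: cinner_orth_proj_left)

lemma norm_orth_proj_le: "norm (orth_proj K x) \<le> norm x"
proof -
  have "norm (orth_proj K x) * norm (orth_proj K x) = cmod (cinner (orth_proj K x) x)"
    by (metis cinner_self norm_of_real abs_of_nonneg zero_le_power2 power2_eq_square cinner_orth_proj
        orth_proj_in)
  also have "\<dots> \<le> norm (orth_proj K x) * norm x" by (rule cinner_cauchy_schwarz)
  finally show ?thesis
    by (cases "orth_proj K x = 0") (auto simp: mult_le_cancel_left)
qed

text \<open>Operators on a closed subspace \<open>K\<close> are operators of the ambient space that live on \<open>K\<close>: the projection
  onto \<open>K\<close> is absorbed on either side, and is the unit of \<open>\<B> K\<close>.\<close>

lemma bounded_ops_iff: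
  "A \<in> \<B> K \<longleftrightarrow> clinear A \<and> (\<forall>x. A x \<in> K) \<and> (\<forall>x. A (orth_proj K x) = A x)"
proof -
  have "(\<forall>x. (\<forall>y\<in>K. cinner y x = 0) \<longrightarrow> A x = 0) \<longleftrightarrow> (\<forall>x. A (orth_proj K x) = A x)"
  proof safe
    fix x assume "\<forall>x. (\<forall>y\<in>K. cinner y x = 0) \<longrightarrow> A x = 0"
    then have "A (x - orth_proj K x) = 0" using cinner_orth_proj_diff by blast
    then show "A (orth_proj K x) = A x" by (simp add: blinfun.diff_right)
  next
    fix x assume *: "\<forall>x. A (orth_proj K x) = A x" and "\<forall>y\<in>K. cinner y x = 0"
    then have "cinner (orth_proj K x) (orth_proj K x) = 0"
      by (simp add: cinner_orth_proj orth_proj_in)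
    then show "A x = 0" using * by (metis blinfun.zero_right cinner_self_eq_0)
  qed
  then show ?thesis unfolding bounded_ops_def by auto
qed

lemma cstar_subalgebra_bounded_ops: "cstar_subalgebra K (\<B> K)"
proof -
  have Ks: "complex_subspace K" "closed K" "subspace K"
    using K by (auto simp: hilbert_subspace_def complex_subspace_imp_subspace)
  have "closed (\<B> K)"
    unfolding closed_sequential_limits
  proof (intro allI impI)
    fix X :: "nat \<Rightarrow> 'a \<Rightarrow>\<^sub>L 'a" and L
    assume XL: "(\<forall>n. X n \<in> \<B> K) \<and> X \<longlonglongrightarrow> L"
    then have lim: "\<And>x. (\<lambda>n. X n x) \<longlonglongrightarrow> L x" and X: "\<And>n. X n \<in> \<B> K"
      by (auto intro: cinner_tendsto_operator)
    show "L \<in> \<B> K"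
      unfolding bounded_ops_iff
    proof (intro conjI allI clinearI)
      fix a x
      have "(\<lambda>n. X n (a *\<^sub>C x)) \<longlonglongrightarrow> a *\<^sub>C L x"
        using X by (simp add: bounded_ops_iff clinear_scaleC)
           (intro bounded_linear.tendsto [OF bounded_linear_scaleC] lim)
      then show "L (a *\<^sub>C x) = a *\<^sub>C L x" using lim LIMSEQ_unique by blast
    next
      fix x
      show "L x \<in> K" using closed_sequentially [OF Ks(2) _ lim] X by (simp add: bounded_ops_iff)
      have "(\<lambda>n. X n (orth_proj K x)) \<longlonglongrightarrow> L x"
        using X lim by (simp add: bounded_ops_iff)
      then show "L (orth_proj K x) = L x" using lim LIMSEQ_unique by blast
    qed
  qed
  moreover have "adj A \<in> \<B> K" if A: "A \<in> \<B> K" for A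
  proof -
    have A': "clinear A" "\<And>x. A x \<in> K" "\<And>x. A (orth_proj K x) = A x"
      using A by (auto simp: bounded_ops_iff)
    have "orth_proj K (adj A x) = adj A x" for x
      by (rule cinner_eqI) (simp add: cinner_adj A' flip: cinner_orth_proj_left)
    then have "adj A x \<in> K" for x by (metis orth_proj_in)
    moreover have "adj A (orth_proj K x) = adj A x" for x
      by (rule cinner_eqI) (simp add: cinner_adj A' cinner_orth_proj)
    ultimately show ?thesis by (simp add: bounded_ops_iff A' clinear_adj)
  qed
  ultimately show ?thesis
    using Ks unfolding cstar_subalgebra_def complex_subspace_def
    by (auto simp: bounded_ops_iff clinear_intros scaleC_blinfun_apply blinfun.add_left
        subspace_add)
qed

lemma orth_proj_bounded_ops: "orth_proj K \<in> \<B> K"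
  by (simp add: bounded_ops_iff clinear_orth_proj orth_proj_in orth_proj_fixes)

lemma orth_proj_compose_left: "A \<in> \<B> K \<Longrightarrow> orth_proj K o\<^sub>L A = A"
  and orth_proj_compose_right: "A \<in> \<B> K \<Longrightarrow> A o\<^sub>L orth_proj K = A"
  by (auto intro!: blinfun_eqI simp: bounded_ops_iff orth_proj_fixes)

end

lemma hilbert_subspace_UNIV: "hilbert_subspace UNIV"
  by (simp add: hilbert_subspace_def complex_subspace_def)

lemma bounded_ops_UNIV_iff: "A \<in> \<B> UNIV \<longleftrightarrow> clinear A"
  by (simp add: bounded_ops_iff [OF hilbert_subspace_UNIV] orth_proj_UNIV)

lemma bounded_ops_clinear: "A \<in> \<B> K \<Longrightarrow> clinear A"
  by (simp add: bounded_ops_def)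

lemma blinfun_compose_assoc: "(A o\<^sub>L B) o\<^sub>L C = A o\<^sub>L (B o\<^sub>L C)"
  by (rule blinfun_eqI) simp

subsection \<open>Positive operators and generated algebras\<close>

definition positive_op :: "('a::complex_hilbert_space \<Rightarrow>\<^sub>L 'a) \<Rightarrow> bool" where
  "positive_op A \<longleftrightarrow> (\<forall>x. cinner x (A x) \<in> \<real>\<^sub>\<ge>\<^sub>0)"

lemma nonneg_Reals_of_real_iff [simp]: "complex_of_real r \<in> \<real>\<^sub>\<ge>\<^sub>0 \<longleftrightarrow> 0 \<le> r"
  by (simp add: complex_nonneg_Reals_iff)

lemma cinner_orth_proj_self:
  "hilbert_subspace K \<Longrightarrow> cinner x (orth_proj K x) = complex_of_real ((norm (orth_proj K x))\<^sup>2)"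
  by (metis cinner_orth_proj cinner_orth_proj_left cinner_self orth_proj_in)

text \<open>Polarization: over the complex numbers an operator is determined by its quadratic form.\<close>

lemma clinear_eqI:
  assumes A: "clinear A" and B: "clinear B"
    and eq: "\<And>x. cinner x (blinfun_apply A x) = cinner x (blinfun_apply B x)"
  shows "A = B"
proof -
  define D where "D = A - B"
  have D: "clinear D" unfolding D_def by (intro clinear_intros A B)
  have q: "cinner x (D x) = 0" for x
    by (simp add: D_def blinfun.diff_left cinner_diff_right eq)
  have "cinner x (D y) = 0" for x y
  proof -
    have 1: "cinner x (D y) + cinner y (D x) = 0"
      using q [of "x + y"] q [of x] q [of y]
      by (simp add: blinfun.add_right cinner_add_left cinner_add_right add.commute)
    have 2: "\<i> * cinner x (D y) - \<i> * cinner y (D x) = 0"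
      using q [of "x + \<i> *\<^sub>C y"] q [of x] q [of y]
      by (simp add: blinfun.add_right cinner_add_left cinner_add_right clinear_scaleC D
          cinner_scaleC_left cinner_scaleC_right)
    have "\<i> * (2 * cinner x (D y)) = \<i> * (cinner x (D y) + cinner y (D x))
        + (\<i> * cinner x (D y) - \<i> * cinner y (D x))"
      by (simp add: algebra_simps)
    then show ?thesis using 1 2 by simp
  qed
  then have "D = 0"
    by (intro blinfun_eqI) (metis blinfun.zero_left cinner_self_eq_0)
  then show ?thesis by (simp add: D_def)
qed

lemma positive_op_antisym:
  assumes "clinear A" "clinear B" "positive_op (A - B)" "positive_op (B - A)"
  shows "A = B"
proof (rule clinear_eqI [OF assms(1,2)])
  fix x
  have "cinner x (A x) - cinner x (B x) \<in> \<real>\<^sub>\<ge>\<^sub>0" "cinner x (B x) - cinner x (A x) \<in> \<real>\<^sub>\<ge>\<^sub>0"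
    using assms(3,4) by (auto simp: positive_op_def blinfun.diff_left cinner_diff_right)
  then show "cinner x (A x) = cinner x (B x)"
    by (auto simp: complex_nonneg_Reals_iff complex_eq_iff)
qed

lemma positive_op_add: "positive_op A \<Longrightarrow> positive_op B \<Longrightarrow> positive_op (A + B)"
  by (simp add: positive_op_def blinfun.add_left cinner_add_right nonneg_Reals_add_I)

lemma positive_op_trans: "positive_op (A - B) \<Longrightarrow> positive_op (B - C) \<Longrightarrow> positive_op (A - C)"
  using positive_op_add [of "A - B" "B - C"] by simp

lemma positive_op_adj_compose: "clinear X \<Longrightarrow> positive_op (adj X o\<^sub>L X)"
  by (simp add: positive_op_def cinner_adj cinner_self)

lemma cstar_least:
  "cstar_subalgebra K \<A> \<Longrightarrow> orth_proj K \<in> \<A> \<Longrightarrow> S \<subseteq> \<A> \<Longrightarrow> cstar K S \<subseteq> \<A>"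
  by (auto simp: cstar_def)

lemma cstar_contains: "S \<subseteq> cstar K S" "orth_proj K \<in> cstar K S"
  by (auto simp: cstar_def)

lemma cstar_subalgebra_Inter:
  assumes "\<X> \<noteq> {}" "\<And>\<A>. \<A> \<in> \<X> \<Longrightarrow> cstar_subalgebra K \<A>"
  shows "cstar_subalgebra K (\<Inter>\<X>)"
  unfolding cstar_subalgebra_def complex_subspace_def
proof (intro conjI ballI allI closed_Inter)
  obtain \<A> where "\<A> \<in> \<X>" using assms(1) by blast
  then show "\<Inter>\<X> \<subseteq> \<B> K" using assms(2) [of \<A>] by (auto simp: cstar_subalgebra_def)
qed (use assms in \<open>auto simp: cstar_subalgebra_def complex_subspace_def\<close>)

lemma cstar_subalgebra_cstar:
  assumes "hilbert_subspace K" "S \<subseteq> \<B> K"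
  shows "cstar_subalgebra K (cstar K S)"
  unfolding cstar_def
proof (rule cstar_subalgebra_Inter)
  have "\<B> K \<in> {\<A>. cstar_subalgebra K \<A> \<and> orth_proj K \<in> \<A> \<and> S \<subseteq> \<A>}"
    using assms by (auto simp: cstar_subalgebra_bounded_ops orth_proj_bounded_ops)
  then show "{\<A>. cstar_subalgebra K \<A> \<and> orth_proj K \<in> \<A> \<and> S \<subseteq> \<A>} \<noteq> {}" by blast
qed auto

context
  fixes K :: "'a::complex_hilbert_space set" and \<A>
  assumes \<A>: "cstar_subalgebra K \<A>"
begin

lemma cstar_subalgebraD:
  "A \<in> \<A> \<Longrightarrow> A \<in> \<B> K" "A \<in> \<A> \<Longrightarrow> clinear A" "closed \<A>" "0 \<in> \<A>"
  "A \<in> \<A> \<Longrightarrow> B \<in> \<A> \<Longrightarrow> A + B \<in> \<A>" "A \<in> \<A> \<Longrightarrow> a *\<^sub>C A \<in> \<A>"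
  "A \<in> \<A> \<Longrightarrow> B \<in> \<A> \<Longrightarrow> A o\<^sub>L B \<in> \<A>" "A \<in> \<A> \<Longrightarrow> adj A \<in> \<A>"
  using \<A> by (auto simp: cstar_subalgebra_def complex_subspace_def dest: bounded_ops_clinear)

lemma cstar_subalgebra_minus: "A \<in> \<A> \<Longrightarrow> - A \<in> \<A>"
  using cstar_subalgebraD(6) [of A "- 1"] by (simp add: scaleC_blinfun_simps)

lemma cstar_subalgebra_diff: "A \<in> \<A> \<Longrightarrow> B \<in> \<A> \<Longrightarrow> A - B \<in> \<A>"
  using cstar_subalgebraD(5) [of A "- B"] by (simp add: cstar_subalgebra_minus)

lemma cstar_subalgebra_sum: "(\<And>i. i \<in> I \<Longrightarrow> f i \<in> \<A>) \<Longrightarrow> (\<Sum>i\<in>I. f i) \<in> \<A>"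
  by (induction I rule: infinite_finite_induct) (auto simp: cstar_subalgebraD)

end

lemmas bounded_ops_closure = cstar_subalgebraD(3-8) [OF cstar_subalgebra_bounded_ops]
  cstar_subalgebra_minus [OF cstar_subalgebra_bounded_ops]
  cstar_subalgebra_diff [OF cstar_subalgebra_bounded_ops]
  cstar_subalgebra_sum [OF cstar_subalgebra_bounded_ops]

section \<open>Unital completely positive maps and their multiplicative domains\<close>

text \<open>Operators on a subspace are operators of the ambient space, so that the units which have to correspond
  to each other are the orthogonal projections.\<close>

locale ucp_map =
  fixes K :: "'a::complex_hilbert_space set" and L :: "'b::complex_hilbert_space set"
    and \<theta> :: "('a \<Rightarrow>\<^sub>L 'a) \<Rightarrow> ('b \<Rightarrow>\<^sub>L 'b)"
  assumes K: "hilbert_subspace K" and L: "hilbert_subspace L"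
    and cp: "completely_positive (\<B> K) \<theta>"
    and into: "X \<in> \<B> K \<Longrightarrow> \<theta> X \<in> \<B> L"
    and unital: "\<theta> (orth_proj K) = orth_proj L"
begin

lemma add: "X \<in> \<B> K \<Longrightarrow> Y \<in> \<B> K \<Longrightarrow> \<theta> (X + Y) = \<theta> X + \<theta> Y"
  and scale: "X \<in> \<B> K \<Longrightarrow> \<theta> (a *\<^sub>C X) = a *\<^sub>C \<theta> X"
  using cp by (auto simp: completely_positive_def complex_linear_on_def)

lemma minus: "X \<in> \<B> K \<Longrightarrow> \<theta> (- X) = - \<theta> X"
  using scale [of X "- 1"] by (simp add: scaleC_blinfun_simps)

lemma zero: "\<theta> 0 = 0"
  using scale [of 0 0] bounded_ops_closure(2) [OF K] by (simp add: scaleC_blinfun_simps)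

lemma diff: "X \<in> \<B> K \<Longrightarrow> Y \<in> \<B> K \<Longrightarrow> \<theta> (X - Y) = \<theta> X - \<theta> Y"
  using add [of X "- Y"] by (simp add: minus bounded_ops_closure K)

lemma sum: "(\<And>i. i \<in> I \<Longrightarrow> f i \<in> \<B> K) \<Longrightarrow> \<theta> (\<Sum>i\<in>I. f i) = (\<Sum>i\<in>I. \<theta> (f i))"
  by (induction I rule: infinite_finite_induct) (auto simp: zero add bounded_ops_closure K)

lemma lin: "X \<in> \<B> K \<Longrightarrow> clinear X" "X \<in> \<B> K \<Longrightarrow> clinear (\<theta> X)"
  using into bounded_ops_clinear by auto

lemma matrix_positive:
  assumes "\<And>i j. i < n \<Longrightarrow> j < n \<Longrightarrow> A i j \<in> \<B> K" "op_matrix_positive n A"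
  shows "op_matrix_positive n (\<lambda>i j. \<theta> (A i j))"
  using cp assms by (auto simp: completely_positive_def)

lemma positive: "X \<in> \<B> K \<Longrightarrow> positive_op X \<Longrightarrow> positive_op (\<theta> X)"
proof -
  assume "X \<in> \<B> K" "positive_op X"
  then have "op_matrix_positive 1 (\<lambda>i j. \<theta> X)"
    by (intro matrix_positive) (auto simp: op_matrix_positive_def positive_op_def)
  then have "cinner ((\<lambda>_. x) 0) (\<theta> X ((\<lambda>_. x) (0::nat))) \<in> \<real>\<^sub>\<ge>\<^sub>0" for x
    unfolding op_matrix_positive_def by (simp add: all_conj_distrib) (erule allE [of _ "\<lambda>_. x"], simp)
  then show ?thesis by (simp add: positive_op_def)
qed

lemma mono: "X \<in> \<B> K \<Longrightarrow> Y \<in> \<B> K \<Longrightarrow> positive_op (X - Y) \<Longrightarrow> positive_op (\<theta> X - \<theta> Y)"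
  using positive [of "X - Y"] by (simp add: diff bounded_ops_closure K)

text \<open>Both the star property and the Schwarz inequality come from the positive matrix with rows
  \<open>(1, X)\<close> and \<open>(X\<^sup>*, X\<^sup>* X)\<close>.\<close>

lemma two_by_two:
  assumes X: "X \<in> \<B> K"
  shows "cinner y (orth_proj L y) + cinner y (\<theta> X x) + cinner x (\<theta> (adj X) y)
    + cinner x (\<theta> (adj X o\<^sub>L X) x) \<in> \<real>\<^sub>\<ge>\<^sub>0"
proof -
  define A where "A = (\<lambda>(i::nat) (j::nat). if i = 0 then if j = 0 then orth_proj K else X
    else if j = 0 then adj X else adj X o\<^sub>L X)"
  have "op_matrix_positive 2 A"
    unfolding op_matrix_positive_def
  proof
    fix z :: "nat \<Rightarrow> 'a"
    let ?w = "orth_proj K (z 0) + X (z 1)"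
    have PX: "orth_proj K (X (z 1)) = X (z 1)"
      using X by (simp add: bounded_ops_iff [OF K] orth_proj_fixes [OF K])
    have "cinner (z 0) (X (z 1)) = cinner (orth_proj K (z 0)) (X (z 1))"
      by (simp only: cinner_orth_proj_left [OF K] PX)
    moreover have "cinner (X (z 1)) (z 0) = cinner (X (z 1)) (orth_proj K (z 0))"
      by (simp only: PX flip: cinner_orth_proj_left [OF K])
    moreover have "cinner (z 0) (orth_proj K (z 0)) = cinner (orth_proj K (z 0)) (orth_proj K (z 0))"
      by (simp add: cinner_orth_proj_left [OF K] orth_proj_fixes [OF K] orth_proj_in [OF K])
    ultimately have "(\<Sum>i<2. cinner (z i) (\<Sum>j<2. A i j (z j))) = cinner ?w ?w"
      using lin(1) [OF X]
      by (simp add: numeral_2_eq_2 A_def cinner_add_left cinner_add_right cinner_adj)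
    then show "(\<Sum>i<2. cinner (z i) (\<Sum>j<2. A i j (z j))) \<in> \<real>\<^sub>\<ge>\<^sub>0"
      by (simp add: cinner_self)
  qed
  moreover have "A i j \<in> \<B> K" for i j
    using X by (auto simp: A_def bounded_ops_closure orth_proj_bounded_ops K)
  ultimately have "op_matrix_positive 2 (\<lambda>i j. \<theta> (A i j))"
    by (intro matrix_positive)
  then have "(\<Sum>i<2. cinner ((\<lambda>i. if i = 0 then y else x) i)
      (\<Sum>j<2. \<theta> (A i j) ((\<lambda>i::nat. if i = 0 then y else x) j))) \<in> \<real>\<^sub>\<ge>\<^sub>0"
    unfolding op_matrix_positive_def by (rule spec)
  then show ?thesis
    by (simp add: numeral_2_eq_2 A_def cinner_add_right unital add.assoc)
qed

lemma star:
  assumes X: "X \<in> \<B> K"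
  shows "\<theta> (adj X) = adj (\<theta> X)"
proof (rule adj_unique [symmetric])
  fix x y
  let ?Z = "\<theta> (adj X o\<^sub>L X)"
  have XX: "adj X o\<^sub>L X \<in> \<B> K" "positive_op (adj X o\<^sub>L X)"
    using X by (auto simp: bounded_ops_closure K positive_op_adj_compose lin)
  have Im0: "Im (cinner y (orth_proj L y)) = 0" "Im (cinner z (?Z z)) = 0" for y z
    using positive [OF XX]
    by (auto simp: positive_op_def complex_nonneg_Reals_iff cinner_orth_proj_self [OF L])
  have Im1: "Im (cinner y (\<theta> X x) + cinner x (\<theta> (adj X) y)) = 0" for x y
    using two_by_two [OF X, of y x] by (simp add: complex_nonneg_Reals_iff Im0)
  have "Im (cinner y (\<theta> X x)) + Im (cinner x (\<theta> (adj X) y)) = 0"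
    using Im1 by simp
  moreover have "Re (cinner y (\<theta> X x)) - Re (cinner x (\<theta> (adj X) y)) = 0"
    using Im1 [of y "\<i> *\<^sub>C x"] lin(2) [OF X]
    by (simp add: clinear_scaleC cinner_scaleC_left cinner_scaleC_right)
  ultimately have "cinner x (\<theta> (adj X) y) = cnj (cinner y (\<theta> X x))"
    by (simp add: complex_eq_iff)
  then show "cinner (\<theta> X x) y = cinner x (\<theta> (adj X) y)"
    by (metis cinner_commute)
qed

text \<open>The optimal choice of the first vector in the two by two inequality is \<open>- \<theta>(X) x\<close>.\<close>

lemma schwarz:
  assumes X: "X \<in> \<B> K"
  shows "positive_op (\<theta> (adj X o\<^sub>L X) - (adj (\<theta> X) o\<^sub>L \<theta> X))"
  unfolding positive_op_def
proof
  fix x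
  have "orth_proj L (\<theta> X x) = \<theta> X x"
    using into [OF X] by (simp add: bounded_ops_iff [OF L] orth_proj_fixes [OF L])
  with two_by_two [OF X, of "- \<theta> X x" x]
  show "cinner x ((\<theta> (adj X o\<^sub>L X) - (adj (\<theta> X) o\<^sub>L \<theta> X)) x) \<in> \<real>\<^sub>\<ge>\<^sub>0"
    by (simp add: star X blinfun.diff_left cinner_diff_right cinner_adj lin blinfun.minus_right)
qed

text \<open>\<open>\<theta>(X)\<^sup>* \<theta>(X) \<le> \<theta>(X\<^sup>* X) \<le> \<parallel>X\<parallel>\<^sup>2 1\<close> by the Schwarz inequality and monotonicity.\<close>

lemma contractive_apply:
  assumes X: "X \<in> \<B> K"
  shows "norm (\<theta> X x) \<le> norm X * norm x"
proof -
  let ?Y = "complex_of_real ((norm X)\<^sup>2) *\<^sub>C orth_proj K"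
  have XX: "?Y \<in> \<B> K" "adj X o\<^sub>L X \<in> \<B> K"
    using X by (auto simp: bounded_ops_closure K orth_proj_bounded_ops)
  have "positive_op (?Y - (adj X o\<^sub>L X))"
    unfolding positive_op_def
  proof
    fix x
    let ?p = "orth_proj K x"
    have "(norm (X ?p))\<^sup>2 \<le> (norm X * norm ?p)\<^sup>2"
      by (intro power_mono norm_blinfun) simp
    moreover have "X ?p = X x" using X by (simp add: bounded_ops_iff [OF K])
    moreover have "cinner x ((?Y - (adj X o\<^sub>L X)) x)
       = complex_of_real ((norm X)\<^sup>2 * (norm ?p)\<^sup>2 - (norm (X x))\<^sup>2)"
      using X by (simp add: blinfun.diff_left cinner_diff_right scaleC_blinfun_apply cinner_self
          cinner_scaleC_right cinner_adj lin cinner_orth_proj_self K)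
    ultimately show "cinner x ((?Y - (adj X o\<^sub>L X)) x) \<in> \<real>\<^sub>\<ge>\<^sub>0"
      by (simp only: nonneg_Reals_of_real_iff) (simp add: power_mult_distrib)
  qed
  then have "positive_op (\<theta> ?Y - \<theta> (adj X o\<^sub>L X))"
    by (intro mono XX)
  then have "positive_op (\<theta> ?Y - (adj (\<theta> X) o\<^sub>L \<theta> X))"
    by (rule positive_op_trans) (rule schwarz [OF X])
  then have "cinner x ((\<theta> ?Y - (adj (\<theta> X) o\<^sub>L \<theta> X)) x) \<in> \<real>\<^sub>\<ge>\<^sub>0"
    by (simp only: positive_op_def)
  moreover have "cinner x ((\<theta> ?Y - (adj (\<theta> X) o\<^sub>L \<theta> X)) x)
     = complex_of_real ((norm X)\<^sup>2 * (norm (orth_proj L x))\<^sup>2 - (norm (\<theta> X x))\<^sup>2)"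
    using X by (simp add: scale orth_proj_bounded_ops K unital blinfun.diff_left L
        cinner_diff_right scaleC_blinfun_apply cinner_scaleC_right cinner_adj lin cinner_self
        cinner_orth_proj_self)
  ultimately have "(norm (\<theta> X x))\<^sup>2 \<le> (norm X)\<^sup>2 * (norm (orth_proj L x))\<^sup>2"
    by (simp only: nonneg_Reals_of_real_iff)
  also have "(norm X)\<^sup>2 * (norm (orth_proj L x))\<^sup>2 \<le> (norm X * norm x)\<^sup>2"
    using norm_orth_proj_le [OF L, of x] by (simp add: power_mult_distrib mult_left_mono power_mono)
  finally have "(norm (\<theta> X x))\<^sup>2 \<le> (norm X * norm x)\<^sup>2" by simp
  then show ?thesis by (rule power2_le_imp_le) simp
qed

lemma contractive: "X \<in> \<B> K \<Longrightarrow> norm (\<theta> X) \<le> norm X"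
  by (rule norm_blinfun_bound) (auto intro: contractive_apply)

lemma tendsto:
  assumes "\<And>n. X n \<in> \<B> K" "X \<longlonglongrightarrow> Y"
  shows "(\<lambda>n. \<theta> (X n)) \<longlonglongrightarrow> \<theta> Y"
proof -
  have Y: "Y \<in> \<B> K"
    by (rule closed_sequentially [OF bounded_ops_closure(1) [OF K] assms])
  have "(\<lambda>n. norm (X n - Y)) \<longlonglongrightarrow> 0"
    using assms(2) by (simp add: LIM_zero tendsto_norm_zero)
  then have "(\<lambda>n. \<theta> (X n) - \<theta> Y) \<longlonglongrightarrow> 0"
  proof (rule Lim_null_comparison [rotated])
    show "\<forall>\<^sub>F n in sequentially. norm (\<theta> (X n) - \<theta> Y) \<le> norm (X n - Y)"
      using contractive [of "X n - Y" for n] assms(1) Y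
      by (intro always_eventually allI) (metis diff bounded_ops_closure(8) [OF K])
  qed
  then show ?thesis by (rule LIM_zero_cancel)
qed

text \<open>Choi's multiplicative domain.  Defined by multiplicativity, it is visibly a closed algebra; that
  equality in the Schwarz inequality for \<open>X\<close> and \<open>X\<^sup>*\<close> suffices for membership is the theorem about it.\<close>

definition mult_domain :: "('a \<Rightarrow>\<^sub>L 'a) set" where
  "mult_domain = {X \<in> \<B> K. \<forall>Y\<in>\<B> K. \<theta> (Y o\<^sub>L X) = \<theta> Y o\<^sub>L \<theta> X \<and> \<theta> (X o\<^sub>L Y) = \<theta> X o\<^sub>L \<theta> Y}"

lemma mult_domainD:
  "X \<in> mult_domain \<Longrightarrow> Y \<in> \<B> K \<Longrightarrow> \<theta> (Y o\<^sub>L X) = \<theta> Y o\<^sub>L \<theta> X"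
  "X \<in> mult_domain \<Longrightarrow> Y \<in> \<B> K \<Longrightarrow> \<theta> (X o\<^sub>L Y) = \<theta> X o\<^sub>L \<theta> Y"
  "X \<in> mult_domain \<Longrightarrow> X \<in> \<B> K"
  by (auto simp: mult_domain_def)

text \<open>For a vector \<open>h\<close> the map \<open>(Y, X) \<mapsto> \<langle>h, (\<theta>(Y\<^sup>* X) - \<theta>(Y)\<^sup>* \<theta>(X)) h\<rangle>\<close> is a positive semidefinite
  sesquilinear form by the Schwarz inequality, so that equality on the diagonal propagates.\<close>

lemma multiplicative_right:
  assumes X: "X \<in> \<B> K" and eq: "\<theta> (adj X o\<^sub>L X) = adj (\<theta> X) o\<^sub>L \<theta> X" and Y: "Y \<in> \<B> K"
  shows "\<theta> (Y o\<^sub>L X) = \<theta> Y o\<^sub>L \<theta> X"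
proof -
  define D where "D = (\<lambda>Y X. \<theta> (adj Y o\<^sub>L X) - (adj (\<theta> Y) o\<^sub>L \<theta> X))"
  note B = bounded_ops_closure [OF K]
  \<comment> \<open>\<open>D Y Y\<close> is positive and \<open>D X X = 0\<close>, whence the form of \<open>D (c X + Y) (c X + Y)\<close> is affine in \<open>c\<close>.\<close>
  have D0: "D Y X = 0" if Y: "Y \<in> \<B> K" for Y
  proof (rule clinear_eqI)
    show "clinear (D Y X)" "clinear 0"
      unfolding D_def by (intro clinear_intros lin B X Y)+
    fix h
    define z where "z = cinner h (D Y X h)"
    define r where "r = Re (cinner h (D Y Y h))"
    have exp: "D (c *\<^sub>C X + Y) (c *\<^sub>C X + Y) = cnj c *\<^sub>C D X Y + c *\<^sub>C D Y X + D Y Y" for c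
    proof -
      have "D (c *\<^sub>C X + Y) (c *\<^sub>C X + Y)
         = cnj c *\<^sub>C (c *\<^sub>C D X X) + cnj c *\<^sub>C D X Y + c *\<^sub>C D Y X + D Y Y"
        unfolding D_def using X Y
        by (simp add: add scale B lin adj_plus adj_scaleC clinear_intros compose_add_left
            compose_add_right compose_scaleC_left compose_scaleC_right scaleC_blinfun_simps)
      then show ?thesis using eq by (simp add: D_def scaleC_blinfun_simps)
    qed
    have "cinner h (D X Y h) = cnj z"
    proof -
      have "adj (D Y X) = D X Y"
        unfolding D_def using X Y
        by (simp add: adj_minus clinear_intros lin B adj_compose adj_adj flip: star)
      then show ?thesis
        unfolding z_def by (metis cinner_adj cinner_commute \<open>clinear (D Y X)\<close>)
    qed
    then have ge: "0 \<le> 2 * Re (c * z) + r" for c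
    proof -
      have "positive_op (D (c *\<^sub>C X + Y) (c *\<^sub>C X + Y))"
        unfolding D_def using X Y by (intro schwarz) (simp add: B)
      then have "0 \<le> Re (cinner h (D (c *\<^sub>C X + Y) (c *\<^sub>C X + Y) h))"
        by (auto simp: positive_op_def complex_nonneg_Reals_iff)
      then show ?thesis
        unfolding exp using \<open>cinner h (D X Y h) = cnj z\<close>
        by (simp add: blinfun.add_left scaleC_blinfun_apply cinner_add_right cinner_scaleC_right
            z_def [symmetric] r_def)
    qed
    have "z = 0"
    proof (rule ccontr)
      assume "z \<noteq> 0"
      \<comment> \<open>A scalar large enough to make \<open>2 Re (c z) + r\<close> negative.\<close>
      define c where "c = - complex_of_real ((\<bar>r\<bar> + 1) / (2 * (cmod z)\<^sup>2)) * cnj z"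
      have "c * z = complex_of_real (- ((\<bar>r\<bar> + 1) / (2 * (cmod z)\<^sup>2))) * complex_of_real ((cmod z)\<^sup>2)"
        unfolding c_def complex_norm_square of_real_minus
        by (simp only: mult.assoc mult.commute [of "cnj z"])
      also have "\<dots> = complex_of_real (- (\<bar>r\<bar> + 1) / 2)"
        unfolding of_real_mult [symmetric] using \<open>z \<noteq> 0\<close> by (simp add: field_simps)
      finally have "Re (c * z) = - (\<bar>r\<bar> + 1) / 2" by (simp only: Re_complex_of_real)
      with ge [of c] show False by simp
    qed
    then show "cinner h (D Y X h) = cinner h (blinfun_apply 0 h)"
      by (simp add: z_def)
  qed
  from D0 [of "adj Y"] Y show ?thesis
    by (simp add: D_def B adj_adj lin star)
qed

lemma mult_domainI:
  assumes X: "X \<in> \<B> K" and eq: "\<theta> (adj X o\<^sub>L X) = adj (\<theta> X) o\<^sub>L \<theta> X"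
    "\<theta> (X o\<^sub>L adj X) = \<theta> X o\<^sub>L adj (\<theta> X)"
  shows "X \<in> mult_domain"
  unfolding mult_domain_def
proof (intro CollectI conjI ballI X)
  fix Y assume Y: "Y \<in> \<B> K"
  note B = bounded_ops_closure [OF K]
  show "\<theta> (Y o\<^sub>L X) = \<theta> Y o\<^sub>L \<theta> X"
    by (rule multiplicative_right [OF X eq(1) Y])
  have "\<theta> (adj Y o\<^sub>L adj X) = \<theta> (adj Y) o\<^sub>L \<theta> (adj X)"
    using X Y eq by (intro multiplicative_right) (simp_all add: B star adj_adj lin)
  then have "adj (\<theta> (X o\<^sub>L Y)) = adj (\<theta> X o\<^sub>L \<theta> Y)"
    using X Y by (simp add: adj_compose lin B flip: star)
  then show "\<theta> (X o\<^sub>L Y) = \<theta> X o\<^sub>L \<theta> Y"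
    using X Y by (metis adj_adj lin(2) B(5) clinear_compose)
qed

lemma cstar_subalgebra_mult_domain: "cstar_subalgebra K mult_domain"
proof -
  note B = bounded_ops_closure [OF K]
  note D = mult_domainD
  have "closed mult_domain"
    unfolding closed_sequential_limits
  proof (intro allI impI)
    fix X and Z assume "(\<forall>n. X n \<in> mult_domain) \<and> X \<longlonglongrightarrow> Z"
    then have X: "\<And>n. X n \<in> mult_domain" and lim: "X \<longlonglongrightarrow> Z" by auto
    then have XB: "\<And>n. X n \<in> \<B> K" by (auto dest: D)
    have Z: "Z \<in> \<B> K"
      using closed_sequentially [OF B(1) XB lim] .
    note cmp = bounded_bilinear.tendsto [OF bounded_bilinear_blinfun_compose]
    have "\<theta> (Y o\<^sub>L Z) = \<theta> Y o\<^sub>L \<theta> Z" "\<theta> (Z o\<^sub>L Y) = \<theta> Z o\<^sub>L \<theta> Y" if Y: "Y \<in> \<B> K" for Y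
    proof -
      have "(\<lambda>n. \<theta> (Y o\<^sub>L X n)) \<longlonglongrightarrow> \<theta> (Y o\<^sub>L Z)" "(\<lambda>n. \<theta> (X n o\<^sub>L Y)) \<longlonglongrightarrow> \<theta> (Z o\<^sub>L Y)"
        by (intro tendsto cmp tendsto_const lim B XB Y)+
      moreover have "(\<lambda>n. \<theta> (Y o\<^sub>L X n)) \<longlonglongrightarrow> (\<theta> Y o\<^sub>L \<theta> Z)"
        "(\<lambda>n. \<theta> (X n o\<^sub>L Y)) \<longlonglongrightarrow> (\<theta> Z o\<^sub>L \<theta> Y)"
        unfolding D(1,2) [OF X Y] by (intro cmp tendsto_const tendsto XB lim)+
      ultimately show "\<theta> (Y o\<^sub>L Z) = \<theta> Y o\<^sub>L \<theta> Z" "\<theta> (Z o\<^sub>L Y) = \<theta> Z o\<^sub>L \<theta> Y"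
        using LIMSEQ_unique by blast+
    qed
    with Z show "Z \<in> mult_domain" by (simp add: mult_domain_def)
  qed
  moreover have "X + Y \<in> mult_domain" if "X \<in> mult_domain" "Y \<in> mult_domain" for X Y
    unfolding mult_domain_def
    using D [OF that(1)] D [OF that(2)] by (auto simp: B add compose_add_left compose_add_right)
  moreover have "a *\<^sub>C X \<in> mult_domain" if "X \<in> mult_domain" for a X
    unfolding mult_domain_def
    using D [OF that] by (auto simp: B scale compose_scaleC_left compose_scaleC_right lin)
  moreover have "X o\<^sub>L Y \<in> mult_domain" if XY: "X \<in> mult_domain" "Y \<in> mult_domain" for X Y
    unfolding mult_domain_def
  proof (intro CollectI conjI ballI)
    show "X o\<^sub>L Y \<in> \<B> K" by (intro B(5) D(3) XY)
    fix Z assume Z: "Z \<in> \<B> K"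
    note XB = D(3) [OF XY(1)] D(3) [OF XY(2)]
    have XYm: "\<theta> (X o\<^sub>L Y) = \<theta> X o\<^sub>L \<theta> Y"
      by (rule D(1) [OF XY(2) XB(1)])
    have "\<theta> (Z o\<^sub>L (X o\<^sub>L Y)) = \<theta> (Z o\<^sub>L X) o\<^sub>L \<theta> Y"
      unfolding blinfun_compose_assoc [symmetric] by (intro D(1) XY B Z XB)
    then show "\<theta> (Z o\<^sub>L (X o\<^sub>L Y)) = \<theta> Z o\<^sub>L \<theta> (X o\<^sub>L Y)"
      by (simp only: XYm D(1) [OF XY(1) Z] blinfun_compose_assoc)
    have "\<theta> ((X o\<^sub>L Y) o\<^sub>L Z) = \<theta> X o\<^sub>L \<theta> (Y o\<^sub>L Z)"
      unfolding blinfun_compose_assoc by (intro D(2) XY B Z XB)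
    then show "\<theta> ((X o\<^sub>L Y) o\<^sub>L Z) = \<theta> (X o\<^sub>L Y) o\<^sub>L \<theta> Z"
      by (simp only: XYm D(2) [OF XY(2) Z] blinfun_compose_assoc)
  qed
  moreover have "adj X \<in> mult_domain" if X: "X \<in> mult_domain" for X
    unfolding mult_domain_def
  proof (intro CollectI conjI ballI)
    have XB: "X \<in> \<B> K" by (rule D(3) [OF X])
    then show "adj X \<in> \<B> K" by (rule B)
    fix Y assume Y: "Y \<in> \<B> K"
    have "\<theta> (Y o\<^sub>L adj X) = \<theta> (adj (X o\<^sub>L adj Y))"
      using XB Y by (simp add: adj_compose lin clinear_adj adj_adj)
    also have "\<dots> = adj (\<theta> X o\<^sub>L \<theta> (adj Y))"
      using XB Y by (simp only: star B D(2) [OF X])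
    also have "\<dots> = \<theta> Y o\<^sub>L \<theta> (adj X)"
      using XB Y by (simp add: star B adj_compose lin clinear_adj adj_adj)
    finally show "\<theta> (Y o\<^sub>L adj X) = \<theta> Y o\<^sub>L \<theta> (adj X)" .
    have "\<theta> (adj X o\<^sub>L Y) = \<theta> (adj (adj Y o\<^sub>L X))"
      using XB Y by (simp add: adj_compose lin clinear_adj adj_adj)
    also have "\<dots> = adj (\<theta> (adj Y) o\<^sub>L \<theta> X)"
      using XB Y by (simp only: star B D(1) [OF X])
    also have "\<dots> = \<theta> (adj X) o\<^sub>L \<theta> Y"
      using XB Y by (simp add: star B adj_compose lin clinear_adj adj_adj)
    finally show "\<theta> (adj X o\<^sub>L Y) = \<theta> (adj X) o\<^sub>L \<theta> Y" .
  qed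
  moreover have "0 \<in> mult_domain"
    by (simp add: mult_domain_def B zero)
  ultimately show ?thesis
    unfolding cstar_subalgebra_def complex_subspace_def by (auto dest: D(3))
qed

lemma orth_proj_mult_domain: "orth_proj K \<in> mult_domain"
  by (simp add: mult_domain_def orth_proj_bounded_ops K orth_proj_compose_left
      orth_proj_compose_right L into unital)

end

lemma ucp_map_compose:
  assumes "ucp_map K L \<theta>" "ucp_map L M \<eta>"
  shows "ucp_map K M (\<lambda>X. \<eta> (\<theta> X))"
proof -
  interpret a: ucp_map K L \<theta> by fact
  interpret b: ucp_map L M \<eta> by fact
  show ?thesis
  proof
    show "completely_positive (\<B> K) (\<lambda>X. \<eta> (\<theta> X))"
      unfolding completely_positive_def complex_linear_on_def
      using a.matrix_positive b.matrix_positive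
      by (simp add: a.add a.scale b.add b.scale a.into)
  qed (simp_all add: a.K b.L a.into b.into a.unital b.unital)
qed

section \<open>Spherical families\<close>

lemma wot_has_sum_unique:
  "wot_has_sum A S I \<Longrightarrow> wot_has_sum A S' I \<Longrightarrow> S = S'"
  unfolding wot_has_sum_def by (intro blinfun_eqI cinner_eqI) (blast intro: has_sum_unique)

lemma has_sum_finite_sum:
  fixes f :: "'i \<Rightarrow> 'b \<Rightarrow> 'c::{topological_comm_monoid_add}"
  assumes "\<And>i. i \<in> I \<Longrightarrow> (f i has_sum s i) A"
  shows "((\<lambda>x. \<Sum>i\<in>I. f i x) has_sum (\<Sum>i\<in>I. s i)) A"
  using assms by (induction I rule: infinite_finite_induct) (simp_all add: has_sum_add)

text \<open>Everything is dominated by the product of the two square summable sequences \<open>\<parallel>S\<^sub>j x\<parallel>\<close> and \<open>\<parallel>S\<^sub>j y\<parallel>\<close>.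
  Absolute convergence is what allows sums over arbitrary index sets to be interchanged and to be passed to
  weak limits below.\<close>

lemma row_contraction_abs_summable:
  fixes S :: "'j \<Rightarrow> 'a::complex_hilbert_space \<Rightarrow>\<^sub>L 'a" and X :: "'a \<Rightarrow>\<^sub>L 'a"
  assumes row: "\<And>F x. finite F \<Longrightarrow> F \<subseteq> I \<Longrightarrow> (\<Sum>j\<in>F. (norm (S j x))\<^sup>2) \<le> (norm x)\<^sup>2"
  shows "(\<lambda>j. norm (S j x) * norm (S j y)) summable_on I"
    and "(\<lambda>j. norm (cinner (S j x) (X (S j y)))) summable_on I"
    and "norm (\<Sum>\<^sub>\<infinity>j\<in>I. cinner (S j x) (X (S j y))) \<le> norm X * norm x * norm y"
proof -
  have fin: "(\<Sum>j\<in>F. norm (S j x) * norm (S j y)) \<le> norm x * norm y"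
    if "finite F" "F \<subseteq> I" for F x y
  proof -
    have "(\<Sum>j\<in>F. norm (S j x) * norm (S j y))
       \<le> L2_set (\<lambda>j. norm (S j x)) F * L2_set (\<lambda>j. norm (S j y)) F"
      using L2_set_mult_ineq [of "\<lambda>j. norm (S j x)" "\<lambda>j. norm (S j y)" F] by simp
    also have "\<dots> \<le> norm x * norm y"
      using row [OF that] by (intro mult_mono) (auto simp: L2_set_def intro: real_le_lsqrt sum_nonneg)
    finally show ?thesis .
  qed
  show sm: "(\<lambda>j. norm (S j x) * norm (S j y)) summable_on I"
    using fin by (intro nonneg_bdd_above_summable_on) (auto intro!: bdd_aboveI)
  have le: "norm (cinner (S j x) (X (S j y))) \<le> norm X * (norm (S j x) * norm (S j y))" for j
  proof -
    have "norm (cinner (S j x) (X (S j y))) \<le> norm (S j x) * norm (X (S j y))"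
      by (rule cinner_cauchy_schwarz)
    also have "\<dots> \<le> norm (S j x) * (norm X * norm (S j y))"
      by (intro mult_left_mono norm_blinfun) simp
    finally show ?thesis by (simp add: mult.left_commute)
  qed
  show abs: "(\<lambda>j. norm (cinner (S j x) (X (S j y)))) summable_on I"
    using le by (intro summable_on_comparison_test [OF summable_on_cmult_right [OF sm]]) auto
  have "norm (\<Sum>\<^sub>\<infinity>j\<in>I. cinner (S j x) (X (S j y)))
     \<le> (\<Sum>\<^sub>\<infinity>j\<in>I. norm (cinner (S j x) (X (S j y))))"
    by (rule norm_infsum_bound [OF abs])
  also have "\<dots> \<le> norm X * norm x * norm y"
  proof (rule infsum_le_finite_sums [OF abs])
    fix F assume F: "finite F" "F \<subseteq> I"
    have "(\<Sum>j\<in>F. norm (cinner (S j x) (X (S j y))))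
       \<le> norm X * (\<Sum>j\<in>F. norm (S j x) * norm (S j y))"
      unfolding sum_distrib_left by (intro sum_mono le)
    also have "\<dots> \<le> norm X * (norm x * norm y)"
      by (intro mult_left_mono fin F) simp
    finally show "(\<Sum>j\<in>F. norm (cinner (S j x) (X (S j y)))) \<le> norm X * norm x * norm y"
      by (simp add: mult.assoc)
  qed
  finally show "norm (\<Sum>\<^sub>\<infinity>j\<in>I. cinner (S j x) (X (S j y))) \<le> norm X * norm x * norm y" .
qed

lemma row_contraction_sum_exists:
  fixes S :: "'j \<Rightarrow> 'a::complex_hilbert_space \<Rightarrow>\<^sub>L 'a" and X :: "'a \<Rightarrow>\<^sub>L 'a"
  assumes row: "\<And>F x. finite F \<Longrightarrow> F \<subseteq> I \<Longrightarrow> (\<Sum>j\<in>F. (norm (S j x))\<^sup>2) \<le> (norm x)\<^sup>2"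
    and S: "\<And>j. j \<in> I \<Longrightarrow> clinear (S j)" and X: "clinear X"
  obtains Z where "clinear Z" "\<And>x y. ((\<lambda>j. cinner (S j x) (X (S j y))) has_sum cinner x (Z y)) I"
proof -
  define B where "B = (\<lambda>x y. \<Sum>\<^sub>\<infinity>j\<in>I. cinner (S j x) (X (S j y)))"
  have hs: "((\<lambda>j. cinner (S j x) (X (S j y))) has_sum B x y) I" for x y
    unfolding B_def
    by (rule has_sum_infsum) (rule abs_summable_summable, rule row_contraction_abs_summable, rule row)
  obtain Z where "clinear Z" "\<And>x y. cinner x (Z y) = B x y"
  proof (rule operator_of_form [of B "norm X"])
    fix x x' y y' and a :: complex
    show "B (x + x') y = B x y + B x' y"
      by (rule has_sum_unique [OF hs])
        (use has_sum_add [OF hs hs] in \<open>simp add: blinfun.add_right cinner_add_left\<close>)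
    show "B x (y + y') = B x y + B x y'"
      by (rule has_sum_unique [OF hs])
        (use has_sum_add [OF hs hs] in \<open>simp add: blinfun.add_right cinner_add_right\<close>)
    have "((\<lambda>j. cinner (S j (a *\<^sub>C x)) (X (S j y))) has_sum cnj a * B x y) I"
      using has_sum_cmult_right [OF hs [of x y], of "cnj a"]
      by (rule has_sum_cong [THEN iffD1, rotated]) (simp add: S clinear_scaleC cinner_scaleC_left)
    then show "B (a *\<^sub>C x) y = cnj a * B x y" by (rule has_sum_unique [OF hs])
    have "((\<lambda>j. cinner (S j x) (X (S j (a *\<^sub>C y)))) has_sum a * B x y) I"
      using has_sum_cmult_right [OF hs [of x y], of a]
      by (rule has_sum_cong [THEN iffD1, rotated]) (simp add: S X clinear_scaleC cinner_scaleC_right)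
    then show "B x (a *\<^sub>C y) = a * B x y" by (rule has_sum_unique [OF hs])
    show "cmod (B x y) \<le> norm X * norm x * norm y"
      unfolding B_def by (rule row_contraction_abs_summable, rule row)
  qed auto
  with hs show ?thesis by (intro that) auto
qed

locale spherical_family =
  fixes K :: "'a::complex_hilbert_space set" and \<Gamma> :: "'g set" and J :: "'g \<Rightarrow> 'j set"
    and N :: "'g \<Rightarrow> 'j \<Rightarrow> 'a \<Rightarrow>\<^sub>L 'a"
  assumes K: "hilbert_subspace K" and family: "commuting_spherical_family K \<Gamma> J N"
begin

lemmas BK = bounded_ops_closure [OF K]

lemma N_in: "\<alpha> \<in> \<Gamma> \<Longrightarrow> j \<in> J \<alpha> \<Longrightarrow> N \<alpha> j \<in> \<B> K"
  and N_commute: "\<alpha> \<in> \<Gamma> \<Longrightarrow> i \<in> J \<alpha> \<Longrightarrow> \<beta> \<in> \<Gamma> \<Longrightarrow> j \<in> J \<beta> \<Longrightarrow> N \<alpha> i o\<^sub>L N \<beta> j = N \<beta> j o\<^sub>L N \<alpha> i"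
  using family
  by (auto simp: commuting_spherical_family_def spherical_isometry_def commuting_ops_def
      family_ops_def image_subset_iff)

lemma N_clinear: "\<alpha> \<in> \<Gamma> \<Longrightarrow> j \<in> J \<alpha> \<Longrightarrow> clinear (N \<alpha> j)"
  using N_in bounded_ops_clinear by blast

lemma N_apply_commute:
  "\<alpha> \<in> \<Gamma> \<Longrightarrow> i \<in> J \<alpha> \<Longrightarrow> \<beta> \<in> \<Gamma> \<Longrightarrow> j \<in> J \<beta> \<Longrightarrow> N \<alpha> i (N \<beta> j x) = N \<beta> j (N \<alpha> i x)"
  using N_commute by (metis blinfun_apply_blinfun_compose)

lemma N_apply_in: "\<alpha> \<in> \<Gamma> \<Longrightarrow> j \<in> J \<alpha> \<Longrightarrow> N \<alpha> j x \<in> K"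
  using N_in bounded_ops_iff [OF K] by blast

lemma wot_has_sum_conjugation_iff:
  assumes "\<alpha> \<in> \<Gamma>"
  shows "wot_has_sum (\<lambda>j. adj (N \<alpha> j) o\<^sub>L X o\<^sub>L N \<alpha> j) Z (J \<alpha>) \<longleftrightarrow>
    (\<forall>x y. ((\<lambda>j. cinner (N \<alpha> j x) (X (N \<alpha> j y))) has_sum cinner x (Z y)) (J \<alpha>))"
proof -
  have "((\<lambda>j. cinner x ((adj (N \<alpha> j) o\<^sub>L X o\<^sub>L N \<alpha> j) y)) has_sum cinner x (Z y)) (J \<alpha>) \<longleftrightarrow>
    ((\<lambda>j. cinner (N \<alpha> j x) (X (N \<alpha> j y))) has_sum cinner x (Z y)) (J \<alpha>)" for x y
    by (intro has_sum_cong) (simp add: cinner_adj N_clinear assms)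
  then show ?thesis by (simp only: wot_has_sum_def)
qed

lemma has_sum_norm_N:
  assumes "\<alpha> \<in> \<Gamma>"
  shows "((\<lambda>j. (norm (N \<alpha> j x))\<^sup>2) has_sum (norm (orth_proj K x))\<^sup>2) (J \<alpha>)"
proof -
  have "wot_has_sum (\<lambda>j. adj (N \<alpha> j) o\<^sub>L N \<alpha> j) (orth_proj K) (J \<alpha>)"
    using family assms by (auto simp: commuting_spherical_family_def spherical_isometry_def)
  then have "((\<lambda>j. cinner x ((adj (N \<alpha> j) o\<^sub>L N \<alpha> j) x)) has_sum cinner x (orth_proj K x)) (J \<alpha>)"
    unfolding wot_has_sum_def by blast
  then have "((\<lambda>j. Re (cinner x ((adj (N \<alpha> j) o\<^sub>L N \<alpha> j) x))) has_sum Re (cinner x (orth_proj K x))) (J \<alpha>)"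
    by (rule has_sum_Re)
  also have "?this \<longleftrightarrow> ((\<lambda>j. (norm (N \<alpha> j x))\<^sup>2) has_sum Re (cinner x (orth_proj K x))) (J \<alpha>)"
    using assms by (intro has_sum_cong) (simp add: cinner_adj N_clinear cinner_self)
  finally show ?thesis
    by (simp only: cinner_orth_proj_self [OF K] Re_complex_of_real)
qed

lemma row:
  assumes "\<alpha> \<in> \<Gamma>" "finite F" "F \<subseteq> J \<alpha>"
  shows "(\<Sum>j\<in>F. (norm (N \<alpha> j x))\<^sup>2) \<le> (norm x)\<^sup>2"
proof -
  have "(\<Sum>j\<in>F. (norm (N \<alpha> j x))\<^sup>2) \<le> (norm (orth_proj K x))\<^sup>2"
    using assms by (intro finite_sum_le_has_sum [OF has_sum_norm_N]) auto
  also have "\<dots> \<le> (norm x)\<^sup>2"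
    by (intro power_mono norm_orth_proj_le K) simp
  finally show ?thesis .
qed

text \<open>The normal unital completely positive map \<open>X \<mapsto> \<Sum>\<^sub>j N\<^sub>j\<^sup>* X N\<^sub>j\<close>, whose fixed points are the Toeplitz operators
  for the index \<open>\<alpha>\<close>.\<close>

definition conj_sum :: "'g \<Rightarrow> ('a \<Rightarrow>\<^sub>L 'a) \<Rightarrow> ('a \<Rightarrow>\<^sub>L 'a)" where
  "conj_sum \<alpha> X = (THE Z. wot_has_sum (\<lambda>j. adj (N \<alpha> j) o\<^sub>L X o\<^sub>L N \<alpha> j) Z (J \<alpha>))"

lemma conj_sum:
  assumes \<alpha>: "\<alpha> \<in> \<Gamma>" and X: "X \<in> \<B> K"
  shows "wot_has_sum (\<lambda>j. adj (N \<alpha> j) o\<^sub>L X o\<^sub>L N \<alpha> j) (conj_sum \<alpha> X) (J \<alpha>)"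
    and "conj_sum \<alpha> X \<in> \<B> K"
proof -
  obtain Z where Z: "clinear Z"
    "\<And>x y. ((\<lambda>j. cinner (N \<alpha> j x) (X (N \<alpha> j y))) has_sum cinner x (Z y)) (J \<alpha>)"
    using row_contraction_sum_exists [OF row [OF \<alpha>] N_clinear [OF \<alpha>] bounded_ops_clinear [OF X]]
    by blast
  then have w: "wot_has_sum (\<lambda>j. adj (N \<alpha> j) o\<^sub>L X o\<^sub>L N \<alpha> j) Z (J \<alpha>)"
    using wot_has_sum_conjugation_iff [OF \<alpha>] by blast
  then have eq: "conj_sum \<alpha> X = Z"
    unfolding conj_sum_def by (intro the_equality) (auto intro: wot_has_sum_unique)
  show "wot_has_sum (\<lambda>j. adj (N \<alpha> j) o\<^sub>L X o\<^sub>L N \<alpha> j) (conj_sum \<alpha> X) (J \<alpha>)"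
    using w eq by simp
  have NP: "N \<alpha> j (orth_proj K x) = N \<alpha> j x" if "j \<in> J \<alpha>" for j x
    using N_in [OF \<alpha> that] by (simp add: bounded_ops_iff [OF K])
  have "cinner x (Z (orth_proj K y)) = cinner x (Z y)" for x y
    by (rule has_sum_unique [OF Z(2)], rule has_sum_cong [THEN iffD1, OF _ Z(2)]) (simp add: NP)
  moreover have "cinner (orth_proj K x) (Z y) = cinner x (Z y)" for x y
    by (rule has_sum_unique [OF Z(2)], rule has_sum_cong [THEN iffD1, OF _ Z(2)]) (simp add: NP)
  then have "orth_proj K (Z y) = Z y" for y
    by (intro cinner_eqI) (simp flip: cinner_orth_proj_left [OF K])
  then have "Z y \<in> K" for y by (metis orth_proj_in [OF K])
  ultimately show "conj_sum \<alpha> X \<in> \<B> K"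
    unfolding eq bounded_ops_iff [OF K] using Z(1) by (auto intro: cinner_eqI)
qed

lemma conj_sum_unique:
  "\<alpha> \<in> \<Gamma> \<Longrightarrow> X \<in> \<B> K \<Longrightarrow> wot_has_sum (\<lambda>j. adj (N \<alpha> j) o\<^sub>L X o\<^sub>L N \<alpha> j) Z (J \<alpha>) \<Longrightarrow> conj_sum \<alpha> X = Z"
  by (blast intro: wot_has_sum_unique conj_sum)

lemma has_sum_conj_sum:
  "\<alpha> \<in> \<Gamma> \<Longrightarrow> X \<in> \<B> K \<Longrightarrow>
    ((\<lambda>j. cinner (N \<alpha> j x) (X (N \<alpha> j y))) has_sum cinner x (conj_sum \<alpha> X y)) (J \<alpha>)"
  using conj_sum(1) wot_has_sum_conjugation_iff by blast

lemma conj_sum_eqI: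
  assumes "\<alpha> \<in> \<Gamma>" "X \<in> \<B> K"
    "\<And>x y. ((\<lambda>j. cinner (N \<alpha> j x) (X (N \<alpha> j y))) has_sum cinner x (blinfun_apply Z y)) (J \<alpha>)"
  shows "conj_sum \<alpha> X = Z"
  using assms by (intro conj_sum_unique) (auto simp: wot_has_sum_conjugation_iff)

lemma ucp_conj_sum:
  assumes \<alpha>: "\<alpha> \<in> \<Gamma>"
  shows "ucp_map K K (conj_sum \<alpha>)"
proof
  note hs = has_sum_conj_sum [OF \<alpha>]
  show "completely_positive (\<B> K) (conj_sum \<alpha>)"
    unfolding completely_positive_def complex_linear_on_def
  proof (intro conjI ballI allI impI)
    fix X Y assume "X \<in> \<B> K" "Y \<in> \<B> K"
    then show "conj_sum \<alpha> (X + Y) = conj_sum \<alpha> X + conj_sum \<alpha> Y"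
      using has_sum_add [OF hs [of X] hs [of Y]]
      by (intro conj_sum_eqI \<alpha> BK) (simp_all add: blinfun.add_left cinner_add_right)
  next
    fix a X assume "X \<in> \<B> K"
    then show "conj_sum \<alpha> (a *\<^sub>C X) = a *\<^sub>C conj_sum \<alpha> X"
      using has_sum_cmult_right [OF hs [of X], of a]
      by (intro conj_sum_eqI \<alpha> BK) (simp_all add: scaleC_blinfun_apply cinner_scaleC_right)
  next
    fix n and A :: "nat \<Rightarrow> nat \<Rightarrow> 'a \<Rightarrow>\<^sub>L 'a"
    assume A: "(\<forall>i<n. \<forall>j<n. A i j \<in> \<B> K) \<and> op_matrix_positive n A"
    show "op_matrix_positive n (\<lambda>i j. conj_sum \<alpha> (A i j))"
      unfolding op_matrix_positive_def
    proof
      fix x :: "nat \<Rightarrow> 'a"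
      let ?f = "\<lambda>l. \<Sum>i<n. cinner (N \<alpha> l (x i)) (\<Sum>j<n. A i j (N \<alpha> l (x j)))"
      have "((\<lambda>l. \<Sum>i<n. \<Sum>j<n. cinner (N \<alpha> l (x i)) (A i j (N \<alpha> l (x j)))) has_sum
         (\<Sum>i<n. \<Sum>j<n. cinner (x i) (conj_sum \<alpha> (A i j) (x j)))) (J \<alpha>)"
        using A by (intro has_sum_finite_sum hs) auto
      then have f: "(?f has_sum (\<Sum>i<n. cinner (x i) (\<Sum>j<n. conj_sum \<alpha> (A i j) (x j)))) (J \<alpha>)"
        by (simp add: cinner_sum_right)
      have "?f l \<in> \<real>\<^sub>\<ge>\<^sub>0" for l
        using A spec [of _ "\<lambda>i. N \<alpha> l (x i)"] unfolding op_matrix_positive_def by auto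
      then have "Im (?f l) = 0" "0 \<le> Re (?f l)" for l
        by (simp_all add: complex_nonneg_Reals_iff)
      with has_sum_Re [OF f] has_sum_Im [OF f]
      show "(\<Sum>i<n. cinner (x i) (\<Sum>j<n. conj_sum \<alpha> (A i j) (x j))) \<in> \<real>\<^sub>\<ge>\<^sub>0"
        by (intro nonneg_Reals_complexI) (auto intro: has_sum_nonneg has_sum_unique [OF _ has_sum_0])
    qed
  qed
next
  show "conj_sum \<alpha> (orth_proj K) = orth_proj K"
  proof (rule conj_sum_unique [OF \<alpha> orth_proj_bounded_ops [OF K]])
    have "wot_has_sum (\<lambda>j. adj (N \<alpha> j) o\<^sub>L N \<alpha> j) (orth_proj K) (J \<alpha>)"
      using family \<alpha> by (auto simp: commuting_spherical_family_def spherical_isometry_def)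
    then show "wot_has_sum (\<lambda>j. adj (N \<alpha> j) o\<^sub>L orth_proj K o\<^sub>L N \<alpha> j) (orth_proj K) (J \<alpha>)"
      unfolding wot_has_sum_def
      by (simp add: orth_proj_fixes K N_apply_in \<alpha> cong: has_sum_cong)
  qed
qed (auto simp: K conj_sum \<alpha>)

text \<open>Either side is a double sum of \<open>\<langle>N\<^sub>j N\<^sub>i x, X N\<^sub>j N\<^sub>i y\<rangle>\<close>, because the generators commute.  It converges
  absolutely, since \<open>\<parallel>N\<^sub>j N\<^sub>i x\<parallel>\<^sup>2\<close> sums up to \<open>\<parallel>x\<parallel>\<^sup>2\<close> for \<open>x\<close> in \<open>K\<close>, and so the order of
  summation may be changed.\<close>

lemma conj_sum_commute:
  assumes \<alpha>: "\<alpha> \<in> \<Gamma>" and \<beta>: "\<beta> \<in> \<Gamma>" and X: "X \<in> \<B> K"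
  shows "conj_sum \<alpha> (conj_sum \<beta> X) = conj_sum \<beta> (conj_sum \<alpha> X)"
proof (rule conj_sum_eqI)
  show "\<alpha> \<in> \<Gamma>" "conj_sum \<beta> X \<in> \<B> K" by (auto simp: \<alpha> \<beta> X conj_sum)
  fix x y
  define f where "f = (\<lambda>(i, j). cinner (N \<beta> j (N \<alpha> i x)) (X (N \<beta> j (N \<alpha> i y))))"
  define g where "g = (\<lambda>x (i, j). (norm (N \<beta> j (N \<alpha> i x)))\<^sup>2)"
  have inner: "((\<lambda>j. g x (i, j)) has_sum (norm (N \<alpha> i x))\<^sup>2) (J \<beta>)" if "i \<in> J \<alpha>" for i x
    using has_sum_norm_N [OF \<beta>, of "N \<alpha> i x"] that
    by (simp add: g_def orth_proj_fixes K N_apply_in \<alpha>)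
  have gs: "g x summable_on J \<alpha> \<times> J \<beta>" for x
  proof -
    have "(\<lambda>p. norm (g x p)) summable_on J \<alpha> \<times> J \<beta>"
      unfolding Infinite_Sum.abs_summable_on_Sigma_iff
    proof (intro conjI ballI)
      have nn: "norm (g x (i, j)) = g x (i, j)" for i j by (simp add: g_def)
      show "(\<lambda>j. norm (g x (i, j))) summable_on J \<beta>" if "i \<in> J \<alpha>" for i
        unfolding nn using inner [OF that] by (rule has_sum_imp_summable)
      have "(\<lambda>i. \<Sum>\<^sub>\<infinity>j\<in>J \<beta>. norm (g x (i, j))) summable_on J \<alpha> \<longleftrightarrow> (\<lambda>i. (norm (N \<alpha> i x))\<^sup>2) summable_on J \<alpha>"
        unfolding nn by (intro summable_on_cong infsumI inner)
      then show "(\<lambda>i. norm (\<Sum>\<^sub>\<infinity>j\<in>J \<beta>. norm (g x (i, j)))) summable_on J \<alpha>"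
        using has_sum_imp_summable [OF has_sum_norm_N [OF \<alpha>]] by (simp add: infsum_nonneg)
    qed
    then show ?thesis by (rule abs_summable_summable)
  qed
  have "(\<lambda>p. norm (f p)) summable_on J \<alpha> \<times> J \<beta>"
  proof (rule summable_on_comparison_test)
    show "(\<lambda>p. norm X * (g x p + g y p)) summable_on J \<alpha> \<times> J \<beta>"
      by (intro summable_on_cmult_right summable_on_add gs)
    show "norm (f p) \<le> norm X * (g x p + g y p)" for p
    proof (cases p)
      case (Pair i j)
      let ?u = "N \<beta> j (N \<alpha> i x)" and ?v = "N \<beta> j (N \<alpha> i y)"
      have "norm (f p) \<le> norm ?u * norm (X ?v)"
        unfolding Pair f_def by (simp add: cinner_cauchy_schwarz)
      also have "\<dots> \<le> norm ?u * (norm X * norm ?v)"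
        by (intro mult_left_mono norm_blinfun) simp
      also have "\<dots> = norm X * (norm ?u * norm ?v)" by simp
      also have "norm ?u * norm ?v \<le> (norm ?u)\<^sup>2 + (norm ?v)\<^sup>2"
        using sum_squares_bound [of "norm ?u" "norm ?v"]
          mult_nonneg_nonneg [OF norm_ge_zero [of ?u] norm_ge_zero [of ?v]] by linarith
      finally show ?thesis by (simp add: Pair g_def mult_left_mono)
    qed
  qed auto
  then obtain s where s: "(f has_sum s) (J \<alpha> \<times> J \<beta>)"
    using abs_summable_summable summable_on_def by blast
  have s1: "((\<lambda>i. cinner (N \<alpha> i x) (conj_sum \<beta> X (N \<alpha> i y))) has_sum s) (J \<alpha>)"
    by (rule has_sum_Sigma' [OF s]) (simp add: f_def has_sum_conj_sum \<beta> X)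
  have "((\<lambda>(j, i). f (i, j)) has_sum s) (J \<beta> \<times> J \<alpha>)"
    using s by (subst has_sum_swap)  (simp add: case_prod_unfold)
  then have "((\<lambda>j. cinner (N \<beta> j x) (conj_sum \<alpha> X (N \<beta> j y))) has_sum s) (J \<beta>)"
  proof (rule has_sum_Sigma')
    fix j assume j: "j \<in> J \<beta>"
    show "((\<lambda>i. case (j, i) of (j, i) \<Rightarrow> f (i, j)) has_sum
        cinner (N \<beta> j x) (conj_sum \<alpha> X (N \<beta> j y))) (J \<alpha>)"
      using has_sum_conj_sum [OF \<alpha> X, of "N \<beta> j x" "N \<beta> j y"]
      by (simp add: f_def N_apply_commute [OF \<beta> j \<alpha>] cong: has_sum_cong)
  qed
  moreover have "((\<lambda>j. cinner (N \<beta> j x) (conj_sum \<alpha> X (N \<beta> j y))) has_sum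
      cinner x (conj_sum \<beta> (conj_sum \<alpha> X) y)) (J \<beta>)"
    by (intro has_sum_conj_sum \<beta> conj_sum \<alpha> X)
  ultimately show "((\<lambda>i. cinner (N \<alpha> i x) (conj_sum \<beta> X (N \<alpha> i y))) has_sum
      cinner x (conj_sum \<beta> (conj_sum \<alpha> X) y)) (J \<alpha>)"
    using s1 has_sum_unique by blast
qed

end

section \<open>The projection onto the Toeplitz operators\<close>

lemma scaleC_of_real_blinfun: "complex_of_real r *\<^sub>C A = r *\<^sub>R A"
  for A :: "'a::real_normed_vector \<Rightarrow>\<^sub>L 'b::complex_hilbert_space"
  by (rule blinfun_eqI) (simp add: scaleC_blinfun_apply scaleC_of_real blinfun.scaleR_left)

lemma scaleC_sum_blinfun: "a *\<^sub>C (\<Sum>i\<in>I. A i) = (\<Sum>i\<in>I. a *\<^sub>C A i)"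
  for A :: "'i \<Rightarrow> 'a::real_normed_vector \<Rightarrow>\<^sub>L 'b::complex_hilbert_space"
  by (rule blinfun_eqI) (simp add: scaleC_blinfun_apply blinfun.sum_left scaleC_sum)

lemma sum_nonneg_Reals: "(\<And>i. i \<in> I \<Longrightarrow> f i \<in> \<real>\<^sub>\<ge>\<^sub>0) \<Longrightarrow> (\<Sum>i\<in>I. f i) \<in> \<real>\<^sub>\<ge>\<^sub>0"
  by (induction I rule: infinite_finite_induct) auto

lemma ucp_map_ident: "hilbert_subspace K \<Longrightarrow> ucp_map K K (\<lambda>X. X)"
  by unfold_locales (auto simp: completely_positive_def complex_linear_on_def)

lemma ucp_map_average:
  assumes "\<And>k. ucp_map K L (\<theta> k)"
  shows "ucp_map K L (\<lambda>X. complex_of_real (1 / real (Suc n)) *\<^sub>C (\<Sum>k\<le>n. \<theta> k X))"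
proof -
  interpret u: ucp_map K L "\<theta> k" for k by fact
  note KL = u.K u.L
  let ?c = "complex_of_real (1 / real (Suc n))"
  show ?thesis
  proof
    show "completely_positive (\<B> K) (\<lambda>X. ?c *\<^sub>C (\<Sum>k\<le>n. \<theta> k X))"
      unfolding completely_positive_def complex_linear_on_def
    proof (intro conjI ballI allI impI)
      show "?c *\<^sub>C (\<Sum>k\<le>n. \<theta> k (X + Y)) = ?c *\<^sub>C (\<Sum>k\<le>n. \<theta> k X) + ?c *\<^sub>C (\<Sum>k\<le>n. \<theta> k Y)"
        if "X \<in> \<B> K" "Y \<in> \<B> K" for X Y
        using that by (simp only: u.add sum.distrib scaleC_blinfun_simps)
      show "?c *\<^sub>C (\<Sum>k\<le>n. \<theta> k (a *\<^sub>C X)) = a *\<^sub>C (?c *\<^sub>C (\<Sum>k\<le>n. \<theta> k X))" if "X \<in> \<B> K" for a X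
        using that by (simp only: u.scale scaleC_sum_blinfun [symmetric])
          (auto intro!: blinfun_eqI simp: scaleC_blinfun_apply mult.commute)
    next
      fix m and A :: "nat \<Rightarrow> nat \<Rightarrow> 'a \<Rightarrow>\<^sub>L 'a"
      assume A: "(\<forall>i<m. \<forall>j<m. A i j \<in> \<B> K) \<and> op_matrix_positive m A"
      show "op_matrix_positive m (\<lambda>i j. ?c *\<^sub>C (\<Sum>k\<le>n. \<theta> k (A i j)))"
        unfolding op_matrix_positive_def
      proof
        fix x
        have "(\<Sum>i<m. cinner (x i) (\<Sum>j<m. \<theta> k (A i j) (x j))) \<in> \<real>\<^sub>\<ge>\<^sub>0" for k
          using u.matrix_positive [of m A k] A by (simp add: op_matrix_positive_def)
        then have "?c * (\<Sum>k\<le>n. \<Sum>i<m. cinner (x i) (\<Sum>j<m. \<theta> k (A i j) (x j))) \<in> \<real>\<^sub>\<ge>\<^sub>0"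
          by (intro nonneg_Reals_mult_I sum_nonneg_Reals [where f = "\<lambda>k. \<Sum>i<m. _ k i"]) simp_all
        also have "?c * (\<Sum>k\<le>n. \<Sum>i<m. cinner (x i) (\<Sum>j<m. \<theta> k (A i j) (x j)))
          = (\<Sum>i<m. cinner (x i) (\<Sum>j<m. (?c *\<^sub>C (\<Sum>k\<le>n. \<theta> k (A i j))) (x j)))"
          unfolding scaleC_blinfun_apply scaleC_sum [symmetric] cinner_scaleC_right
            sum_distrib_left [symmetric] blinfun.sum_left
          by (subst sum.swap) (simp add: cinner_sum_right sum.swap [of _ "{..n}"])
        finally show "(\<Sum>i<m. cinner (x i) (\<Sum>j<m. (?c *\<^sub>C (\<Sum>k\<le>n. \<theta> k (A i j))) (x j))) \<in> \<real>\<^sub>\<ge>\<^sub>0" .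
      qed
    qed
    show "?c *\<^sub>C (\<Sum>k\<le>n. \<theta> k X) \<in> \<B> L" if "X \<in> \<B> K" for X
      using that by (intro bounded_ops_closure KL u.into)
    show "?c *\<^sub>C (\<Sum>k\<le>n. \<theta> k (orth_proj K)) = orth_proj L"
      unfolding scaleC_of_real_blinfun by (simp add: u.unital sum_constant_scaleR)
  qed (rule KL)+
qed

text \<open>By compactness a bounded family of scalar nets converges simultaneously along a finer filter.\<close>

lemma common_limit_filter:
  fixes f :: "'i \<Rightarrow> 'c \<Rightarrow> complex"
  assumes bound: "\<forall>\<^sub>F i in F. \<forall>c. cmod (f i c) \<le> b c" and F: "F \<noteq> bot"
  obtains G l where "G \<noteq> bot" "G \<le> F" "\<And>c. ((\<lambda>i. f i c) \<longlongrightarrow> l c) G"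
proof -
  define S where "S = PiE UNIV (\<lambda>c. cball (0::complex) (b c))"
  have "compact S"
    unfolding S_def compactin_euclidean_iff [symmetric] euclidean_product_topology [symmetric]
      compactin_PiE by simp
  moreover have "\<forall>\<^sub>F g in filtermap f F. g \<in> S"
    using bound unfolding eventually_filtermap by eventually_elim (auto simp: S_def)
  moreover have "filtermap f F \<noteq> bot" using F by (simp add: filtermap_bot_iff)
  ultimately obtain l where l: "inf (nhds l) (filtermap f F) \<noteq> bot"
    unfolding compact_filter by blast
  define G where "G = inf F (filtercomap f (nhds l))"
  have "G \<noteq> bot"
  proof
    assume "G = bot"
    then have "eventually (\<lambda>_. False) G" by simp
    then obtain Q R where QR: "eventually Q F" "eventually R (nhds l)" "\<And>i. Q i \<Longrightarrow> \<not> R (f i)"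
      unfolding G_def eventually_inf eventually_filtercomap by blast
    have "eventually (\<lambda>g. \<not> R g) (filtermap f F)"
      unfolding eventually_filtermap using QR(1) by eventually_elim (rule QR(3))
    then have "eventually (\<lambda>_. False) (inf (nhds l) (filtermap f F))"
      unfolding eventually_inf using QR(2) by blast
    then show False using l by (simp add: trivial_limit_def)
  qed
  moreover have "((\<lambda>i. f i c) \<longlongrightarrow> l c) G" for c
  proof (rule topological_tendstoI)
    fix U assume U: "open U" "l c \<in> U"
    have "open ((\<lambda>g :: 'c \<Rightarrow> complex. g c) -` U)"
      by (intro open_vimage U continuous_on_product_coordinates)
    then have "\<forall>\<^sub>F g in nhds l. g c \<in> U"
      unfolding eventually_nhds using U(2) by (intro exI [of _ "(\<lambda>g. g c) -` U"]) auto
    then have "\<forall>\<^sub>F i in filtercomap f (nhds l). f i c \<in> U"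
      by (rule eventually_filtercomapI)
    then show "\<forall>\<^sub>F i in G. f i c \<in> U"
      unfolding G_def by (rule filter_leD [OF inf_le2])
  qed
  ultimately show ?thesis using that [of G l] by (simp add: G_def)
qed

context spherical_family
begin

definition toeplitz_on :: "('a \<Rightarrow>\<^sub>L 'a) set" where
  "toeplitz_on = {X \<in> \<B> K. \<forall>\<alpha>\<in>\<Gamma>. wot_has_sum (\<lambda>j. adj (N \<alpha> j) o\<^sub>L X o\<^sub>L N \<alpha> j) X (J \<alpha>)}"

lemma toeplitz_on_iff: "X \<in> toeplitz_on \<longleftrightarrow> X \<in> \<B> K \<and> (\<forall>\<alpha>\<in>\<Gamma>. conj_sum \<alpha> X = X)"
proof -
  have "wot_has_sum (\<lambda>j. adj (N \<alpha> j) o\<^sub>L X o\<^sub>L N \<alpha> j) X (J \<alpha>) \<longleftrightarrow> conj_sum \<alpha> X = X"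
    if "\<alpha> \<in> \<Gamma>" "X \<in> \<B> K" for \<alpha>
    using conj_sum(1) [OF that] conj_sum_unique [OF that, of X] by auto
  then show ?thesis unfolding toeplitz_on_def by auto
qed

text \<open>On norm bounded families the sum is continuous for weak convergence: a summable majorant makes
  the series converge uniformly.  This is why a weak limit of almost invariant operators is invariant.\<close>

lemma conj_sum_weak_tendsto:
  assumes \<alpha>: "\<alpha> \<in> \<Gamma>" and Y: "Y \<in> \<B> K"
    and Z: "\<forall>\<^sub>F i in G. Z i \<in> \<B> K \<and> norm (Z i) \<le> C"
    and lim: "\<And>x y. ((\<lambda>i. cinner x (blinfun_apply (Z i) y)) \<longlongrightarrow> cinner x (blinfun_apply Y y)) G"
  shows "((\<lambda>i. cinner x (conj_sum \<alpha> (Z i) y)) \<longlongrightarrow> cinner x (conj_sum \<alpha> Y y)) G"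
proof (rule swap_uniform_limit')
  let ?F = "finite_subsets_at_top (J \<alpha>)"
  show "\<forall>\<^sub>F A in ?F. ((\<lambda>i. \<Sum>j\<in>A. cinner (N \<alpha> j x) (Z i (N \<alpha> j y)))
      \<longlongrightarrow> (\<Sum>j\<in>A. cinner (N \<alpha> j x) (Y (N \<alpha> j y)))) G"
    by (intro always_eventually allI tendsto_sum lim)
  show "((\<lambda>A. \<Sum>j\<in>A. cinner (N \<alpha> j x) (Y (N \<alpha> j y))) \<longlongrightarrow> cinner x (conj_sum \<alpha> Y y)) ?F"
    using has_sum_conj_sum [OF \<alpha> Y] by (simp add: has_sum_def)
  let ?S = "{i. Z i \<in> \<B> K \<and> norm (Z i) \<le> C}"
  show "uniform_limit ?S (\<lambda>A i. \<Sum>j\<in>A. cinner (N \<alpha> j x) (Z i (N \<alpha> j y)))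
      (\<lambda>i. cinner x (conj_sum \<alpha> (Z i) y)) ?F"
  proof (rule Weierstrass_m_test_general')
    show "((\<lambda>j. cinner (N \<alpha> j x) (Z i (N \<alpha> j y))) has_sum cinner x (conj_sum \<alpha> (Z i) y)) (J \<alpha>)"
      if "i \<in> ?S" for i
      using that by (intro has_sum_conj_sum \<alpha>) simp
    show "(\<lambda>j. C * (norm (N \<alpha> j x) * norm (N \<alpha> j y))) summable_on J \<alpha>"
      by (intro summable_on_cmult_right row_contraction_abs_summable(1) row \<alpha>)
    show "norm (cinner (N \<alpha> j x) (Z i (N \<alpha> j y))) \<le> C * (norm (N \<alpha> j x) * norm (N \<alpha> j y))"
      if "i \<in> ?S" for i j
    proof -
      have "norm (cinner (N \<alpha> j x) (Z i (N \<alpha> j y))) \<le> norm (N \<alpha> j x) * norm (Z i (N \<alpha> j y))"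
        by (rule cinner_cauchy_schwarz)
      also have "\<dots> \<le> norm (N \<alpha> j x) * (C * norm (N \<alpha> j y))"
        using that by (intro mult_left_mono order_trans [OF norm_blinfun] mult_right_mono) auto
      finally show ?thesis by (simp add: mult.left_commute)
    qed
  qed
  show "\<forall>\<^sub>F i in G. i \<in> ?S" using Z by simp
qed simp

text \<open>Only finitely many indices can be averaged over at a time, whereas \<open>\<Gamma>\<close> may be infinite; the list in
  \<open>average\<close> holds those that are treated, and they become exhaustive in the limit.\<close>

definition cesaro :: "nat \<Rightarrow> 'g \<Rightarrow> ('a \<Rightarrow>\<^sub>L 'a) \<Rightarrow> ('a \<Rightarrow>\<^sub>L 'a)" where
  "cesaro n \<alpha> X = complex_of_real (1 / real (Suc n)) *\<^sub>C (\<Sum>k\<le>n. (conj_sum \<alpha> ^^ k) X)"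

primrec average :: "nat \<Rightarrow> 'g list \<Rightarrow> ('a \<Rightarrow>\<^sub>L 'a) \<Rightarrow> ('a \<Rightarrow>\<^sub>L 'a)" where
  "average n [] X = X"
| "average n (\<alpha> # L) X = cesaro n \<alpha> (average n L X)"

lemma ucp_funpow: "\<alpha> \<in> \<Gamma> \<Longrightarrow> ucp_map K K (conj_sum \<alpha> ^^ k)"
proof (induction k)
  case 0
  show ?case using ucp_map_ident [OF K] by (simp add: id_def)
next
  case (Suc k)
  then show ?case using ucp_map_compose [OF Suc.IH ucp_conj_sum] by (simp add: comp_def)
qed

lemma ucp_cesaro: "\<alpha> \<in> \<Gamma> \<Longrightarrow> ucp_map K K (cesaro n \<alpha>)"
  unfolding cesaro_def [abs_def] by (intro ucp_map_average ucp_funpow)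

lemma ucp_average: "set L \<subseteq> \<Gamma> \<Longrightarrow> ucp_map K K (average n L)"
proof (induction L)
  case Nil
  show ?case using ucp_map_ident [OF K] by simp
next
  case (Cons \<alpha> L)
  then show ?case using ucp_map_compose [OF Cons.IH ucp_cesaro] by simp
qed

lemma funpow_conj_sum_commute:
  assumes "\<alpha> \<in> \<Gamma>" "\<beta> \<in> \<Gamma>" "X \<in> \<B> K"
  shows "conj_sum \<alpha> ((conj_sum \<beta> ^^ k) X) = (conj_sum \<beta> ^^ k) (conj_sum \<alpha> X)"
  using assms
proof (induction k)
  case (Suc k)
  have "(conj_sum \<beta> ^^ k) X \<in> \<B> K"
    by (rule ucp_map.into [OF ucp_funpow]) (use Suc.prems in auto)
  with Suc show ?case by (simp add: conj_sum_commute [of \<alpha> \<beta>])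
qed simp

lemma cesaro_conj_sum_commute:
  assumes \<alpha>: "\<alpha> \<in> \<Gamma>" and \<beta>: "\<beta> \<in> \<Gamma>" and X: "X \<in> \<B> K"
  shows "conj_sum \<alpha> (cesaro n \<beta> X) = cesaro n \<beta> (conj_sum \<alpha> X)"
proof -
  interpret u: ucp_map K K "conj_sum \<alpha>" by (rule ucp_conj_sum [OF \<alpha>])
  have p: "(conj_sum \<beta> ^^ k) X \<in> \<B> K" for k
    using ucp_map.into [OF ucp_funpow [OF \<beta>]] X by blast
  then show ?thesis
    by (simp only: cesaro_def u.scale u.sum BK funpow_conj_sum_commute [OF \<alpha> \<beta> X])
qed

lemma average_conj_sum_commute:
  assumes "\<alpha> \<in> \<Gamma>" "set L \<subseteq> \<Gamma>" "X \<in> \<B> K"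
  shows "conj_sum \<alpha> (average n L X) = average n L (conj_sum \<alpha> X)"
  using assms
proof (induction L)
  case (Cons \<beta> L)
  then show ?case
    using ucp_map.into [OF ucp_average [of L n]] by (simp add: cesaro_conj_sum_commute)
qed simp

text \<open>The sum telescopes, and only its first and last terms survive.\<close>

lemma cesaro_shift:
  assumes \<alpha>: "\<alpha> \<in> \<Gamma>" and X: "X \<in> \<B> K"
  shows "norm (conj_sum \<alpha> (cesaro n \<alpha> X) - cesaro n \<alpha> X) \<le> 2 / real (Suc n) * norm X"
proof -
  interpret u: ucp_map K K "conj_sum \<alpha>" by (rule ucp_conj_sum [OF \<alpha>])
  interpret p: ucp_map K K "conj_sum \<alpha> ^^ k" for k by (rule ucp_funpow [OF \<alpha>])
  let ?c = "complex_of_real (1 / real (Suc n))"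
  have "conj_sum \<alpha> (cesaro n \<alpha> X) - cesaro n \<alpha> X
      = ?c *\<^sub>C ((\<Sum>k\<le>n. (conj_sum \<alpha> ^^ Suc k) X) - (\<Sum>k\<le>n. (conj_sum \<alpha> ^^ k) X))"
    using p.into [OF X] by (simp add: cesaro_def u.scale u.sum BK scaleC_blinfun_simps)
  also have "(\<Sum>k\<le>n. (conj_sum \<alpha> ^^ Suc k) X) - (\<Sum>k\<le>n. (conj_sum \<alpha> ^^ k) X)
      = (conj_sum \<alpha> ^^ Suc n) X - X"
    using sum_lessThan_telescope [of "\<lambda>k. (conj_sum \<alpha> ^^ k) X" "Suc n"]
    by (simp only: lessThan_Suc_atMost sum_subtractf) simp
  finally have "norm (conj_sum \<alpha> (cesaro n \<alpha> X) - cesaro n \<alpha> X)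
      \<le> cmod ?c * norm ((conj_sum \<alpha> ^^ Suc n) X - X)"
    by (simp only: norm_scaleC_blinfun)
  also have "norm ((conj_sum \<alpha> ^^ Suc n) X - X) \<le> norm ((conj_sum \<alpha> ^^ Suc n) X) + norm X"
    by (rule norm_triangle_ineq4)
  also have "\<dots> \<le> 2 * norm X" using p.contractive [OF X, of "Suc n"] by simp
  finally have "norm (conj_sum \<alpha> (cesaro n \<alpha> X) - cesaro n \<alpha> X) \<le> cmod ?c * (2 * norm X)"
    by (simp add: mult_left_mono)
  also have "cmod ?c = 1 / real (Suc n)" by (simp only: norm_of_real) simp
  finally show ?thesis by simp
qed

text \<open>Averaging over one index makes the result almost invariant under it, and the averages over the other indices
  are contractions commuting with this map.\<close>

lemma average_shift:
  assumes "\<alpha> \<in> set L" "set L \<subseteq> \<Gamma>" "X \<in> \<B> K"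
  shows "norm (average n L (conj_sum \<alpha> X) - average n L X) \<le> 2 / real (Suc n) * norm X"
  using assms
proof (induction L)
  case (Cons \<beta> L)
  then have \<alpha>: "\<alpha> \<in> \<Gamma>" and \<beta>: "\<beta> \<in> \<Gamma>" and L: "set L \<subseteq> \<Gamma>" and X: "X \<in> \<B> K" by auto
  interpret u: ucp_map K K "conj_sum \<alpha>" by (rule ucp_conj_sum [OF \<alpha>])
  interpret a: ucp_map K K "average n L" by (rule ucp_average [OF L])
  interpret c: ucp_map K K "cesaro n \<beta>" by (rule ucp_cesaro [OF \<beta>])
  show ?case
  proof (cases "\<alpha> = \<beta>")
    case True
    have "average n (\<beta> # L) (conj_sum \<alpha> X) = conj_sum \<alpha> (cesaro n \<alpha> (average n L X))"
      unfolding True [symmetric] average.simps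
      by (simp only: cesaro_conj_sum_commute [OF \<alpha> \<alpha> a.into [OF X]]
          average_conj_sum_commute [OF \<alpha> L X])
    then have "norm (average n (\<beta> # L) (conj_sum \<alpha> X) - average n (\<beta> # L) X)
        \<le> 2 / real (Suc n) * norm (average n L X)"
      using cesaro_shift [OF \<alpha> a.into [OF X], of n] True by simp
    also have "\<dots> \<le> 2 / real (Suc n) * norm X"
      by (intro mult_left_mono a.contractive X) simp
    finally show ?thesis .
  next
    case False
    have "norm (average n (\<beta> # L) (conj_sum \<alpha> X) - average n (\<beta> # L) X)
       = norm (cesaro n \<beta> (average n L (conj_sum \<alpha> X) - average n L X))"
      by (simp add: c.diff a.into u.into X)
    also have "\<dots> \<le> norm (average n L (conj_sum \<alpha> X) - average n L X)"
      by (intro c.contractive BK a.into u.into X)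
    also have "\<dots> \<le> 2 / real (Suc n) * norm X"
      using Cons False by simp
    finally show ?thesis .
  qed
qed simp

text \<open>The forms of \<open>conj_sum \<alpha> Y\<close> at vectors of the invariant set \<open>M\<close> only involve those of \<open>Y\<close> at vectors of
  \<open>M\<close>.  Hence if the forms of \<open>X\<close> on \<open>M\<close> are fixed by all the sums, so are those of all averages of \<open>X\<close>.\<close>

lemma average_invariant_form:
  assumes M: "\<And>\<alpha> j x. \<alpha> \<in> \<Gamma> \<Longrightarrow> j \<in> J \<alpha> \<Longrightarrow> x \<in> M \<Longrightarrow> N \<alpha> j x \<in> M" and X: "X \<in> \<B> K"
    and inv: "\<And>\<alpha> x y. \<alpha> \<in> \<Gamma> \<Longrightarrow> x \<in> M \<Longrightarrow> y \<in> M \<Longrightarrow> cinner x (conj_sum \<alpha> X y) = cinner x (X y)"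
    and L: "set L \<subseteq> \<Gamma>" and xy: "x \<in> M" "y \<in> M"
  shows "cinner x (average n L X y) = cinner x (X y)"
proof -
  define Q where "Q = {Y \<in> \<B> K. \<forall>x\<in>M. \<forall>y\<in>M. cinner x (Y y) = cinner x (X y)}"
  have sphQ: "conj_sum \<alpha> Y \<in> Q" if \<alpha>: "\<alpha> \<in> \<Gamma>" and Y: "Y \<in> Q" for \<alpha> Y
  proof -
    have YB: "Y \<in> \<B> K" using Y by (simp add: Q_def)
    have "cinner x (conj_sum \<alpha> Y y) = cinner x (X y)" if xy: "x \<in> M" "y \<in> M" for x y
    proof -
      have "((\<lambda>j. cinner (N \<alpha> j x) (X (N \<alpha> j y))) has_sum cinner x (conj_sum \<alpha> Y y)) (J \<alpha>)"
        using has_sum_conj_sum [OF \<alpha> YB, of x y]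
        by (rule has_sum_cong [THEN iffD1, rotated]) (use Y M \<alpha> xy in \<open>auto simp: Q_def\<close>)
      then have "cinner x (conj_sum \<alpha> Y y) = cinner x (conj_sum \<alpha> X y)"
        by (rule has_sum_unique [OF _ has_sum_conj_sum [OF \<alpha> X]])
      then show ?thesis by (simp add: inv \<alpha> xy)
    qed
    then show ?thesis by (simp add: Q_def conj_sum \<alpha> YB)
  qed
  have pow: "(conj_sum \<alpha> ^^ k) Y \<in> Q" if "\<alpha> \<in> \<Gamma>" "Y \<in> Q" for \<alpha> Y k
    by (induction k) (auto simp: that sphQ)
  have ces: "cesaro n \<alpha> Y \<in> Q" if \<alpha>: "\<alpha> \<in> \<Gamma>" and Y: "Y \<in> Q" for \<alpha> Y
  proof -
    have "Y \<in> \<B> K" using Y by (simp add: Q_def)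
    moreover have "cinner x (cesaro n \<alpha> Y y) = cinner x (X y)" if "x \<in> M" "y \<in> M" for x y
    proof -
      have "cinner x ((conj_sum \<alpha> ^^ k) Y y) = cinner x (X y)" for k
        using pow [OF \<alpha> Y] that by (simp add: Q_def)
      then have "cinner x (cesaro n \<alpha> Y y)
          = complex_of_real (1 / real (Suc n)) * (of_nat (Suc n) * cinner x (X y))"
        by (simp only: cesaro_def scaleC_blinfun_apply cinner_scaleC_right blinfun.sum_left
            cinner_sum_right sum_constant card_atMost)
      moreover have "complex_of_real (1 / real (Suc n)) * of_nat (Suc n) = 1"
        by (simp del: of_nat_Suc)
      ultimately show ?thesis by (simp only: mult.assoc [symmetric] mult_1_left)
    qed
    ultimately show ?thesis using ucp_map.into [OF ucp_cesaro [OF \<alpha>]] by (simp add: Q_def)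
  qed
  have "average n L X \<in> Q"
    using L
  proof (induction L)
    case Nil
    show ?case by (simp add: Q_def X)
  next
    case (Cons \<alpha> L)
    then show ?case by (simp add: ces)
  qed
  with xy show ?thesis by (simp add: Q_def)
qed

text \<open>The last property, for an invariant set \<open>M\<close>, is a local form of \<open>\<Phi>(X) = X\<close> for a Toeplitz operator \<open>X\<close>.
  With \<open>M = UNIV\<close> it says exactly this, so that \<open>\<Phi>\<close> is idempotent.  When \<open>M\<close> is the range
  of an isometry onto an invariant subspace, it says that \<open>\<Phi>\<close> does not change a compression which is a Toeplitz
  operator for the restricted family.\<close>

definition averaging_projection :: "(('a \<Rightarrow>\<^sub>L 'a) \<Rightarrow> ('a \<Rightarrow>\<^sub>L 'a)) \<Rightarrow> bool" where
  "averaging_projection \<Phi> \<longleftrightarrow> ucp_map K K \<Phi> \<and> (\<forall>X\<in>\<B> K. \<Phi> X \<in> toeplitz_on) \<and>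
    (\<forall>X\<in>\<B> K. \<forall>\<alpha>\<in>\<Gamma>. \<Phi> (conj_sum \<alpha> X) = \<Phi> X) \<and>
    (\<forall>M. \<forall>X\<in>\<B> K. (\<forall>\<alpha>\<in>\<Gamma>. \<forall>j\<in>J \<alpha>. \<forall>x\<in>M. N \<alpha> j x \<in> M) \<and>
      (\<forall>\<alpha>\<in>\<Gamma>. \<forall>x\<in>M. \<forall>y\<in>M. cinner x (conj_sum \<alpha> X y) = cinner x (X y)) \<longrightarrow>
      (\<forall>x\<in>M. \<forall>y\<in>M. cinner x (\<Phi> X y) = cinner x (X y)))"

text \<open>A simultaneous weak limit of the averages, along a filter finer than that of the finite subsets of \<open>\<Gamma>\<close> and
  the averaging lengths.  All properties are inherited from the averages by passing to the limit of the scalars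
  \<open>\<langle>x, average(X) y\<rangle>\<close>.\<close>

lemma averaging_projection_exists: "\<exists>\<Phi>. averaging_projection \<Phi>"
proof -
  define F where "F = finite_subsets_at_top \<Gamma> \<times>\<^sub>F sequentially"
  define a where "a = (\<lambda>i. average (snd i) (SOME L. set L = fst i))"
  define f where "f = (\<lambda>i (X, x, y). if X \<in> \<B> K then cinner x (a i X y) else 0)"
  define b where "b = (\<lambda>(X :: 'a \<Rightarrow>\<^sub>L 'a, x :: 'a, y :: 'a). norm x * (norm X * norm y))"
  have set_some: "set (SOME L. set L = A) = A" if "finite A" for A :: "'g set"
    using someI_ex [OF finite_list [OF that]] .
  have good: "\<forall>\<^sub>F i in F. finite (fst i) \<and> fst i \<subseteq> \<Gamma>"
  proof -
    have "\<forall>\<^sub>F A in finite_subsets_at_top \<Gamma>. finite A \<and> A \<subseteq> \<Gamma>"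
      by (intro eventually_finite_subsets_at_top_weakI) simp
    from eventually_prodI [OF this, of "\<lambda>_. True" sequentially] show ?thesis
      by (simp add: F_def)
  qed
  have ucp: "ucp_map K K (a i)" if "finite (fst i) \<and> fst i \<subseteq> \<Gamma>" for i
    unfolding a_def using that by (intro ucp_average) (simp add: set_some)
  have "\<forall>\<^sub>F i in F. \<forall>c. cmod (f i c) \<le> b c"
    using good
  proof eventually_elim
    case (elim i)
    interpret u: ucp_map K K "a i" by (rule ucp [OF elim])
    show ?case
      by (auto simp: f_def b_def intro!: order_trans [OF cinner_cauchy_schwarz] mult_left_mono
          u.contractive_apply)
  qed
  moreover have "F \<noteq> bot"
    by (simp add: F_def prod_filter_eq_bot)
  ultimately obtain G l where G: "G \<noteq> bot" "G \<le> F" and l: "\<And>c. ((\<lambda>i. f i c) \<longlongrightarrow> l c) G"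
    by (rule common_limit_filter [of f b F]) blast
  have good': "\<forall>\<^sub>F i in G. finite (fst i) \<and> fst i \<subseteq> \<Gamma>"
    by (rule filter_leD [OF G(2) good])
  have lim: "((\<lambda>i. cinner x (a i X y)) \<longlongrightarrow> l (X, x, y)) G" if "X \<in> \<B> K" for X x y
    using l [of "(X, x, y)"] that by (simp add: f_def)
  have lim_eq: "t = l (X, x, y)"
    if "X \<in> \<B> K" "((\<lambda>i. cinner x (a i X y)) \<longlongrightarrow> t) G" for X x y t
    using tendsto_unique [OF G(1) that(2) lim [OF that(1)]] .
  have "\<exists>A. A \<in> \<B> K \<and> (\<forall>x y. cinner x (blinfun_apply A y) = l (X, x, y))" if X: "X \<in> \<B> K" for X
  proof -
    obtain A where A: "clinear A" "\<And>x y. cinner x (blinfun_apply A y) = l (X, x, y)"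
    proof (rule operator_of_form [of "\<lambda>x y. l (X, x, y)" "norm X"])
      fix x x' y y' and c :: complex
      show "l (X, x + x', y) = l (X, x, y) + l (X, x', y)"
        by (rule lim_eq [OF X, symmetric])
          (simp add: cinner_add_left, intro tendsto_add lim X)
      show "l (X, x, y + y') = l (X, x, y) + l (X, x, y')"
        by (rule lim_eq [OF X, symmetric])
          (simp add: blinfun.add_right cinner_add_right, intro tendsto_add lim X)
      show "l (X, c *\<^sub>C x, y) = cnj c * l (X, x, y)"
        by (rule lim_eq [OF X, symmetric])
          (simp add: cinner_scaleC_left, intro tendsto_mult tendsto_const lim X)
      show "l (X, x, c *\<^sub>C y) = c * l (X, x, y)"
      proof (rule lim_eq [OF X, symmetric])
        have "\<forall>\<^sub>F i in G. c * cinner x (a i X y) = cinner x (a i X (c *\<^sub>C y))"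
          using good'
        proof eventually_elim
          case (elim i)
          then show ?case
            using ucp_map.lin(2) [OF ucp X] by (simp add: clinear_scaleC cinner_scaleC_right)
        qed
        then show "((\<lambda>i. cinner x (a i X (c *\<^sub>C y))) \<longlongrightarrow> c * l (X, x, y)) G"
          by (rule Lim_transform_eventually [rotated]) (intro tendsto_mult tendsto_const lim X)
      qed
      show "cmod (l (X, x, y)) \<le> norm X * norm x * norm y"
      proof (rule tendsto_upperbound [OF tendsto_norm [OF lim [OF X]] _ G(1)])
        show "\<forall>\<^sub>F i in G. norm (cinner x (a i X y)) \<le> norm X * norm x * norm y"
          using good'
        proof eventually_elim
          case (elim i)
          have "norm (cinner x (a i X y)) \<le> norm x * norm (a i X y)"
            by (rule cinner_cauchy_schwarz)
          also have "\<dots> \<le> norm x * (norm X * norm y)"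
            by (intro mult_left_mono ucp_map.contractive_apply [OF ucp [OF elim] X]) simp
          finally show ?case by (simp add: mult_ac)
        qed
      qed
    qed auto
    have "l (X, x, orth_proj K y) = l (X, x, y)" for x y
    proof (rule lim_eq [OF X, symmetric])
      have "\<forall>\<^sub>F i in G. cinner x (a i X y) = cinner x (a i X (orth_proj K y))"
        using good' by eventually_elim
          (use ucp_map.into [OF ucp X] in \<open>simp add: bounded_ops_iff [OF K]\<close>)
      then show "((\<lambda>i. cinner x (a i X (orth_proj K y))) \<longlongrightarrow> l (X, x, y)) G"
        by (rule Lim_transform_eventually [OF lim [OF X]])
    qed
    then have "A (orth_proj K y) = A y" for y by (intro cinner_eqI) (simp add: A)
    moreover have "l (X, orth_proj K x, y) = l (X, x, y)" for x y
    proof (rule lim_eq [OF X, symmetric])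
      have "\<forall>\<^sub>F i in G. cinner x (a i X y) = cinner (orth_proj K x) (a i X y)"
        using good' by eventually_elim
          (use ucp_map.into [OF ucp X] in
            \<open>simp add: bounded_ops_iff [OF K] cinner_orth_proj_left [OF K] orth_proj_fixes [OF K]\<close>)
      then show "((\<lambda>i. cinner (orth_proj K x) (a i X y)) \<longlongrightarrow> l (X, x, y)) G"
        by (rule Lim_transform_eventually [OF lim [OF X]])
    qed
    then have "orth_proj K (A y) = A y" for y
      by (intro cinner_eqI) (simp add: A flip: cinner_orth_proj_left [OF K])
    then have "A y \<in> K" for y by (metis orth_proj_in [OF K])
    ultimately have "A \<in> \<B> K" using A(1) by (simp add: bounded_ops_iff [OF K])
    with A(2) show ?thesis by blast
  qed
  then obtain \<Phi> where \<Phi>B: "\<And>X. X \<in> \<B> K \<Longrightarrow> \<Phi> X \<in> \<B> K"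
    and \<Phi>: "\<And>X x y. X \<in> \<B> K \<Longrightarrow> cinner x (blinfun_apply (\<Phi> X) y) = l (X, x, y)" by metis
  have \<Phi>lim: "((\<lambda>i. cinner x (a i X y)) \<longlongrightarrow> cinner x (\<Phi> X y)) G" if "X \<in> \<B> K" for X x y
    using lim [OF that] by (simp add: \<Phi> that)
  have \<Phi>eq: "\<Phi> X = A" if "X \<in> \<B> K"
    "\<And>x y. ((\<lambda>i. cinner x (a i X y)) \<longlongrightarrow> cinner x (blinfun_apply A y)) G" for X A
    using lim_eq [OF that(1) that(2)] by (intro blinfun_eqI cinner_eqI) (simp add: \<Phi> that(1))
  \<comment> \<open>Every index \<open>\<alpha>\<close> is eventually among those averaged over, and the lengths of the averages tend to infinity.\<close>
  have small: "((\<lambda>i. cinner x ((a i (conj_sum \<alpha> X) - a i X) y)) \<longlongrightarrow> 0) G"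
    if X: "X \<in> \<B> K" and \<alpha>: "\<alpha> \<in> \<Gamma>" for X \<alpha> x y
  proof (rule Lim_null_comparison)
    let ?b = "\<lambda>i. norm x * (2 / real (Suc (snd i)) * norm X * norm y)"
    have "\<forall>\<^sub>F A in finite_subsets_at_top \<Gamma>. \<alpha> \<in> A"
      unfolding eventually_finite_subsets_at_top using \<alpha> by (intro exI [of _ "{\<alpha>}"]) auto
    from eventually_prodI [OF this, of "\<lambda>_. True" sequentially]
    have "\<forall>\<^sub>F i in F. \<alpha> \<in> fst i" by (simp add: F_def)
    then have "\<forall>\<^sub>F i in G. \<alpha> \<in> fst i" by (rule filter_leD [OF G(2)])
    with good' show "\<forall>\<^sub>F i in G. norm (cinner x ((a i (conj_sum \<alpha> X) - a i X) y)) \<le> ?b i"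
    proof eventually_elim
      case (elim i)
      have "norm (cinner x ((a i (conj_sum \<alpha> X) - a i X) y))
          \<le> norm x * norm ((a i (conj_sum \<alpha> X) - a i X) y)"
        by (rule cinner_cauchy_schwarz)
      also have "\<dots> \<le> norm x * (norm (a i (conj_sum \<alpha> X) - a i X) * norm y)"
        by (intro mult_left_mono norm_blinfun) simp
      also have "\<dots> \<le> ?b i"
        unfolding a_def using elim X
        by (intro mult_left_mono mult_right_mono average_shift) (auto simp: set_some)
      finally show ?case .
    qed
    have "(\<lambda>n. 2 / real (Suc n)) \<longlonglongrightarrow> 0"
      using tendsto_mult_right [OF LIMSEQ_inverse_real_of_nat, of 2] by (simp add: field_simps)
    then have "((\<lambda>i. 2 / real (Suc (snd i))) \<longlongrightarrow> 0) F"
      unfolding F_def by (rule filterlim_compose [OF _ filterlim_snd])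
    then have "((\<lambda>i. 2 / real (Suc (snd i))) \<longlongrightarrow> 0) G"
      by (rule tendsto_mono [OF G(2)])
    then have "(?b \<longlongrightarrow> norm x * (0 * norm X * norm y)) G"
      by (intro tendsto_mult tendsto_const)
    then show "(?b \<longlongrightarrow> 0) G" by simp
  qed
  interpret \<Phi>: ucp_map K K \<Phi>
  proof
    show "completely_positive (\<B> K) \<Phi>"
      unfolding completely_positive_def complex_linear_on_def
    proof (intro conjI ballI allI impI)
      fix X Y assume XY: "X \<in> \<B> K" "Y \<in> \<B> K"
      show "\<Phi> (X + Y) = \<Phi> X + \<Phi> Y"
      proof (rule \<Phi>eq)
        fix x y
        have "\<forall>\<^sub>F i in G. cinner x (a i X y) + cinner x (a i Y y) = cinner x (a i (X + Y) y)"
          using good' by eventually_elim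
            (simp add: ucp_map.add [OF ucp XY] blinfun.add_left cinner_add_right)
        then show "((\<lambda>i. cinner x (a i (X + Y) y)) \<longlongrightarrow> cinner x ((\<Phi> X + \<Phi> Y) y)) G"
          unfolding blinfun.add_left cinner_add_right
          by (rule Lim_transform_eventually [rotated]) (intro tendsto_add \<Phi>lim XY)
      qed (intro BK XY)
    next
      fix c X assume X: "X \<in> \<B> K"
      show "\<Phi> (c *\<^sub>C X) = c *\<^sub>C \<Phi> X"
      proof (rule \<Phi>eq)
        fix x y
        have "\<forall>\<^sub>F i in G. c * cinner x (a i X y) = cinner x (a i (c *\<^sub>C X) y)"
          using good' by eventually_elim
            (simp add: ucp_map.scale [OF ucp X] scaleC_blinfun_apply cinner_scaleC_right)
        then show "((\<lambda>i. cinner x (a i (c *\<^sub>C X) y)) \<longlongrightarrow> cinner x ((c *\<^sub>C \<Phi> X) y)) G"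
          unfolding scaleC_blinfun_apply cinner_scaleC_right
          by (rule Lim_transform_eventually [rotated]) (intro tendsto_mult tendsto_const \<Phi>lim X)
      qed (intro BK X)
    next
      fix n and A :: "nat \<Rightarrow> nat \<Rightarrow> 'a \<Rightarrow>\<^sub>L 'a"
      assume A: "(\<forall>i<n. \<forall>j<n. A i j \<in> \<B> K) \<and> op_matrix_positive n A"
      show "op_matrix_positive n (\<lambda>i j. \<Phi> (A i j))"
        unfolding op_matrix_positive_def cinner_sum_right
      proof (intro allI Lim_in_closed_set [OF closed_nonneg_Reals_complex _ G(1)])
        fix x :: "nat \<Rightarrow> 'a"
        show "((\<lambda>k. \<Sum>i<n. \<Sum>j<n. cinner (x i) (a k (A i j) (x j)))
            \<longlongrightarrow> (\<Sum>i<n. \<Sum>j<n. cinner (x i) (\<Phi> (A i j) (x j)))) G"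
          using A by (intro tendsto_sum \<Phi>lim) auto
        show "\<forall>\<^sub>F k in G. (\<Sum>i<n. \<Sum>j<n. cinner (x i) (a k (A i j) (x j))) \<in> \<real>\<^sub>\<ge>\<^sub>0"
          using good'
        proof eventually_elim
          case (elim k)
          interpret u: ucp_map K K "a k" by (rule ucp [OF elim])
          show ?case
            using u.matrix_positive [of n A] A by (simp add: op_matrix_positive_def cinner_sum_right)
        qed
      qed
    qed
    show "\<Phi> (orth_proj K) = orth_proj K"
    proof (rule \<Phi>eq [OF orth_proj_bounded_ops [OF K]])
      fix x y
      have "\<forall>\<^sub>F i in G. cinner x (orth_proj K y) = cinner x (a i (orth_proj K) y)"
        using good' by eventually_elim (simp add: ucp_map.unital [OF ucp])
      then show "((\<lambda>i. cinner x (a i (orth_proj K) y)) \<longlongrightarrow> cinner x (orth_proj K y)) G"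
        by (rule Lim_transform_eventually [rotated]) (rule tendsto_const)
    qed
  qed (auto simp: K \<Phi>B)
  have shift: "\<Phi> (conj_sum \<alpha> X) = \<Phi> X" if X: "X \<in> \<B> K" and \<alpha>: "\<alpha> \<in> \<Gamma>" for X \<alpha>
  proof (rule \<Phi>eq)
    show "conj_sum \<alpha> X \<in> \<B> K" by (intro conj_sum \<alpha> X)
    fix x y
    have "((\<lambda>i. cinner x ((a i (conj_sum \<alpha> X) - a i X) y) + cinner x (a i X y)) \<longlongrightarrow> 0 + cinner x (\<Phi> X y)) G"
      by (intro tendsto_add small \<Phi>lim X \<alpha>)
    then show "((\<lambda>i. cinner x (a i (conj_sum \<alpha> X) y)) \<longlongrightarrow> cinner x (\<Phi> X y)) G"
      by (simp add: blinfun.diff_left cinner_diff_right)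
  qed
  have "\<Phi> X \<in> toeplitz_on" if X: "X \<in> \<B> K" for X
    unfolding toeplitz_on_iff
  proof (intro conjI ballI \<Phi>B X)
    fix \<alpha> assume \<alpha>: "\<alpha> \<in> \<Gamma>"
    have "((\<lambda>i. cinner x (conj_sum \<alpha> (a i X) y)) \<longlongrightarrow> cinner x (conj_sum \<alpha> (\<Phi> X) y)) G" for x y
    proof (rule conj_sum_weak_tendsto [OF \<alpha> \<Phi>B [OF X] _ \<Phi>lim [OF X]])
      show "\<forall>\<^sub>F i in G. a i X \<in> \<B> K \<and> norm (a i X) \<le> norm X"
        using good'
        by eventually_elim (auto intro: ucp_map.into [OF ucp] ucp_map.contractive [OF ucp] X)
    qed
    moreover have "\<forall>\<^sub>F i in G. cinner x (conj_sum \<alpha> (a i X) y) = cinner x (a i (conj_sum \<alpha> X) y)" for x y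
      using good' by eventually_elim (simp add: a_def average_conj_sum_commute \<alpha> X set_some)
    ultimately have "((\<lambda>i. cinner x (a i (conj_sum \<alpha> X) y)) \<longlongrightarrow> cinner x (conj_sum \<alpha> (\<Phi> X) y)) G" for x y
      by (rule Lim_transform_eventually)
    then have "\<Phi> (conj_sum \<alpha> X) = conj_sum \<alpha> (\<Phi> X)"
      by (intro \<Phi>eq conj_sum \<alpha> X)
    then show "conj_sum \<alpha> (\<Phi> X) = \<Phi> X" by (simp add: shift X \<alpha>)
  qed
  moreover have "cinner x (\<Phi> X y) = cinner x (X y)"
    if M: "\<forall>\<alpha>\<in>\<Gamma>. \<forall>j\<in>J \<alpha>. \<forall>x\<in>M. N \<alpha> j x \<in> M" and X: "X \<in> \<B> K"
      and inv: "\<forall>\<alpha>\<in>\<Gamma>. \<forall>x\<in>M. \<forall>y\<in>M. cinner x (conj_sum \<alpha> X y) = cinner x (X y)"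
      and xy: "x \<in> M" "y \<in> M" for M X x y
  proof -
    have "\<forall>\<^sub>F i in G. cinner x (X y) = cinner x (a i X y)"
      using good'
    proof eventually_elim
      case (elim i)
      show ?case
        unfolding a_def
        by (rule average_invariant_form [symmetric, of M])
          (use M X inv xy elim in \<open>auto simp: set_some\<close>)
    qed
    then have "((\<lambda>i. cinner x (a i X y)) \<longlongrightarrow> cinner x (X y)) G"
      by (rule Lim_transform_eventually [rotated]) (rule tendsto_const)
    then show ?thesis using lim_eq X \<Phi> by simp
  qed
  ultimately have "averaging_projection \<Phi>"
    using shift \<Phi>.ucp_map_axioms unfolding averaging_projection_def
    by (intro conjI allI ballI impI) blast+
  then show ?thesis by blast
qed

end

lemma has_sum_cong2:
  "(\<And>x. x \<in> A \<Longrightarrow> f x = g x) \<Longrightarrow> a = b \<Longrightarrow> (f has_sum a) A \<longleftrightarrow> (g has_sum b) A"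
  using has_sum_cong [of A f g] by simp

lemma tendsto_adj:
  assumes "\<And>n. clinear (X n)" "X \<longlonglongrightarrow> Y" "clinear Y"
  shows "(\<lambda>n. adj (X n)) \<longlonglongrightarrow> adj Y"
proof -
  have "(\<lambda>n. norm (X n - Y)) \<longlonglongrightarrow> 0"
    using assms(2) by (simp add: LIM_zero tendsto_norm_zero)
  then have "(\<lambda>n. adj (X n) - adj Y) \<longlonglongrightarrow> 0"
  proof (rule Lim_null_comparison [rotated])
    show "\<forall>\<^sub>F n in sequentially. norm (adj (X n) - adj Y) \<le> norm (X n - Y)"
      using norm_adj_le [OF clinear_minus [OF assms(1,3)]] assms(1,3) by (simp add: adj_minus)
  qed
  then show ?thesis by (rule LIM_zero_cancel)
qed

lemmas tendsto_compose_blinfun = bounded_bilinear.tendsto [OF bounded_bilinear_blinfun_compose]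

text \<open>No approximation by polynomials in the generators is needed to see that a closed subspace exhausts
  the algebra: the elements which, together with their adjoints, map it into itself form a C*-algebra.\<close>

lemma cstar_least_left_invariant:
  assumes K: "hilbert_subspace K" and S: "S \<subseteq> \<B> K" and E: "E \<subseteq> cstar K S" "complex_subspace E" "closed E"
    and unit: "orth_proj K \<in> E"
    and inv: "\<And>A X. A \<in> S \<Longrightarrow> X \<in> E \<Longrightarrow> A o\<^sub>L X \<in> E" "\<And>A X. A \<in> S \<Longrightarrow> X \<in> E \<Longrightarrow> adj A o\<^sub>L X \<in> E"
  shows "cstar K S \<subseteq> E"
proof -
  note A = cstar_subalgebraD [OF cstar_subalgebra_cstar [OF K S]]
  define D where "D = {Z \<in> cstar K S. \<forall>X\<in>E. Z o\<^sub>L X \<in> E \<and> adj Z o\<^sub>L X \<in> E}"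
  have "cstar_subalgebra K D"
    unfolding cstar_subalgebra_def
  proof (intro conjI ballI)
    show "D \<subseteq> \<B> K" using A(1) by (auto simp: D_def)
    show "complex_subspace D"
      using A E(2) by (auto simp: D_def complex_subspace_def compose_add_left compose_scaleC_left
          adj_plus adj_scaleC adj_unique [of 0 0])
    show "closed D"
      unfolding closed_sequential_limits
    proof (intro allI impI)
      fix X Z assume "(\<forall>n. X n \<in> D) \<and> X \<longlonglongrightarrow> Z"
      then have X: "\<And>n. X n \<in> D" and lim: "X \<longlonglongrightarrow> Z" by auto
      have XA: "\<And>n. X n \<in> cstar K S" using X by (simp add: D_def)
      have Z: "Z \<in> cstar K S" by (rule closed_sequentially [OF A(3) XA lim])
      have "Z o\<^sub>L Y \<in> E" "adj Z o\<^sub>L Y \<in> E" if "Y \<in> E" for Y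
      proof -
        show "Z o\<^sub>L Y \<in> E"
          by (rule closed_sequentially [OF E(3) _ tendsto_compose_blinfun [OF lim tendsto_const]])
            (use X that in \<open>simp add: D_def\<close>)
        have "(\<lambda>n. adj (X n)) \<longlonglongrightarrow> adj Z"
          by (intro tendsto_adj lim A(2) XA Z)
        then show "adj Z o\<^sub>L Y \<in> E"
          by (rule closed_sequentially [OF E(3) _ tendsto_compose_blinfun [OF _ tendsto_const], rotated])
            (use X that in \<open>simp add: D_def\<close>)
      qed
      with Z show "Z \<in> D" by (simp add: D_def)
    qed
    show "X o\<^sub>L Y \<in> D" if "X \<in> D" "Y \<in> D" for X Y
      using that by (simp add: D_def A(7) A(2) adj_compose blinfun_compose_assoc)
    show "adj X \<in> D" if "X \<in> D" for X
      using that by (simp add: D_def A(8) A(2) adj_adj)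
  qed
  moreover have "orth_proj K \<in> D"
    using E(1) A(1) cstar_contains(2)
    by (auto simp: D_def adj_orth_proj K orth_proj_compose_left subset_iff)
  moreover have "S \<subseteq> D"
    using inv cstar_contains(1) [of S K] by (auto simp: D_def)
  ultimately have "cstar K S \<subseteq> D" by (rule cstar_least)
  show ?thesis
  proof
    fix Z assume "Z \<in> cstar K S"
    then have "Z \<in> D" "Z \<in> \<B> K" using \<open>cstar K S \<subseteq> D\<close> A(1) by auto
    then have "Z o\<^sub>L orth_proj K \<in> E" "Z o\<^sub>L orth_proj K = Z"
      using unit K by (auto simp: D_def orth_proj_compose_right)
    then show "Z \<in> E" by simp
  qed
qed

lemma cstar_subalgebra_commuting:
  assumes K: "hilbert_subspace K" and Y: "clinear Y"
  shows "cstar_subalgebra K {Z \<in> \<B> K. Z o\<^sub>L Y = Y o\<^sub>L Z \<and> adj Z o\<^sub>L Y = Y o\<^sub>L adj Z}"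
    (is "cstar_subalgebra K ?D")
proof -
  note B = bounded_ops_closure [OF K]
  show ?thesis
    unfolding cstar_subalgebra_def
  proof (intro conjI ballI)
    show "complex_subspace ?D"
      using B Y by (auto simp: complex_subspace_def compose_add_left compose_add_right
          compose_scaleC_left compose_scaleC_right adj_plus adj_scaleC adj_unique [of 0 0]
          bounded_ops_clinear [where K = K])
    show "closed ?D"
      unfolding closed_sequential_limits
    proof (intro allI impI)
      fix X Z assume "(\<forall>n. X n \<in> ?D) \<and> X \<longlonglongrightarrow> Z"
      then have X: "\<And>n. X n \<in> ?D" and lim: "X \<longlonglongrightarrow> Z" by auto
      have XB: "\<And>n. X n \<in> \<B> K" using X by simp
      have Z: "Z \<in> \<B> K" by (rule closed_sequentially [OF B(1) XB lim])
      have lim': "(\<lambda>n. adj (X n)) \<longlonglongrightarrow> adj Z"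
        by (intro tendsto_adj lim bounded_ops_clinear [OF XB] bounded_ops_clinear [OF Z])
      note c = tendsto_compose_blinfun [OF _ tendsto_const] tendsto_compose_blinfun [OF tendsto_const]
      have "Z o\<^sub>L Y = Y o\<^sub>L Z"
        by (rule LIMSEQ_unique [OF c(1) [OF lim]]) (use X c(2) [OF lim, of Y] in simp)
      moreover have "adj Z o\<^sub>L Y = Y o\<^sub>L adj Z"
        by (rule LIMSEQ_unique [OF c(1) [OF lim']]) (use X c(2) [OF lim', of Y] in simp)
      ultimately show "Z \<in> ?D" using Z by simp
    qed
    show "A o\<^sub>L C \<in> ?D" if AC: "A \<in> ?D" "C \<in> ?D" for A C
    proof -
      have m: "(P o\<^sub>L Q) o\<^sub>L Y = Y o\<^sub>L (P o\<^sub>L Q)"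
        if "P o\<^sub>L Y = Y o\<^sub>L P" "Q o\<^sub>L Y = Y o\<^sub>L Q" for P Q
        unfolding blinfun_compose_assoc that(2) by (simp only: that(1) flip: blinfun_compose_assoc)
      have "(A o\<^sub>L C) o\<^sub>L Y = Y o\<^sub>L (A o\<^sub>L C)" "(adj C o\<^sub>L adj A) o\<^sub>L Y = Y o\<^sub>L (adj C o\<^sub>L adj A)"
        using AC by (auto intro: m)
      then show ?thesis using AC by (simp add: B adj_compose bounded_ops_clinear [where K = K])
    qed
    show "adj A \<in> ?D" if "A \<in> ?D" for A
      using that by (simp add: B adj_adj bounded_ops_clinear [where K = K])
  qed auto
qed

section \<open>Toeplitz operators as a multiplicative system\<close>

context spherical_family
begin

lemma toeplitz_onD: "X \<in> toeplitz_on \<Longrightarrow> X \<in> \<B> K" "X \<in> toeplitz_on \<Longrightarrow> \<alpha> \<in> \<Gamma> \<Longrightarrow> conj_sum \<alpha> X = X"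
  by (auto simp: toeplitz_on_iff)

lemma toeplitz_on_unit: "orth_proj K \<in> toeplitz_on"
  by (simp add: toeplitz_on_iff orth_proj_bounded_ops K ucp_map.unital [OF ucp_conj_sum])

lemma toeplitz_on_adj: "X \<in> toeplitz_on \<Longrightarrow> adj X \<in> toeplitz_on"
  by (auto simp: toeplitz_on_iff BK ucp_map.star [OF ucp_conj_sum])

text \<open>Toeplitz operators are not closed under products, but they may be multiplied by generators on the right and
  by their adjoints on the left: in \<open>N\<^sub>i\<^sup>* X N\<^sub>j N\<^sub>i = N\<^sub>i\<^sup>* X N\<^sub>i N\<^sub>j\<close> the factor \<open>N\<^sub>j\<close> leaves the sum over \<open>i\<close>.\<close>

lemma toeplitz_on_compose:
  assumes X: "X \<in> toeplitz_on" and \<alpha>: "\<alpha> \<in> \<Gamma>" "j \<in> J \<alpha>"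
  shows "X o\<^sub>L N \<alpha> j \<in> toeplitz_on"
  unfolding toeplitz_on_iff
proof (intro conjI ballI conj_sum_eqI)
  show "X o\<^sub>L N \<alpha> j \<in> \<B> K" "X o\<^sub>L N \<alpha> j \<in> \<B> K"
    by (intro BK toeplitz_onD X N_in \<alpha>)+
  fix \<beta> x y assume \<beta>: "\<beta> \<in> \<Gamma>"
  have "((\<lambda>i. cinner (N \<beta> i x) (X (N \<beta> i (N \<alpha> j y)))) has_sum cinner x (conj_sum \<beta> X (N \<alpha> j y))) (J \<beta>)"
    by (intro has_sum_conj_sum \<beta> toeplitz_onD X)
  then show "((\<lambda>i. cinner (N \<beta> i x) ((X o\<^sub>L N \<alpha> j) (N \<beta> i y))) has_sum cinner x ((X o\<^sub>L N \<alpha> j) y)) (J \<beta>)"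
    by (simp add: toeplitz_onD X \<beta> N_apply_commute [OF \<beta> _ \<alpha>] cong: has_sum_cong2)
qed

lemma toeplitz_on_adj_compose:
  assumes "X \<in> toeplitz_on" "\<alpha> \<in> \<Gamma>" "j \<in> J \<alpha>"
  shows "adj (N \<alpha> j) o\<^sub>L X \<in> toeplitz_on"
proof -
  have "adj (adj X o\<^sub>L N \<alpha> j) \<in> toeplitz_on"
    by (intro toeplitz_on_adj toeplitz_on_compose assms)
  then show ?thesis
    using assms by (simp add: adj_compose clinear_adj bounded_ops_clinear [where K = K] toeplitz_onD N_clinear adj_adj)
qed

lemma N_in_toeplitz_on: "\<alpha> \<in> \<Gamma> \<Longrightarrow> j \<in> J \<alpha> \<Longrightarrow> N \<alpha> j \<in> toeplitz_on"
  using toeplitz_on_compose [OF toeplitz_on_unit] by (simp add: orth_proj_compose_left K N_in)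

text \<open>For \<open>X\<close> commuting with the family, \<open>\<Sum> N\<^sub>j\<^sup>* X\<^sup>* X N\<^sub>j = X\<^sup>* (\<Sum> N\<^sub>j\<^sup>* N\<^sub>j) X\<close>.\<close>

lemma commuting_in_toeplitz_on:
  assumes X: "X \<in> \<B> K" and comm: "\<And>\<alpha> j. \<alpha> \<in> \<Gamma> \<Longrightarrow> j \<in> J \<alpha> \<Longrightarrow> X o\<^sub>L N \<alpha> j = N \<alpha> j o\<^sub>L X"
  shows "X \<in> toeplitz_on" "adj X o\<^sub>L X \<in> toeplitz_on"
proof -
  have ap: "X (N \<alpha> j x) = N \<alpha> j (X x)" if "\<alpha> \<in> \<Gamma>" "j \<in> J \<alpha>" for \<alpha> j x
    using comm [OF that] by (metis blinfun_apply_blinfun_compose)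
  have PX: "orth_proj K (X x) = X x" for x
    using X by (simp add: bounded_ops_iff [OF K] orth_proj_fixes [OF K])
  have N: "((\<lambda>j. cinner (N \<alpha> j x) (N \<alpha> j y)) has_sum cinner x (orth_proj K y)) (J \<alpha>)" if "\<alpha> \<in> \<Gamma>" for \<alpha> x y
    using has_sum_conj_sum [OF that orth_proj_bounded_ops [OF K], of x y] that
    by (simp add: ucp_map.unital [OF ucp_conj_sum] orth_proj_fixes K N_apply_in cong: has_sum_cong2)
  show "X \<in> toeplitz_on"
    unfolding toeplitz_on_iff
  proof (intro conjI ballI conj_sum_eqI X)
    fix \<alpha> x y assume \<alpha>: "\<alpha> \<in> \<Gamma>"
    show "((\<lambda>j. cinner (N \<alpha> j x) (X (N \<alpha> j y))) has_sum cinner x (X y)) (J \<alpha>)"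
      using N [OF \<alpha>, of x "X y"] by (simp add: ap \<alpha> PX cong: has_sum_cong2)
  qed
  show "adj X o\<^sub>L X \<in> toeplitz_on"
    unfolding toeplitz_on_iff
  proof (intro conjI ballI conj_sum_eqI BK X)
    fix \<alpha> x y assume \<alpha>: "\<alpha> \<in> \<Gamma>"
    show "((\<lambda>j. cinner (N \<alpha> j x) ((adj X o\<^sub>L X) (N \<alpha> j y))) has_sum cinner x ((adj X o\<^sub>L X) y)) (J \<alpha>)"
      using N [OF \<alpha>, of "X x" "X y"] bounded_ops_clinear [OF X]
      by (simp add: ap \<alpha> PX cinner_adj cong: has_sum_cong2)
  qed
qed

text \<open>On expanding the square, the mixed terms sum up to \<open>\<parallel>X x\<parallel>\<^sup>2\<close> because \<open>X\<close> is a Toeplitz operator.\<close>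

lemma commutator_norm_has_sum:
  assumes X: "X \<in> toeplitz_on" and \<alpha>: "\<alpha> \<in> \<Gamma>"
  shows "((\<lambda>j. (norm (((N \<alpha> j o\<^sub>L X) - (X o\<^sub>L N \<alpha> j)) x))\<^sup>2) has_sum
    Re (cinner x (conj_sum \<alpha> (adj X o\<^sub>L X) x)) - (norm (X x))\<^sup>2) (J \<alpha>)"
proof -
  have XB: "X \<in> \<B> K" by (rule toeplitz_onD [OF X])
  have 1: "((\<lambda>j. (norm (N \<alpha> j (X x)))\<^sup>2) has_sum (norm (X x))\<^sup>2) (J \<alpha>)"
    using has_sum_norm_N [OF \<alpha>, of "X x"] XB
    by (simp add: bounded_ops_iff [OF K] orth_proj_fixes [OF K])
  have 2: "((\<lambda>j. Re (cinner (N \<alpha> j (X x)) (X (N \<alpha> j x)))) has_sum (norm (X x))\<^sup>2) (J \<alpha>)"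
    using has_sum_Re [OF has_sum_conj_sum [OF \<alpha> XB, of "X x" x]]
    by (simp add: toeplitz_onD X \<alpha> cinner_self)
  have 3: "((\<lambda>j. Re (cinner (N \<alpha> j x) ((adj X o\<^sub>L X) (N \<alpha> j x)))) has_sum
      Re (cinner x (conj_sum \<alpha> (adj X o\<^sub>L X) x))) (J \<alpha>)"
    by (intro has_sum_Re has_sum_conj_sum \<alpha> BK XB)
  have "(norm (((N \<alpha> j o\<^sub>L X) - (X o\<^sub>L N \<alpha> j)) x))\<^sup>2 = (norm (N \<alpha> j (X x)))\<^sup>2
      + (- 2) * Re (cinner (N \<alpha> j (X x)) (X (N \<alpha> j x))) + Re (cinner (N \<alpha> j x) ((adj X o\<^sub>L X) (N \<alpha> j x)))" for j
    using bounded_ops_clinear [OF XB]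
    by (simp add: blinfun.diff_left cinner_adj cinner_self Re_cinner power2_norm_eq_inner inner_diff
        inner_commute)
  then show ?thesis
    using has_sum_add [OF has_sum_add [OF 1 has_sum_cmult_right [OF 2, of "- 2"]] 3] by simp
qed

text \<open>A commutator with a Toeplitz operator has negligible square: its square is dominated by
  \<open>conj_sum \<alpha> (X\<^sup>* X) - X\<^sup>* X\<close>, on which every shift invariant map vanishes.\<close>

lemma commutator_negligible:
  assumes \<Phi>: "ucp_map K K \<Phi>" and shift: "\<And>Y. Y \<in> \<B> K \<Longrightarrow> \<Phi> (conj_sum \<alpha> Y) = \<Phi> Y"
    and X: "X \<in> toeplitz_on" and \<alpha>: "\<alpha> \<in> \<Gamma>" "j \<in> J \<alpha>" and Y: "Y \<in> \<B> K"
  shows "\<Phi> (Y o\<^sub>L (N \<alpha> j o\<^sub>L X)) = \<Phi> (Y o\<^sub>L (X o\<^sub>L N \<alpha> j))"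
proof -
  interpret \<Phi>: ucp_map K K \<Phi> by fact
  define C where "C = (N \<alpha> j o\<^sub>L X) - (X o\<^sub>L N \<alpha> j)"
  have XB: "X \<in> \<B> K" by (rule toeplitz_onD [OF X])
  have CB: "C \<in> \<B> K" unfolding C_def by (intro BK XB N_in \<alpha>)
  note lin = bounded_ops_clinear [OF XB] bounded_ops_clinear [OF CB]
  let ?Q = "conj_sum \<alpha> (adj X o\<^sub>L X)"
  have QB: "?Q \<in> \<B> K" by (intro conj_sum \<alpha> BK XB)
  have XX: "adj X o\<^sub>L X \<in> \<B> K" "adj C o\<^sub>L C \<in> \<B> K" by (intro BK XB CB)+
  have "positive_op (?Q - (adj X o\<^sub>L X) - (adj C o\<^sub>L C))"
    unfolding positive_op_def
  proof
    fix x
    have "(norm (C x))\<^sup>2 \<le> Re (cinner x (?Q x)) - (norm (X x))\<^sup>2"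
      using finite_sum_le_has_sum [OF commutator_norm_has_sum [OF X \<alpha>(1), of x], of "{j}"] \<alpha>
      by (simp add: C_def)
    moreover have "cinner x (?Q x) \<in> \<real>\<^sub>\<ge>\<^sub>0"
      using ucp_map.positive [OF ucp_conj_sum [OF \<alpha>(1)] XX(1)] lin
      by (simp add: positive_op_def positive_op_adj_compose cinner_adj cinner_self)
    ultimately show "cinner x ((?Q - (adj X o\<^sub>L X) - (adj C o\<^sub>L C)) x) \<in> \<real>\<^sub>\<ge>\<^sub>0"
      using lin by (simp add: blinfun.diff_left cinner_diff_right cinner_adj cinner_self
          complex_nonneg_Reals_iff)
  qed
  then have "positive_op (\<Phi> (?Q - (adj X o\<^sub>L X) - (adj C o\<^sub>L C)))"
    by (intro \<Phi>.positive BK QB XX)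
  then have "positive_op (0 - \<Phi> (adj C o\<^sub>L C))"
    by (simp add: \<Phi>.diff BK QB XX shift)
  then have "positive_op (0 - (adj (\<Phi> C) o\<^sub>L \<Phi> C))"
    by (rule positive_op_trans) (rule \<Phi>.schwarz [OF CB])
  then have "(norm (\<Phi> C x))\<^sup>2 \<le> 0" for x
    using \<Phi>.lin(2) [OF CB]
    by (auto simp: positive_op_def blinfun.minus_left cinner_adj cinner_self complex_nonneg_Reals_iff
        dest!: spec [of _ x])
  then have \<Phi>C: "\<Phi> C = 0" by (intro blinfun_eqI) simp
  have "\<Phi> (adj C o\<^sub>L C) = 0"
  proof (rule positive_op_antisym)
    show "positive_op (0 - \<Phi> (adj C o\<^sub>L C))" by fact
    show "positive_op (\<Phi> (adj C o\<^sub>L C) - 0)"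
      using \<Phi>.positive [OF XX(2)] lin by (simp add: positive_op_adj_compose)
  qed (simp_all add: \<Phi>.lin XX clinear_zero)
  then have "\<Phi> (adj C o\<^sub>L C) = adj (\<Phi> C) o\<^sub>L \<Phi> C"
    by (simp add: \<Phi>C)
  then have "\<Phi> (Y o\<^sub>L C) = \<Phi> Y o\<^sub>L \<Phi> C"
    by (intro \<Phi>.multiplicative_right CB Y)
  then have "\<Phi> (Y o\<^sub>L (N \<alpha> j o\<^sub>L X)) - \<Phi> (Y o\<^sub>L (X o\<^sub>L N \<alpha> j)) = 0"
    by (simp add: C_def [symmetric] \<Phi>C compose_diff_right [symmetric]
       \<Phi>.diff [symmetric] BK Y XB N_in \<alpha>)
  then show ?thesis by simp
qed

text \<open>With \<open>N\<close> also \<open>N\<^sup>* N\<close> is a Toeplitz operator, so that there is equality in the Schwarz inequality for \<open>N\<close>.\<close>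

lemma fixing_map_right_module:
  assumes \<Phi>: "ucp_map K K \<Phi>" and fixed: "\<And>X. X \<in> toeplitz_on \<Longrightarrow> \<Phi> X = X"
    and \<alpha>: "\<alpha> \<in> \<Gamma>" "j \<in> J \<alpha>" and Y: "Y \<in> \<B> K"
  shows "\<Phi> (Y o\<^sub>L N \<alpha> j) = \<Phi> Y o\<^sub>L N \<alpha> j"
proof -
  have "\<Phi> (adj (N \<alpha> j) o\<^sub>L N \<alpha> j) = adj (\<Phi> (N \<alpha> j)) o\<^sub>L \<Phi> (N \<alpha> j)"
    by (simp add: fixed N_in_toeplitz_on toeplitz_on_adj_compose \<alpha>)
  then show ?thesis
    using ucp_map.multiplicative_right [OF \<Phi> N_in [OF \<alpha>] _ Y]
    by (simp add: fixed N_in_toeplitz_on \<alpha>)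
qed

definition toeplitz_proj :: "('a \<Rightarrow>\<^sub>L 'a) \<Rightarrow> ('a \<Rightarrow>\<^sub>L 'a)" where
  "toeplitz_proj = (SOME \<Phi>. averaging_projection \<Phi>)"

lemma toeplitz_proj_props: "averaging_projection toeplitz_proj"
  unfolding toeplitz_proj_def
  by (rule someI_ex [OF averaging_projection_exists])

lemma ucp_toeplitz_proj: "ucp_map K K toeplitz_proj"
  and toeplitz_proj_in: "X \<in> \<B> K \<Longrightarrow> toeplitz_proj X \<in> toeplitz_on"
  and toeplitz_proj_shift: "X \<in> \<B> K \<Longrightarrow> \<alpha> \<in> \<Gamma> \<Longrightarrow> toeplitz_proj (conj_sum \<alpha> X) = toeplitz_proj X"
  using toeplitz_proj_props by (auto simp: averaging_projection_def)

lemma toeplitz_proj_invariant_form: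
  assumes "\<And>\<alpha> j x. \<alpha> \<in> \<Gamma> \<Longrightarrow> j \<in> J \<alpha> \<Longrightarrow> x \<in> M \<Longrightarrow> N \<alpha> j x \<in> M" "X \<in> \<B> K"
    "\<And>\<alpha> x y. \<alpha> \<in> \<Gamma> \<Longrightarrow> x \<in> M \<Longrightarrow> y \<in> M \<Longrightarrow> cinner x (conj_sum \<alpha> X y) = cinner x (X y)"
    "x \<in> M" "y \<in> M"
  shows "cinner x (toeplitz_proj X y) = cinner x (X y)"
  by (rule toeplitz_proj_props [unfolded averaging_projection_def, THEN conjunct2, THEN conjunct2, THEN conjunct2, rule_format])
    (use assms in auto)

lemma toeplitz_proj_fixes: "X \<in> toeplitz_on \<Longrightarrow> toeplitz_proj X = X"
  by (intro blinfun_eqI cinner_eqI toeplitz_proj_invariant_form [of UNIV]) (auto simp: toeplitz_onD)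

text \<open>For a normal family the generators lie in the multiplicative domain on both sides, so that a Toeplitz
  operator \<open>X\<close> satisfies \<open>N X = \<Phi>(N X) = \<Phi>(X N) = X N\<close>.  This replaces Fuglede's theorem, because
  the space of Toeplitz operators is closed under adjoints.\<close>

lemma toeplitz_on_commutes:
  assumes normal: "\<And>\<alpha> j. \<alpha> \<in> \<Gamma> \<Longrightarrow> j \<in> J \<alpha> \<Longrightarrow> normal_op (N \<alpha> j)"
    and X: "X \<in> toeplitz_on" and \<alpha>: "\<alpha> \<in> \<Gamma>" "j \<in> J \<alpha>"
  shows "X o\<^sub>L N \<alpha> j = N \<alpha> j o\<^sub>L X"
proof -
  interpret \<Phi>: ucp_map K K toeplitz_proj by (rule ucp_toeplitz_proj)
  have XB: "X \<in> \<B> K" by (rule toeplitz_onD [OF X])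
  have T: "N \<alpha> j \<in> toeplitz_on" "adj (N \<alpha> j) o\<^sub>L N \<alpha> j \<in> toeplitz_on"
    by (auto intro: N_in_toeplitz_on toeplitz_on_adj_compose \<alpha>)
  have "N \<alpha> j o\<^sub>L adj (N \<alpha> j) = adj (N \<alpha> j) o\<^sub>L N \<alpha> j"
    using normal [OF \<alpha>] by (simp add: normal_op_def)
  with T have "N \<alpha> j \<in> \<Phi>.mult_domain"
    by (intro \<Phi>.mult_domainI N_in \<alpha>) (simp_all add: toeplitz_proj_fixes)
  from \<Phi>.mult_domainD(1,2) [OF this XB] T X
  have "toeplitz_proj (X o\<^sub>L N \<alpha> j) = X o\<^sub>L N \<alpha> j" "toeplitz_proj (N \<alpha> j o\<^sub>L X) = N \<alpha> j o\<^sub>L X"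
    by (simp_all add: toeplitz_proj_fixes)
  moreover have "toeplitz_proj (N \<alpha> j o\<^sub>L X) = toeplitz_proj (X o\<^sub>L N \<alpha> j)"
    using commutator_negligible [OF ucp_toeplitz_proj toeplitz_proj_shift X \<alpha> orth_proj_bounded_ops [OF K]] \<alpha>
    by (simp add: orth_proj_compose_left K BK XB N_in)
  ultimately show ?thesis by simp
qed

lemma commutant_eq_toeplitz_on:
  assumes normal: "\<And>\<alpha> j. \<alpha> \<in> \<Gamma> \<Longrightarrow> j \<in> J \<alpha> \<Longrightarrow> normal_op (N \<alpha> j)"
  shows "commutant K (family_ops \<Gamma> J N) = toeplitz_on"
  using toeplitz_on_commutes [OF normal] commuting_in_toeplitz_on(1) toeplitz_onD(1)
  by (fastforce simp: commutant_def family_ops_def)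

end

section \<open>Norms of operator matrices\<close>

lemma op_matrix_norm_le:
  assumes c: "0 \<le> c" and le: "\<And>x. (\<Sum>i<n. (norm (\<Sum>j<n. blinfun_apply (A i j) (x j)))\<^sup>2) \<le> c\<^sup>2 * (\<Sum>i<n. (norm (x i))\<^sup>2)"
  shows "op_matrix_norm n A \<le> c"
  unfolding op_matrix_norm_def
proof (rule cSUP_least)
  show "{x :: nat \<Rightarrow> 'a. (\<Sum>i<n. (norm (x i))\<^sup>2) \<le> 1} \<noteq> {}"
    by (auto intro!: exI [of _ "\<lambda>_. 0"])
  fix x :: "nat \<Rightarrow> 'a" assume "x \<in> {x. (\<Sum>i<n. (norm (x i))\<^sup>2) \<le> 1}"
  then have "(\<Sum>i<n. (norm (\<Sum>j<n. A i j (x j)))\<^sup>2) \<le> c\<^sup>2"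
    using le [of x] mult_left_mono [of "\<Sum>i<n. (norm (x i))\<^sup>2" 1 "c\<^sup>2"] by simp
  then show "sqrt (\<Sum>i<n. (norm (\<Sum>j<n. A i j (x j)))\<^sup>2) \<le> c"
    using c by (intro real_le_lsqrt) (auto intro: sum_nonneg)
qed

lemma op_matrix_norm_bound:
  fixes A :: "nat \<Rightarrow> nat \<Rightarrow> 'a::complex_hilbert_space \<Rightarrow>\<^sub>L 'a"
  shows "(\<Sum>i<n. (norm (\<Sum>j<n. A i j (x j)))\<^sup>2) \<le> (op_matrix_norm n A)\<^sup>2 * (\<Sum>i<n. (norm (x i))\<^sup>2)"
    and "0 \<le> op_matrix_norm n A"
proof -
  let ?S = "{x :: nat \<Rightarrow> 'a. (\<Sum>i<n. (norm (x i))\<^sup>2) \<le> 1}"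
  let ?f = "\<lambda>x. sqrt (\<Sum>i<n. (norm (\<Sum>j<n. A i j (x j)))\<^sup>2)"
  have "?f x \<le> sqrt (\<Sum>i<n. (\<Sum>j<n. norm (A i j))\<^sup>2)" if x: "x \<in> ?S" for x
  proof (intro real_sqrt_le_mono sum_mono power_mono)
    fix i
    have "norm (x j) \<le> 1" if "j < n" for j
    proof -
      have "(norm (x j))\<^sup>2 \<le> (\<Sum>i<n. (norm (x i))\<^sup>2)"
        using that by (intro member_le_sum) auto
      then have "(norm (x j))\<^sup>2 \<le> 1\<^sup>2" using x by simp
      then show ?thesis by (rule power2_le_imp_le) simp
    qed
    then have "norm (A i j (x j)) \<le> norm (A i j)" if "j < n" for j
      using that mult_left_mono [of "norm (x j)" 1 "norm (A i j)"] norm_blinfun [of "A i j" "x j"]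
      by force
    then show "norm (\<Sum>j<n. A i j (x j)) \<le> (\<Sum>j<n. norm (A i j))"
      by (intro order_trans [OF norm_sum] sum_mono) auto
  qed simp
  then have bdd: "bdd_above (?f ` ?S)"
    by (intro bdd_aboveI2)
  have upper: "?f x \<le> op_matrix_norm n A" if "x \<in> ?S" for x
    unfolding op_matrix_norm_def using that by (rule cSUP_upper [OF _ bdd])
  show nn: "0 \<le> op_matrix_norm n A"
    using upper [of "\<lambda>_. 0"] by simp
  define s where "s = sqrt (\<Sum>i<n. (norm (x i))\<^sup>2)"
  have s2: "s\<^sup>2 = (\<Sum>i<n. (norm (x i))\<^sup>2)"
    by (simp add: s_def sum_nonneg)
  show "(\<Sum>i<n. (norm (\<Sum>j<n. A i j (x j)))\<^sup>2) \<le> (op_matrix_norm n A)\<^sup>2 * (\<Sum>i<n. (norm (x i))\<^sup>2)"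
  proof (cases "s = 0")
    case True
    then have "(norm (x i))\<^sup>2 = 0" if "i < n" for i
      using s2 that sum_nonneg_eq_0_iff [of "{..<n}" "\<lambda>i. (norm (x i))\<^sup>2"] by simp
    then have "x i = 0" if "i < n" for i using that by simp
    then show ?thesis by simp
  next
    case False
    then have s: "s > 0" by (simp add: s_def less_le sum_nonneg)
    define y where "y = (\<lambda>i. (1 / s) *\<^sub>R x i)"
    have "(\<Sum>i<n. (norm (y i))\<^sup>2) = (1 / s)\<^sup>2 * s\<^sup>2"
      unfolding s2 sum_distrib_left by (simp add: y_def power_mult_distrib power_divide)
    then have "y \<in> ?S" using s by (simp add: power_divide)
    from upper [OF this] have "(?f y)\<^sup>2 \<le> (op_matrix_norm n A)\<^sup>2"
      by (intro power_mono) (auto intro: sum_nonneg)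
    moreover have "(?f y)\<^sup>2 = (1 / s)\<^sup>2 * (\<Sum>i<n. (norm (\<Sum>j<n. A i j (x j)))\<^sup>2)"
    proof -
      have "(\<Sum>j<n. A i j (y j)) = (1 / s) *\<^sub>R (\<Sum>j<n. A i j (x j))" for i
        by (simp add: y_def blinfun.scaleR_right scaleR_sum_right)
      then have "(norm (\<Sum>j<n. A i j (y j)))\<^sup>2 = (1 / s)\<^sup>2 * (norm (\<Sum>j<n. A i j (x j)))\<^sup>2" for i
        by (simp add: power_mult_distrib power_divide)
      then show ?thesis by (simp add: sum_nonneg sum_distrib_left)
    qed
    ultimately show ?thesis
      unfolding s2 [symmetric] using s by (simp add: power_divide field_simps)
  qed
qed

text \<open>A bound for the norm of an operator matrix \<open>X\<close> becomes positivity of the matrix \<open>c 1 - X\<^sup>* X\<close>, to which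
  completely positive maps can be applied.\<close>

lemma gram_matrix_form:
  fixes X :: "nat \<Rightarrow> nat \<Rightarrow> 'a::complex_hilbert_space \<Rightarrow>\<^sub>L 'a"
  assumes L: "hilbert_subspace L" and X: "\<And>i j. i < n \<Longrightarrow> j < n \<Longrightarrow> clinear (X i j)"
  shows "(\<Sum>i<n. cinner (x i) (\<Sum>j<n. ((if i = j then complex_of_real c *\<^sub>C orth_proj L else 0)
      - (\<Sum>k<n. adj (X k i) o\<^sub>L X k j)) (x j)))
    = complex_of_real (c * (\<Sum>i<n. (norm (orth_proj L (x i)))\<^sup>2)
      - (\<Sum>k<n. (norm (\<Sum>j<n. X k j (x j)))\<^sup>2))"
proof -
  have "(\<Sum>i<n. cinner (x i) (\<Sum>j<n. (if i = j then complex_of_real c *\<^sub>C orth_proj L else 0) (x j)))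
      = (\<Sum>i<n. complex_of_real (c * (norm (orth_proj L (x i)))\<^sup>2))"
  proof (rule sum.cong)
    fix i assume "i \<in> {..<n}"
    then have "(\<Sum>j<n. (if i = j then complex_of_real c *\<^sub>C orth_proj L else 0) (x j))
        = complex_of_real c *\<^sub>C orth_proj L (x i)"
      by (subst sum.remove [of _ i]) (auto simp: scaleC_blinfun_apply intro!: sum.neutral)
    then show "cinner (x i) (\<Sum>j<n. (if i = j then complex_of_real c *\<^sub>C orth_proj L else 0) (x j))
        = complex_of_real (c * (norm (orth_proj L (x i)))\<^sup>2)"
      by (simp add: cinner_scaleC_right cinner_orth_proj_self [OF L])
  qed simp
  moreover have "(\<Sum>i<n. cinner (x i) (\<Sum>j<n. (\<Sum>k<n. adj (X k i) o\<^sub>L X k j) (x j)))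
      = (\<Sum>k<n. complex_of_real ((norm (\<Sum>j<n. X k j (x j)))\<^sup>2))"
  proof -
    have "(\<Sum>i<n. cinner (x i) (\<Sum>j<n. (\<Sum>k<n. adj (X k i) o\<^sub>L X k j) (x j)))
      = (\<Sum>i<n. \<Sum>j<n. \<Sum>k<n. cinner (X k i (x i)) (X k j (x j)))"
      by (simp add: cinner_sum_right blinfun.sum_left cinner_adj X)
    also have "\<dots> = (\<Sum>i<n. \<Sum>k<n. \<Sum>j<n. cinner (X k i (x i)) (X k j (x j)))"
      by (intro sum.cong refl sum.swap)
    also have "\<dots> = (\<Sum>k<n. \<Sum>i<n. \<Sum>j<n. cinner (X k i (x i)) (X k j (x j)))"
      by (rule sum.swap)
    also have "\<dots> = (\<Sum>k<n. cinner (\<Sum>i<n. X k i (x i)) (\<Sum>j<n. X k j (x j)))"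
      by (simp only: cinner_sum_left, simp only: cinner_sum_right)
    finally show ?thesis by (simp add: cinner_self)
  qed
  ultimately show ?thesis
    by (simp add: blinfun.diff_left sum_subtractf cinner_diff_right sum_distrib_left)
qed

section \<open>Minimal normal extensions\<close>

lemma hilbert_subspace_common_kernel:
  fixes K :: "'k::complex_hilbert_space set" and F :: "('k \<Rightarrow>\<^sub>L 'h::complex_hilbert_space) set"
  assumes K: "hilbert_subspace K" and F: "\<And>f. f \<in> F \<Longrightarrow> clinear f"
  shows "hilbert_subspace {x \<in> K. \<forall>f\<in>F. f x = 0}"
proof -
  have "{x \<in> K. \<forall>f\<in>F. f x = 0} = K \<inter> (\<Inter>f\<in>F. {x. blinfun_apply f x = 0})" by auto
  moreover have "closed {x. blinfun_apply f x = 0}" for f :: "'k \<Rightarrow>\<^sub>L 'h"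
    by (intro closed_Collect_eq continuous_intros)
  ultimately have "closed {x \<in> K. \<forall>f\<in>F. f x = 0}"
    using K by (auto simp: hilbert_subspace_def intro!: closed_Int closed_INT)
  then show ?thesis
    using K F by (auto simp: hilbert_subspace_def complex_subspace_def blinfun.add_right clinear_scaleC)
qed

locale minimal_extension =
  base: spherical_family UNIV \<Gamma> J T +
  ext: spherical_family K \<Gamma> J N
  for \<Gamma> :: "'g set" and J :: "'g \<Rightarrow> 'j set" and T :: "'g \<Rightarrow> 'j \<Rightarrow> 'h::complex_hilbert_space \<Rightarrow>\<^sub>L 'h"
    and K :: "'k::complex_hilbert_space set" and N +
  fixes V :: "'h \<Rightarrow>\<^sub>L 'k"
  assumes V: "isometric_embedding V K"
    and normal: "\<alpha> \<in> \<Gamma> \<Longrightarrow> j \<in> J \<alpha> \<Longrightarrow> normal_op (N \<alpha> j)"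
    and restricts: "\<alpha> \<in> \<Gamma> \<Longrightarrow> j \<in> J \<alpha> \<Longrightarrow> restricts_to V (N \<alpha> j) (T \<alpha> j)"
    and minimal: "reducing_subspace K (family_ops \<Gamma> J N) M \<Longrightarrow> range (blinfun_apply V) \<subseteq> M \<Longrightarrow> M = K"
begin

text \<open>By normality the Toeplitz operators \<open>\<C>\<close> of the extension form the commutant of its generators, and also that of the
  commutative algebra \<open>\<N>\<close> generated by them.\<close>

abbreviation "\<T> \<equiv> base.toeplitz_on"
abbreviation "\<C> \<equiv> ext.toeplitz_on"
abbreviation "\<N> \<equiv> cstar K (family_ops \<Gamma> J N)"

lemmas K = ext.K
lemmas BK = ext.BK

lemma V_clinear: "clinear V" and norm_V [simp]: "norm (V x) = norm x" and V_in: "V x \<in> K"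
  using V by (auto simp: isometric_embedding_def)

lemma adj_V_V [simp]: "adj V (V x) = x"
proof -
  have "adj V o\<^sub>L V = id_blinfun"
    by (intro clinear_eqI clinear_intros V_clinear) (simp add: cinner_adj V_clinear cinner_self)
  then show ?thesis by (metis blinfun_apply_blinfun_compose id_blinfun.rep_eq id_apply)
qed

lemma cinner_V [simp]: "cinner (V x) (V y) = cinner x y"
  by (metis V_clinear adj_V_V cinner_adj)

lemma norm_adj_V: "norm (adj V y) \<le> norm y"
proof -
  have "norm V \<le> 1" by (rule norm_blinfun_bound) simp_all
  then show ?thesis
    using adj_exists(3) [OF V_clinear, of y] mult_right_mono [of "norm V" 1 "norm y"] by simp
qed

lemma adj_V_orth_proj: "adj V (orth_proj K x) = adj V x"
  by (rule cinner_eqI) (simp add: cinner_adj V_clinear cinner_orth_proj K V_in)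

lemma N_V: "\<alpha> \<in> \<Gamma> \<Longrightarrow> j \<in> J \<alpha> \<Longrightarrow> N \<alpha> j (V x) = V (T \<alpha> j x)"
  using restricts by (simp add: restricts_to_def)

lemma adj_V_adj_N: "\<alpha> \<in> \<Gamma> \<Longrightarrow> j \<in> J \<alpha> \<Longrightarrow> adj V (adj (N \<alpha> j) y) = adj (T \<alpha> j) (adj V y)"
  by (rule cinner_eqI) (simp add: cinner_adj V_clinear ext.N_clinear base.N_clinear N_V)

lemma compression_eq:
  assumes Y: "clinear Y"
  shows "compression V Y = adj V o\<^sub>L Y o\<^sub>L V"
proof -
  have "range (blinfun_apply V) = {y. V (adj V y) = y}"
    by (auto intro: sym [THEN range_eqI])
  then have "closed (range (blinfun_apply V))"
    by (simp add: closed_Collect_eq continuous_intros)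
  moreover have "complex_subspace (range (blinfun_apply V))"
    unfolding complex_subspace_def
    by (auto simp: image_iff) (metis blinfun.zero_right, metis blinfun.add_right, metis V_clinear clinear_scaleC)
  ultimately have "hilbert_subspace (range (blinfun_apply V))"
    by (simp add: hilbert_subspace_def)
  then have "orth_proj (range (blinfun_apply V)) = V o\<^sub>L adj V"
    by (rule orth_proj_unique) (auto simp: cinner_diff_right simp flip: cinner_adj [OF V_clinear])
  moreover have "inj (blinfun_apply V)"
    by (metis adj_V_V injI)
  ultimately have "(\<lambda>x. inv (blinfun_apply V) (orth_proj (range (blinfun_apply V)) (Y (V x))))
      = blinfun_apply (adj V o\<^sub>L Y o\<^sub>L V)"
    by (simp add: fun_eq_iff inv_f_f)
  then show ?thesis
    unfolding compression_def by (simp only: blinfun_apply_inverse)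
qed

definition rho :: "('k \<Rightarrow>\<^sub>L 'k) \<Rightarrow> ('h \<Rightarrow>\<^sub>L 'h)" where
  "rho Y = adj V o\<^sub>L Y o\<^sub>L V"

lemma rho_apply [simp]: "rho Y x = adj V (Y (V x))"
  by (simp add: rho_def)

lemma rho_clinear: "clinear Y \<Longrightarrow> clinear (rho Y)"
  unfolding rho_def by (intro clinear_intros V_clinear)

lemma rho_add: "rho (Y + Z) = rho Y + rho Z"
  and rho_diff: "rho (Y - Z) = rho Y - rho Z"
  and rho_scale: "rho (a *\<^sub>C Y) = a *\<^sub>C rho Y"
  by (auto intro!: blinfun_eqI simp: blinfun.add_left blinfun.add_right blinfun.diff_left
      blinfun.diff_right scaleC_blinfun_apply clinear_scaleC clinear_adj V_clinear)

lemma rho_unit: "rho (orth_proj K) = id_blinfun"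
  by (rule blinfun_eqI) (simp add: orth_proj_fixes K V_in)

lemma norm_rho: "norm (rho Y) \<le> norm Y"
proof (rule norm_blinfun_bound)
  fix x
  have "norm (rho Y x) \<le> norm (Y (V x))" by (simp add: norm_adj_V)
  also have "\<dots> \<le> norm Y * norm x" using norm_blinfun [of Y "V x"] by simp
  finally show "norm (rho Y x) \<le> norm Y * norm x" .
qed simp

lemma tendsto_rho: "Y \<longlonglongrightarrow> Z \<Longrightarrow> (\<lambda>n. rho (Y n)) \<longlonglongrightarrow> rho Z"
  unfolding rho_def by (intro tendsto_compose_blinfun tendsto_const)

lemma rho_N: "\<alpha> \<in> \<Gamma> \<Longrightarrow> j \<in> J \<alpha> \<Longrightarrow> rho (N \<alpha> j) = T \<alpha> j"
  by (rule blinfun_eqI) (simp add: N_V)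

lemma C_commutes:
  assumes "Y \<in> \<C>" "\<alpha> \<in> \<Gamma>" "j \<in> J \<alpha>"
  shows "Y o\<^sub>L N \<alpha> j = N \<alpha> j o\<^sub>L Y" and "Y o\<^sub>L adj (N \<alpha> j) = adj (N \<alpha> j) o\<^sub>L Y"
proof -
  show "Y o\<^sub>L N \<alpha> j = N \<alpha> j o\<^sub>L Y"
    by (rule ext.toeplitz_on_commutes [OF normal assms])
  have "adj Y o\<^sub>L N \<alpha> j = N \<alpha> j o\<^sub>L adj Y"
    by (intro ext.toeplitz_on_commutes [OF normal] ext.toeplitz_on_adj assms)
  then have "adj (adj Y o\<^sub>L N \<alpha> j) = adj (N \<alpha> j o\<^sub>L adj Y)" by simp
  then show "Y o\<^sub>L adj (N \<alpha> j) = adj (N \<alpha> j) o\<^sub>L Y"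
    using assms bounded_ops_clinear [OF ext.toeplitz_onD(1) [OF assms(1)]]
    by (simp add: adj_compose clinear_adj ext.N_clinear adj_adj)
qed

lemma C_lin: "Y \<in> \<C> \<Longrightarrow> clinear Y"
  by (rule bounded_ops_clinear [OF ext.toeplitz_onD(1)])

lemma C_eq_commutant: "commutant K (family_ops \<Gamma> J N) = \<C>"
  by (intro ext.commutant_eq_toeplitz_on normal)

lemma cstar_subalgebra_C: "cstar_subalgebra K \<C>"
proof -
  let ?D = "\<lambda>A. {Z \<in> \<B> K. Z o\<^sub>L A = A o\<^sub>L Z \<and> adj Z o\<^sub>L A = A o\<^sub>L adj Z}"
  have "\<C> = \<Inter>(insert (\<B> K) (?D ` family_ops \<Gamma> J N))"
    using C_commutes(1) ext.toeplitz_on_adj ext.toeplitz_onD(1) C_eq_commutant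
    by (auto simp: family_ops_def commutant_def)
  moreover have "cstar_subalgebra K (\<Inter>(insert (\<B> K) (?D ` family_ops \<Gamma> J N)))"
    by (rule cstar_subalgebra_Inter)
      (auto simp: family_ops_def intro!: cstar_subalgebra_bounded_ops K cstar_subalgebra_commuting ext.N_clinear)
  ultimately show ?thesis by simp
qed

lemmas C_closure = cstar_subalgebraD(3-8) [OF cstar_subalgebra_C] cstar_subalgebra_diff [OF cstar_subalgebra_C]

lemma family_ops_subset: "family_ops \<Gamma> J N \<subseteq> \<B> K" "family_ops \<Gamma> J N \<subseteq> \<C>"
  by (auto simp: family_ops_def intro: ext.N_in ext.N_in_toeplitz_on)

lemma cstar_subalgebra_N: "cstar_subalgebra K \<N>"
  by (rule cstar_subalgebra_cstar [OF K family_ops_subset(1)])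

lemmas N_closure = cstar_subalgebraD(3-8) [OF cstar_subalgebra_N] cstar_subalgebra_diff [OF cstar_subalgebra_N]

lemma N_subset_C: "\<N> \<subseteq> \<C>"
  by (intro cstar_least cstar_subalgebra_C ext.toeplitz_on_unit family_ops_subset)

lemma N_gen: "\<alpha> \<in> \<Gamma> \<Longrightarrow> j \<in> J \<alpha> \<Longrightarrow> N \<alpha> j \<in> \<N>"
  using cstar_contains(1) [of "family_ops \<Gamma> J N" K] by (auto simp: family_ops_def)

lemma C_N_commute:
  assumes "Y \<in> \<C>" "Z \<in> \<N>"
  shows "Z o\<^sub>L Y = Y o\<^sub>L Z"
proof -
  have "\<N> \<subseteq> {Z \<in> \<B> K. Z o\<^sub>L Y = Y o\<^sub>L Z \<and> adj Z o\<^sub>L Y = Y o\<^sub>L adj Z}"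
  proof (intro cstar_least cstar_subalgebra_commuting K C_lin assms)
    show "orth_proj K \<in> {Z \<in> \<B> K. Z o\<^sub>L Y = Y o\<^sub>L Z \<and> adj Z o\<^sub>L Y = Y o\<^sub>L adj Z}"
      using ext.toeplitz_onD(1) [OF assms(1)]
      by (simp add: orth_proj_bounded_ops adj_orth_proj K orth_proj_compose_left orth_proj_compose_right)
    show "family_ops \<Gamma> J N \<subseteq> {Z \<in> \<B> K. Z o\<^sub>L Y = Y o\<^sub>L Z \<and> adj Z o\<^sub>L Y = Y o\<^sub>L adj Z}"
      using C_commutes [OF assms(1)] ext.N_in by (auto simp: family_ops_def)
  qed
  then show ?thesis using assms by auto
qed

lemma commutant_N: "commutant K \<N> = \<C>"
proof
  show "commutant K \<N> \<subseteq> \<C>"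
    unfolding C_eq_commutant [symmetric] commutant_def using cstar_contains(1) by blast
  show "\<C> \<subseteq> commutant K \<N>"
    using C_N_commute ext.toeplitz_onD(1) by (auto simp: commutant_def)
qed

lemma rho_in_T:
  assumes Y: "Y \<in> \<C>"
  shows "rho Y \<in> \<T>"
  unfolding base.toeplitz_on_iff
proof (intro conjI ballI base.conj_sum_eqI)
  show "rho Y \<in> \<B> UNIV" "rho Y \<in> \<B> UNIV"
    by (auto simp: bounded_ops_UNIV_iff intro: rho_clinear C_lin Y)
  fix \<alpha> x y assume \<alpha>: "\<alpha> \<in> \<Gamma>"
  show "((\<lambda>j. cinner (T \<alpha> j x) (rho Y (T \<alpha> j y))) has_sum cinner x (rho Y y)) (J \<alpha>)"
    using ext.has_sum_conj_sum [OF \<alpha> ext.toeplitz_onD(1) [OF Y], of "V x" "V y"]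
    by (simp add: ext.toeplitz_onD(2) [OF Y \<alpha>] N_V \<alpha> cinner_adj V_clinear cong: has_sum_cong2)
qed

lemma reducing_subspaceI:
  assumes "hilbert_subspace M" "M \<subseteq> K"
    "\<And>\<alpha> j x. \<alpha> \<in> \<Gamma> \<Longrightarrow> j \<in> J \<alpha> \<Longrightarrow> x \<in> M \<Longrightarrow> N \<alpha> j x \<in> M"
    "\<And>\<alpha> j x. \<alpha> \<in> \<Gamma> \<Longrightarrow> j \<in> J \<alpha> \<Longrightarrow> x \<in> M \<Longrightarrow> adj (N \<alpha> j) x \<in> M"
  shows "reducing_subspace K (family_ops \<Gamma> J N) M"
  using assms by (auto simp: reducing_subspace_def family_ops_def)

text \<open>An operator \<open>Y\<close> in the commutant is determined by its compression.  For \<open>rho Y = 0\<close> also \<open>V\<^sup>* Y Z V = 0\<close> for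
  all \<open>Z\<close> in \<open>\<N>\<close>: in a word in the generators and their adjoints, which commute with each other, the adjoints
  can be moved to the left past \<open>Y\<close> and \<open>V\<^sup>*\<close>, and the generators to the right past \<open>V\<close>.  By minimality the vectors
  \<open>Z V x\<close> are total, whence \<open>V\<^sup>* Y = 0\<close>; another use of minimality yields \<open>Y = 0\<close>.\<close>

lemma rho_injective:
  assumes Y: "Y \<in> \<C>" and 0: "rho Y = 0"
  shows "Y = 0"
proof -
  have lin: "clinear Y" by (rule C_lin [OF Y])
  let ?E = "{Z \<in> \<N>. adj V o\<^sub>L Y o\<^sub>L Z o\<^sub>L V = 0}"
  have "\<N> \<subseteq> ?E"
  proof (rule cstar_least_left_invariant [OF K family_ops_subset(1)])
    show "complex_subspace ?E"
      using N_closure lin V_clinear by (auto simp: complex_subspace_def compose_add_left compose_add_right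
          compose_scaleC_left compose_scaleC_right clinear_intros scaleC_blinfun_simps)
    show "closed ?E"
      unfolding closed_sequential_limits
    proof (intro allI impI)
      fix X Z assume "(\<forall>n. X n \<in> ?E) \<and> X \<longlonglongrightarrow> Z"
      then have X: "\<And>n. X n \<in> \<N>" "\<And>n. adj V o\<^sub>L Y o\<^sub>L X n o\<^sub>L V = 0" and lim: "X \<longlonglongrightarrow> Z" by auto
      have "(\<lambda>n. adj V o\<^sub>L Y o\<^sub>L X n o\<^sub>L V) \<longlonglongrightarrow> (adj V o\<^sub>L Y o\<^sub>L Z o\<^sub>L V)"
        by (intro tendsto_compose_blinfun tendsto_const lim)
      then have "adj V o\<^sub>L Y o\<^sub>L Z o\<^sub>L V = 0"
        unfolding X(2) using LIMSEQ_unique tendsto_const by blast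
      then show "Z \<in> ?E" using closed_sequentially [OF N_closure(1) X(1) lim] by simp
    qed
    show "orth_proj K \<in> ?E"
      using 0 Y by (simp add: cstar_contains blinfun_compose_assoc orth_proj_compose_right K
          ext.toeplitz_onD(1) flip: rho_def)
         (metis K Y blinfun_compose_assoc ext.toeplitz_onD(1) orth_proj_compose_right rho_def)
  next
    fix A Z assume A: "A \<in> family_ops \<Gamma> J N" and Z: "Z \<in> ?E"
    then obtain \<alpha> j where \<alpha>: "\<alpha> \<in> \<Gamma>" "j \<in> J \<alpha>" "A = N \<alpha> j" by (auto simp: family_ops_def)
    have zero: "adj V (Y (Z (V x))) = 0" for x
      using Z by (auto dest: arg_cong [where f = "\<lambda>A. blinfun_apply A x"])
    have comm: "N \<alpha> j o\<^sub>L Z = Z o\<^sub>L N \<alpha> j"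
      by (rule C_N_commute [OF N_subset_C [THEN subsetD] N_gen [OF \<alpha>(1,2)]]) (use Z in simp)
    have AZ: "N \<alpha> j (Z x) = Z (N \<alpha> j x)" for x
      using comm by (metis blinfun_apply_blinfun_compose)
    have AY: "Y (adj (N \<alpha> j) x) = adj (N \<alpha> j) (Y x)" for x
      using C_commutes(2) [OF Y \<alpha>(1,2)] by (metis blinfun_apply_blinfun_compose)
    show "A o\<^sub>L Z \<in> ?E"
      using Z \<alpha> zero by (auto intro!: N_closure N_gen blinfun_eqI simp: AZ N_V \<alpha>)
    show "adj A o\<^sub>L Z \<in> ?E"
      using Z \<alpha> zero by (auto intro!: N_closure N_gen blinfun_eqI simp: AY adj_V_adj_N \<alpha>)
  qed auto
  then have kill: "adj V (Y (Z (V x))) = 0" if "Z \<in> \<N>" for Z x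
    using that by (auto dest!: subsetD arg_cong [where f = "\<lambda>A. blinfun_apply A x"])
  let ?M = "{x \<in> K. \<forall>f\<in>(\<lambda>Z. adj V o\<^sub>L Y o\<^sub>L Z) ` \<N>. blinfun_apply f x = 0}"
  have "?M = K"
  proof (rule minimal)
    have hs: "hilbert_subspace ?M"
      by (rule hilbert_subspace_common_kernel [OF K])
        (auto intro!: clinear_intros V_clinear lin dest: N_subset_C [THEN subsetD] C_lin)
    have inv: "N \<alpha> j x \<in> ?M" "adj (N \<alpha> j) x \<in> ?M"
      if \<alpha>: "\<alpha> \<in> \<Gamma>" "j \<in> J \<alpha>" and x: "x \<in> ?M" for \<alpha> j x
    proof -
      have "adj V (Y (Z (N \<alpha> j x))) = 0" "adj V (Y (Z (adj (N \<alpha> j) x))) = 0" if Z: "Z \<in> \<N>" for Z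
      proof -
        have M: "adj V (Y (W x)) = 0" if "W \<in> \<N>" for W
          using x that by simp
        show "adj V (Y (Z (N \<alpha> j x))) = 0" "adj V (Y (Z (adj (N \<alpha> j) x))) = 0"
          using M [OF N_closure(5) [OF Z N_gen [OF \<alpha>]]]
            M [OF N_closure(5) [OF Z N_closure(6) [OF N_gen [OF \<alpha>]]]] by simp_all
      qed
      moreover have "N \<alpha> j x \<in> K" "adj (N \<alpha> j) x \<in> K"
        using ext.N_in [OF \<alpha>] BK(6) [OF ext.N_in [OF \<alpha>]] by (auto simp: bounded_ops_iff [OF K])
      ultimately show "N \<alpha> j x \<in> ?M" "adj (N \<alpha> j) x \<in> ?M" by auto
    qed
    show "reducing_subspace K (family_ops \<Gamma> J N) ?M"
      by (rule reducing_subspaceI [OF hs _ inv]) auto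
    show "range (blinfun_apply V) \<subseteq> ?M"
      using kill V_in by auto
  qed
  then have kill': "adj V (Y x) = 0" if "x \<in> K" for x
    using that cstar_contains(2) [of K "family_ops \<Gamma> J N"] by (force simp: orth_proj_fixes K)
  have "adj V (Y x) = 0" for x
    using kill' [OF orth_proj_in [OF K]] ext.toeplitz_onD(1) [OF Y] by (simp add: bounded_ops_iff [OF K])
  then have V0: "adj Y (V x) = 0" for x
    by (intro cinner_eqI) (simp add: cinner_adj lin flip: cinner_adj_left [OF V_clinear])
  have Y': "adj Y \<in> \<C>" by (intro C_closure Y)
  \<comment> \<open>Now \<open>Y\<^sup>* V = 0\<close>, and the kernel of \<open>Y\<^sup>*\<close> is reducing.\<close>
  let ?M = "{x \<in> K. \<forall>f\<in>{adj Y}. blinfun_apply f x = 0}"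
  have "?M = K"
  proof (rule minimal)
    have hs: "hilbert_subspace ?M"
      by (rule hilbert_subspace_common_kernel [OF K]) (simp add: clinear_adj lin)
    have inv: "N \<alpha> j x \<in> ?M" "adj (N \<alpha> j) x \<in> ?M"
      if \<alpha>: "\<alpha> \<in> \<Gamma>" "j \<in> J \<alpha>" and x: "x \<in> ?M" for \<alpha> j x
    proof -
      have "adj Y (N \<alpha> j x) = N \<alpha> j (adj Y x)" "adj Y (adj (N \<alpha> j) x) = adj (N \<alpha> j) (adj Y x)"
        using C_commutes [OF Y' \<alpha>] by (metis blinfun_apply_blinfun_compose)+
      moreover have "N \<alpha> j x \<in> K" "adj (N \<alpha> j) x \<in> K"
        using ext.N_in [OF \<alpha>] BK(6) [OF ext.N_in [OF \<alpha>]] by (auto simp: bounded_ops_iff [OF K])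
      ultimately show "N \<alpha> j x \<in> ?M" "adj (N \<alpha> j) x \<in> ?M" using x by auto
    qed
    show "reducing_subspace K (family_ops \<Gamma> J N) ?M"
      by (rule reducing_subspaceI [OF hs _ inv]) auto
    show "range (blinfun_apply V) \<subseteq> ?M"
      using V0 V_in by auto
  qed
  then have "adj Y (orth_proj K x) = 0" for x
    using orth_proj_in [OF K] by blast
  then have "adj Y = 0"
    using ext.toeplitz_onD(1) [OF Y'] by (intro blinfun_eqI) (simp add: bounded_ops_iff [OF K])
  then have "adj (adj Y) = 0" by (simp add: adj_unique [of 0 0])
  then show "Y = 0" by (simp add: adj_adj lin)
qed

lemma rho_eqD: "Y \<in> \<C> \<Longrightarrow> Z \<in> \<C> \<Longrightarrow> rho Y = rho Z \<Longrightarrow> Y = Z"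
  using rho_injective [of "Y - Z"] by (simp add: rho_diff C_closure)

text \<open>A Toeplitz operator is lifted to the commutant by extending it by \<open>0\<close> and averaging the result.\<close>

definition sigma :: "('h \<Rightarrow>\<^sub>L 'h) \<Rightarrow> ('k \<Rightarrow>\<^sub>L 'k)" where
  "sigma X = ext.toeplitz_proj (V o\<^sub>L X o\<^sub>L adj V)"

lemma conjugate_V_in: "clinear X \<Longrightarrow> V o\<^sub>L X o\<^sub>L adj V \<in> \<B> K"
  by (simp add: bounded_ops_iff [OF K] clinear_intros V_clinear V_in adj_V_orth_proj)

lemma sigma_in_C: "clinear X \<Longrightarrow> sigma X \<in> \<C>"
  unfolding sigma_def by (intro ext.toeplitz_proj_in conjugate_V_in)

text \<open>The forms of \<open>V X V\<^sup>*\<close> on the invariant range of \<open>V\<close> are those of \<open>X\<close>, which the sums of the extension leave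
  fixed when \<open>X\<close> is a Toeplitz operator; the averaging projection does not change them either.\<close>

lemma rho_sigma:
  assumes X: "X \<in> \<T>"
  shows "rho (sigma X) = X"
proof (intro blinfun_eqI cinner_eqI)
  fix x y
  have XB: "X \<in> \<B> UNIV" by (rule base.toeplitz_onD [OF X])
  have lin: "clinear X" by (rule bounded_ops_clinear [OF XB])
  let ?Z = "V o\<^sub>L X o\<^sub>L adj V"
  have "cinner (V x) (ext.toeplitz_proj ?Z (V y)) = cinner (V x) (?Z (V y))"
  proof (rule ext.toeplitz_proj_invariant_form [of "range (blinfun_apply V)"])
    show "N \<alpha> j x \<in> range (blinfun_apply V)"
      if "\<alpha> \<in> \<Gamma>" "j \<in> J \<alpha>" "x \<in> range (blinfun_apply V)" for \<alpha> j x
      using that by (auto simp: N_V)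
    show "?Z \<in> \<B> K" by (rule conjugate_V_in [OF lin])
    fix \<alpha> u v assume \<alpha>: "\<alpha> \<in> \<Gamma>" and "u \<in> range (blinfun_apply V)" "v \<in> range (blinfun_apply V)"
    then obtain x y where uv: "u = V x" "v = V y" by auto
    have "((\<lambda>j. cinner (N \<alpha> j (V x)) (?Z (N \<alpha> j (V y)))) has_sum cinner x (X y)) (J \<alpha>)"
      using base.has_sum_conj_sum [OF \<alpha> XB, of x y]
      by (simp add: base.toeplitz_onD(2) [OF X \<alpha>] N_V \<alpha> cong: has_sum_cong2)
    then have "cinner (V x) (ext.conj_sum \<alpha> ?Z (V y)) = cinner x (X y)"
      by (rule has_sum_unique [OF ext.has_sum_conj_sum [OF \<alpha> conjugate_V_in [OF lin]]])
    then show "cinner u (ext.conj_sum \<alpha> ?Z v) = cinner u (?Z v)" by (simp add: uv)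
  qed auto
  then show "cinner x (rho (sigma X) y) = cinner x (X y)"
    by (simp add: sigma_def cinner_adj V_clinear)
qed

lemma sigma_rho: "Y \<in> \<C> \<Longrightarrow> sigma (rho Y) = Y"
  by (intro rho_eqD sigma_in_C rho_clinear C_lin rho_sigma rho_in_T)

lemma sigma_unit: "sigma id_blinfun = orth_proj K"
  using sigma_rho [OF ext.toeplitz_on_unit] by (simp add: rho_unit)

lemma ucp_sigma: "ucp_map UNIV K sigma"
proof -
  interpret E: ucp_map K K ext.toeplitz_proj by (rule ext.ucp_toeplitz_proj)
  show ?thesis
  proof
    show "completely_positive (\<B> UNIV) sigma"
      unfolding completely_positive_def complex_linear_on_def
    proof (intro conjI ballI allI impI)
      show "sigma (X + Y) = sigma X + sigma Y" if "X \<in> \<B> UNIV" "Y \<in> \<B> UNIV" for X Y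
        using that by (simp add: sigma_def compose_add_left compose_add_right E.add conjugate_V_in
            bounded_ops_UNIV_iff)
      show "sigma (a *\<^sub>C X) = a *\<^sub>C sigma X" if "X \<in> \<B> UNIV" for a X
        using that by (simp add: sigma_def compose_scaleC_left compose_scaleC_right E.scale conjugate_V_in
            bounded_ops_UNIV_iff V_clinear)
      fix n and A :: "nat \<Rightarrow> nat \<Rightarrow> 'h \<Rightarrow>\<^sub>L 'h"
      assume A: "(\<forall>i<n. \<forall>j<n. A i j \<in> \<B> UNIV) \<and> op_matrix_positive n A"
      show "op_matrix_positive n (\<lambda>i j. sigma (A i j))"
        unfolding sigma_def
      proof (rule E.matrix_positive)
        show "V o\<^sub>L A i j o\<^sub>L adj V \<in> \<B> K" if "i < n" "j < n" for i j
          using A that by (intro conjugate_V_in) (simp add: bounded_ops_UNIV_iff)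
        show "op_matrix_positive n (\<lambda>i j. V o\<^sub>L A i j o\<^sub>L adj V)"
          unfolding op_matrix_positive_def
        proof
          fix y :: "nat \<Rightarrow> 'k"
          have "(\<Sum>i<n. cinner (adj V (y i)) (\<Sum>j<n. A i j (adj V (y j)))) \<in> \<real>\<^sub>\<ge>\<^sub>0"
            using A unfolding op_matrix_positive_def by (auto dest: spec [of _ "\<lambda>i. adj V (y i)"])
          then show "(\<Sum>i<n. cinner (y i) (\<Sum>j<n. (V o\<^sub>L A i j o\<^sub>L adj V) (y j))) \<in> \<real>\<^sub>\<ge>\<^sub>0"
            by (simp add: cinner_sum_right cinner_adj_left V_clinear)
        qed
      qed
    qed
  qed (auto simp: K hilbert_subspace_UNIV bounded_ops_UNIV_iff orth_proj_UNIV sigma_unit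
      intro: sigma_in_C ext.toeplitz_onD)
qed

end

section \<open>Closed ideals\<close>

definition closed_ideal ::
  "('a::complex_hilbert_space \<Rightarrow>\<^sub>L 'a) set \<Rightarrow> ('a \<Rightarrow>\<^sub>L 'a) set \<Rightarrow> bool" where
  "closed_ideal \<A> I \<longleftrightarrow> I \<subseteq> \<A> \<and> complex_subspace I \<and> closed I \<and>
     (\<forall>A\<in>\<A>. \<forall>X\<in>I. A o\<^sub>L X \<in> I \<and> X o\<^sub>L A \<in> I)"

lemma closed_ideal_gen_least: "closed_ideal \<A> I \<Longrightarrow> S \<subseteq> I \<Longrightarrow> closed_ideal_gen \<A> S \<subseteq> I"
  unfolding closed_ideal_gen_def closed_ideal_def by (rule Inter_lower) auto

lemma closed_ideal_gen_contains: "S \<subseteq> closed_ideal_gen \<A> S"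
  by (auto simp: closed_ideal_gen_def)

lemma closed_ideal_gen_mono: "S \<subseteq> S' \<Longrightarrow> closed_ideal_gen \<A> S \<subseteq> closed_ideal_gen \<A> S'"
  unfolding closed_ideal_gen_def by (rule Inter_anti_mono) blast

lemma closed_ideal_closed_ideal_gen:
  assumes \<A>: "cstar_subalgebra K \<A>" and S: "S \<subseteq> \<A>"
  shows "closed_ideal \<A> (closed_ideal_gen \<A> S)"
proof -
  let ?X = "{I. I \<subseteq> \<A> \<and> complex_subspace I \<and> closed I \<and> S \<subseteq> I \<and>
     (\<forall>A\<in>\<A>. \<forall>X\<in>I. A o\<^sub>L X \<in> I \<and> X o\<^sub>L A \<in> I)}"
  have A: "\<A> \<in> ?X" using \<A> S by (auto simp: cstar_subalgebra_def)
  have "\<Inter>?X \<subseteq> \<A>" by (rule Inter_lower [OF A])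
  moreover have "complex_subspace (\<Inter>?X)"
    by (auto simp: complex_subspace_def)
  moreover have "closed (\<Inter>?X)" by (rule closed_Inter) auto
  ultimately show ?thesis
    unfolding closed_ideal_def closed_ideal_gen_def by auto
qed

text \<open>The projection \<open>\<Phi>\<close> is arbitrary here: it need not arise from averages.\<close>

locale toeplitz_lifting = minimal_extension \<Gamma> J T K N V
  for \<Gamma> :: "'g set" and J :: "'g \<Rightarrow> 'j set" and T :: "'g \<Rightarrow> 'j \<Rightarrow> 'h::complex_hilbert_space \<Rightarrow>\<^sub>L 'h"
    and K :: "'k::complex_hilbert_space set" and N V +
  fixes \<Phi> :: "('h \<Rightarrow>\<^sub>L 'h) \<Rightarrow> ('h \<Rightarrow>\<^sub>L 'h)"
  assumes ucp_\<Phi>: "ucp_map UNIV UNIV \<Phi>"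
    and \<Phi>_in: "clinear X \<Longrightarrow> \<Phi> X \<in> \<T>"
    and \<Phi>_fixes: "X \<in> \<T> \<Longrightarrow> \<Phi> X = X"
begin

sublocale \<Phi>: ucp_map UNIV UNIV \<Phi> by (rule ucp_\<Phi>)
sublocale \<sigma>: ucp_map UNIV K sigma by (rule ucp_sigma)

lemma T_clinear: "X \<in> \<T> \<Longrightarrow> clinear X"
  using base.toeplitz_onD(1) bounded_ops_clinear by blast

lemma positive_rho: "positive_op A \<Longrightarrow> positive_op (rho A)"
  by (simp add: positive_op_def cinner_adj V_clinear)

text \<open>With \<open>Z = \<sigma>(X)\<close> the compression \<open>R\<close> of \<open>Z\<^sup>* Z\<close> is a Toeplitz operator above \<open>X\<^sup>* X\<close>, whence
  \<open>\<Phi>(X\<^sup>* X) \<le> \<Phi>(R) = R\<close>, while the Schwarz inequalities for \<open>\<Phi>\<close> and \<open>\<sigma>\<close> give the converse.\<close>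

lemma sigma_\<Phi>_square:
  assumes X: "X \<in> \<T>"
  shows "sigma (\<Phi> (adj X o\<^sub>L X)) = adj (sigma X) o\<^sub>L sigma X"
proof -
  define Z where "Z = sigma X"
  define R where "R = rho (adj Z o\<^sub>L Z)"
  have lin: "clinear X" by (rule T_clinear [OF X])
  have XX: "adj X o\<^sub>L X \<in> \<B> UNIV" "X \<in> \<B> UNIV"
    by (auto simp: bounded_ops_UNIV_iff intro!: clinear_intros lin)
  have Z: "Z \<in> \<C>" "clinear Z" unfolding Z_def by (auto intro: sigma_in_C lin C_lin)
  have ZZ: "adj Z o\<^sub>L Z \<in> \<C>" by (intro C_closure Z)
  have R: "R \<in> \<T>" "R \<in> \<B> UNIV" unfolding R_def
    using rho_in_T [OF ZZ] base.toeplitz_onD(1) by auto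
  have PT: "\<Phi> (adj X o\<^sub>L X) \<in> \<T>" using XX by (intro \<Phi>_in) (simp add: bounded_ops_UNIV_iff)
  have PB: "\<Phi> (adj X o\<^sub>L X) \<in> \<B> UNIV" by (rule \<Phi>.into [OF XX(1)])
  have "positive_op (R - (adj X o\<^sub>L X))"
    unfolding positive_op_def
  proof
    fix x
    have "X x = adj V (Z (V x))"
      using rho_sigma [OF X] by (metis rho_apply Z_def)
    then have "(norm (X x))\<^sup>2 \<le> (norm (Z (V x)))\<^sup>2"
      using norm_adj_V by (intro power_mono) auto
    moreover have "cinner x ((R - (adj X o\<^sub>L X)) x) = complex_of_real ((norm (Z (V x)))\<^sup>2 - (norm (X x))\<^sup>2)"
      by (simp add: R_def blinfun.diff_left cinner_diff_right cinner_adj V_clinear Z lin cinner_self)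
    ultimately show "cinner x ((R - (adj X o\<^sub>L X)) x) \<in> \<real>\<^sub>\<ge>\<^sub>0"
      by (simp only: nonneg_Reals_of_real_iff diff_ge_0_iff_ge)
  qed
  then have "positive_op (\<Phi> R - \<Phi> (adj X o\<^sub>L X))"
    by (intro \<Phi>.mono R XX)
  then have le: "positive_op (R - \<Phi> (adj X o\<^sub>L X))"
    by (simp add: \<Phi>_fixes R)
  have "positive_op (\<Phi> (adj X o\<^sub>L X) - (adj X o\<^sub>L X))"
    using \<Phi>.schwarz [OF XX(2)] by (simp add: \<Phi>_fixes X)
  then have "positive_op (sigma (\<Phi> (adj X o\<^sub>L X)) - sigma (adj X o\<^sub>L X))"
    by (intro \<sigma>.mono PB XX)
  moreover have "positive_op (sigma (adj X o\<^sub>L X) - (adj Z o\<^sub>L Z))"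
    unfolding Z_def by (rule \<sigma>.schwarz [OF XX(2)])
  ultimately have "positive_op (sigma (\<Phi> (adj X o\<^sub>L X)) - (adj Z o\<^sub>L Z))"
    by (rule positive_op_trans)
  then have "positive_op (\<Phi> (adj X o\<^sub>L X) - R)"
    using positive_rho [of "sigma (\<Phi> (adj X o\<^sub>L X)) - (adj Z o\<^sub>L Z)"]
    by (simp add: rho_diff R_def rho_sigma PT)
  then have "\<Phi> (adj X o\<^sub>L X) = R"
    by (intro positive_op_antisym le T_clinear PT R)
  then show ?thesis by (simp add: R_def sigma_rho ZZ Z_def [symmetric])
qed

text \<open>A completely positive map on all operators, which becomes a representation when it is restricted to the
  algebra generated by the Toeplitz operators; \<open>A_subset_mult_domain\<close> is the crucial point.\<close>

definition pi :: "('h \<Rightarrow>\<^sub>L 'h) \<Rightarrow> ('k \<Rightarrow>\<^sub>L 'k)" where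
  "pi X = sigma (\<Phi> X)"

sublocale \<pi>: ucp_map UNIV K pi
  unfolding pi_def [abs_def] by (rule ucp_map_compose [OF ucp_\<Phi> ucp_sigma])

abbreviation "\<A> \<equiv> cstar UNIV \<T>"
abbreviation "\<F> \<equiv> cstar UNIV (family_ops \<Gamma> J T)"

lemma pi_in_C: "clinear X \<Longrightarrow> pi X \<in> \<C>"
  unfolding pi_def by (rule sigma_in_C [OF T_clinear [OF \<Phi>_in]])

lemma pi_T: "X \<in> \<T> \<Longrightarrow> pi X = sigma X"
  by (simp add: pi_def \<Phi>_fixes)

lemma rho_pi: "clinear X \<Longrightarrow> rho (pi X) = \<Phi> X"
  unfolding pi_def by (rule rho_sigma [OF \<Phi>_in])

lemma pi_rho: "Y \<in> \<C> \<Longrightarrow> pi (rho Y) = Y"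
  by (simp add: pi_T rho_in_T sigma_rho)

lemma pi_\<Phi>: "clinear X \<Longrightarrow> pi (\<Phi> X) = pi X"
  by (simp add: pi_def \<Phi>_fixes \<Phi>_in)

lemma T_in_A: "\<T> \<subseteq> \<A>"
  by (rule cstar_contains)

lemma T_subset: "\<T> \<subseteq> \<B> UNIV"
  using base.toeplitz_onD(1) by blast

lemma cstar_subalgebra_A: "cstar_subalgebra UNIV \<A>"
  by (rule cstar_subalgebra_cstar [OF hilbert_subspace_UNIV T_subset])

lemma family_T: "family_ops \<Gamma> J T \<subseteq> \<T>"
  by (auto simp: family_ops_def intro: base.N_in_toeplitz_on)

lemma cstar_subalgebra_F: "cstar_subalgebra UNIV \<F>"
  using family_T T_subset by (intro cstar_subalgebra_cstar [OF hilbert_subspace_UNIV]) blast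

lemmas A_closure = cstar_subalgebraD(3-8) [OF cstar_subalgebra_A] cstar_subalgebra_diff [OF cstar_subalgebra_A]
lemmas F_closure = cstar_subalgebraD(3-8) [OF cstar_subalgebra_F] cstar_subalgebra_diff [OF cstar_subalgebra_F]

lemma F_subset_A: "\<F> \<subseteq> \<A>"
  using family_T T_in_A by (intro cstar_least cstar_subalgebra_A cstar_contains) blast

lemma A_clinear: "X \<in> \<A> \<Longrightarrow> clinear X"
  by (rule cstar_subalgebraD(2) [OF cstar_subalgebra_A])

lemma A_subset_mult_domain: "\<A> \<subseteq> \<pi>.mult_domain"
proof (rule cstar_least [OF \<pi>.cstar_subalgebra_mult_domain \<pi>.orth_proj_mult_domain subsetI])
  fix X assume X: "X \<in> \<T>"
  have lin: "clinear X" by (rule T_clinear [OF X])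
  have X': "adj X \<in> \<T>" by (rule base.toeplitz_on_adj [OF X])
  have XB: "X \<in> \<B> UNIV" using lin by (simp add: bounded_ops_UNIV_iff)
  show "X \<in> \<pi>.mult_domain"
  proof (rule \<pi>.mult_domainI [OF XB])
    show "pi (adj X o\<^sub>L X) = adj (pi X) o\<^sub>L pi X"
      unfolding pi_T [OF X] unfolding pi_def by (rule sigma_\<Phi>_square [OF X])
    have "pi (X o\<^sub>L adj X) = adj (sigma (adj X)) o\<^sub>L sigma (adj X)"
      unfolding pi_def using sigma_\<Phi>_square [OF X'] by (simp add: adj_adj lin)
    also have "\<dots> = pi X o\<^sub>L adj (pi X)"
      by (simp add: pi_T X \<sigma>.star [OF XB] adj_adj \<sigma>.lin XB)
    finally show "pi (X o\<^sub>L adj X) = pi X o\<^sub>L adj (pi X)" .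
  qed
qed

lemma pi_mult: "X \<in> \<A> \<Longrightarrow> clinear Y \<Longrightarrow> pi (X o\<^sub>L Y) = pi X o\<^sub>L pi Y"
  and pi_mult_right: "X \<in> \<A> \<Longrightarrow> clinear Y \<Longrightarrow> pi (Y o\<^sub>L X) = pi Y o\<^sub>L pi X"
  using A_subset_mult_domain \<pi>.mult_domainD(1,2) by (auto simp: bounded_ops_UNIV_iff)

lemma pi_star: "clinear X \<Longrightarrow> pi (adj X) = adj (pi X)"
  by (simp add: \<pi>.star bounded_ops_UNIV_iff)

lemma pi_generator: "\<alpha> \<in> \<Gamma> \<Longrightarrow> j \<in> J \<alpha> \<Longrightarrow> pi (T \<alpha> j) = N \<alpha> j"
  by (metis ext.N_in_toeplitz_on pi_rho rho_N)

lemma pi_unit: "pi id_blinfun = orth_proj K"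
  using \<pi>.unital by (simp add: orth_proj_UNIV)

lemma star_hom_pi: "\<X> \<subseteq> \<A> \<Longrightarrow> star_hom \<X> pi"
  unfolding star_hom_def complex_linear_on_def
  by (auto simp: \<pi>.add \<pi>.scale bounded_ops_UNIV_iff pi_mult pi_star A_clinear subset_iff)

lemma unital_star_rep_pi: "unital_star_rep \<A> pi K"
  using star_hom_pi [of \<A>] A_clinear pi_in_C ext.toeplitz_onD(1)
  by (auto simp: unital_star_rep_def pi_unit)

lemma compression_rho: "Y \<in> \<C> \<Longrightarrow> compression V Y = rho Y"
  by (simp add: compression_eq C_lin rho_def)

lemma pi_image: "pi ` \<A> = \<C>"
proof
  show "pi ` \<A> \<subseteq> \<C>" using A_clinear pi_in_C by auto
  show "\<C> \<subseteq> pi ` \<A>"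
  proof
    fix Y assume Y: "Y \<in> \<C>"
    then have "rho Y \<in> \<A>" using rho_in_T T_in_A by blast
    then show "Y \<in> pi ` \<A>" using pi_rho [OF Y] by (metis imageI)
  qed
qed

lemma compression_image: "compression V ` \<C> = \<T>"
proof
  show "compression V ` \<C> \<subseteq> \<T>" by (auto simp: compression_rho rho_in_T)
  show "\<T> \<subseteq> compression V ` \<C>"
  proof
    fix X assume "X \<in> \<T>"
    then have "compression V (sigma X) = X" "sigma X \<in> \<C>"
      by (auto simp: compression_rho sigma_in_C T_clinear rho_sigma)
    then show "X \<in> compression V ` \<C>" by (metis imageI)
  qed
qed

text \<open>The compression is completely contractive.  Conversely let \<open>X = (\<rho>(A\<^sub>i\<^sub>j))\<close> be the compressed matrix and \<open>c\<close> its
  norm.  The representation \<open>\<pi>\<close> is completely positive and multiplicative, and it takes the positive matrix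
  \<open>c\<^sup>2 1 - X\<^sup>* X\<close> to \<open>c\<^sup>2 1 - A\<^sup>* A\<close>.\<close>

lemma complete_isometry_C: "\<X> \<subseteq> \<C> \<Longrightarrow> complete_isometry \<X> (compression V)"
  unfolding complete_isometry_def
proof (intro conjI allI impI)
  assume sub: "\<X> \<subseteq> \<C>"
  show "complex_linear_on \<X> (compression V)"
    unfolding complex_linear_on_def
  proof (intro conjI ballI allI)
    fix Y Z a assume "Y \<in> \<X>" "Z \<in> \<X>"
    then have "Y \<in> \<C>" "Z \<in> \<C>" using sub by auto
    then show "compression V (Y + Z) = compression V Y + compression V Z"
      by (simp add: compression_rho C_closure rho_add)
  next
    fix a Y assume "Y \<in> \<X>"
    then have "Y \<in> \<C>" using sub by auto
    then show "compression V (a *\<^sub>C Y) = a *\<^sub>C compression V Y"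
      by (simp add: compression_rho C_closure rho_scale)
  qed
  fix n and A :: "nat \<Rightarrow> nat \<Rightarrow> _"
  assume "\<forall>i<n. \<forall>j<n. A i j \<in> \<X>"
  then have A: "A i j \<in> \<C>" if "i < n" "j < n" for i j using that sub by blast
  define X where "X = (\<lambda>i j. compression V (A i j))"
  have XA: "X i j = rho (A i j)" if "i < n" "j < n" for i j
    using that by (simp add: X_def compression_rho A)
  have XT: "X i j \<in> \<T>" if "i < n" "j < n" for i j
    using that by (simp add: XA rho_in_T A)
  have piX: "pi (X i j) = A i j" if "i < n" "j < n" for i j
    using that by (simp add: XA pi_rho A)
  have "op_matrix_norm n X \<le> op_matrix_norm n A"
  proof (rule op_matrix_norm_le [OF op_matrix_norm_bound(2)])
    fix x :: "nat \<Rightarrow> 'h"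
    have "(\<Sum>j<n. X i j (x j)) = adj V (\<Sum>j<n. A i j (V (x j)))" if "i < n" for i
      using that by (simp add: XA blinfun.sum_right)
    then have "(\<Sum>i<n. (norm (\<Sum>j<n. X i j (x j)))\<^sup>2) \<le> (\<Sum>i<n. (norm (\<Sum>j<n. A i j (V (x j))))\<^sup>2)"
      by (intro sum_mono power_mono) (auto simp: norm_adj_V)
    also have "\<dots> \<le> (op_matrix_norm n A)\<^sup>2 * (\<Sum>i<n. (norm (x i))\<^sup>2)"
      using op_matrix_norm_bound(1) [of A "\<lambda>j. V (x j)" n] by simp
    finally show "(\<Sum>i<n. (norm (\<Sum>j<n. X i j (x j)))\<^sup>2) \<le> (op_matrix_norm n A)\<^sup>2 * (\<Sum>i<n. (norm (x i))\<^sup>2)" .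
  qed
  moreover have "op_matrix_norm n A \<le> op_matrix_norm n X"
  proof (rule op_matrix_norm_le [OF op_matrix_norm_bound(2)])
    fix y :: "nat \<Rightarrow> 'k"
    let ?c = "(op_matrix_norm n X)\<^sup>2"
    define B where "B = (\<lambda>i j. (if i = j then complex_of_real ?c *\<^sub>C orth_proj UNIV else 0)
      - (\<Sum>k<n. adj (X k i) o\<^sub>L X k j))"
    have XB: "X i j \<in> \<B> UNIV" "X i j \<in> \<A>" "clinear (X i j)" if "i < n" "j < n" for i j
      using XT [OF that] T_in_A T_subset T_clinear by auto
    have B0: "(\<Sum>k<n. adj (X k i) o\<^sub>L X k j) \<in> \<B> UNIV"
      "complex_of_real ?c *\<^sub>C (orth_proj UNIV :: 'h \<Rightarrow>\<^sub>L 'h) \<in> \<B> UNIV"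
      "(0 :: 'h \<Rightarrow>\<^sub>L 'h) \<in> \<B> UNIV" if "i < n" "j < n" for i j
      using that XB by (auto intro!: bounded_ops_closure hilbert_subspace_UNIV orth_proj_bounded_ops)
    have "op_matrix_positive n B"
      unfolding op_matrix_positive_def
    proof
      fix x :: "nat \<Rightarrow> 'h"
      have "(\<Sum>k<n. (norm (\<Sum>j<n. X k j (x j)))\<^sup>2) \<le> ?c * (\<Sum>i<n. (norm (x i))\<^sup>2)"
        by (rule op_matrix_norm_bound)
      then show "(\<Sum>i<n. cinner (x i) (\<Sum>j<n. B i j (x j))) \<in> \<real>\<^sub>\<ge>\<^sub>0"
        using gram_matrix_form [OF hilbert_subspace_UNIV XB(3), where c = ?c and x = x]
        by (simp only: B_def nonneg_Reals_of_real_iff orth_proj_UNIV) simp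
    qed
    moreover have "B i j \<in> \<B> UNIV" if "i < n" "j < n" for i j
      unfolding B_def using B0 [OF that]
      by (auto intro!: bounded_ops_closure hilbert_subspace_UNIV orth_proj_bounded_ops)
    ultimately have pos: "op_matrix_positive n (\<lambda>i j. pi (B i j))"
      by (intro \<pi>.matrix_positive)
    have piB: "pi (B i j) = (if i = j then complex_of_real ?c *\<^sub>C orth_proj K else 0)
      - (\<Sum>k<n. adj (A k i) o\<^sub>L A k j)" if ij: "i < n" "j < n" for i j
    proof -
      have "pi (\<Sum>k<n. adj (X k i) o\<^sub>L X k j) = (\<Sum>k<n. pi (adj (X k i) o\<^sub>L X k j))"
        using ij XB by (intro \<pi>.sum bounded_ops_closure hilbert_subspace_UNIV) auto
      also have "\<dots> = (\<Sum>k<n. adj (A k i) o\<^sub>L A k j)"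
        using ij XB piX by (intro sum.cong refl) (simp add: pi_mult_right pi_star clinear_adj)
      finally have s: "pi (\<Sum>k<n. adj (X k i) o\<^sub>L X k j) = (\<Sum>k<n. adj (A k i) o\<^sub>L A k j)" .
      let ?D = "if i = j then complex_of_real ?c *\<^sub>C (orth_proj UNIV :: 'h \<Rightarrow>\<^sub>L 'h) else 0"
      have "?D \<in> \<B> UNIV" using B0 [OF ij] by simp
      moreover have "pi ?D = (if i = j then complex_of_real ?c *\<^sub>C orth_proj K else 0)"
        by (auto simp: \<pi>.scale \<pi>.unital \<pi>.zero orth_proj_bounded_ops [OF \<pi>.K])
      ultimately show ?thesis
        unfolding B_def using \<pi>.diff [OF _ B0(1) [OF ij], of ?D] by (simp only: s)
    qed
    have "(\<Sum>i<n. cinner (y i) (\<Sum>j<n. ((if i = j then complex_of_real ?c *\<^sub>C orth_proj K else 0)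
      - (\<Sum>k<n. adj (A k i) o\<^sub>L A k j)) (y j))) = (\<Sum>i<n. cinner (y i) (\<Sum>j<n. pi (B i j) (y j)))"
      by (simp add: piB)
    also have "\<dots> \<in> \<real>\<^sub>\<ge>\<^sub>0"
      using pos by (simp only: op_matrix_positive_def)
    finally have "complex_of_real (?c * (\<Sum>i<n. (norm (orth_proj K (y i)))\<^sup>2)
        - (\<Sum>k<n. (norm (\<Sum>j<n. A k j (y j)))\<^sup>2)) \<in> \<real>\<^sub>\<ge>\<^sub>0"
      using gram_matrix_form [OF K C_lin [OF A], where c = ?c and x = y] by simp
    then have "(\<Sum>k<n. (norm (\<Sum>j<n. A k j (y j)))\<^sup>2) \<le> ?c * (\<Sum>i<n. (norm (orth_proj K (y i)))\<^sup>2)"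
      by (simp only: nonneg_Reals_of_real_iff diff_ge_0_iff_ge)
    also have "\<dots> \<le> ?c * (\<Sum>i<n. (norm (y i))\<^sup>2)"
      by (intro mult_left_mono sum_mono power_mono norm_orth_proj_le K) auto
    finally show "(\<Sum>i<n. (norm (\<Sum>j<n. A i j (y j)))\<^sup>2) \<le> ?c * (\<Sum>i<n. (norm (y i))\<^sup>2)" .
  qed
  ultimately show "op_matrix_norm n (\<lambda>i j. compression V (A i j)) = op_matrix_norm n A"
    unfolding X_def by simp
qed

lemma cross_section_C:
  "completely_isometric_cross_section \<A> pi \<C> (compression V)"
  unfolding completely_isometric_cross_section_def
  using complete_isometry_C [OF order_refl] compression_image T_in_A
  by (auto simp: compression_rho pi_rho)

lemma closed_ideal_kernel:
  assumes \<X>: "cstar_subalgebra UNIV \<X>" and sub: "\<X> \<subseteq> \<A>"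
  shows "closed_ideal \<X> (star_kernel \<X> pi)"
proof -
  note D = cstar_subalgebraD [OF \<X>]
  have "closed (star_kernel \<X> pi)"
    unfolding closed_sequential_limits
  proof (intro allI impI)
    fix X Z assume "(\<forall>n. X n \<in> star_kernel \<X> pi) \<and> X \<longlonglongrightarrow> Z"
    then have X: "\<And>n. X n \<in> \<X>" "\<And>n. pi (X n) = 0" and lim: "X \<longlonglongrightarrow> Z"
      by (auto simp: star_kernel_def)
    have "(\<lambda>n. pi (X n)) \<longlonglongrightarrow> pi Z"
      by (rule \<pi>.tendsto [OF _ lim]) (use X(1) D(1) in auto)
    then have "pi Z = 0" unfolding X(2) using LIMSEQ_unique tendsto_const by blast
    then show "Z \<in> star_kernel \<X> pi"
      using closed_sequentially [OF D(3) X(1) lim] by (simp add: star_kernel_def)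
  qed
  then show ?thesis
    using D sub by (auto simp: closed_ideal_def complex_subspace_def star_kernel_def \<pi>.zero \<pi>.add
        \<pi>.scale scaleC_blinfun_simps pi_mult subset_iff)
qed

text \<open>Both kernels are found by showing that \<open>X - \<Phi>(X)\<close> lies in the ideal for all \<open>X\<close> in the algebra; on the
  kernel of \<open>\<pi>\<close> this difference is \<open>X\<close> itself, because \<open>\<Phi> = \<rho> \<circ> \<pi>\<close> vanishes there.\<close>

lemma complex_subspace_modulo:
  assumes \<X>: "cstar_subalgebra UNIV \<X>" and I: "closed_ideal \<X> I"
  shows "complex_subspace {X \<in> \<X>. X - \<Phi> X \<in> I}" and "closed {X \<in> \<X>. X - \<Phi> X \<in> I}"
proof -
  note D = cstar_subalgebraD [OF \<X>]
  have I': "0 \<in> I" "\<And>X Y. X \<in> I \<Longrightarrow> Y \<in> I \<Longrightarrow> X + Y \<in> I" "\<And>a X. X \<in> I \<Longrightarrow> a *\<^sub>C X \<in> I" "closed I"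
    using I by (auto simp: closed_ideal_def complex_subspace_def)
  show "complex_subspace {X \<in> \<X>. X - \<Phi> X \<in> I}"
    unfolding complex_subspace_def
  proof (intro conjI ballI allI)
    show "0 \<in> {X \<in> \<X>. X - \<Phi> X \<in> I}" by (simp add: D(4) \<Phi>.zero I')
    fix X assume X: "X \<in> {X \<in> \<X>. X - \<Phi> X \<in> I}"
    show "a *\<^sub>C X \<in> {X \<in> \<X>. X - \<Phi> X \<in> I}" for a
      using X D(1) [of X] I'(3) [of "X - \<Phi> X" a] by (simp add: D \<Phi>.scale scaleC_blinfun_simps)
    fix Y assume Y: "Y \<in> {X \<in> \<X>. X - \<Phi> X \<in> I}"
    show "X + Y \<in> {X \<in> \<X>. X - \<Phi> X \<in> I}"
      using X Y D(1) [of X] D(1) [of Y] I'(2) [of "X - \<Phi> X" "Y - \<Phi> Y"]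
      by (simp add: D \<Phi>.add algebra_simps)
  qed
  show "closed {X \<in> \<X>. X - \<Phi> X \<in> I}"
    unfolding closed_sequential_limits
  proof (intro allI impI)
    fix X Z assume "(\<forall>n. X n \<in> {X \<in> \<X>. X - \<Phi> X \<in> I}) \<and> X \<longlonglongrightarrow> Z"
    then have X: "\<And>n. X n \<in> \<X>" "\<And>n. X n - \<Phi> (X n) \<in> I" and lim: "X \<longlonglongrightarrow> Z" by auto
    have "(\<lambda>n. X n - \<Phi> (X n)) \<longlonglongrightarrow> Z - \<Phi> Z"
      by (intro tendsto_diff lim \<Phi>.tendsto D(1) X)
    then have "Z - \<Phi> Z \<in> I" by (rule closed_sequentially [OF I'(4) X(2)])
    then show "Z \<in> {X \<in> \<X>. X - \<Phi> X \<in> I}"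
      using closed_sequentially [OF D(3) X(1) lim] by simp
  qed
qed

lemma \<Phi>_left_absorb: "A \<in> \<A> \<Longrightarrow> clinear X \<Longrightarrow> \<Phi> (A o\<^sub>L \<Phi> X) = \<Phi> (A o\<^sub>L X)"
proof -
  assume A: "A \<in> \<A>" and X: "clinear X"
  have lin: "clinear A" "clinear (\<Phi> X)" using A X A_clinear T_clinear \<Phi>_in by auto
  have "pi (A o\<^sub>L \<Phi> X) = pi (A o\<^sub>L X)" using A X lin by (simp add: pi_mult pi_\<Phi>)
  then show ?thesis using lin X by (metis rho_pi clinear_compose)
qed

text \<open>For a Toeplitz operator \<open>A\<close> the difference for \<open>A X\<close> is \<open>A (X - \<Phi>(X))\<close> plus the generator
  \<open>A \<Phi>(X) - \<Phi>(A \<Phi>(X))\<close>, so that left multiplication by \<open>A\<close> preserves membership in the ideal.\<close>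

lemma kernel_A:
  "star_kernel \<A> pi =
    closed_ideal_gen \<A> {(X o\<^sub>L Y) - \<Phi> (X o\<^sub>L Y) | X Y. X \<in> \<T> \<and> Y \<in> \<T>}" (is "_ = closed_ideal_gen \<A> ?S")
proof
  have TA: "X \<in> \<A>" if "X \<in> \<T>" for X using that T_in_A by blast
  have \<Phi>A: "\<Phi> X \<in> \<A>" if "clinear X" for X using that \<Phi>_in TA by blast
  have "(X o\<^sub>L Y) - \<Phi> (X o\<^sub>L Y) \<in> \<A>" if "X \<in> \<T>" "Y \<in> \<T>" for X Y
    by (intro A_closure(7) A_closure(5) TA that \<Phi>A clinear_compose T_clinear)
  then have SA: "?S \<subseteq> \<A>" by auto
  let ?I = "closed_ideal_gen \<A> ?S"
  have I: "closed_ideal \<A> ?I" by (rule closed_ideal_closed_ideal_gen [OF cstar_subalgebra_A SA])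
  then have I': "\<And>X Y. X \<in> ?I \<Longrightarrow> Y \<in> ?I \<Longrightarrow> X + Y \<in> ?I" "\<And>A X. A \<in> \<A> \<Longrightarrow> X \<in> ?I \<Longrightarrow> A o\<^sub>L X \<in> ?I" "0 \<in> ?I"
    by (auto simp: closed_ideal_def complex_subspace_def)
  show "?I \<subseteq> star_kernel \<A> pi"
  proof (rule closed_ideal_gen_least [OF closed_ideal_kernel [OF cstar_subalgebra_A order_refl]])
    have "pi (Z - \<Phi> Z) = 0" if "clinear Z" for Z
      using that \<Phi>.lin(2) [of Z] by (simp add: \<pi>.diff bounded_ops_UNIV_iff pi_\<Phi>)
    then show "?S \<subseteq> star_kernel \<A> pi"
      using SA by (auto simp: star_kernel_def clinear_compose T_clinear)
  qed
  have left: "A o\<^sub>L X \<in> {X \<in> \<A>. X - \<Phi> X \<in> ?I}" if A: "A \<in> \<T>" and X: "X \<in> {X \<in> \<A>. X - \<Phi> X \<in> ?I}" for A X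
  proof -
    have lin: "clinear X" "clinear A" using A X A_clinear T_clinear by auto
    have "(A o\<^sub>L \<Phi> X) - \<Phi> (A o\<^sub>L \<Phi> X) \<in> ?I"
      using A \<Phi>_in [OF lin(1)] by (intro closed_ideal_gen_contains [THEN subsetD]) blast
    moreover have "A o\<^sub>L (X - \<Phi> X) \<in> ?I" using X by (intro I' TA A) simp
    ultimately have "(A o\<^sub>L (X - \<Phi> X)) + ((A o\<^sub>L \<Phi> X) - \<Phi> (A o\<^sub>L \<Phi> X)) \<in> ?I"
      by (rule I'(1) [rotated])
    then show ?thesis
      using X A_closure(5) [OF TA [OF A]]
      by (simp add: \<Phi>_left_absorb TA A lin compose_diff_right)
  qed
  have "\<A> \<subseteq> {X \<in> \<A>. X - \<Phi> X \<in> ?I}"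
  proof (rule cstar_least_left_invariant [OF hilbert_subspace_UNIV T_subset])
    show "complex_subspace {X \<in> \<A>. X - \<Phi> X \<in> ?I}" "closed {X \<in> \<A>. X - \<Phi> X \<in> ?I}"
      by (rule complex_subspace_modulo [OF cstar_subalgebra_A I])+
    show "orth_proj UNIV \<in> {X \<in> \<A>. X - \<Phi> X \<in> ?I}"
      by (simp add: cstar_contains \<Phi>.unital I')
  qed (use left base.toeplitz_on_adj in \<open>auto\<close>)
  moreover have "\<Phi> X = 0" if "X \<in> star_kernel \<A> pi" for X
    using that rho_pi [of X] A_clinear by (auto simp: star_kernel_def rho_def)
  ultimately show "star_kernel \<A> pi \<subseteq> ?I"
    by (force simp: star_kernel_def)
qed

subsection \<open>The algebra generated by the family\<close>

lemma F_clinear: "X \<in> \<F> \<Longrightarrow> clinear X"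
  using F_subset_A A_clinear by blast

lemma family_F: "\<alpha> \<in> \<Gamma> \<Longrightarrow> j \<in> J \<alpha> \<Longrightarrow> T \<alpha> j \<in> \<F>"
  using cstar_contains(1) [of "family_ops \<Gamma> J T" UNIV] by (auto simp: family_ops_def)

lemma family_UNIV: "family_ops \<Gamma> J T \<subseteq> \<B> UNIV"
  using family_T T_subset by blast

lemma rho_right_module: "\<alpha> \<in> \<Gamma> \<Longrightarrow> j \<in> J \<alpha> \<Longrightarrow> rho (Y o\<^sub>L N \<alpha> j) = rho Y o\<^sub>L T \<alpha> j"
  and rho_left_module: "\<alpha> \<in> \<Gamma> \<Longrightarrow> j \<in> J \<alpha> \<Longrightarrow> rho (adj (N \<alpha> j) o\<^sub>L Y) = adj (T \<alpha> j) o\<^sub>L rho Y"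
  by (auto intro!: blinfun_eqI simp: N_V adj_V_adj_N)

text \<open>Since \<open>\<rho>(N\<^sub>i\<^sup>* Y N\<^sub>j) = T\<^sub>i\<^sup>* \<rho>(Y) T\<^sub>j\<close> and \<open>\<N>\<close> is commutative, words in the extension are compressed to words
  in the original family.\<close>

lemma rho_N_subset_F: "Z \<in> \<N> \<Longrightarrow> rho Z \<in> \<F>"
proof -
  let ?E = "{Z \<in> \<N>. rho Z \<in> \<F>}"
  have "\<N> \<subseteq> ?E"
  proof (rule cstar_least_left_invariant [OF K family_ops_subset(1)])
    have "rho 0 = 0" by (simp add: rho_def)
    then show "complex_subspace ?E"
      by (auto simp: complex_subspace_def N_closure F_closure rho_add rho_scale)
    show "closed ?E"
      unfolding closed_sequential_limits
    proof (intro allI impI)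
      fix X Z assume "(\<forall>n. X n \<in> ?E) \<and> X \<longlonglongrightarrow> Z"
      then have X: "\<And>n. X n \<in> \<N>" "\<And>n. rho (X n) \<in> \<F>" and lim: "X \<longlonglongrightarrow> Z" by auto
      show "Z \<in> ?E"
        using closed_sequentially [OF N_closure(1) X(1) lim]
          closed_sequentially [OF F_closure(1) X(2) tendsto_rho [OF lim]] by simp
    qed
    show "orth_proj K \<in> ?E"
      using cstar_contains(2) [of UNIV "family_ops \<Gamma> J T"] by (simp add: cstar_contains rho_unit orth_proj_UNIV)
  next
    fix A Z assume A: "A \<in> family_ops \<Gamma> J N" and Z: "Z \<in> ?E"
    then obtain \<alpha> j where \<alpha>: "\<alpha> \<in> \<Gamma>" "j \<in> J \<alpha>" "A = N \<alpha> j" by (auto simp: family_ops_def)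
    have "A o\<^sub>L Z = Z o\<^sub>L A"
      using Z \<alpha> N_gen C_N_commute N_subset_C by blast
    then show "A o\<^sub>L Z \<in> ?E"
      using Z \<alpha> N_closure(5) [OF _ N_gen [OF \<alpha>(1,2)], of Z]
      by (simp add: rho_right_module F_closure family_F)
    show "adj A o\<^sub>L Z \<in> ?E"
      using Z \<alpha> by (simp add: rho_left_module F_closure N_closure family_F N_gen)
  qed auto
  then show "Z \<in> \<N> \<Longrightarrow> rho Z \<in> \<F>" by blast
qed

lemma pi_F_in_N: "X \<in> \<F> \<Longrightarrow> pi X \<in> \<N>"
proof -
  let ?E = "{X \<in> \<F>. pi X \<in> \<N>}"
  have FB: "X \<in> \<B> UNIV" if "X \<in> \<F>" for X using F_clinear [OF that] by (simp add: bounded_ops_UNIV_iff)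
  have "\<F> \<subseteq> ?E"
  proof (rule cstar_least_left_invariant [OF hilbert_subspace_UNIV family_UNIV])
    show "complex_subspace ?E"
      by (auto simp: complex_subspace_def N_closure F_closure \<pi>.zero \<pi>.add \<pi>.scale FB)
    show "closed ?E"
      unfolding closed_sequential_limits
    proof (intro allI impI)
      fix X Z assume "(\<forall>n. X n \<in> ?E) \<and> X \<longlonglongrightarrow> Z"
      then have X: "\<And>n. X n \<in> \<F>" "\<And>n. pi (X n) \<in> \<N>" and lim: "X \<longlonglongrightarrow> Z" by auto
      show "Z \<in> ?E"
        using closed_sequentially [OF F_closure(1) X(1) lim]
          closed_sequentially [OF N_closure(1) X(2) \<pi>.tendsto [OF FB [OF X(1)] lim]] by simp
    qed
    show "orth_proj UNIV \<in> ?E"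
      by (simp add: cstar_contains \<pi>.unital)
  next
    fix A Z assume A: "A \<in> family_ops \<Gamma> J T" and Z: "Z \<in> ?E"
    then obtain \<alpha> j where \<alpha>: "\<alpha> \<in> \<Gamma>" "j \<in> J \<alpha>" "A = T \<alpha> j" by (auto simp: family_ops_def)
    have AF: "A \<in> \<F>" using \<alpha> family_F by blast
    then have AA: "A \<in> \<A>" "adj A \<in> \<A>" "clinear A" using F_subset_A A_closure F_clinear by auto
    show "A o\<^sub>L Z \<in> ?E"
      using Z AF AA \<alpha> F_clinear [of Z] by (simp add: F_closure pi_mult pi_generator N_closure N_gen)
    show "adj A o\<^sub>L Z \<in> ?E"
      using Z AF AA \<alpha> F_clinear [of Z]
      by (simp add: F_closure pi_mult pi_star pi_generator N_closure N_gen)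
  qed auto
  then show "X \<in> \<F> \<Longrightarrow> pi X \<in> \<N>" by blast
qed

lemma pi_image_F: "pi ` \<F> = \<N>"
proof
  show "pi ` \<F> \<subseteq> \<N>" using pi_F_in_N by blast
  show "\<N> \<subseteq> pi ` \<F>"
  proof
    fix Z assume Z: "Z \<in> \<N>"
    then have "pi (rho Z) = Z" using N_subset_C pi_rho by blast
    then show "Z \<in> pi ` \<F>" using rho_N_subset_F [OF Z] by (metis imageI)
  qed
qed

lemma \<Phi>_in_F: "X \<in> \<F> \<Longrightarrow> \<Phi> X \<in> \<F>"
  using rho_N_subset_F [OF pi_F_in_N] by (simp add: rho_pi F_clinear)

lemma \<Phi>_image_F: "\<Phi> ` \<F> = \<F> \<inter> \<T>"
proof
  show "\<Phi> ` \<F> \<subseteq> \<F> \<inter> \<T>" using \<Phi>_in_F \<Phi>_in F_clinear by blast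
  show "\<F> \<inter> \<T> \<subseteq> \<Phi> ` \<F>"
  proof
    fix X assume "X \<in> \<F> \<inter> \<T>"
    then have "\<Phi> X = X" "X \<in> \<F>" using \<Phi>_fixes by auto
    then show "X \<in> \<Phi> ` \<F>" by (metis imageI)
  qed
qed

text \<open>For a generator \<open>A\<close> one has \<open>\<Phi>(A X) = \<Phi>(X) A\<close>, and hence the difference for \<open>A X\<close> is \<open>A (X - \<Phi>(X))\<close> plus
  the commutator of the Toeplitz operators \<open>A\<close> and \<open>\<Phi>(X)\<close>; for its adjoint, \<open>\<Phi>(A\<^sup>* X) = A\<^sup>* \<Phi>(X)\<close>, and there is no
  correction.  Conversely, commutators are in the kernel because \<open>\<pi>\<close> maps \<open>\<F>\<close> to the commutative algebra \<open>\<N>\<close>.\<close>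

lemma kernel_F:
  "star_kernel \<F> pi = closed_ideal_gen \<F> (commutators (\<T> \<inter> \<F>))"
  "star_kernel \<F> pi = commutator_ideal \<F>"
proof -
  let ?I = "closed_ideal_gen \<F> (commutators (\<T> \<inter> \<F>))"
  have "commutators (\<T> \<inter> \<F>) \<subseteq> commutators \<F>"
    by (auto simp: commutators_def)
  then have 1: "?I \<subseteq> commutator_ideal \<F>"
    unfolding commutator_ideal_def by (rule closed_ideal_gen_mono)
  have 2: "commutator_ideal \<F> \<subseteq> star_kernel \<F> pi"
    unfolding commutator_ideal_def
  proof (rule closed_ideal_gen_least [OF closed_ideal_kernel [OF cstar_subalgebra_F F_subset_A]] subsetI)+
    fix Z assume "Z \<in> commutators \<F>"
    then obtain X Y where XY: "X \<in> \<F>" "Y \<in> \<F>" "Z = (X o\<^sub>L Y) - (Y o\<^sub>L X)"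
      by (auto simp: commutators_def)
    then have "pi Z = (pi X o\<^sub>L pi Y) - (pi Y o\<^sub>L pi X)"
      using F_subset_A F_clinear
      by (simp add: \<pi>.diff bounded_ops_UNIV_iff clinear_compose pi_mult subset_iff)
    moreover have "pi X o\<^sub>L pi Y = pi Y o\<^sub>L pi X"
      using C_N_commute N_subset_C pi_F_in_N XY by blast
    ultimately show "Z \<in> star_kernel \<F> pi"
      using XY by (simp add: star_kernel_def F_closure)
  qed
  have comm_F: "commutators (\<T> \<inter> \<F>) \<subseteq> \<F>"
    by (auto simp: commutators_def F_closure)
  have I: "closed_ideal \<F> ?I" by (rule closed_ideal_closed_ideal_gen [OF cstar_subalgebra_F comm_F])
  then have I': "\<And>X Y. X \<in> ?I \<Longrightarrow> Y \<in> ?I \<Longrightarrow> X + Y \<in> ?I" "\<And>A X. A \<in> \<F> \<Longrightarrow> X \<in> ?I \<Longrightarrow> A o\<^sub>L X \<in> ?I" "0 \<in> ?I"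
    by (auto simp: closed_ideal_def complex_subspace_def)
  have "\<F> \<subseteq> {X \<in> \<F>. X - \<Phi> X \<in> ?I}"
  proof (rule cstar_least_left_invariant [OF hilbert_subspace_UNIV family_UNIV])
    show "complex_subspace {X \<in> \<F>. X - \<Phi> X \<in> ?I}" "closed {X \<in> \<F>. X - \<Phi> X \<in> ?I}"
      by (rule complex_subspace_modulo [OF cstar_subalgebra_F I])+
    show "orth_proj UNIV \<in> {X \<in> \<F>. X - \<Phi> X \<in> ?I}"
      by (simp add: cstar_contains \<Phi>.unital I')
  next
    fix A X assume A: "A \<in> family_ops \<Gamma> J T" and X: "X \<in> {X \<in> \<F>. X - \<Phi> X \<in> ?I}"
    then obtain \<alpha> j where \<alpha>: "\<alpha> \<in> \<Gamma>" "j \<in> J \<alpha>" and A_eq: "A = T \<alpha> j" by (auto simp: family_ops_def)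
    have AF: "A \<in> \<F>" using \<alpha> A_eq family_F by blast
    then have AA: "A \<in> \<A>" "adj A \<in> \<A>" "clinear A" using F_subset_A A_closure F_clinear by auto
    have lin: "clinear X" using X F_clinear by blast
    have piA: "pi A = N \<alpha> j" by (simp add: A_eq pi_generator \<alpha>)
    have "\<Phi> (A o\<^sub>L X) = rho (N \<alpha> j o\<^sub>L pi X)"
      using AA lin by (simp add: pi_mult piA clinear_compose flip: rho_pi)
    also have "N \<alpha> j o\<^sub>L pi X = pi X o\<^sub>L N \<alpha> j"
      using C_N_commute [OF pi_in_C [OF lin] N_gen [OF \<alpha>]] .
    also have "rho (pi X o\<^sub>L N \<alpha> j) = \<Phi> X o\<^sub>L A"
      by (simp add: rho_right_module \<alpha> A_eq rho_pi lin)
    finally have \<Phi>A: "\<Phi> (A o\<^sub>L X) = \<Phi> X o\<^sub>L A" .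
    have "(A o\<^sub>L \<Phi> X) - (\<Phi> X o\<^sub>L A) \<in> ?I"
      using A family_T AF X \<Phi>_in [OF lin] \<Phi>_in_F
      by (intro closed_ideal_gen_contains [THEN subsetD]) (auto simp: commutators_def)
    moreover have "A o\<^sub>L (X - \<Phi> X) \<in> ?I" using X by (intro I'(2) AF) simp
    ultimately have "(A o\<^sub>L (X - \<Phi> X)) + ((A o\<^sub>L \<Phi> X) - (\<Phi> X o\<^sub>L A)) \<in> ?I"
      by (rule I'(1) [rotated])
    then show "A o\<^sub>L X \<in> {X \<in> \<F>. X - \<Phi> X \<in> ?I}"
      using X AF by (simp add: \<Phi>A F_closure compose_diff_right)
    have "\<Phi> (adj A o\<^sub>L X) = rho (adj (N \<alpha> j) o\<^sub>L pi X)"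
      using AA lin by (simp add: pi_mult pi_star piA clinear_intros flip: rho_pi)
    then have "\<Phi> (adj A o\<^sub>L X) = adj A o\<^sub>L \<Phi> X"
      by (simp add: rho_left_module \<alpha> A_eq rho_pi lin)
    moreover have "adj A o\<^sub>L (X - \<Phi> X) \<in> ?I"
      using X by (intro I'(2) F_closure(6) AF) simp
    ultimately show "adj A o\<^sub>L X \<in> {X \<in> \<F>. X - \<Phi> X \<in> ?I}"
      using X AF by (simp add: F_closure compose_diff_right)
  qed auto
  moreover have "\<Phi> X = 0" if "X \<in> star_kernel \<F> pi" for X
    using that rho_pi [of X] F_clinear by (auto simp: star_kernel_def rho_def)
  ultimately have 3: "star_kernel \<F> pi \<subseteq> ?I"
    by (force simp: star_kernel_def)
  show "star_kernel \<F> pi = ?I" "star_kernel \<F> pi = commutator_ideal \<F>"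
    using 1 2 3 by auto
qed

lemma cross_section_F: "completely_isometric_cross_section \<F> pi \<N> (compression V)"
  unfolding completely_isometric_cross_section_def
  using complete_isometry_C [OF N_subset_C] N_subset_C rho_N_subset_F
  by (auto simp: compression_rho pi_rho subset_iff)

end

section \<open>Lifting the commutant\<close>

text \<open>When \<open>X\<^sup>* X\<close> is a Toeplitz operator as well, the squares of the commutators of \<open>X\<close> with the generators sum up
  to \<open>0\<close>.\<close>

lemma (in spherical_family) commuting_iff:
  assumes X: "X \<in> \<B> K"
  shows "X \<in> commutant K (family_ops \<Gamma> J N) \<longleftrightarrow> X \<in> toeplitz_on \<and> adj X o\<^sub>L X \<in> toeplitz_on"
proof
  assume "X \<in> commutant K (family_ops \<Gamma> J N)"
  then show "X \<in> toeplitz_on \<and> adj X o\<^sub>L X \<in> toeplitz_on"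
    using commuting_in_toeplitz_on [OF X] by (auto simp: commutant_def family_ops_def)
next
  assume T: "X \<in> toeplitz_on \<and> adj X o\<^sub>L X \<in> toeplitz_on"
  have "X o\<^sub>L N \<alpha> j = N \<alpha> j o\<^sub>L X" if \<alpha>: "\<alpha> \<in> \<Gamma>" "j \<in> J \<alpha>" for \<alpha> j
  proof (rule blinfun_eqI)
    fix x
    have "Re (cinner x (conj_sum \<alpha> (adj X o\<^sub>L X) x)) - (norm (X x))\<^sup>2 = 0"
      using T bounded_ops_clinear [OF X]
      by (simp add: toeplitz_onD(2) \<alpha> cinner_adj cinner_self)
    then have "((\<lambda>j. (norm (((N \<alpha> j o\<^sub>L X) - (X o\<^sub>L N \<alpha> j)) x))\<^sup>2) has_sum 0) (J \<alpha>)"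
      using commutator_norm_has_sum [OF conjunct1 [OF T] \<alpha>(1), of x] by simp
    from finite_sum_le_has_sum [OF this, of "{j}"] \<alpha>
    have "(norm (((N \<alpha> j o\<^sub>L X) - (X o\<^sub>L N \<alpha> j)) x))\<^sup>2 \<le> 0" by simp
    then show "(X o\<^sub>L N \<alpha> j) x = (N \<alpha> j o\<^sub>L X) x"
      by (simp add: blinfun.diff_left)
  qed
  then show "X \<in> commutant K (family_ops \<Gamma> J N)"
    using X by (auto simp: commutant_def family_ops_def)
qed

context toeplitz_lifting
begin

lemma restricts_imp_rho: "restricts_to V Y X \<Longrightarrow> rho Y = X"
  by (rule blinfun_eqI) (simp add: restricts_to_def)

text \<open>The compression of \<open>\<sigma>(X)\<^sup>* \<sigma>(X)\<close> is \<open>\<Phi>(X\<^sup>* X) = X\<^sup>* X\<close>, so that \<open>\<sigma>(X) V x\<close> has the same norm as \<open>X x\<close>, which is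
  \<open>V\<^sup>* \<sigma>(X) V x\<close>.  A vector keeping its norm under \<open>V\<^sup>*\<close> lies in the range of \<open>V\<close>.\<close>

lemma commutant_lifting:
  assumes X: "X \<in> \<T>" "adj X o\<^sub>L X \<in> \<T>"
  shows "restricts_to V (sigma X) X"
  unfolding restricts_to_def
proof
  fix x
  have lin: "clinear X" "clinear (sigma X)"
    using T_clinear [OF X(1)] by (auto intro: C_lin sigma_in_C)
  have "rho (adj (sigma X) o\<^sub>L sigma X) = adj X o\<^sub>L X"
    using sigma_\<Phi>_square [OF X(1)] rho_sigma [OF X(2)] by (simp add: \<Phi>_fixes X)
  then have "cinner x (rho (adj (sigma X) o\<^sub>L sigma X) x) = cinner x ((adj X o\<^sub>L X) x)" by simp
  then have sq: "cinner (sigma X (V x)) (sigma X (V x)) = cinner (X x) (X x)"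
    by (simp add: cinner_adj lin V_clinear)
  have adjV: "adj V (sigma X (V x)) = X x"
    using rho_sigma [OF X(1)] by (metis rho_apply)
  have c: "cinner (V (X x)) (sigma X (V x)) = cinner (X x) (X x)"
    by (simp add: adjV flip: cinner_adj [OF V_clinear])
  have "cinner (sigma X (V x)) (V (X x)) = cinner (X x) (X x)"
    using c by (metis cinner_commute)
  then have "cinner (sigma X (V x) - V (X x)) (sigma X (V x) - V (X x)) = 0"
    using c sq by (simp add: cinner_diff_left cinner_diff_right del: cinner_self_eq_0)
  then show "sigma X (V x) = V (X x)" by simp
qed

lemma commutant_lifting_unique:
  assumes X: "X \<in> \<T>" "adj X o\<^sub>L X \<in> \<T>"
  shows "\<exists>!Y. Y \<in> \<C> \<and> restricts_to V Y X"
    and "Y \<in> \<C> \<Longrightarrow> restricts_to V Y X \<Longrightarrow> norm Y = norm X"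
proof -
  have s: "sigma X \<in> \<C>" by (intro sigma_in_C T_clinear X)
  have u: "Y = sigma X" if "Y \<in> \<C>" "restricts_to V Y X" for Y
    using that restricts_imp_rho sigma_rho by metis
  show "\<exists>!Y. Y \<in> \<C> \<and> restricts_to V Y X"
    using commutant_lifting [OF X] s u by blast
  assume Y: "Y \<in> \<C>" "restricts_to V Y X"
  have "norm (sigma X) \<le> norm X"
    using T_clinear [OF X(1)] by (intro \<sigma>.contractive) (simp add: bounded_ops_UNIV_iff)
  moreover have "norm X \<le> norm (sigma X)"
    using norm_rho [of "sigma X"] by (simp add: rho_sigma X)
  ultimately show "norm Y = norm X" using u [OF Y] by simp
qed

end

section \<open>Realizing positive definite kernels\<close>

text \<open>The discriminant argument for the Cauchy--Schwarz inequality; \<open>t\<close> stands for the square of the modulus of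
  the inner product, and \<open>- r\<close> times the inner product is the scalar to be optimized.\<close>

lemma quadratic_bound:
  fixes a t s :: real
  assumes "0 \<le> a" "0 \<le> s" and q: "\<And>r. 0 \<le> r\<^sup>2 * a * t - 2 * r * t + s"
  shows "t \<le> a * s"
proof (cases "a = 0")
  case True
  have "t \<le> 0"
  proof (rule ccontr)
    assume "\<not> t \<le> 0"
    then show False using q [of "(s + 1) / (2 * t)"] True by simp
  qed
  then show ?thesis using True by simp
next
  case False
  have "(1 / a)\<^sup>2 * a * t - 2 * (1 / a) * t + s = s - t / a"
    using False by (simp add: power2_eq_square field_simps)
  then have "t / a \<le> s" using q [of "1 / a"] by simp
  then show ?thesis using False assms(1) by (simp add: field_simps)
qed

lemma cinner_sum_list_left: "cinner (\<Sum>p\<leftarrow>ps. f p) x = (\<Sum>p\<leftarrow>ps. cinner (f p) x)"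
  by (induction ps) (simp_all add: cinner_add_left)

lemma cinner_sum_list_right: "cinner x (\<Sum>p\<leftarrow>ps. f p) = (\<Sum>p\<leftarrow>ps. cinner x (f p))"
  by (induction ps) (simp_all add: cinner_add_right)

lemma scaleC_sum_list: "a *\<^sub>C (\<Sum>p\<leftarrow>ps. f p) = (\<Sum>p\<leftarrow>ps. a *\<^sub>C f p)"
  for f :: "'i \<Rightarrow> 'a::complex_hilbert_space"
  by (induction ps) (simp_all add: scaleC_add_right)

lemma has_sum_sum_list:
  fixes f :: "'i \<Rightarrow> 'b \<Rightarrow> 'c::topological_comm_monoid_add"
  assumes "\<And>p. p \<in> set ps \<Longrightarrow> (f p has_sum s p) A"
  shows "((\<lambda>x. \<Sum>p\<leftarrow>ps. f p x) has_sum (\<Sum>p\<leftarrow>ps. s p)) A"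
  using assms by (induction ps) (simp_all add: has_sum_add)

definition ell2_unit :: "'x \<Rightarrow> 'x ell2" where
  "ell2_unit x = Ell2 (\<lambda>i. if i = x then 1 else 0)"

lemma ell2_apply_unit: "ell2_apply (ell2_unit x) i = (if i = x then 1 else 0)"
proof -
  have "(\<lambda>i. (cmod (if i = x then 1 else 0))\<^sup>2) summable_on UNIV \<longleftrightarrow>
      (\<lambda>i. (cmod (if i = x then 1 else 0))\<^sup>2) summable_on {x}"
    by (rule summable_on_cong_neutral) auto
  then have "(\<lambda>i. (cmod (if i = x then 1 else 0))\<^sup>2) summable_on UNIV" by simp
  then show ?thesis by (simp add: ell2_unit_def Ell2_inverse)
qed

lemma cinner_ell2_unit: "cinner f (ell2_unit x) = cnj (ell2_apply f x)"
proof -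
  have "cinner f (ell2_unit x) = (\<Sum>\<^sub>\<infinity>i. cnj (ell2_apply f i) * (if i = x then 1 else 0))"
    by (simp add: cinner_ell2_def ell2_cinner.rep_eq ell2_apply_unit)
  also have "\<dots> = (\<Sum>\<^sub>\<infinity>i\<in>{x}. cnj (ell2_apply f i) * (if i = x then 1 else 0))"
    by (rule infsum_cong_neutral) auto
  finally show ?thesis by simp
qed

lemma ell2_apply_continuous: "\<lbrakk>f \<longlonglongrightarrow> g\<rbrakk> \<Longrightarrow> (\<lambda>n. ell2_apply (f n) i) \<longlonglongrightarrow> ell2_apply g i"
proof -
  assume "f \<longlonglongrightarrow> g"
  then have "(\<lambda>n. cnj (cinner (f n) (ell2_unit i))) \<longlonglongrightarrow> cnj (cinner g (ell2_unit i))"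
    by (intro tendsto_intros)
  then show ?thesis by (simp add: cinner_ell2_unit)
qed

text \<open>The vectors are found by a transfinite Cholesky decomposition: for a well-ordering of the
  index set, the vector with index \<open>x\<close> is the element of the closed span of its predecessors prescribed
  by the kernel, plus a multiple of a unit vector that no predecessor has used.\<close>

theorem kernel_realization:
  fixes \<kappa> :: "'x \<Rightarrow> 'x \<Rightarrow> complex"
  assumes herm: "\<And>a b. \<kappa> a b = cnj (\<kappa> b a)"
    and psd: "\<And>ps. (\<Sum>(c, a)\<leftarrow>ps. \<Sum>(d, b)\<leftarrow>ps. cnj c * d * \<kappa> a b) \<in> \<real>\<^sub>\<ge>\<^sub>0"
  shows "\<exists>v :: 'x \<Rightarrow> 'x ell2. \<forall>a b. cinner (v a) (v b) = \<kappa> a b"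
proof -
  obtain r :: "'x rel" where r: "well_order_on UNIV r"
    using well_order_on by blast
  then have wf: "wf (r - Id)" and tot: "\<And>a b. a \<noteq> b \<Longrightarrow> (a, b) \<in> r \<or> (b, a) \<in> r"
    and trans: "trans r" and antisym: "antisym r"
    by (auto simp: well_order_on_def linear_order_on_def partial_order_on_def preorder_on_def total_on_def)
  have less_trans: "(i, x) \<in> r - Id" if "(i, b) \<in> r" "(b, x) \<in> r - Id" for i b x
    using that transD [OF trans] antisymD [OF antisym] by auto
  \<comment> \<open>The vector \<open>w\<close> for \<open>x\<close> is supported on the initial segment up to \<open>x\<close>.\<close>
  define P where "P = (\<lambda>f x w. (\<forall>i. (i, x) \<notin> r \<longrightarrow> ell2_apply w i = 0) \<and>
    (\<forall>y. (y, x) \<in> r - Id \<longrightarrow> cinner (f y) w = \<kappa> y x) \<and> cinner w w = \<kappa> x x)"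
  have "\<exists>v :: 'x \<Rightarrow> 'x ell2. \<forall>x. P v x (v x)"
  proof (rule dependent_wf_choice [OF wf])
    show "P f x w = P g x w" if "\<And>z. (z, x) \<in> r - Id \<Longrightarrow> f z = g z" for f g x w
      using that by (simp add: P_def)
    fix x and f :: "'x \<Rightarrow> 'x ell2"
    assume IH: "\<And>y. (y, x) \<in> r - Id \<Longrightarrow> P f y (f y)"
    have ff: "cinner (f y) (f z) = \<kappa> y z" if y: "(y, x) \<in> r - Id" and z: "(z, x) \<in> r - Id" for y z
    proof -
      consider "y = z" | "(y, z) \<in> r - Id" | "(z, y) \<in> r - Id" using tot by blast
      then show ?thesis
      proof cases
        case 3
        then have "cinner (f z) (f y) = \<kappa> z y" using IH [OF y] by (auto simp: P_def)
        then show ?thesis by (metis cinner_commute herm)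
      qed (use IH [OF y] IH [OF z] in \<open>auto simp: P_def\<close>)
    qed
    have supp: "ell2_apply (f b) i = 0" if "(b, x) \<in> r - Id" "(i, x) \<notin> r - Id" for b i
      using IH [OF that(1)] less_trans that by (auto simp: P_def)
    have \<kappa>xx: "\<kappa> x x \<in> \<real>\<^sub>\<ge>\<^sub>0" using psd [of "[(1, x)]"] by simp
    define k where "k = Re (\<kappa> x x)"
    have k: "0 \<le> k" "\<kappa> x x = complex_of_real k"
      using \<kappa>xx by (auto simp: k_def complex_nonneg_Reals_iff complex_eq_iff)
    \<comment> \<open>The graph of the functional that the inner products with \<open>x\<close> prescribe on the span of its predecessors; its values
      are well defined and bounded because the kernel is positive on the predecessors together with \<open>x\<close>.\<close>
    define G where "G = {(\<Sum>(c, b)\<leftarrow>ps. c *\<^sub>C f b, \<Sum>(c, b)\<leftarrow>ps. c * \<kappa> x b) | ps :: (complex \<times> 'x) list.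
      \<forall>(c, b)\<in>set ps. (b, x) \<in> r - Id}"
    have GI: "(\<Sum>(c, b)\<leftarrow>ps. c *\<^sub>C f b, \<Sum>(c, b)\<leftarrow>ps. c * \<kappa> x b) \<in> G"
      if "\<forall>(c, b)\<in>set ps. (b, x) \<in> r - Id" for ps
      using that by (auto simp: G_def)
    have "\<exists>u. u \<in> closure (fst ` G) \<and> norm u \<le> sqrt k \<and> (\<forall>y t. (y, t) \<in> G \<longrightarrow> cinner u y = t)"
    proof (rule bounded_functional_graph)
      show "(0, 0) \<in> G" using GI [of "[]"] by simp
      show "(y + z, s + t) \<in> G" if "(y, s) \<in> G" "(z, t) \<in> G" for y z s t
      proof -
        from that obtain ps qs :: "(complex \<times> 'x) list" where
          "y = (\<Sum>(c, b)\<leftarrow>ps. c *\<^sub>C f b)" "s = (\<Sum>(c, b)\<leftarrow>ps. c * \<kappa> x b)" "\<forall>(c, b)\<in>set ps. (b, x) \<in> r - Id"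
          "z = (\<Sum>(c, b)\<leftarrow>qs. c *\<^sub>C f b)" "t = (\<Sum>(c, b)\<leftarrow>qs. c * \<kappa> x b)" "\<forall>(c, b)\<in>set qs. (b, x) \<in> r - Id"
          unfolding G_def by blast
        then show ?thesis using GI [of "ps @ qs"] by auto
      qed
      show "(a *\<^sub>C y, a * t) \<in> G" if "(y, t) \<in> G" for a y t
      proof -
        from that obtain ps :: "(complex \<times> 'x) list" where ps:
          "y = (\<Sum>(c, b)\<leftarrow>ps. c *\<^sub>C f b)" "t = (\<Sum>(c, b)\<leftarrow>ps. c * \<kappa> x b)" "\<forall>(c, b)\<in>set ps. (b, x) \<in> r - Id"
          unfolding G_def by blast
        have "(\<Sum>(c, b)\<leftarrow>map (\<lambda>(c, b). (a * c, b)) ps. c *\<^sub>C f b) = a *\<^sub>C y"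
          unfolding ps(1) scaleC_sum_list by (simp add: case_prod_unfold comp_def)
        moreover have "(\<Sum>(c, b)\<leftarrow>map (\<lambda>(c, b). (a * c, b)) ps. c * \<kappa> x b) = a * t"
          unfolding ps(2) sum_list_const_mult [symmetric] by (simp add: case_prod_unfold comp_def mult.assoc)
        moreover have "\<forall>(c, b)\<in>set (map (\<lambda>(c, b). (a * c, b)) ps). (b, x) \<in> r - Id"
          using ps(3) by (auto simp: case_prod_unfold)
        ultimately show ?thesis
          using GI [of "map (\<lambda>(c, b). (a * c, b)) ps"] by (simp only: case_prod_unfold)
      qed
      show "cmod t \<le> sqrt k * norm y" if "(y, t) \<in> G" for y t
      proof -
        from that obtain ps :: "(complex \<times> 'x) list" where ps:
          "y = (\<Sum>(c, b)\<leftarrow>ps. c *\<^sub>C f b)" "t = (\<Sum>(c, b)\<leftarrow>ps. c * \<kappa> x b)" "\<forall>(c, b)\<in>set ps. (b, x) \<in> r - Id"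
          unfolding G_def by blast
        have yy: "complex_of_real ((norm y)\<^sup>2) = (\<Sum>(c, a)\<leftarrow>ps. \<Sum>(d, b)\<leftarrow>ps. cnj c * d * \<kappa> a b)"
        proof -
          have fp: "cinner (f (snd p)) (f (snd q)) = \<kappa> (snd p) (snd q)" if "p \<in> set ps" "q \<in> set ps" for p q
            by (rule ff) (use ps(3) that in \<open>auto simp: case_prod_unfold\<close>)
          have "cinner y y = (\<Sum>p\<leftarrow>ps. \<Sum>q\<leftarrow>ps. cnj (fst p) * (fst q * cinner (f (snd p)) (f (snd q))))"
            unfolding ps(1) cinner_sum_list_left unfolding cinner_sum_list_right
            by (simp add: case_prod_unfold cinner_scaleC_left cinner_scaleC_right mult.left_commute)
          also have "\<dots> = (\<Sum>p\<leftarrow>ps. \<Sum>q\<leftarrow>ps. cnj (fst p) * fst q * \<kappa> (snd p) (snd q))"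
            by (intro arg_cong [where f = sum_list] map_cong refl) (simp add: fp)
          finally show ?thesis by (simp add: cinner_self case_prod_unfold)
        qed
        have t': "cnj t = (\<Sum>(c, a)\<leftarrow>ps. cnj c * \<kappa> a x)"
        proof -
          have "cnj (\<Sum>(c, b)\<leftarrow>qs. c * \<kappa> x b) = (\<Sum>(c, a)\<leftarrow>qs. cnj c * \<kappa> a x)" for qs :: "(complex \<times> 'x) list"
            by (induction qs) (auto simp: herm [of _ x])
          then show ?thesis by (simp add: ps(2))
        qed
        have "0 \<le> \<rho>\<^sup>2 * k * (cmod t)\<^sup>2 - 2 * \<rho> * (cmod t)\<^sup>2 + (norm y)\<^sup>2" for \<rho> :: real
        proof -
          let ?z = "- complex_of_real \<rho> * t"
          have "(\<Sum>(c, a)\<leftarrow>(?z, x) # ps. \<Sum>(d, b)\<leftarrow>(?z, x) # ps. cnj c * d * \<kappa> a b)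
            = cnj ?z * ?z * \<kappa> x x + cnj ?z * t + (cnj t * ?z + complex_of_real ((norm y)\<^sup>2))"
          proof -
            define F where "F = (\<lambda>(c, a) (d, b). cnj c * d * \<kappa> a b)"
            have "(\<Sum>p\<leftarrow>(?z, x) # ps. \<Sum>q\<leftarrow>(?z, x) # ps. F p q) = F (?z, x) (?z, x)
                + (\<Sum>q\<leftarrow>ps. F (?z, x) q) + ((\<Sum>p\<leftarrow>ps. F p (?z, x)) + (\<Sum>p\<leftarrow>ps. \<Sum>q\<leftarrow>ps. F p q))"
              by (simp add: sum_list_addf)
            moreover have "(\<Sum>q\<leftarrow>ps. F (?z, x) q) = cnj ?z * t"
              unfolding ps(2) sum_list_const_mult [symmetric]
              by (simp add: F_def case_prod_unfold mult.assoc)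
            moreover have "(\<Sum>p\<leftarrow>ps. F p (?z, x)) = cnj t * ?z"
              unfolding t' sum_list_mult_const [symmetric]
              by (simp add: F_def case_prod_unfold mult_ac)
            moreover have "(\<Sum>p\<leftarrow>ps. \<Sum>q\<leftarrow>ps. F p q) = complex_of_real ((norm y)\<^sup>2)"
              unfolding yy by (simp add: F_def case_prod_unfold)
            ultimately show ?thesis by (simp add: F_def case_prod_unfold)
          qed
          also have "\<dots> = (complex_of_real \<rho>)\<^sup>2 * complex_of_real k * (t * cnj t)
              - 2 * complex_of_real \<rho> * (t * cnj t) + complex_of_real ((norm y)\<^sup>2)"
            by (simp add: k(2) power2_eq_square algebra_simps)
          also have "\<dots> = complex_of_real (\<rho>\<^sup>2 * k * (cmod t)\<^sup>2 - 2 * \<rho> * (cmod t)\<^sup>2 + (norm y)\<^sup>2)"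
            unfolding complex_norm_square [symmetric] by simp
          finally show ?thesis using psd [of "(?z, x) # ps"] by (simp only: nonneg_Reals_of_real_iff)
        qed
        then have "(cmod t)\<^sup>2 \<le> k * (norm y)\<^sup>2"
          by (intro quadratic_bound k) auto
        also have "\<dots> = (sqrt k * norm y)\<^sup>2" using k by (simp add: power_mult_distrib)
        finally show ?thesis by (rule power2_le_imp_le) (simp add: k)
      qed
    qed (use k in simp)
    then obtain u where u: "u \<in> closure (fst ` G)" "norm u \<le> sqrt k" "\<And>y t. (y, t) \<in> G \<Longrightarrow> cinner u y = t"
      by blast
    have u0: "ell2_apply u i = 0" if i: "(i, x) \<notin> r - Id" for i
    proof -
      have supp_i: "ell2_apply (f b) i = 0" if "(b, x) \<in> r" "b \<noteq> x" for b
        by (rule supp [OF _ i]) (simp add: that)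
      have "ell2_apply g i = 0" if "g \<in> fst ` G" for g
      proof -
        from that obtain ps :: "(complex \<times> 'x) list" where
          "g = (\<Sum>(c, b)\<leftarrow>ps. c *\<^sub>C f b)" "\<forall>(c, b)\<in>set ps. (b, x) \<in> r - Id"
          unfolding G_def by auto
        moreover have "ell2_apply (\<Sum>(c, b)\<leftarrow>ps. c *\<^sub>C f b) i = 0" if "\<forall>(c, b)\<in>set ps. (b, x) \<in> r - Id"
          for ps :: "(complex \<times> 'x) list"
          using that by (induction ps)
            (auto simp: zero_ell2.rep_eq plus_ell2.rep_eq scaleC_ell2.rep_eq supp_i)
        ultimately show ?thesis by blast
      qed
      then have G0: "ell2_apply g i = 0" if "g \<in> fst ` G" for g using that .
      obtain s where s: "\<And>n. s n \<in> fst ` G" "s \<longlonglongrightarrow> u"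
        using u(1) unfolding closure_sequential by blast
      have "(\<lambda>n. ell2_apply (s n) i) \<longlonglongrightarrow> ell2_apply u i"
        by (rule ell2_apply_continuous [OF s(2)])
      then have "(\<lambda>n. 0) \<longlonglongrightarrow> ell2_apply u i"
        by (simp add: G0 s(1))
      then show ?thesis by (simp add: LIMSEQ_const_iff)
    qed
    have fu: "cinner (f y) u = \<kappa> y x" if "(y, x) \<in> r - Id" for y
    proof -
      have "cinner u (f y) = \<kappa> x y" using u(3) [OF GI [of "[(1, y)]"]] that by simp
      then show ?thesis by (metis cinner_commute herm)
    qed
    \<comment> \<open>The length that is missing is supplied in the fresh coordinate \<open>x\<close>.\<close>
    define t where "t = complex_of_real (sqrt (k - (norm u)\<^sup>2))"
    define w where "w = u + t *\<^sub>C ell2_unit x"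
    have "(norm u)\<^sup>2 \<le> k"
      using power_mono [OF u(2), of 2] k by simp
    then have tt: "cnj t * t = complex_of_real (k - (norm u)\<^sup>2)"
      unfolding t_def complex_cnj_complex_of_real of_real_mult [symmetric] by simp
    have ue: "cinner u (ell2_unit x) = 0" "cinner (ell2_unit x) u = 0"
    proof -
      show "cinner u (ell2_unit x) = 0" using u0 [of x] by (simp add: cinner_ell2_unit)
      then show "cinner (ell2_unit x) u = 0" by (metis cinner_commute complex_cnj_zero)
    qed
    have "P f x w"
      unfolding P_def
    proof (intro conjI allI impI)
      show "ell2_apply w i = 0" if "(i, x) \<notin> r" for i
      proof -
        have "i \<noteq> x" using that r by (auto simp: well_order_on_def linear_order_on_def
          partial_order_on_def preorder_on_def refl_on_def)
        then show ?thesis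
          using u0 [of i] that by (simp add: w_def plus_ell2.rep_eq scaleC_ell2.rep_eq ell2_apply_unit)
      qed
      show "cinner (f y) w = \<kappa> y x" if y: "(y, x) \<in> r - Id" for y
      proof -
        have "ell2_apply (f y) x = 0" by (rule supp [OF y]) simp
        then show ?thesis
          by (simp add: w_def cinner_add_right cinner_scaleC_right cinner_ell2_unit fu y del: Diff_iff)
      qed
      have "cinner (ell2_unit x) (ell2_unit x) = 1"
        by (simp add: cinner_ell2_unit ell2_apply_unit del: cinner_self_eq_0)
      then have "cinner w w = cinner u u + cnj t * t"
        by (simp add: w_def cinner_add_left cinner_add_right cinner_scaleC_left cinner_scaleC_right ue
            del: cinner_self_eq_0)
      then show "cinner w w = \<kappa> x x" by (simp add: tt cinner_self k(2))
    qed
    then show "\<exists>w. P f x w" by blast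
  qed
  then obtain v :: "'x \<Rightarrow> 'x ell2" where v: "\<And>x. P v x (v x)" by blast
  have "cinner (v a) (v b) = \<kappa> a b" for a b
  proof -
    consider "a = b" | "(a, b) \<in> r - Id" | "(b, a) \<in> r - Id" using tot by blast
    then show ?thesis
    proof cases
      case 3
      then have "cinner (v b) (v a) = \<kappa> b a" using v [of a] by (auto simp: P_def)
      then show ?thesis by (metis cinner_commute herm)
    qed (use v [of b] in \<open>auto simp: P_def\<close>)
  qed
  then show ?thesis by blast
qed

text \<open>The adjoint is constructed directly: for each \<open>z\<close>, the assignment of \<open>\<langle>z, y\<rangle>\<close> to \<open>x\<close> for \<open>(x, y)\<close> in the graph is a bounded
  functional, and \<open>S\<^sup>* z\<close> is the vector that represents it.\<close>

lemma contraction_of_graph: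
  fixes G :: "('a::complex_hilbert_space \<times> 'a) set"
  assumes K: "hilbert_subspace K" and G: "closure (fst ` G) = K" "snd ` G \<subseteq> K"
    and zero: "(0, 0) \<in> G"
    and add: "\<And>x y x' y'. (x, y) \<in> G \<Longrightarrow> (x', y') \<in> G \<Longrightarrow> (x + x', y + y') \<in> G"
    and scale: "\<And>a x y. (x, y) \<in> G \<Longrightarrow> (a *\<^sub>C x, a *\<^sub>C y) \<in> G"
    and le: "\<And>x y. (x, y) \<in> G \<Longrightarrow> norm y \<le> norm x"
  shows "\<exists>S\<in>\<B> K. \<forall>x y. (x, y) \<in> G \<longrightarrow> blinfun_apply S x = y"
proof -
  have uniq: "u = u'" if "u \<in> K" "u' \<in> K" "\<And>x y. (x, y) \<in> G \<Longrightarrow> cinner u x = cinner u' x" for u u'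
  proof -
    have "closed {x. cinner (u - u') x = 0}"
      by (intro closed_Collect_eq continuous_intros)
    moreover have "fst ` G \<subseteq> {x. cinner (u - u') x = 0}"
      using that(3) by (auto simp: cinner_diff_left)
    ultimately have "K \<subseteq> {x. cinner (u - u') x = 0}"
      using G(1) closure_minimal by blast
    moreover have "u - u' \<in> K"
      using that K by (intro subspace_diff) (auto simp: hilbert_subspace_def complex_subspace_imp_subspace)
    ultimately show ?thesis by auto
  qed
  have "\<exists>u. u \<in> K \<and> norm u \<le> norm z \<and> (\<forall>x y. (x, y) \<in> G \<longrightarrow> cinner u x = cinner z y)" for z
  proof -
    define H where "H = (\<lambda>(x, y). (x, cinner z y)) ` G"
    have HI: "(x, cinner z y) \<in> H" if "(x, y) \<in> G" for x y using that by (force simp: H_def)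
    have "\<exists>u. u \<in> closure (fst ` H) \<and> norm u \<le> norm z \<and> (\<forall>x t. (x, t) \<in> H \<longrightarrow> cinner u x = t)"
    proof (rule bounded_functional_graph)
      show "(0, 0) \<in> H" using HI [OF zero] by simp
      show "(x + x', s + t) \<in> H" if "(x, s) \<in> H" "(x', t) \<in> H" for x x' s t
      proof -
        from that obtain y y' where "(x, y) \<in> G" "s = cinner z y" "(x', y') \<in> G" "t = cinner z y'"
          by (auto simp: H_def)
        then show ?thesis using HI [OF add] by (simp add: cinner_add_right [symmetric])
      qed
      show "(a *\<^sub>C x, a * t) \<in> H" if "(x, t) \<in> H" for a x t
      proof -
        from that obtain y where "(x, y) \<in> G" "t = cinner z y" by (auto simp: H_def)
        then show ?thesis using HI [OF scale, of x y a] by (simp add: cinner_scaleC_right)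
      qed
      show "cmod t \<le> norm z * norm x" if "(x, t) \<in> H" for x t
        using that le by (auto simp: H_def intro!: order_trans [OF cinner_cauchy_schwarz] mult_left_mono)
    qed simp
    moreover have "fst ` H = fst ` G" by (force simp: H_def)
    ultimately show ?thesis using HI G(1) by metis
  qed
  then obtain R where R: "\<And>z. R z \<in> K" "\<And>z. norm (R z) \<le> norm z"
    "\<And>z x y. (x, y) \<in> G \<Longrightarrow> cinner (R z) x = cinner z y" by metis
  have Ks: "complex_subspace K" "subspace K"
    using K by (simp_all add: hilbert_subspace_def complex_subspace_imp_subspace)
  have Rs: "R (a *\<^sub>C z) = a *\<^sub>C R z" for a z
    using Ks by (intro uniq) (auto simp: R cinner_scaleC_left complex_subspace_def)
  have "bounded_linear R"
  proof (rule bounded_linear_intro)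
    show "R (x + y) = R x + R y" for x y
      using Ks by (intro uniq) (auto simp: R cinner_add_left subspace_add)
    show "R (c *\<^sub>R x) = c *\<^sub>R R x" for c x
      using Rs [of "complex_of_real c"] by (simp add: scaleC_of_real)
    show "norm (R x) \<le> norm x * 1" for x by (simp add: R)
  qed
  then have app: "blinfun_apply (Blinfun R) = R" by (rule bounded_linear_Blinfun_apply)
  define S where "S = adj (Blinfun R)"
  have lin: "clinear (Blinfun R)" by (rule clinearI) (simp add: app Rs)
  have S: "cinner z (S x) = cinner (R z) x" for z x
    unfolding S_def cinner_adj [OF lin] app ..
  have RP: "R (orth_proj K z) = R z" for z
    using G(2) by (intro uniq) (force simp: R cinner_orth_proj_left [OF K] orth_proj_fixes [OF K])+
  have "orth_proj K (S x) = S x" for x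
    by (rule cinner_eqI) (simp add: S RP flip: cinner_orth_proj_left [OF K])
  then have "S x \<in> K" for x by (metis K orth_proj_in)
  moreover have "S (orth_proj K x) = S x" for x
    by (rule cinner_eqI) (simp add: S cinner_orth_proj K R)
  ultimately have "S \<in> \<B> K"
    by (simp add: bounded_ops_iff [OF K] S_def clinear_adj lin)
  moreover have "S x = y" if "(x, y) \<in> G" for x y
    by (rule cinner_eqI) (simp add: S R that)
  ultimately show ?thesis by blast
qed

section \<open>Construction of a normal extension\<close>

text \<open>The vector \<open>v X h\<close> plays the role of \<open>\<pi>(X) V h\<close> in a minimal normal extension.  There these vectors are total,
  have the prescribed inner products \<open>\<langle>V h, \<pi>(X\<^sup>* Y) V k\<rangle> = \<langle>h, \<Phi>(X\<^sup>* Y) k\<rangle>\<close>, and satisfy \<open>N \<pi>(X) V h = \<pi>(X) V T h\<close> and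
  \<open>N\<^sup>* \<pi>(X) V h = \<pi>(T\<^sup>* X) V h\<close>; so the extension can be rebuilt from them.\<close>

locale toeplitz_dilation = spherical_family UNIV \<Gamma> J T
  for \<Gamma> :: "'g set" and J :: "'g \<Rightarrow> 'j set" and T :: "'g \<Rightarrow> 'j \<Rightarrow> 'h::complex_hilbert_space \<Rightarrow>\<^sub>L 'h" +
  fixes v :: "('h \<Rightarrow>\<^sub>L 'h) \<Rightarrow> 'h \<Rightarrow> 'k::complex_hilbert_space"
  assumes cinner_v: "X \<in> toeplitz_on \<Longrightarrow> Y \<in> toeplitz_on \<Longrightarrow>
    cinner (v X h) (v Y k) = cinner h (toeplitz_proj (adj X o\<^sub>L Y) k)"
begin

sublocale \<Phi>: ucp_map UNIV UNIV toeplitz_proj by (rule ucp_toeplitz_proj)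

lemma adj_compose_in: "X \<in> toeplitz_on \<Longrightarrow> Y \<in> toeplitz_on \<Longrightarrow> adj X o\<^sub>L Y \<in> \<B> UNIV"
  by (intro BK toeplitz_onD)

lemma v_scale: "X \<in> toeplitz_on \<Longrightarrow> v X (a *\<^sub>C h) = a *\<^sub>C v X h"
proof -
  assume X: "X \<in> toeplitz_on"
  let ?d = "v X (a *\<^sub>C h) - a *\<^sub>C v X h"
  have "cinner ?d ?d = 0"
    by (simp add: cinner_diff_left cinner_diff_right cinner_scaleC_left cinner_scaleC_right cinner_v X
        clinear_scaleC \<Phi>.lin adj_compose_in del: cinner_self_eq_0)
  then show ?thesis by simp
qed

lemma v_add: "X \<in> toeplitz_on \<Longrightarrow> v X (h + k) = v X h + v X k"
proof -
  assume X: "X \<in> toeplitz_on"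
  let ?d = "v X (h + k) - (v X h + v X k)"
  have "cinner ?d ?d = 0"
    by (simp add: cinner_diff_left cinner_diff_right cinner_add_left cinner_add_right cinner_v X
        blinfun.add_right del: cinner_self_eq_0)
  then show ?thesis by simp
qed

definition span_v :: "'k set" where
  "span_v = {\<Sum>(X, h)\<leftarrow>ps. v X h | ps. \<forall>(X, h)\<in>set ps. X \<in> toeplitz_on}"

definition K :: "'k set" where
  "K = closure span_v"

lemma span_vI: "\<forall>(X, h)\<in>set ps. X \<in> toeplitz_on \<Longrightarrow> (\<Sum>(X, h)\<leftarrow>ps. v X h) \<in> span_v"
  by (auto simp: span_v_def)

lemma v_in_span: "X \<in> toeplitz_on \<Longrightarrow> v X h \<in> span_v"
  using span_vI [of "[(X, h)]"] by simp

lemma v_in_K: "X \<in> toeplitz_on \<Longrightarrow> v X h \<in> K"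
  using v_in_span closure_subset by (auto simp: K_def)

lemma scale_sum_v:
  assumes "\<forall>(X, h)\<in>set ps. X \<in> toeplitz_on"
  shows "a *\<^sub>C (\<Sum>(X, h)\<leftarrow>ps. v X h) = (\<Sum>(X, h)\<leftarrow>map (\<lambda>(X, h). (X, a *\<^sub>C h)) ps. v X h)"
  using assms by (induction ps) (auto simp: scaleC_add_right v_scale)

lemma complex_subspace_span_v: "complex_subspace span_v"
  unfolding complex_subspace_def
proof (intro conjI ballI allI)
  show "0 \<in> span_v" using span_vI [of "[]"] by simp
  fix x assume "x \<in> span_v"
  then obtain ps where x: "x = (\<Sum>(X, h)\<leftarrow>ps. v X h)" "\<forall>(X, h)\<in>set ps. X \<in> toeplitz_on"
    by (auto simp: span_v_def)
  have "\<forall>(X, h)\<in>set (map (\<lambda>(X, h). (X, a *\<^sub>C h)) ps). X \<in> toeplitz_on" for a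
    using x(2) by auto
  then show "a *\<^sub>C x \<in> span_v" for a
    unfolding x(1) scale_sum_v [OF x(2)] by (rule span_vI)
  fix y assume "y \<in> span_v"
  then obtain qs where y: "y = (\<Sum>(X, h)\<leftarrow>qs. v X h)" "\<forall>(X, h)\<in>set qs. X \<in> toeplitz_on"
    by (auto simp: span_v_def)
  show "x + y \<in> span_v"
    using span_vI [of "ps @ qs"] x y by auto
qed

lemma hilbert_subspace_K: "hilbert_subspace K"
  unfolding hilbert_subspace_def K_def
  by (simp add: closure_complex_subspace complex_subspace_span_v)

lemma K_eqI:
  assumes xy: "x \<in> K" "y \<in> K"
    and eq: "\<And>Y k. Y \<in> toeplitz_on \<Longrightarrow> cinner (v Y k) x = cinner (v Y k) y"
  shows "x = y"
proof -
  have "span_v \<subseteq> {z. cinner z (x - y) = 0}"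
  proof
    fix z assume "z \<in> span_v"
    then obtain ps where z: "z = (\<Sum>(X, h)\<leftarrow>ps. v X h)" "\<forall>(X, h)\<in>set ps. X \<in> toeplitz_on"
      by (auto simp: span_v_def)
    have "cinner (\<Sum>(X, h)\<leftarrow>ps. v X h) (x - y) = 0"
      using z(2) by (induction ps) (auto simp: cinner_add_left cinner_diff_right eq)
    then show "z \<in> {z. cinner z (x - y) = 0}" by (simp add: z(1))
  qed
  moreover have "closed {z. cinner z (x - y) = 0}"
    by (intro closed_Collect_eq continuous_intros)
  ultimately have "K \<subseteq> {z. cinner z (x - y) = 0}"
    unfolding K_def by (rule closure_minimal)
  moreover have "x - y \<in> K"
    using xy hilbert_subspace_K
    by (intro subspace_diff) (auto simp: hilbert_subspace_def complex_subspace_imp_subspace)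
  ultimately show ?thesis by auto
qed

lemma operator_eqI:
  assumes A: "A \<in> \<B> K" and B: "B \<in> \<B> K"
    and eq: "\<And>X h. X \<in> toeplitz_on \<Longrightarrow> blinfun_apply A (v X h) = blinfun_apply B (v X h)"
  shows "A = B"
proof (rule blinfun_eqI)
  fix x
  have "span_v \<subseteq> {z. A z = B z}"
  proof
    fix z assume "z \<in> span_v"
    then obtain ps where z: "z = (\<Sum>(X, h)\<leftarrow>ps. v X h)" "\<forall>(X, h)\<in>set ps. X \<in> toeplitz_on"
      by (auto simp: span_v_def)
    have "A (\<Sum>(X, h)\<leftarrow>ps. v X h) = B (\<Sum>(X, h)\<leftarrow>ps. v X h)"
      using z(2) by (induction ps) (auto simp: blinfun.add_right eq)
    then show "z \<in> {z. A z = B z}" by (simp add: z(1))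
  qed
  moreover have "closed {z. A z = B z}"
    by (intro closed_Collect_eq continuous_intros)
  ultimately have "K \<subseteq> {z. A z = B z}"
    unfolding K_def by (rule closure_minimal)
  then have "A (orth_proj K x) = B (orth_proj K x)"
    using orth_proj_in [OF hilbert_subspace_K] by blast
  then show "A x = B x"
    using A B by (simp add: bounded_ops_iff [OF hilbert_subspace_K])
qed

definition shift :: "'g \<Rightarrow> 'j \<Rightarrow> (('h \<Rightarrow>\<^sub>L 'h) \<times> 'h) list \<Rightarrow> (('h \<Rightarrow>\<^sub>L 'h) \<times> 'h) list" where
  "shift \<alpha> j ps = map (\<lambda>(X, h). (X, T \<alpha> j h)) ps"

lemma shift_valid: "\<forall>(X, h)\<in>set ps. X \<in> toeplitz_on \<Longrightarrow> \<forall>(X, h)\<in>set (shift \<alpha> j ps). X \<in> toeplitz_on"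
  by (auto simp: shift_def)

text \<open>Because \<open>\<Phi>(X\<^sup>* Y)\<close> is a Toeplitz operator, the operators \<open>v X h \<mapsto> v X (T h)\<close> together form a
  spherical isometry on the span, and in particular each of them is a contraction.\<close>

lemma has_sum_shift:
  assumes \<alpha>: "\<alpha> \<in> \<Gamma>" and ps: "\<forall>(X, h)\<in>set ps. X \<in> toeplitz_on"
  shows "((\<lambda>j. (norm (\<Sum>(X, h)\<leftarrow>shift \<alpha> j ps. v X h))\<^sup>2) has_sum (norm (\<Sum>(X, h)\<leftarrow>ps. v X h))\<^sup>2) (J \<alpha>)"
proof -
  have exp: "cinner (\<Sum>(X, h)\<leftarrow>qs. v X h) (\<Sum>(X, h)\<leftarrow>qs. v X h)
      = (\<Sum>p\<leftarrow>qs. \<Sum>q\<leftarrow>qs. cinner (snd p) (toeplitz_proj (adj (fst p) o\<^sub>L fst q) (snd q)))"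
    if qs: "\<forall>(X, h)\<in>set qs. X \<in> toeplitz_on" for qs
  proof -
    have "fst p \<in> toeplitz_on" if "p \<in> set qs" for p using qs that by (auto simp: case_prod_unfold)
    then show ?thesis
      unfolding cinner_sum_list_left unfolding cinner_sum_list_right
      by (intro arg_cong [where f = sum_list] map_cong refl) (simp add: case_prod_unfold cinner_v)
  qed
  have "((\<lambda>j. \<Sum>p\<leftarrow>ps. \<Sum>q\<leftarrow>ps. cinner (T \<alpha> j (snd p)) (toeplitz_proj (adj (fst p) o\<^sub>L fst q) (T \<alpha> j (snd q))))
      has_sum (\<Sum>p\<leftarrow>ps. \<Sum>q\<leftarrow>ps. cinner (snd p) (toeplitz_proj (adj (fst p) o\<^sub>L fst q) (snd q)))) (J \<alpha>)"
  proof (intro has_sum_sum_list)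
    fix p q assume "p \<in> set ps" "q \<in> set ps"
    then have X: "fst p \<in> toeplitz_on" "fst q \<in> toeplitz_on" using ps by (auto simp: case_prod_unfold)
    have Z: "toeplitz_proj (adj (fst p) o\<^sub>L fst q) \<in> toeplitz_on"
      by (intro toeplitz_proj_in adj_compose_in X)
    show "((\<lambda>j. cinner (T \<alpha> j (snd p)) (toeplitz_proj (adj (fst p) o\<^sub>L fst q) (T \<alpha> j (snd q)))) has_sum
        cinner (snd p) (toeplitz_proj (adj (fst p) o\<^sub>L fst q) (snd q))) (J \<alpha>)"
      using has_sum_conj_sum [OF \<alpha> toeplitz_onD(1) [OF Z], of "snd p" "snd q"]
      by (simp add: toeplitz_onD(2) [OF Z \<alpha>])
  qed
  also have "(\<Sum>p\<leftarrow>ps. \<Sum>q\<leftarrow>ps. cinner (snd p) (toeplitz_proj (adj (fst p) o\<^sub>L fst q) (snd q)))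
      = complex_of_real ((norm (\<Sum>(X, h)\<leftarrow>ps. v X h))\<^sup>2)"
    unfolding exp [OF ps, symmetric] by (rule cinner_self)
  also have "(\<lambda>j. \<Sum>p\<leftarrow>ps. \<Sum>q\<leftarrow>ps. cinner (T \<alpha> j (snd p)) (toeplitz_proj (adj (fst p) o\<^sub>L fst q) (T \<alpha> j (snd q))))
      = (\<lambda>j. complex_of_real ((norm (\<Sum>(X, h)\<leftarrow>shift \<alpha> j ps. v X h))\<^sup>2))"
  proof
    fix j
    have "complex_of_real ((norm (\<Sum>(X, h)\<leftarrow>shift \<alpha> j ps. v X h))\<^sup>2)
        = (\<Sum>p\<leftarrow>shift \<alpha> j ps. \<Sum>q\<leftarrow>shift \<alpha> j ps. cinner (snd p) (toeplitz_proj (adj (fst p) o\<^sub>L fst q) (snd q)))"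
      unfolding exp [OF shift_valid [OF ps], symmetric] by (rule cinner_self [symmetric])
    then show "(\<Sum>p\<leftarrow>ps. \<Sum>q\<leftarrow>ps. cinner (T \<alpha> j (snd p)) (toeplitz_proj (adj (fst p) o\<^sub>L fst q) (T \<alpha> j (snd q))))
        = complex_of_real ((norm (\<Sum>(X, h)\<leftarrow>shift \<alpha> j ps. v X h))\<^sup>2)"
      by (simp add: shift_def case_prod_unfold comp_def)
  qed
  finally show ?thesis
    by (simp only: has_sum_of_real_iff)
qed

lemma norm_shift_le:
  assumes \<alpha>: "\<alpha> \<in> \<Gamma>" and j: "j \<in> J \<alpha>" and ps: "\<forall>(X, h)\<in>set ps. X \<in> toeplitz_on"
  shows "norm (\<Sum>(X, h)\<leftarrow>shift \<alpha> j ps. v X h) \<le> norm (\<Sum>(X, h)\<leftarrow>ps. v X h)"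
proof -
  have "(norm (\<Sum>(X, h)\<leftarrow>shift \<alpha> j ps. v X h))\<^sup>2 \<le> (norm (\<Sum>(X, h)\<leftarrow>ps. v X h))\<^sup>2"
    using finite_sum_le_has_sum [OF has_sum_shift [OF \<alpha> ps], of "{j}"] j by simp
  then show ?thesis by (rule power2_le_imp_le) simp
qed

lemma dilated_operator_exists:
  assumes \<alpha>: "\<alpha> \<in> \<Gamma>" and j: "j \<in> J \<alpha>"
  shows "\<exists>S\<in>\<B> K. \<forall>X\<in>toeplitz_on. \<forall>h. blinfun_apply S (v X h) = v X (T \<alpha> j h)"
proof -
  define G where "G = {(\<Sum>(X, h)\<leftarrow>ps. v X h, \<Sum>(X, h)\<leftarrow>shift \<alpha> j ps. v X h) | ps.
    \<forall>(X, h)\<in>set ps. X \<in> toeplitz_on}"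
  have GI: "(\<Sum>(X, h)\<leftarrow>ps. v X h, \<Sum>(X, h)\<leftarrow>shift \<alpha> j ps. v X h) \<in> G"
    if "\<forall>(X, h)\<in>set ps. X \<in> toeplitz_on" for ps
    using that by (auto simp: G_def)
  have GE: "\<exists>ps. x = (\<Sum>(X, h)\<leftarrow>ps. v X h) \<and> y = (\<Sum>(X, h)\<leftarrow>shift \<alpha> j ps. v X h) \<and>
      (\<forall>(X, h)\<in>set ps. X \<in> toeplitz_on)" if "(x, y) \<in> G" for x y
    using that by (auto simp: G_def)
  have "\<exists>S\<in>\<B> K. \<forall>x y. (x, y) \<in> G \<longrightarrow> blinfun_apply S x = y"
  proof (rule contraction_of_graph [OF hilbert_subspace_K])
    have "fst ` G = span_v"
      unfolding G_def span_v_def by force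
    then show "closure (fst ` G) = K" by (simp add: K_def)
    show "snd ` G \<subseteq> K"
    proof
      fix y assume "y \<in> snd ` G"
      then obtain ps where "y = (\<Sum>(X, h)\<leftarrow>shift \<alpha> j ps. v X h)" "\<forall>(X, h)\<in>set ps. X \<in> toeplitz_on"
        unfolding G_def by auto
      then have "y \<in> span_v" using span_vI [OF shift_valid] by simp
      then show "y \<in> K" using closure_subset by (auto simp: K_def)
    qed
    show "(0, 0) \<in> G" using GI [of "[]"] by (simp add: shift_def)
    show "(x + x', y + y') \<in> G" if G: "(x, y) \<in> G" "(x', y') \<in> G" for x y x' y'
    proof -
      obtain ps where ps: "x = (\<Sum>(X, h)\<leftarrow>ps. v X h)" "y = (\<Sum>(X, h)\<leftarrow>shift \<alpha> j ps. v X h)"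
        "\<forall>(X, h)\<in>set ps. X \<in> toeplitz_on" using GE [OF G(1)] by blast
      obtain qs where qs: "x' = (\<Sum>(X, h)\<leftarrow>qs. v X h)" "y' = (\<Sum>(X, h)\<leftarrow>shift \<alpha> j qs. v X h)"
        "\<forall>(X, h)\<in>set qs. X \<in> toeplitz_on" using GE [OF G(2)] by blast
      have "\<forall>(X, h)\<in>set (ps @ qs). X \<in> toeplitz_on" using ps(3) qs(3) by auto
      from GI [OF this] show ?thesis by (simp add: ps(1,2) qs(1,2) shift_def)
    qed
    show "(a *\<^sub>C x, a *\<^sub>C y) \<in> G" if G: "(x, y) \<in> G" for a x y
    proof -
      obtain ps where ps: "x = (\<Sum>(X, h)\<leftarrow>ps. v X h)" "y = (\<Sum>(X, h)\<leftarrow>shift \<alpha> j ps. v X h)"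
        "\<forall>(X, h)\<in>set ps. X \<in> toeplitz_on" using GE [OF G] by blast
      let ?qs = "map (\<lambda>(X, h). (X, a *\<^sub>C h)) ps"
      have v: "\<forall>(X, h)\<in>set ?qs. X \<in> toeplitz_on" using ps(3) by auto
      have "shift \<alpha> j ?qs = map (\<lambda>(X, h). (X, a *\<^sub>C h)) (shift \<alpha> j ps)"
        by (simp add: shift_def case_prod_unfold comp_def clinear_scaleC N_clinear \<alpha> j)
      with GI [OF v] show ?thesis
        unfolding ps(1,2) scale_sum_v [OF ps(3)] scale_sum_v [OF shift_valid [OF ps(3)]] by simp
    qed
    show "norm y \<le> norm x" if G: "(x, y) \<in> G" for x y
      using GE [OF G] norm_shift_le [OF \<alpha> j] by blast
  qed
  then obtain S where S: "S \<in> \<B> K" "\<And>x y. (x, y) \<in> G \<Longrightarrow> blinfun_apply S x = y" by blast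
  have "S (v X h) = v X (T \<alpha> j h)" if "X \<in> toeplitz_on" for X h
    using S(2) [OF GI [of "[(X, h)]"]] that by (simp add: shift_def)
  with S(1) show ?thesis by blast
qed

definition N :: "'g \<Rightarrow> 'j \<Rightarrow> 'k \<Rightarrow>\<^sub>L 'k" where
  "N \<alpha> j = (SOME S. S \<in> \<B> K \<and> (\<forall>X\<in>toeplitz_on. \<forall>h. blinfun_apply S (v X h) = v X (T \<alpha> j h)))"

lemma N:
  assumes "\<alpha> \<in> \<Gamma>" "j \<in> J \<alpha>"
  shows "N \<alpha> j \<in> \<B> K" "X \<in> toeplitz_on \<Longrightarrow> N \<alpha> j (v X h) = v X (T \<alpha> j h)"
proof -
  have "N \<alpha> j \<in> \<B> K \<and> (\<forall>X\<in>toeplitz_on. \<forall>h. N \<alpha> j (v X h) = v X (T \<alpha> j h))"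
    unfolding N_def by (rule someI_ex) (use dilated_operator_exists [OF assms] in blast)
  then show "N \<alpha> j \<in> \<B> K" "X \<in> toeplitz_on \<Longrightarrow> N \<alpha> j (v X h) = v X (T \<alpha> j h)" by auto
qed

lemmas KK = bounded_ops_closure [OF hilbert_subspace_K]

lemma N_lin: "\<alpha> \<in> \<Gamma> \<Longrightarrow> j \<in> J \<alpha> \<Longrightarrow> clinear (N \<alpha> j)"
  using N(1) bounded_ops_clinear by blast

lemma N_shift:
  assumes \<alpha>: "\<alpha> \<in> \<Gamma>" "j \<in> J \<alpha>" and ps: "\<forall>(X, h)\<in>set ps. X \<in> toeplitz_on"
  shows "N \<alpha> j (\<Sum>(X, h)\<leftarrow>ps. v X h) = (\<Sum>(X, h)\<leftarrow>shift \<alpha> j ps. v X h)"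
  using ps by (induction ps) (auto simp: shift_def blinfun.add_right N \<alpha>)

text \<open>The adjoint acts by \<open>v X h \<mapsto> v (T\<^sup>* X) h\<close>, on the other argument of \<open>v\<close>; hence it commutes
  with the operator itself.  In terms of inner products this says \<open>\<Phi>(X\<^sup>* T Y) = \<Phi>(X\<^sup>* Y) T\<close>, which holds because
  commutators with Toeplitz operators are negligible.\<close>

lemma adj_N:
  assumes \<alpha>: "\<alpha> \<in> \<Gamma>" "j \<in> J \<alpha>" and X: "X \<in> toeplitz_on"
  shows "adj (N \<alpha> j) (v X h) = v (adj (T \<alpha> j) o\<^sub>L X) h"
proof (rule K_eqI)
  note TX = toeplitz_on_adj_compose [OF X \<alpha>]
  show "adj (N \<alpha> j) (v X h) \<in> K"
    using KK(6) [OF N(1) [OF \<alpha>]] by (simp add: bounded_ops_iff [OF hilbert_subspace_K])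
  show "v (adj (T \<alpha> j) o\<^sub>L X) h \<in> K" by (rule v_in_K [OF TX])
  fix Y k assume Y: "Y \<in> toeplitz_on"
  let ?A = "adj (T \<alpha> j)"
  note B = toeplitz_onD(1) [OF X] toeplitz_onD(1) [OF Y] N_in [OF \<alpha>]
  have "toeplitz_proj (adj X o\<^sub>L (T \<alpha> j o\<^sub>L Y)) = toeplitz_proj (adj X o\<^sub>L (Y o\<^sub>L T \<alpha> j))"
    by (intro commutator_negligible ucp_toeplitz_proj toeplitz_proj_shift Y \<alpha> BK B)
  also have "\<dots> = toeplitz_proj (adj X o\<^sub>L Y) o\<^sub>L T \<alpha> j"
    unfolding blinfun_compose_assoc [symmetric]
    by (intro fixing_map_right_module ucp_toeplitz_proj toeplitz_proj_fixes \<alpha> adj_compose_in X Y)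
  finally have "adj (toeplitz_proj (adj X o\<^sub>L (T \<alpha> j o\<^sub>L Y))) = adj (toeplitz_proj (adj X o\<^sub>L Y) o\<^sub>L T \<alpha> j)"
    by simp
  moreover have "adj (toeplitz_proj (adj X o\<^sub>L (T \<alpha> j o\<^sub>L Y))) = toeplitz_proj (adj Y o\<^sub>L (?A o\<^sub>L X))"
    using B by (simp add: \<Phi>.star [symmetric] BK adj_compose clinear_intros bounded_ops_clinear [where K = UNIV]
        adj_adj blinfun_compose_assoc)
  moreover have "adj (toeplitz_proj (adj X o\<^sub>L Y) o\<^sub>L T \<alpha> j) = ?A o\<^sub>L toeplitz_proj (adj Y o\<^sub>L X)"
    using B by (simp add: adj_compose \<Phi>.lin BK \<Phi>.star [symmetric] clinear_intros bounded_ops_clinear [where K = UNIV] adj_adj)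
  ultimately have eq: "toeplitz_proj (adj Y o\<^sub>L (?A o\<^sub>L X)) = ?A o\<^sub>L toeplitz_proj (adj Y o\<^sub>L X)" by simp
  have "cinner (v Y k) (adj (N \<alpha> j) (v X h)) = cinner (v Y (T \<alpha> j k)) (v X h)"
    by (simp add: cinner_adj N_lin N \<alpha> Y)
  also have "\<dots> = cinner (v Y k) (v (?A o\<^sub>L X) h)"
    by (simp add: cinner_v X Y TX eq cinner_adj N_clinear \<alpha>)
  finally show "cinner (v Y k) (adj (N \<alpha> j) (v X h)) = cinner (v Y k) (v (?A o\<^sub>L X) h)" .
qed

lemma normal_N:
  assumes \<alpha>: "\<alpha> \<in> \<Gamma>" "j \<in> J \<alpha>"
  shows "normal_op (N \<alpha> j)"
  unfolding normal_op_def
  by (rule operator_eqI) (simp_all add: KK N adj_N \<alpha> toeplitz_on_adj_compose)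

lemma commuting_N:
  assumes "\<alpha> \<in> \<Gamma>" "i \<in> J \<alpha>" "\<beta> \<in> \<Gamma>" "j \<in> J \<beta>"
  shows "N \<alpha> i o\<^sub>L N \<beta> j = N \<beta> j o\<^sub>L N \<alpha> i"
  by (rule operator_eqI) (simp_all add: KK N assms N_apply_commute [OF assms])

text \<open>The finite partial sums are bounded by the unit on the span of the vectors \<open>v X h\<close>, and thus everywhere; hence the sum
  exists, and it suffices to determine it on these vectors.\<close>

lemma spherical_N:
  assumes \<alpha>: "\<alpha> \<in> \<Gamma>"
  shows "wot_has_sum (\<lambda>j. adj (N \<alpha> j) o\<^sub>L N \<alpha> j) (orth_proj K) (J \<alpha>)"
proof -
  note K = hilbert_subspace_K
  have NP: "N \<alpha> j (orth_proj K x) = N \<alpha> j x" if "j \<in> J \<alpha>" for j x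
    using N(1) [OF \<alpha> that] by (simp add: bounded_ops_iff [OF K])
  have row: "(\<Sum>j\<in>F. (norm (N \<alpha> j x))\<^sup>2) \<le> (norm x)\<^sup>2" if F: "finite F" "F \<subseteq> J \<alpha>" for F x
  proof -
    have "span_v \<subseteq> {x. (\<Sum>j\<in>F. (norm (N \<alpha> j x))\<^sup>2) \<le> (norm x)\<^sup>2}"
    proof
      fix x assume "x \<in> span_v"
      then obtain ps where x: "x = (\<Sum>(X, h)\<leftarrow>ps. v X h)" "\<forall>(X, h)\<in>set ps. X \<in> toeplitz_on"
        by (auto simp: span_v_def)
      have "(\<Sum>j\<in>F. (norm (\<Sum>(X, h)\<leftarrow>shift \<alpha> j ps. v X h))\<^sup>2) \<le> (norm x)\<^sup>2"
        unfolding x(1) using F by (intro finite_sum_le_has_sum [OF has_sum_shift [OF \<alpha> x(2)]]) auto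
      moreover have "(\<Sum>j\<in>F. (norm (N \<alpha> j x))\<^sup>2) = (\<Sum>j\<in>F. (norm (\<Sum>(X, h)\<leftarrow>shift \<alpha> j ps. v X h))\<^sup>2)"
        using F by (intro sum.cong refl) (auto simp: x(1) N_shift [OF \<alpha> _ x(2)])
      ultimately show "x \<in> {x. (\<Sum>j\<in>F. (norm (N \<alpha> j x))\<^sup>2) \<le> (norm x)\<^sup>2}" by simp
    qed
    moreover have "closed {x. (\<Sum>j\<in>F. (norm (N \<alpha> j x))\<^sup>2) \<le> (norm x)\<^sup>2}"
      by (intro closed_Collect_le continuous_intros)
    ultimately have "K \<subseteq> {x. (\<Sum>j\<in>F. (norm (N \<alpha> j x))\<^sup>2) \<le> (norm x)\<^sup>2}"
      unfolding K_def by (rule closure_minimal)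
    then have "(\<Sum>j\<in>F. (norm (N \<alpha> j (orth_proj K x)))\<^sup>2) \<le> (norm (orth_proj K x))\<^sup>2"
      using orth_proj_in [OF K] by blast
    also have "\<dots> \<le> (norm x)\<^sup>2" by (intro power_mono norm_orth_proj_le K) simp
    also have "(\<Sum>j\<in>F. (norm (N \<alpha> j (orth_proj K x)))\<^sup>2) = (\<Sum>j\<in>F. (norm (N \<alpha> j x))\<^sup>2)"
      using F by (intro sum.cong refl) (auto simp: NP)
    finally show ?thesis .
  qed
  obtain Z where Z: "clinear Z"
    "\<And>x y. ((\<lambda>j. cinner (N \<alpha> j x) (id_blinfun (N \<alpha> j y))) has_sum cinner x (Z y)) (J \<alpha>)"
    using row_contraction_sum_exists [OF row N_lin [OF \<alpha>] clinear_id] by blast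
  have Zs: "((\<lambda>j. cinner (N \<alpha> j x) (N \<alpha> j y)) has_sum cinner x (Z y)) (J \<alpha>)" for x y
    using Z(2) by simp
  have "cinner x (Z (orth_proj K y)) = cinner x (Z y)" for x y
    by (rule has_sum_unique [OF Zs], rule has_sum_cong [THEN iffD1, OF _ Zs]) (simp add: NP)
  moreover have "cinner (orth_proj K x) (Z y) = cinner x (Z y)" for x y
    by (rule has_sum_unique [OF Zs], rule has_sum_cong [THEN iffD1, OF _ Zs]) (simp add: NP)
  then have "orth_proj K (Z y) = Z y" for y
    by (intro cinner_eqI) (simp flip: cinner_orth_proj_left [OF K])
  then have ZK: "Z y \<in> K" for y by (metis orth_proj_in [OF K])
  ultimately have ZB: "Z \<in> \<B> K"
    unfolding bounded_ops_iff [OF K] using Z(1) by (auto intro: cinner_eqI)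
  have "Z = orth_proj K"
  proof (rule operator_eqI [OF ZB orth_proj_bounded_ops [OF K]])
    fix Y k assume Y: "Y \<in> toeplitz_on"
    have "Z (v Y k) = v Y k"
    proof (rule K_eqI [OF ZK v_in_K [OF Y]])
      fix X h assume X: "X \<in> toeplitz_on"
      have TZ: "toeplitz_proj (adj X o\<^sub>L Y) \<in> toeplitz_on"
        by (intro toeplitz_proj_in adj_compose_in X Y)
      have "((\<lambda>j. cinner (N \<alpha> j (v X h)) (N \<alpha> j (v Y k))) has_sum cinner (v X h) (v Y k)) (J \<alpha>)"
        using has_sum_conj_sum [OF \<alpha> toeplitz_onD(1) [OF TZ], of h k]
        by (simp add: toeplitz_onD(2) [OF TZ \<alpha>] N \<alpha> X Y cinner_v cong: has_sum_cong2)
      then show "cinner (v X h) (Z (v Y k)) = cinner (v X h) (v Y k)"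
        by (rule has_sum_unique [OF Zs])
    qed
    then show "Z (v Y k) = orth_proj K (v Y k)"
      by (simp add: orth_proj_fixes K v_in_K Y)
  qed
  then show ?thesis
    using Zs N_lin [OF \<alpha>] by (simp add: wot_has_sum_def cinner_adj cong: has_sum_cong2)
qed

lemma id_toeplitz: "id_blinfun \<in> toeplitz_on"
  using toeplitz_on_unit by (simp add: orth_proj_UNIV)

theorem normal_extension_dilation: "\<exists>V. normal_extension \<Gamma> J T K V N"
proof -
  have id_id: "id_blinfun o\<^sub>L id_blinfun = (id_blinfun :: 'h \<Rightarrow>\<^sub>L 'h)"
    by (rule blinfun_eqI) simp
  have nv: "norm (v id_blinfun h) = norm h" for h
  proof -
    have "cinner (v id_blinfun h) (v id_blinfun h) = cinner h h"
      using \<Phi>.unital by (simp add: id_id cinner_v id_toeplitz adj_id orth_proj_UNIV del: cinner_self_eq_0)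
    then show ?thesis by (simp add: cinner_self power2_eq_iff_nonneg flip: of_real_power)
  qed
  have "bounded_linear (v id_blinfun)"
  proof (rule bounded_linear_intro)
    show "v id_blinfun (x + y) = v id_blinfun x + v id_blinfun y" for x y
      by (rule v_add [OF id_toeplitz])
    show "v id_blinfun (r *\<^sub>R x) = r *\<^sub>R v id_blinfun x" for r x
      using v_scale [OF id_toeplitz, of "complex_of_real r" x] by (simp add: scaleC_of_real)
    show "norm (v id_blinfun x) \<le> norm x * 1" for x by (simp add: nv)
  qed
  then have app: "blinfun_apply (Blinfun (v id_blinfun)) = v id_blinfun"
    by (rule bounded_linear_Blinfun_apply)
  have "normal_extension \<Gamma> J T K (Blinfun (v id_blinfun)) N"
    unfolding normal_extension_def
  proof (intro conjI ballI)
    show "isometric_embedding (Blinfun (v id_blinfun)) K"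
      unfolding isometric_embedding_def app complex_linear_on_def
      by (auto simp: nv v_add v_scale id_toeplitz v_in_K)
    show "commuting_spherical_family K \<Gamma> J N"
      unfolding commuting_spherical_family_def spherical_isometry_def commuting_ops_def family_ops_def
      using spherical_N N(1) commuting_N by auto
    show "restricts_to (Blinfun (v id_blinfun)) (N \<alpha> j) (T \<alpha> j)" if "\<alpha> \<in> \<Gamma>" "j \<in> J \<alpha>" for \<alpha> j
      using that by (simp add: restricts_to_def app N id_toeplitz)
  qed (simp_all add: hilbert_subspace_K normal_N)
  then show ?thesis by blast
qed

end

text \<open>The pair \<open>(X, h)\<close> is encoded by the function that is \<open>h\<close> at \<open>X\<close> and \<open>0\<close> elsewhere.  All pairs with
  \<open>h = 0\<close> get the same code, which does no harm because the vector \<open>v X 0\<close> vanishes anyway.\<close>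

theorem normal_extension_exists:
  fixes T :: "'g \<Rightarrow> 'j \<Rightarrow> 'h::complex_hilbert_space \<Rightarrow>\<^sub>L 'h"
  assumes "commuting_spherical_family UNIV \<Gamma> J T"
  shows "\<exists>(K :: (('h \<Rightarrow>\<^sub>L 'h) \<Rightarrow> 'h) ell2 set) V N. normal_extension \<Gamma> J T K V N"
proof -
  interpret spherical_family UNIV \<Gamma> J T
    by unfold_locales (simp_all add: hilbert_subspace_UNIV assms)
  interpret \<Phi>: ucp_map UNIV UNIV toeplitz_proj by (rule ucp_toeplitz_proj)
  define code :: "('h \<Rightarrow>\<^sub>L 'h) \<times> 'h \<Rightarrow> (('h \<Rightarrow>\<^sub>L 'h) \<Rightarrow> 'h)"
    where "code = (\<lambda>(X, h) Y. if Y = X then h else 0)"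
  define decode where "decode = (\<lambda>f. SOME p. code p = f)"
  define op where "op = (\<lambda>f. if fst (decode f) \<in> toeplitz_on then fst (decode f) else 0)"
  define \<kappa> where "\<kappa> = (\<lambda>f g. cinner (snd (decode f)) (toeplitz_proj (adj (op f) o\<^sub>L op g) (snd (decode g))))"
  have op: "op f \<in> \<B> UNIV" for f
    by (auto simp: op_def BK toeplitz_onD)
  have dec: "code (decode (code p)) = code p" for p
    unfolding decode_def by (rule someI [of _ p]) simp
  have code_inj: "X = X' \<and> h = h'" if "code (X, h) = code (X', h')" "h \<noteq> 0" for X X' h h'
    using fun_cong [OF that(1), of X] that(2) by (auto simp: code_def split: if_splits)
  have code_zero: "h' = 0" if "code (X', h') = code (X, 0)" for X X' h'
    using fun_cong [OF that, of X'] by (auto simp: code_def split: if_splits)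
  have decode_code: "snd (decode (code (X, h))) = h \<and> (h \<noteq> 0 \<longrightarrow> fst (decode (code (X, h))) = X)" for X h
  proof -
    have "code (fst (decode (code (X, h))), snd (decode (code (X, h)))) = code (X, h)"
      using dec by simp
    then show ?thesis using code_inj code_zero by (cases "h = 0") (metis, metis)
  qed
  have "\<exists>v :: (('h \<Rightarrow>\<^sub>L 'h) \<Rightarrow> 'h) \<Rightarrow> (('h \<Rightarrow>\<^sub>L 'h) \<Rightarrow> 'h) ell2. \<forall>a b. cinner (v a) (v b) = \<kappa> a b"
  proof (rule kernel_realization)
    fix f g
    have "adj (toeplitz_proj (adj (op g) o\<^sub>L op f)) = toeplitz_proj (adj (op f) o\<^sub>L op g)"
      using op by (simp add: \<Phi>.star [symmetric] BK adj_compose clinear_intros adj_adj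
          bounded_ops_clinear [where K = UNIV])
    then show "\<kappa> f g = cnj (\<kappa> g f)"
      unfolding \<kappa>_def using \<Phi>.lin(2) [OF BK(5) [OF BK(6) [OF op] op]]
      by (metis cinner_adj cinner_commute)
  next
    fix ps :: "(complex \<times> (('h \<Rightarrow>\<^sub>L 'h) \<Rightarrow> 'h)) list"
    let ?n = "length ps" and ?X = "\<lambda>i. op (snd (ps ! i))"
    let ?x = "\<lambda>i. fst (ps ! i) *\<^sub>C snd (decode (snd (ps ! i)))"
    have "op_matrix_positive ?n (\<lambda>i j. toeplitz_proj (adj (?X i) o\<^sub>L ?X j))"
    proof (rule \<Phi>.matrix_positive)
      show "adj (?X i) o\<^sub>L ?X j \<in> \<B> UNIV" for i j by (intro BK op)
      show "op_matrix_positive ?n (\<lambda>i j. adj (?X i) o\<^sub>L ?X j)"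
        unfolding op_matrix_positive_def
      proof
        fix x :: "nat \<Rightarrow> 'h"
        have "(\<Sum>i<?n. cinner (x i) (\<Sum>j<?n. (adj (?X i) o\<^sub>L ?X j) (x j)))
          = cinner (\<Sum>i<?n. ?X i (x i)) (\<Sum>j<?n. ?X j (x j))"
          unfolding cinner_sum_left using bounded_ops_clinear [OF op]
          by (simp add: cinner_sum_right cinner_adj)
        then show "(\<Sum>i<?n. cinner (x i) (\<Sum>j<?n. (adj (?X i) o\<^sub>L ?X j) (x j))) \<in> \<real>\<^sub>\<ge>\<^sub>0"
          by (simp only: cinner_self nonneg_Reals_of_real_iff zero_le_power2)
      qed
    qed
    then have "(\<Sum>i<?n. cinner (?x i) (\<Sum>j<?n. toeplitz_proj (adj (?X i) o\<^sub>L ?X j) (?x j))) \<in> \<real>\<^sub>\<ge>\<^sub>0"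
      unfolding op_matrix_positive_def by (rule spec)
    also have "(\<Sum>i<?n. cinner (?x i) (\<Sum>j<?n. toeplitz_proj (adj (?X i) o\<^sub>L ?X j) (?x j)))
      = (\<Sum>(c, a)\<leftarrow>ps. \<Sum>(d, b)\<leftarrow>ps. cnj c * d * \<kappa> a b)"
      by (simp add: sum_list_sum_nth atLeast0LessThan case_prod_unfold cinner_sum_right \<kappa>_def
          clinear_scaleC \<Phi>.lin BK op cinner_scaleC_left cinner_scaleC_right mult.assoc mult.left_commute)
    finally show "(\<Sum>(c, a)\<leftarrow>ps. \<Sum>(d, b)\<leftarrow>ps. cnj c * d * \<kappa> a b) \<in> \<real>\<^sub>\<ge>\<^sub>0" .
  qed
  then obtain v :: "(('h \<Rightarrow>\<^sub>L 'h) \<Rightarrow> 'h) \<Rightarrow> (('h \<Rightarrow>\<^sub>L 'h) \<Rightarrow> 'h) ell2"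
    where v: "\<And>a b. cinner (v a) (v b) = \<kappa> a b" by blast
  interpret D: toeplitz_dilation \<Gamma> J T "\<lambda>X h. v (code (X, h))"
  proof
    fix X Y h k assume "X \<in> toeplitz_on" "Y \<in> toeplitz_on"
    then show "cinner (v (code (X, h))) (v (code (Y, k))) = cinner h (toeplitz_proj (adj X o\<^sub>L Y) k)"
      using decode_code [of X h] decode_code [of Y k]
      by (cases "h = 0"; cases "k = 0") (simp_all add: v \<kappa>_def op_def)
  qed
  show ?thesis using D.normal_extension_dilation by blast
qed

section \<open>The structure of the Toeplitz algebra\<close>

lemma spherical_family_UNIV:
  "commuting_spherical_family UNIV \<Gamma> J T \<Longrightarrow> spherical_family UNIV \<Gamma> J T"
  by unfold_locales (simp_all add: hilbert_subspace_UNIV)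

lemma toeplitz_eq:
  assumes "commuting_spherical_family UNIV \<Gamma> J T"
  shows "toeplitz \<Gamma> J T = spherical_family.toeplitz_on UNIV \<Gamma> J T"
  using spherical_family.toeplitz_on_def [OF spherical_family_UNIV [OF assms]]
  by (simp add: toeplitz_def)

lemma ucp_map_of_toeplitz_projection:
  assumes fam: "commuting_spherical_family UNIV \<Gamma> J T" and \<Phi>: "toeplitz_projection \<Gamma> J T \<Phi>"
  shows "ucp_map UNIV UNIV \<Phi>" and "clinear X \<Longrightarrow> \<Phi> X \<in> toeplitz \<Gamma> J T"
    and "X \<in> toeplitz \<Gamma> J T \<Longrightarrow> \<Phi> X = X"
proof -
  have sub: "toeplitz \<Gamma> J T \<subseteq> \<B> UNIV" by (auto simp: toeplitz_def)
  show "ucp_map UNIV UNIV \<Phi>"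
    using \<Phi> sub by unfold_locales
      (auto simp: toeplitz_projection_def orth_proj_UNIV hilbert_subspace_UNIV)
  show "clinear X \<Longrightarrow> \<Phi> X \<in> toeplitz \<Gamma> J T"
    using \<Phi> by (auto simp: toeplitz_projection_def bounded_ops_UNIV_iff)
  show "\<Phi> X = X" if X: "X \<in> toeplitz \<Gamma> J T"
  proof -
    obtain Y where "X = \<Phi> Y" "Y \<in> \<B> UNIV" using X \<Phi> by (auto simp: toeplitz_projection_def)
    then show ?thesis using \<Phi> by (simp add: toeplitz_projection_def)
  qed
qed

lemma toeplitz_projection_exists:
  assumes fam: "commuting_spherical_family UNIV \<Gamma> J T"
  shows "\<exists>\<Phi>. toeplitz_projection \<Gamma> J T \<Phi>"
proof -
  interpret spherical_family UNIV \<Gamma> J T by (rule spherical_family_UNIV [OF fam])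
  interpret \<Phi>: ucp_map UNIV UNIV toeplitz_proj by (rule ucp_toeplitz_proj)
  have "toeplitz_proj ` \<B> UNIV = toeplitz \<Gamma> J T"
    unfolding toeplitz_eq [OF fam]
  proof
    show "toeplitz_proj ` \<B> UNIV \<subseteq> toeplitz_on" using toeplitz_proj_in by blast
    show "toeplitz_on \<subseteq> toeplitz_proj ` \<B> UNIV"
    proof
      fix X assume "X \<in> toeplitz_on"
      then have "toeplitz_proj X = X" "X \<in> \<B> UNIV" by (auto simp: toeplitz_proj_fixes toeplitz_onD)
      then show "X \<in> toeplitz_proj ` \<B> UNIV" by (metis imageI)
    qed
  qed
  then have "toeplitz_projection \<Gamma> J T toeplitz_proj"
    using \<Phi>.cp \<Phi>.unital toeplitz_proj_in
    by (simp add: toeplitz_projection_def orth_proj_UNIV toeplitz_proj_fixes)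
  then show ?thesis by blast
qed

theorem theorem2p9:
  fixes \<Gamma> :: "'g set" and J :: "'g \<Rightarrow> 'j set"
    and T :: "'g \<Rightarrow> 'j \<Rightarrow> 'h::complex_hilbert_space \<Rightarrow>\<^sub>L 'h"
  assumes "commuting_spherical_family UNIV \<Gamma> J T"
  shows
    "(\<exists>\<Phi>. toeplitz_projection \<Gamma> J T \<Phi>) \<and>
     (\<exists>(K :: (('h \<Rightarrow>\<^sub>L 'h) \<Rightarrow> 'h) ell2 set) V N. normal_extension \<Gamma> J T K V N) \<and>
     (\<forall>\<Phi> (K :: 'k::complex_hilbert_space set) V N.
        toeplitz_projection \<Gamma> J T \<Phi> \<and> minimal_normal_extension \<Gamma> J T K V N \<longrightarrow>
        (\<exists>\<pi>.
           unital_star_rep (cstar UNIV (toeplitz \<Gamma> J T)) \<pi> K \<and>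
           (\<forall>\<alpha>\<in>\<Gamma>. \<forall>j\<in>J \<alpha>. \<pi> (T \<alpha> j) = N \<alpha> j) \<and>
           (\<forall>X \<in> cstar UNIV (toeplitz \<Gamma> J T). \<Phi> X = compression V (\<pi> X)) \<and>
           \<pi> ` cstar UNIV (toeplitz \<Gamma> J T) = commutant K (cstar K (family_ops \<Gamma> J N)) \<and>
           (complete_isometry (\<pi> ` cstar UNIV (toeplitz \<Gamma> J T)) (compression V) \<and>
            compression V ` \<pi> ` cstar UNIV (toeplitz \<Gamma> J T) = toeplitz \<Gamma> J T \<and>
            (\<forall>Y \<in> \<pi> ` cstar UNIV (toeplitz \<Gamma> J T). \<pi> (compression V Y) = Y) \<and>
            short_exact
              (star_kernel (cstar UNIV (toeplitz \<Gamma> J T)) \<pi>)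
              (cstar UNIV (toeplitz \<Gamma> J T)) \<pi>
              K (\<pi> ` cstar UNIV (toeplitz \<Gamma> J T)) \<and>
            (\<exists>\<rho>. completely_isometric_cross_section
              (cstar UNIV (toeplitz \<Gamma> J T)) \<pi> (\<pi> ` cstar UNIV (toeplitz \<Gamma> J T)) \<rho>) \<and>
            star_kernel (cstar UNIV (toeplitz \<Gamma> J T)) \<pi> =
              closed_ideal_gen (cstar UNIV (toeplitz \<Gamma> J T))
                {(X o\<^sub>L Y) - \<Phi> (X o\<^sub>L Y) | X Y. X \<in> toeplitz \<Gamma> J T \<and> Y \<in> toeplitz \<Gamma> J T}) \<and>
           (\<Phi> ` cstar UNIV (family_ops \<Gamma> J T) =
              cstar UNIV (family_ops \<Gamma> J T) \<inter> toeplitz \<Gamma> J T \<and>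
            star_kernel (cstar UNIV (family_ops \<Gamma> J T)) \<pi> =
              closed_ideal_gen (cstar UNIV (family_ops \<Gamma> J T))
                (commutators (toeplitz \<Gamma> J T \<inter> cstar UNIV (family_ops \<Gamma> J T))) \<and>
            star_kernel (cstar UNIV (family_ops \<Gamma> J T)) \<pi> =
              commutator_ideal (cstar UNIV (family_ops \<Gamma> J T)) \<and>
            short_exact
              (commutator_ideal (cstar UNIV (family_ops \<Gamma> J T)))
              (cstar UNIV (family_ops \<Gamma> J T)) \<pi>
              K (cstar K (family_ops \<Gamma> J N)) \<and>
            completely_isometric_cross_section
              (cstar UNIV (family_ops \<Gamma> J T)) \<pi> (cstar K (family_ops \<Gamma> J N)) (compression V))) \<and>
        (\<forall>X \<in> \<B> UNIV.
           (X \<in> commutant UNIV (family_ops \<Gamma> J T) \<longleftrightarrow>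
              X \<in> toeplitz \<Gamma> J T \<and> adj X o\<^sub>L X \<in> toeplitz \<Gamma> J T) \<and>
           (X \<in> commutant UNIV (family_ops \<Gamma> J T) \<longrightarrow>
              (\<exists>!Y. Y \<in> commutant K (family_ops \<Gamma> J N) \<and> restricts_to V Y X) \<and>
              (\<forall>Y \<in> commutant K (family_ops \<Gamma> J N). restricts_to V Y X \<longrightarrow> norm Y = norm X))))"
proof (intro conjI allI impI, goal_cases)
  note fam = assms
  note te = toeplitz_eq [OF fam]
  have lifting: "toeplitz_lifting \<Gamma> J T K N V \<Phi>"
    if h: "toeplitz_projection \<Gamma> J T \<Phi> \<and> minimal_normal_extension \<Gamma> J T K V N"
    for \<Phi> and K :: "'k set" and V N
  proof (intro toeplitz_lifting.intro minimal_extension.intro spherical_family_UNIV fam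
      spherical_family.intro minimal_extension_axioms.intro toeplitz_lifting_axioms.intro)
    show "hilbert_subspace K" "commuting_spherical_family K \<Gamma> J N" "isometric_embedding V K"
      "\<And>\<alpha> j. \<alpha> \<in> \<Gamma> \<Longrightarrow> j \<in> J \<alpha> \<Longrightarrow> normal_op (N \<alpha> j)"
      "\<And>\<alpha> j. \<alpha> \<in> \<Gamma> \<Longrightarrow> j \<in> J \<alpha> \<Longrightarrow> restricts_to V (N \<alpha> j) (T \<alpha> j)"
      "\<And>M. reducing_subspace K (family_ops \<Gamma> J N) M \<Longrightarrow> range (blinfun_apply V) \<subseteq> M \<Longrightarrow> M = K"
      using h unfolding minimal_normal_extension_def normal_extension_def by blast+
    show "ucp_map UNIV UNIV \<Phi>"
      "\<And>X. clinear X \<Longrightarrow> \<Phi> X \<in> spherical_family.toeplitz_on UNIV \<Gamma> J T"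
      "\<And>X. X \<in> spherical_family.toeplitz_on UNIV \<Gamma> J T \<Longrightarrow> \<Phi> X = X"
      using ucp_map_of_toeplitz_projection [OF fam conjunct1 [OF h]] by (simp_all add: te)
  qed
  {
    case 1
    show ?case by (rule toeplitz_projection_exists [OF fam])
  next
    case 2
    show ?case by (rule normal_extension_exists [OF fam])
  next
    case (3 \<Phi> K V N)
    interpret toeplitz_lifting \<Gamma> J T K N V \<Phi> by (rule lifting [OF 3])
    show ?case
      unfolding te
    proof (intro exI [of _ pi] conjI ballI)
      show "unital_star_rep \<A> pi K" by (rule unital_star_rep_pi)
      show "pi (T \<alpha> j) = N \<alpha> j" if "\<alpha> \<in> \<Gamma>" "j \<in> J \<alpha>" for \<alpha> j
        by (rule pi_generator [OF that])
      show "\<Phi> X = compression V (pi X)" if "X \<in> \<A>" for X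
        using A_clinear [OF that] by (simp add: compression_rho pi_in_C rho_pi)
      show "pi ` \<A> = commutant K \<N>" by (simp only: pi_image commutant_N)
      show "complete_isometry (pi ` \<A>) (compression V)"
        unfolding pi_image by (rule complete_isometry_C [OF order_refl])
      show "compression V ` pi ` \<A> = \<T>" by (simp only: pi_image compression_image)
      show "pi (compression V Y) = Y" if "Y \<in> pi ` \<A>" for Y
        using that by (simp add: pi_image compression_rho pi_rho)
      show "short_exact (star_kernel \<A> pi) \<A> pi K (pi ` \<A>)"
        unfolding short_exact_def pi_image
        by (simp add: cstar_subalgebra_A cstar_subalgebra_C star_hom_pi pi_image)
      show "\<exists>\<rho>. completely_isometric_cross_section \<A> pi (pi ` \<A>) \<rho>"
        unfolding pi_image by (rule exI) (rule cross_section_C)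
      show "star_kernel \<A> pi = closed_ideal_gen \<A>
          {(X o\<^sub>L Y) - \<Phi> (X o\<^sub>L Y) | X Y. X \<in> \<T> \<and> Y \<in> \<T>}" by (rule kernel_A)
      show "\<Phi> ` \<F> = \<F> \<inter> \<T>" by (rule \<Phi>_image_F)
      show "star_kernel \<F> pi = closed_ideal_gen \<F> (commutators (\<T> \<inter> \<F>))" by (rule kernel_F)
      show "star_kernel \<F> pi = commutator_ideal \<F>" by (rule kernel_F)
      show "short_exact (commutator_ideal \<F>) \<F> pi K \<N>"
        unfolding short_exact_def
        by (simp add: cstar_subalgebra_F cstar_subalgebra_N star_hom_pi F_subset_A kernel_F(2) pi_image_F)
      show "completely_isometric_cross_section \<F> pi \<N> (compression V)" by (rule cross_section_F)
    qed
  next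
    case (4 \<Phi> K V N)
    interpret toeplitz_lifting \<Gamma> J T K N V \<Phi> by (rule lifting [OF 4])
    show ?case
      unfolding te C_eq_commutant
      using base.commuting_iff commutant_lifting_unique by simp
  }
qed

end
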